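(* Let $D\subset \mathbb C_\infty$ be a regular domain and $z_0\in D$ a point such that, for some $t_*>0$ and every $0<t\le t_*$, the set $\{z\in D:g_D(z,z_0)>t\}$ is a regular subdomain, relatively compact in $D$, with boundary of class $C^1$ coinciding exactly with the level line $\{z\in D:g_D(z,z_0)=t\}$; and suppose that $D$ satisfies condition (1g), or both conditions (2g) and (3g), given in the context. Put $d(z):=\operatorname{dist}(z,\mathbb C_\infty\setminus D)$, and let $0<b_0\le1\le B_0<+\infty$ be constants for which $$b_0\,d(z)\le g_D(z,z_0)\le B_0\,d(z)$$ for all $z\in D$ outside some subdomain, relatively compact in $D$, containing $z_0$. Let $F:(-\infty,0)\to\mathbb R$ be a convex function of class $C^2$, let $M:=F\circ(-d)$, and let $u\not\equiv-\infty$ be a subharmonic function on $D$ with Riesz measure $\nu_u$ satisfying $u\le M$ on $D$; let $b\ge0$. Then there exist a subdomain $D_0\Subset D$ with $z_0\in D_0$ and constants $C\ge0$, depending only on $z_0,D,D_0,b$, and $\overline C_M\ge0$, depending only on $z_0,D,D_0,M$, such that, with $t_0:=B_0\sup_{\partial D_0}d$: (a) for every convex increasing function $f:\mathbb R^+\to\mathbb R^+$ with $f(0)=0$ and $f(t_0)\le b$, $$\int_{D\setminus D_0}f(b_0d)\,d\nu_u\le\frac1{B_0^2}\int_0^{t_0}f(t)\,F''\Bigl(-\frac1{B_0}t\Bigr)\,dt+C\,\overline C_M-C\,u(z_0);$$ (b) for every convex decreasing function $f:\mathbb R^+\to\mathbb R^+$ with right derivative $f'_{\mathrm{right}}(0)<+\infty$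 and with $f(0)\,B_0\sup_{\partial D_0}d\le b$, $$\int_{D\setminus D_0}d\cdot f\Bigl(\frac1{b_0d}\Bigr)\,d\nu_u\le\frac1{b_0B_0^2}\int_0^{t_0}t\,f(1/t)\,F''\bigl(-t/B_0\bigr)\,dt+C\,\overline C_M-C\,u(z_0).$$ In particular, if the integral on the right-hand side of (a) (respectively (b)) is finite, then so is the integral on the left-hand side. If $u=\log|h|$ with $h\not\equiv0$ holomorphic on $D$ and vanishing on $\mathtt Z=\{\mathtt z_k\}_{k\in\mathbb N}\subset D$, the left-hand sides of (a) and (b) may be written respectively as $\sum_{\mathtt z_k\in D\setminus D_0}f\bigl(b_0d(\mathtt z_k)\bigr)$ and $\sum_{\mathtt z_k\in D\setminus D_0}d(\mathtt z_k)\,f\bigl(1/(b_0d(\mathtt z_k))\bigr)$.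
   Context: $\mathbb C_\infty=\mathbb C\cup\{\infty\}$; a domain is an open connected subset of $\mathbb C_\infty$, $D\ne\mathbb C_\infty$; closures, boundaries and relative compactness ($\Subset$) are understood in $\mathbb C_\infty$. $\mathbb R^+=[0,+\infty)$; increasing/decreasing are non-strict. $\operatorname{dist}$ is Euclidean distance with $\operatorname{dist}(z,\infty)=+\infty$ for $z\in\mathbb C$; the distance from $\infty\in D$ to the complement of $D$ is $+\infty$. "Regular" means regular for the Dirichlet problem. $g_D(\cdot,z_0)$ is the Green function of $D$ with pole $z_0$. Subharmonicity near $\infty$ is understood via the inversion $z\mapsto1/\bar z$. The Riesz measure of a subharmonic $u\not\equiv-\infty$ is $\nu_u=\frac1{2\pi}\Delta u$. If $u(z_0)=-\infty$, the right-hand sides are understood as $+\infty$. Conditions on a domain $D$: (1g) the boundary of $D$ consists of finitely many mutually separated simple closed curves of class $C^2$ in $\mathbb C$. (2g) $D\ni\infty=z_0$, the boundary of $D$ is non-polar, and $D$ is a union of open discs of radius not less than some fixed strictly positive number. (3g) $D\Subset\mathbb C$ or $D\ni\infty$, and $D$ is a Lyapunov–Dini domain, i.e. its boundary is of class $C^1$ and the inner normals $\vec n(z)$, $z\in\partial D$, satisfy $|\vec n(z_1)-\vec n(z_2)|\le a(|z_1-z_2|)$ for all $z_1,z_2\in\partial D$, where $a:\mathbb R^+\to\mathbb R^+$ is continuous and increasing, $a(0)=0$, $t\mapsto a(t)/t$ is decreasing on $(0,+\infty)$ and $\int_0^1\frac{a(t)}t\,dt<+\infty$. (These conditions guarantee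 the existence of constants $b_0,B_0$ as in the claim.) A holomorphic $h\not\equiv0$ vanishes on $\mathtt Z$ if at each point $z$ the multiplicity of the zero of $h$ is at least the number of repetitions of $z$ in $\mathtt Z$. *)

theory Defs
  imports "HOL-Complex_Analysis.Complex_Analysis"
begin

section \<open>The extended plane\<close>

text \<open>The point at infinity is \<^term>\<open>None\<close>; the finite point z is \<^term>\<open>Some z\<close>.\<close>

type_synonym csphere = "complex option"

definition riemann_sphere :: "csphere topology" where
  "riemann_sphere = Alexandroff_compactification euclidean"

definition sphere_domain :: "csphere set \<Rightarrow> bool" where
  "sphere_domain D \<longleftrightarrow>
     openin riemann_sphere D \<and> connectedin riemann_sphere D \<and> D \<noteq> {} \<and> D \<noteq> UNIV"

definition rel_compact_in :: "csphere set \<Rightarrow> csphere set \<Rightarrow> bool" where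
  "rel_compact_in E D \<longleftrightarrow> riemann_sphere closure_of E \<subseteq> D"

definition finite_part :: "csphere set \<Rightarrow> complex set" where
  "finite_part D = {z. Some z \<in> D}"

text \<open>The anticonformal inversion \<open>z \<mapsto> 1 / cnj z\<close> of the extended plane (an involution).\<close>

definition sphere_inv :: "csphere \<Rightarrow> csphere" where
  "sphere_inv p = (case p of None \<Rightarrow> Some 0
                   | Some z \<Rightarrow> if z = 0 then None else Some (1 / cnj z))"

definition sphere_edist :: "csphere \<Rightarrow> csphere \<Rightarrow> ereal" where
  "sphere_edist p q = (case (p, q) of
      (Some z, Some w) \<Rightarrow> ereal (dist z w)
    | (None, None) \<Rightarrow> 0
    | _ \<Rightarrow> \<infinity>)"

definition compl_dist :: "csphere set \<Rightarrow> csphere \<Rightarrow> ereal" where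
  "compl_dist D p = (INF q\<in>- D. sphere_edist p q)"

section \<open>Smooth functions in the plane\<close>

definition pdx :: "(complex \<Rightarrow> real) \<Rightarrow> complex \<Rightarrow> real" where
  "pdx \<phi> z = deriv (\<lambda>t::real. \<phi> (z + of_real t)) 0"

definition pdy :: "(complex \<Rightarrow> real) \<Rightarrow> complex \<Rightarrow> real" where
  "pdy \<phi> z = deriv (\<lambda>t::real. \<phi> (z + \<i> * of_real t)) 0"

primrec Ck_on :: "nat \<Rightarrow> complex set \<Rightarrow> (complex \<Rightarrow> real) \<Rightarrow> bool" where
  "Ck_on 0 S \<phi> \<longleftrightarrow> continuous_on S \<phi>"
| "Ck_on (Suc k) S \<phi> \<longleftrightarrow>
     (\<forall>z\<in>S. \<phi> differentiable (at z)) \<and> Ck_on k S (pdx \<phi>) \<and> Ck_on k S (pdy \<phi>)"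

definition gradient :: "(complex \<Rightarrow> real) \<Rightarrow> complex \<Rightarrow> complex" where
  "gradient \<phi> z = Complex (pdx \<phi> z) (pdy \<phi> z)"

definition laplacian :: "(complex \<Rightarrow> real) \<Rightarrow> complex \<Rightarrow> real" where
  "laplacian \<phi> z = pdx (pdx \<phi>) z + pdy (pdy \<phi>) z"

definition test_function :: "complex set \<Rightarrow> (complex \<Rightarrow> real) \<Rightarrow> bool" where
  "test_function S \<phi> \<longleftrightarrow>
     (\<forall>k. Ck_on k UNIV \<phi>) \<and> (\<exists>K. compact K \<and> K \<subseteq> S \<and> (\<forall>z. z \<notin> K \<longrightarrow> \<phi> z = 0))"

section \<open>Harmonic, subharmonic and holomorphic functions\<close>

definition harmonic_on :: "complex set \<Rightarrow> (complex \<Rightarrow> real) \<Rightarrow> bool" where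
  "harmonic_on S h \<longleftrightarrow> Ck_on 2 S h \<and> (\<forall>z\<in>S. laplacian h z = 0)"

definition sphere_harmonic_on :: "csphere set \<Rightarrow> (csphere \<Rightarrow> real) \<Rightarrow> bool" where
  "sphere_harmonic_on D h \<longleftrightarrow>
     harmonic_on (finite_part D) (\<lambda>z. h (Some z)) \<and>
     (None \<in> D \<longrightarrow> harmonic_on (finite_part (sphere_inv ` D)) (\<lambda>w. h (sphere_inv (Some w))))"

text \<open>The circular mean is taken in the extended reals as the mean of the positive part minus
  the mean of the negative part (\<^const>\<open>e2ennreal\<close> truncates negative values to 0); for
  small circles the first one is finite by upper semicontinuity.\<close>

definition circle_mean :: "(complex \<Rightarrow> ereal) \<Rightarrow> complex \<Rightarrow> real \<Rightarrow> ereal" where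
  "circle_mean u z r = ereal (1 / (2 * pi)) *
     (enn2ereal (\<integral>\<^sup>+t\<in>{0..2 * pi}. e2ennreal (u (z + of_real r * cis t)) \<partial>lborel)
    - enn2ereal (\<integral>\<^sup>+t\<in>{0..2 * pi}. e2ennreal (- u (z + of_real r * cis t)) \<partial>lborel))"

text \<open>The function identically equal to minus infinity counts as subharmonic.\<close>

definition subharmonic_on :: "complex set \<Rightarrow> (complex \<Rightarrow> ereal) \<Rightarrow> bool" where
  "subharmonic_on S u \<longleftrightarrow>
     (\<forall>z\<in>S. u z < \<infinity>) \<and>
     (\<forall>z\<in>S. \<forall>c. u z < c \<longrightarrow> (\<forall>\<^sub>F w in at z. u w < c)) \<and>
     (\<forall>z\<in>S. \<exists>\<rho>>0. \<forall>r. 0 < r \<and> r < \<rho> \<longrightarrow> u z \<le> circle_mean u z r)"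

definition sphere_subharmonic_on :: "csphere set \<Rightarrow> (csphere \<Rightarrow> ereal) \<Rightarrow> bool" where
  "sphere_subharmonic_on D u \<longleftrightarrow>
     subharmonic_on (finite_part D) (\<lambda>z. u (Some z)) \<and>
     (None \<in> D \<longrightarrow> subharmonic_on (finite_part (sphere_inv ` D)) (\<lambda>w. u (sphere_inv (Some w))))"

definition hol_chart_inf :: "complex \<Rightarrow> csphere" where
  "hol_chart_inf w = (if w = 0 then None else Some (1 / w))"

definition sphere_holomorphic_on :: "csphere set \<Rightarrow> (csphere \<Rightarrow> complex) \<Rightarrow> bool" where
  "sphere_holomorphic_on D h \<longleftrightarrow>
     (\<lambda>z. h (Some z)) holomorphic_on finite_part D \<and>
     (None \<in> D \<longrightarrow> (\<lambda>w. h (hol_chart_inf w)) holomorphic_on {w. hol_chart_inf w \<in> D})"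

text \<open>For h holomorphic and not locally zero at p; the value is 0 if h does not vanish at p.\<close>

definition zero_mult :: "(csphere \<Rightarrow> complex) \<Rightarrow> csphere \<Rightarrow> int" where
  "zero_mult h p = (case p of
      None \<Rightarrow> zorder (\<lambda>w. h (hol_chart_inf w)) 0
    | Some z \<Rightarrow> zorder (\<lambda>z. h (Some z)) z)"

definition vanishes_on :: "csphere set \<Rightarrow> (csphere \<Rightarrow> complex) \<Rightarrow> (nat \<Rightarrow> csphere) \<Rightarrow> bool" where
  "vanishes_on D h Z \<longleftrightarrow>
     (\<forall>p\<in>D. finite {k. Z k = p} \<and> int (card {k. Z k = p}) \<le> zero_mult h p)"

definition is_zero_sequence :: "csphere set \<Rightarrow> (csphere \<Rightarrow> complex) \<Rightarrow> (nat \<Rightarrow> csphere) \<Rightarrow> bool" where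
  "is_zero_sequence D h Z \<longleftrightarrow>
     (\<forall>p\<in>D. finite {k. Z k = p} \<and> int (card {k. Z k = p}) = zero_mult h p)"

section \<open>Riesz measures\<close>

definition riemann_sphere_borel :: "csphere measure" where
  "riemann_sphere_borel = sigma UNIV {U. openin riemann_sphere U}"

definition extend_zero :: "(complex \<Rightarrow> real) \<Rightarrow> csphere \<Rightarrow> real" where
  "extend_zero \<phi> p = (case p of None \<Rightarrow> 0 | Some z \<Rightarrow> \<phi> z)"

text \<open>The Radon measure on D representing the distribution \<open>(1 / (2 * pi)) \<Delta>u\<close>. The values of
  u equal to minus infinity, replaced by 0 under the integral, form a Lebesgue null set. Near
  infinity the condition is the one for u read in the chart given by the inversion.\<close>

definition is_riesz_measure :: "csphere set \<Rightarrow> (csphere \<Rightarrow> ereal) \<Rightarrow> csphere measure \<Rightarrow> bool" where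
  "is_riesz_measure D u \<nu> \<longleftrightarrow>
     sets \<nu> = sets (restrict_space riemann_sphere_borel D) \<and>
     (\<forall>K. compactin riemann_sphere K \<and> K \<subseteq> D \<longrightarrow> emeasure \<nu> K < \<infinity>) \<and>
     (\<forall>\<phi>. test_function (finite_part D) \<phi> \<longrightarrow>
        (LINT p|\<nu>. extend_zero \<phi> p) =
        1 / (2 * pi) * (LINT z|lborel. real_of_ereal (u (Some z)) * laplacian \<phi> z)) \<and>
     (None \<in> D \<longrightarrow> (\<forall>\<phi>. test_function (finite_part (sphere_inv ` D)) \<phi> \<longrightarrow>
        (LINT p|\<nu>. extend_zero \<phi> (sphere_inv p)) =
        1 / (2 * pi) * (LINT w|lborel. real_of_ereal (u (sphere_inv (Some w))) * laplacian \<phi> w)))"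

section \<open>Polar sets, regularity and Green functions\<close>

definition polar_set :: "csphere set \<Rightarrow> bool" where
  "polar_set E \<longleftrightarrow>
     (\<forall>p\<in>E. \<exists>V s. openin riemann_sphere V \<and> connectedin riemann_sphere V \<and> p \<in> V \<and>
        sphere_subharmonic_on V s \<and> (\<exists>q\<in>V. s q \<noteq> -\<infinity>) \<and> (\<forall>q\<in>E \<inter> V. s q = -\<infinity>))"

definition dirichlet_regular :: "csphere set \<Rightarrow> bool" where
  "dirichlet_regular D \<longleftrightarrow>
     (\<forall>\<phi>. continuous_map (subtopology riemann_sphere (riemann_sphere frontier_of D)) euclideanreal \<phi> \<longrightarrow>
        (\<exists>h. sphere_harmonic_on D h \<and>
           (\<forall>\<zeta>\<in>riemann_sphere frontier_of D.
              (h \<longlongrightarrow> \<phi> \<zeta>) (atin_within riemann_sphere \<zeta> D))))"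

text \<open>The boundary values are 0 outside a polar set; together with boundedness off the pole this
  determines g on D when the boundary of D is not polar. If the boundary is polar there is no
  such g, in particular none for the complement of one point, which \<^const>\<open>dirichlet_regular\<close>
  does not exclude.\<close>

definition is_green_function :: "csphere set \<Rightarrow> csphere \<Rightarrow> (csphere \<Rightarrow> ereal) \<Rightarrow> bool" where
  "is_green_function D z0 g \<longleftrightarrow>
     g z0 = \<infinity> \<and>
     (\<forall>p\<in>D - {z0}. \<bar>g p\<bar> \<noteq> \<infinity>) \<and>
     sphere_harmonic_on (D - {z0}) (\<lambda>p. real_of_ereal (g p)) \<and>
     (\<forall>U. openin riemann_sphere U \<and> z0 \<in> U \<longrightarrow> (\<exists>B::real. \<forall>p\<in>D - U. \<bar>g p\<bar> \<le> ereal B)) \<and>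
     (case z0 of
        None \<Rightarrow> \<exists>B::real. \<forall>\<^sub>F z in at_infinity.
                  \<bar>real_of_ereal (g (Some z)) - ln (cmod z)\<bar> \<le> B
      | Some w \<Rightarrow> \<exists>B::real. \<forall>\<^sub>F z in at w.
                  \<bar>real_of_ereal (g (Some z)) + ln (cmod (z - w))\<bar> \<le> B) \<and>
     (\<exists>E. polar_set E \<and>
        (\<forall>\<zeta>\<in>riemann_sphere frontier_of D - E.
           (g \<longlongrightarrow> 0) (atin_within riemann_sphere \<zeta> D)))"

section \<open>Smoothness of boundaries\<close>

definition C1_defining_function :: "complex set \<Rightarrow> complex set \<Rightarrow> (complex \<Rightarrow> real) \<Rightarrow> bool" where
  "C1_defining_function S U \<rho> \<longleftrightarrow>
     open U \<and> Ck_on 1 U \<rho> \<and> (\<forall>w\<in>U. gradient \<rho> w \<noteq> 0 \<and> (w \<in> S \<longleftrightarrow> \<rho> w > 0))"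

definition C1_boundary :: "csphere set \<Rightarrow> bool" where
  "C1_boundary D \<longleftrightarrow>
     (\<forall>z. Some z \<in> riemann_sphere frontier_of D \<longrightarrow>
        (\<exists>U \<rho>. z \<in> U \<and> C1_defining_function (finite_part D) U \<rho>)) \<and>
     (None \<in> riemann_sphere frontier_of D \<longrightarrow>
        (\<exists>U \<rho>. 0 \<in> U \<and> C1_defining_function (finite_part (sphere_inv ` D)) U \<rho>))"

definition is_inner_normal :: "csphere set \<Rightarrow> complex \<Rightarrow> complex \<Rightarrow> bool" where
  "is_inner_normal D z n \<longleftrightarrow>
     Some z \<in> riemann_sphere frontier_of D \<and>
     (\<exists>U \<rho>. z \<in> U \<and> C1_defining_function (finite_part D) U \<rho> \<and> n = sgn (gradient \<rho> z))"

text \<open>A regular parametrization of period 1 by the whole line, hence also twice continuously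
  differentiable where the curve closes up.\<close>

definition C2_simple_closed_param :: "(real \<Rightarrow> complex) \<Rightarrow> bool" where
  "C2_simple_closed_param \<gamma> \<longleftrightarrow>
     simple_path \<gamma> \<and> (\<forall>t. \<gamma> (t + 1) = \<gamma> t) \<and>
     (\<exists>\<gamma>1 \<gamma>2. (\<forall>t. (\<gamma> has_vector_derivative \<gamma>1 t) (at t)) \<and>
              (\<forall>t. (\<gamma>1 has_vector_derivative \<gamma>2 t) (at t)) \<and>
              continuous_on UNIV \<gamma>2 \<and> (\<forall>t. \<gamma>1 t \<noteq> 0))"

definition C2_on_reals :: "real set \<Rightarrow> (real \<Rightarrow> real) \<Rightarrow> bool" where
  "C2_on_reals S F \<longleftrightarrow>
     (\<forall>x\<in>S. F differentiable (at x)) \<and> (\<forall>x\<in>S. deriv F differentiable (at x)) \<and>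
     continuous_on S (deriv (deriv F))"

section \<open>Conditions on the domain\<close>

definition finite_C2_curve_boundary :: "csphere set \<Rightarrow> bool" where
  "finite_C2_curve_boundary D \<longleftrightarrow>
     (\<exists>(n::nat) \<gamma>. (\<forall>i<n. C2_simple_closed_param (\<gamma> i)) \<and>
        (\<forall>i<n. \<forall>j<n. i \<noteq> j \<longrightarrow> path_image (\<gamma> i) \<inter> path_image (\<gamma> j) = {}) \<and>
        riemann_sphere frontier_of D = Some ` (\<Union>i<n. path_image (\<gamma> i)))"

text \<open>The point at infinity lies in D and can be left out of the union, because a disc of the
  extended plane around infinity, punctured there, is itself a union of Euclidean discs of any
  prescribed radius.\<close>

definition uniform_disc_condition :: "csphere set \<Rightarrow> csphere \<Rightarrow> bool" where
  "uniform_disc_condition D z0 \<longleftrightarrow>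
     z0 = None \<and> None \<in> D \<and> \<not> polar_set (riemann_sphere frontier_of D) \<and>
     (\<exists>r0>0. \<exists>I :: (complex \<times> real) set.
        (\<forall>(c, r)\<in>I. r0 \<le> r) \<and> finite_part D = (\<Union>(c, r)\<in>I. ball c r))"

definition dini_modulus :: "(real \<Rightarrow> real) \<Rightarrow> bool" where
  "dini_modulus a \<longleftrightarrow>
     (\<forall>t\<ge>0. 0 \<le> a t) \<and> continuous_on {0..} a \<and> mono_on {0..} a \<and> a 0 = 0 \<and>
     antimono_on {0<..} (\<lambda>t. a t / t) \<and> set_integrable lborel {0<..1} (\<lambda>t. a t / t)"

definition lyapunov_dini_condition :: "csphere set \<Rightarrow> bool" where
  "lyapunov_dini_condition D \<longleftrightarrow>
     (rel_compact_in D (range Some) \<or> None \<in> D) \<and> C1_boundary D \<and>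
     (\<exists>a. dini_modulus a \<and>
        (\<forall>z1 z2 n1 n2. is_inner_normal D z1 n1 \<and> is_inner_normal D z2 n2 \<longrightarrow>
           cmod (n1 - n2) \<le> a (cmod (z1 - z2))))"

definition green_level_condition :: "csphere set \<Rightarrow> (csphere \<Rightarrow> ereal) \<Rightarrow> bool" where
  "green_level_condition D g \<longleftrightarrow>
     (\<exists>ts>0. \<forall>t::real. 0 < t \<and> t \<le> ts \<longrightarrow>
        (let Dt = {p \<in> D. g p > ereal t} in
           sphere_domain Dt \<and> dirichlet_regular Dt \<and> rel_compact_in Dt D \<and> C1_boundary Dt \<and>
           riemann_sphere frontier_of Dt = {p \<in> D. g p = ereal t}))"

definition green_dist_bounds ::
    "csphere set \<Rightarrow> csphere \<Rightarrow> (csphere \<Rightarrow> ereal) \<Rightarrow> real \<Rightarrow> real \<Rightarrow> bool" where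
  "green_dist_bounds D z0 g b0 B0 \<longleftrightarrow>
     0 < b0 \<and> b0 \<le> 1 \<and> 1 \<le> B0 \<and>
     (\<exists>D1. sphere_domain D1 \<and> z0 \<in> D1 \<and> rel_compact_in D1 D \<and>
        (\<forall>p\<in>D - D1. ereal b0 * compl_dist D p \<le> g p \<and> g p \<le> ereal B0 * compl_dist D p))"

section \<open>The majorant and the two sides of the inequalities\<close>

text \<open>M is \<open>F \<circ> (- d)\<close> on D, with the limit of F at minus infinity as value at infinity;
  the value 0 off D is a dummy.\<close>

definition majorant :: "csphere set \<Rightarrow> (real \<Rightarrow> real) \<Rightarrow> csphere \<Rightarrow> ereal" where
  "majorant D F p =
     (if p \<notin> D then 0
      else if compl_dist D p = \<infinity> then Lim at_bot (\<lambda>x. ereal (F x))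
      else ereal (F (- real_of_ereal (compl_dist D p))))"

definition right_side :: "real \<Rightarrow> ennreal \<Rightarrow> real \<Rightarrow> real \<Rightarrow> ereal \<Rightarrow> ereal" where
  "right_side c J C CM uz0 =
     (if uz0 = -\<infinity> then \<infinity>
      else ereal c * enn2ereal J + ereal (C * CM) - ereal C * uz0)"

definition mass_integral ::
    "csphere set \<Rightarrow> csphere set \<Rightarrow> csphere measure \<Rightarrow> (real \<Rightarrow> real) \<Rightarrow> ennreal" where
  "mass_integral D D0 \<nu> k =
     (\<integral>\<^sup>+p\<in>D - D0. ennreal (k (real_of_ereal (compl_dist D p))) \<partial>\<nu>)"

definition mass_sum ::
    "csphere set \<Rightarrow> csphere set \<Rightarrow> (nat \<Rightarrow> csphere) \<Rightarrow> (real \<Rightarrow> real) \<Rightarrow> ennreal" where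
  "mass_sum D D0 Z k =
     (\<Sum>j. if Z j \<in> D - D0 then ennreal (k (real_of_ereal (compl_dist D (Z j)))) else 0)"

text \<open>The assertion common to both inequalities: k is the function of d integrated on the left,
  J the integral on the right and c its coefficient. The measure of u and the counting sum
  over a sequence Z on which h vanishes are both bounded, and they agree when Z is the full
  zero sequence of h.\<close>

definition mass_estimate ::
    "csphere set \<Rightarrow> csphere set \<Rightarrow> csphere \<Rightarrow> (csphere \<Rightarrow> ereal) \<Rightarrow> csphere measure \<Rightarrow>
     (real \<Rightarrow> real) \<Rightarrow> real \<Rightarrow> ennreal \<Rightarrow> real \<Rightarrow> real \<Rightarrow> bool" where
  "mass_estimate D D0 z0 u \<nu> k c J C CM \<longleftrightarrow>
     enn2ereal (mass_integral D D0 \<nu> k) \<le> right_side c J C CM (u z0) \<and>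
     (J < \<infinity> \<longrightarrow> mass_integral D D0 \<nu> k < \<infinity>) \<and>
     (\<forall>h Z. sphere_holomorphic_on D h \<and> (\<exists>p\<in>D. h p \<noteq> 0) \<and>
        (\<forall>p\<in>D. u p = (if h p = 0 then -\<infinity> else ereal (ln (cmod (h p))))) \<and>
        range Z \<subseteq> D \<and> vanishes_on D h Z \<longrightarrow>
          enn2ereal (mass_sum D D0 Z k) \<le> right_side c J C CM (u z0) \<and>
          (J < \<infinity> \<longrightarrow> mass_sum D D0 Z k < \<infinity>) \<and>
          (is_zero_sequence D h Z \<longrightarrow> mass_integral D D0 \<nu> k = mass_sum D D0 Z k))"

end

theory Submission
  imports Defs
begin

text \<open>Let q be the Green function with its pole smoothed out and \<open>\<kappa>\<close> a smooth convex function that vanishes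
  below s and has slope 1 above s'. The Laplacian of a compactly supported function has integral 0, so the
  part of \<open>\<Delta>(\<kappa> \<circ> q)\<close> living on the collar \<open>s \<le> g \<le> s'\<close>, which is positive, has mass \<open>2 \<pi>\<close>. Pairing
  \<open>\<kappa> \<circ> q\<close> with the Riesz measure and bounding u by M on the collar gives
  \<open>\<integral>(g - s)\<^sup>+ d\<nu> \<le> F(- s / B\<^sub>0) + const - u(z\<^sub>0)\<close>; integrating over s against \<open>f''\<close> gives (a). Part (b) is (a) for
  \<open>s f(1 / s)\<close>, which is convex and increasing and vanishes at 0.\<close>

text \<open>The proof is shaped by what the constants may depend on: D, D0, z0, b and M, but not b0,
  B0 or the level t. Taking D0 = {g > t} with t at most the square of b0 and of 1 / B0 makes the
  cube of \<delta>, the supremum of d over the boundary of D0, a lower bound for t, t / B0 and t b0,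
  and every constant is written in \<delta>. F need not increase, so d >= g / B0 gives F(-d) <= F(-g
  / B0) on the collar only up to the error |F'(-1)|. The pairing uses smooth functions on the whole
  sphere, hence no integrals over level lines, and u enters as a locally integrable function. The
  price: local integrability has to come from the submean inequality, which is given for small
  circles only, and infinity needs a second chart. The term -u(z0) comes from the smoothed pole,
  whose Laplacian is minus 2 pi times a radial probability density in a chart; the mean of u against
  that density is at least u(z0). The integration over s is done for finite sums of kernels (g -
  s)^+ lying below f, followed by Fatou, so that f'' is never formed.\<close>

section \<open>Calculus of \<open>Ck_on\<close> functions and Laplacians in the plane\<close>

lemma pd_derivative:
  assumes "(f has_derivative D) (at z)"
  shows "pdx f z = D 1" "pdy f z = D \<i>"
proof -
  have "((\<lambda>t::real. f (z + c * of_real t)) has_real_derivative D c) (at 0)" for c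
  proof -
    have 1: "((\<lambda>t::real. z + c * of_real t) has_derivative (\<lambda>t. c * of_real t)) (at 0)"
      by (auto intro!: derivative_eq_intros)
    have 2: "(f has_derivative D) (at (z + c * of_real 0))" using assms by simp
    have 3: "((\<lambda>t::real. f (z + c * of_real t)) has_derivative (\<lambda>t. D (c * of_real t))) (at 0)"
      by (rule has_derivative_compose[OF 1 2])
    have "D (c * of_real t) = D c * t" for t
    proof -
      have "linear D" using assms by (rule has_derivative_linear)
      then have "D (t *\<^sub>R c) = t *\<^sub>R D c" by (rule linear_scale)
      then show ?thesis by (simp add: scaleR_conv_of_real mult.commute)
    qed
    with 3 show ?thesis by (simp add: has_field_derivative_def)
  qed
  from this[of 1] this[of \<i>] show "pdx f z = D 1" "pdy f z = D \<i>"
    unfolding pdx_def pdy_def by (auto intro: DERIV_imp_deriv)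
qed

lemma has_derivative_pd:
  assumes "f differentiable (at z)"
  shows "(f has_derivative (\<lambda>v. Re v * pdx f z + Im v * pdy f z)) (at z)"
proof -
  obtain D where D: "(f has_derivative D) (at z)" using assms by (auto simp: differentiable_def)
  have e: "D v = Re v * D 1 + Im v * D \<i>" for v
  proof -
    have l: "linear D" using D has_derivative_linear by blast
    have "v = Re v *\<^sub>R 1 + Im v *\<^sub>R \<i>" by (simp add: complex_eq_iff)
    then have "D v = D (Re v *\<^sub>R 1 + Im v *\<^sub>R \<i>)" by simp
    also have "\<dots> = Re v * D 1 + Im v * D \<i>"
      by (simp only: linear_add[OF l] linear_scale[OF l] real_scaleR_def)
    finally show ?thesis .
  qed
  have "D = (\<lambda>v. Re v * D 1 + Im v * D \<i>)" by (rule ext) (rule e)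
  with D show ?thesis by (simp add: pd_derivative[OF D])
qed

lemma pd_eqI:
  assumes "(f has_derivative (\<lambda>v. Re v * a + Im v * b)) (at z)"
  shows "pdx f z = a" "pdy f z = b"
  using pd_derivative[OF assms] by auto

lemma pd_cong_open:
  assumes "open S" "z \<in> S" "\<And>w. w \<in> S \<Longrightarrow> f w = g w"
  shows "pdx f z = pdx g z" "pdy f z = pdy g z"
proof -
  have "eventually (\<lambda>t::real. z + c * of_real t \<in> S) (nhds 0)" for c
  proof -
    have "isCont (\<lambda>t::real. z + c * of_real t) 0" by (intro continuous_intros)
    then have "((\<lambda>t::real. z + c * of_real t) \<longlongrightarrow> z) (nhds 0)"
      by (simp add: isCont_def tendsto_nhds_iff)
    then show ?thesis using assms(1,2) by (simp add: topological_tendstoD)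
  qed
  then have "eventually (\<lambda>t::real. f (z + c * of_real t) = g (z + c * of_real t)) (nhds 0)" for c
    by (rule eventually_mono) (use assms(3) in auto)
  from this[of 1] this[of \<i>] show "pdx f z = pdx g z" "pdy f z = pdy g z"
    unfolding pdx_def pdy_def by (auto intro!: deriv_cong_ev)
qed

lemma differentiable_cong_open:
  assumes "open S" "z \<in> S" "\<And>w. w \<in> S \<Longrightarrow> f w = g w" "f differentiable (at z)"
  shows "g differentiable (at z)"
  using assms has_derivative_transform_within_open unfolding differentiable_def by blast

lemma Ck_on_cong:
  "open S \<Longrightarrow> (\<And>w. w \<in> S \<Longrightarrow> f w = g w) \<Longrightarrow> Ck_on k S f \<Longrightarrow> Ck_on k S g"
proof (induction k arbitrary: f g)
  case 0 then show ?case using continuous_on_cong by (metis Ck_on.simps(1))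
next
  case (Suc k)
  show ?case unfolding Ck_on.simps
  proof (intro conjI ballI)
    show "g differentiable (at z)" if "z \<in> S" for z
      using differentiable_cong_open[OF Suc.prems(1) that Suc.prems(2)] Suc.prems(3) that by auto
    show "Ck_on k S (pdx g)" "Ck_on k S (pdy g)"
      using Suc.IH[OF Suc.prems(1), of "pdx f" "pdx g"] Suc.IH[OF Suc.prems(1), of "pdy f" "pdy g"]
        pd_cong_open[OF Suc.prems(1) _ Suc.prems(2)] Suc.prems(3) by auto
  qed
qed

text \<open>\<open>Ck_on\<close> speaks of the functions \<open>pdx f\<close> and
  \<open>pdy f\<close> themselves. In inductions the partial derivatives are known on S only, by a
  formula; openness of S lets the formula stand in for them.\<close>

lemma Ck_on_SucI:
  assumes "open S" "\<And>z. z \<in> S \<Longrightarrow> f differentiable (at z)"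
    "\<And>z. z \<in> S \<Longrightarrow> a z = pdx f z" "\<And>z. z \<in> S \<Longrightarrow> b z = pdy f z" "Ck_on k S a" "Ck_on k S b"
  shows "Ck_on (Suc k) S f"
  using Ck_on_cong[OF assms(1) assms(3) assms(5)] Ck_on_cong[OF assms(1) assms(4) assms(6)] assms(2) by auto

lemma Ck_on_subset: "Ck_on k S f \<Longrightarrow> T \<subseteq> S \<Longrightarrow> Ck_on k T f"
  by (induction k arbitrary: f) (auto intro: continuous_on_subset)

lemma Ck_on_continuous: "Ck_on k S f \<Longrightarrow> continuous_on S f"
  by (cases k) (auto intro!: continuous_at_imp_continuous_on differentiable_imp_continuous_within)

lemma Ck_on_SucD: "Ck_on (Suc k) S f \<Longrightarrow> Ck_on k S f"
proof (induction k arbitrary: f)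
  case 0 then show ?case using Ck_on_continuous by (simp del: Ck_on.simps(2) add: Ck_on_continuous)
next
  case (Suc k)
  then show ?case by (metis Ck_on.simps(2))
qed

text \<open>Differentiability is taken at points of the plane, not within S, so only the continuity
  at the bottom of the recursion has to be glued, and that is local on open sets.\<close>

lemma Ck_on_Union:
  "(\<And>S. S \<in> A \<Longrightarrow> open S) \<Longrightarrow> (\<And>S. S \<in> A \<Longrightarrow> Ck_on k S f) \<Longrightarrow> Ck_on k (\<Union>A) f"
  by (induction k arbitrary: f) (auto intro: continuous_on_open_Union)

lemma Ck_on_local:
  assumes "\<And>z. z \<in> S \<Longrightarrow> \<exists>U. open U \<and> z \<in> U \<and> Ck_on k U f"
  shows "Ck_on k S f"
proof -
  have "Ck_on k (\<Union>{U. open U \<and> Ck_on k U f}) f" by (rule Ck_on_Union) auto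
  then show ?thesis by (rule Ck_on_subset) (use assms in blast)
qed

lemma pd_add:
  assumes "f differentiable (at z)" "g differentiable (at z)"
  shows "pdx (\<lambda>w. f w + g w) z = pdx f z + pdx g z" "pdy (\<lambda>w. f w + g w) z = pdy f z + pdy g z"
proof -
  have "((\<lambda>w. f w + g w) has_derivative
     (\<lambda>v. Re v * (pdx f z + pdx g z) + Im v * (pdy f z + pdy g z))) (at z)"
    using has_derivative_add[OF has_derivative_pd[OF assms(1)] has_derivative_pd[OF assms(2)]]
    by (simp add: algebra_simps)
  then show "pdx (\<lambda>w. f w + g w) z = pdx f z + pdx g z" "pdy (\<lambda>w. f w + g w) z = pdy f z + pdy g z"
    using pd_eqI by blast+
qed

lemma pd_mult:
  assumes "f differentiable (at z)" "g differentiable (at z)"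
  shows "pdx (\<lambda>w. f w * g w) z = pdx f z * g z + f z * pdx g z"
        "pdy (\<lambda>w. f w * g w) z = pdy f z * g z + f z * pdy g z"
proof -
  have "((\<lambda>w. f w * g w) has_derivative
     (\<lambda>v. Re v * (pdx f z * g z + f z * pdx g z) + Im v * (pdy f z * g z + f z * pdy g z))) (at z)"
    using has_derivative_mult[OF has_derivative_pd[OF assms(1)] has_derivative_pd[OF assms(2)]]
    by (simp add: algebra_simps)
  then show "pdx (\<lambda>w. f w * g w) z = pdx f z * g z + f z * pdx g z"
        "pdy (\<lambda>w. f w * g w) z = pdy f z * g z + f z * pdy g z"
    using pd_eqI by blast+
qed

lemma pd_compose_real:
  assumes "f differentiable (at z)" "(k has_real_derivative d) (at (f z))"
  shows "pdx (\<lambda>w. k (f w)) z = d * pdx f z" "pdy (\<lambda>w. k (f w)) z = d * pdy f z"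
    "(\<lambda>w. k (f w)) differentiable (at z)"
proof -
  have "((\<lambda>w. k (f w)) has_derivative (\<lambda>v. Re v * (d * pdx f z) + Im v * (d * pdy f z))) (at z)"
    using has_derivative_compose[OF has_derivative_pd[OF assms(1)] assms(2)[unfolded has_field_derivative_def]]
    by (simp add: algebra_simps)
  then show "pdx (\<lambda>w. k (f w)) z = d * pdx f z" "pdy (\<lambda>w. k (f w)) z = d * pdy f z"
    "(\<lambda>w. k (f w)) differentiable (at z)"
    using pd_eqI unfolding differentiable_def by blast+
qed

lemma pd_const [simp]: "pdx (\<lambda>w. c) z = 0" "pdy (\<lambda>w. c) z = 0"
  by (auto simp: pdx_def pdy_def)

lemma pd_const' [simp]: "pdx (\<lambda>w. c) = (\<lambda>w. 0)" "pdy (\<lambda>w. c) = (\<lambda>w. 0)"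
  by auto

lemma Ck_on_const [simp]: "Ck_on k S (\<lambda>z. c)"
  by (induction k arbitrary: c) auto

lemma Ck_on_add: "open S \<Longrightarrow> Ck_on k S f \<Longrightarrow> Ck_on k S g \<Longrightarrow> Ck_on k S (\<lambda>z. f z + g z)"
proof (induction k arbitrary: f g)
  case 0 then show ?case by (auto intro: continuous_intros)
next
  case (Suc k)
  have "Ck_on k S (\<lambda>z. pdx f z + pdx g z)" "Ck_on k S (\<lambda>z. pdy f z + pdy g z)"
    using Suc by auto
  then show ?case using Suc.prems
    by (intro Ck_on_SucI[rotated 4]) (auto intro!: differentiable_add simp: pd_add)
qed

lemma Ck_on_mult: "open S \<Longrightarrow> Ck_on k S f \<Longrightarrow> Ck_on k S g \<Longrightarrow> Ck_on k S (\<lambda>z. f z * g z)"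
proof (induction k arbitrary: f g)
  case 0 then show ?case by (auto intro: continuous_intros)
next
  case (Suc k)
  have "Ck_on k S f" "Ck_on k S g" using Suc.prems Ck_on_SucD by blast+
  then have "Ck_on k S (\<lambda>z. pdx f z * g z + f z * pdx g z)" "Ck_on k S (\<lambda>z. pdy f z * g z + f z * pdy g z)"
    using Suc by (auto intro!: Ck_on_add)
  then show ?case using Suc.prems
    by (intro Ck_on_SucI[rotated 4]) (auto intro!: differentiable_mult simp: pd_mult)
qed

lemma Ck_on_minus: "open S \<Longrightarrow> Ck_on k S f \<Longrightarrow> Ck_on k S (\<lambda>z. - f z)"
  using Ck_on_mult[of S k "\<lambda>_. -1" f] by simp

lemma Ck_on_diff: "open S \<Longrightarrow> Ck_on k S f \<Longrightarrow> Ck_on k S g \<Longrightarrow> Ck_on k S (\<lambda>z. f z - g z)"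
  using Ck_on_add[of S k f "\<lambda>z. - g z"] Ck_on_minus by simp

text \<open>The derivative is asserted to exist rather than computed by \<open>deriv\<close>, so
  closure properties are proved by exhibiting it.\<close>

primrec Ck_real :: "nat \<Rightarrow> (real \<Rightarrow> real) \<Rightarrow> bool" where
  "Ck_real 0 f \<longleftrightarrow> continuous_on UNIV f"
| "Ck_real (Suc k) f \<longleftrightarrow> (\<exists>f'. (\<forall>x. (f has_real_derivative f' x) (at x)) \<and> Ck_real k f')"

lemma Ck_real_continuous: "Ck_real k f \<Longrightarrow> continuous_on UNIV f"
  by (cases k) (auto intro!: continuous_at_imp_continuous_on intro: DERIV_isCont)

lemma Ck_real_SucD: "Ck_real (Suc k) f \<Longrightarrow> Ck_real k f"
proof (induction k arbitrary: f)
  case 0 then show ?case using Ck_real_continuous[OF 0] by simp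
next
  case (Suc k) then show ?case by (metis Ck_real.simps(2))
qed

lemma Ck_on_compose_real:
  "open S \<Longrightarrow> Ck_real k j \<Longrightarrow> Ck_on k S f \<Longrightarrow> Ck_on k S (\<lambda>z. j (f z))"
proof (induction k arbitrary: f j)
  case 0
  then show ?case using continuous_on_compose2[of UNIV j S f] by auto
next
  case (Suc k)
  obtain j' where c: "\<And>x. (j has_real_derivative j' x) (at x)" "Ck_real k j'" using Suc.prems by auto
  have "Ck_on k S (\<lambda>z. j' (f z))" using Suc c Ck_on_SucD by blast
  then have "Ck_on k S (\<lambda>z. j' (f z) * pdx f z)" "Ck_on k S (\<lambda>z. j' (f z) * pdy f z)"
    using Suc.prems by (auto intro!: Ck_on_mult)
  then show ?case using Suc.prems
    by (intro Ck_on_SucI[rotated 4]) (auto simp: pd_compose_real[OF _ c(1)])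
qed

lemma pd_Re_holomorphic:
  assumes "(f has_field_derivative f') (at z)"
  shows "pdx (\<lambda>z. Re (f z)) z = Re f'" "pdy (\<lambda>z. Re (f z)) z = - Im f'"
    "(\<lambda>z. Re (f z)) differentiable (at z)"
proof -
  have "((\<lambda>z. Re (f z)) has_derivative (\<lambda>v. Re v * Re f' + Im v * (- Im f'))) (at z)"
    using has_derivative_Re[OF assms[unfolded has_field_derivative_def]]
    by (simp add: algebra_simps)
  then show "pdx (\<lambda>z. Re (f z)) z = Re f'" "pdy (\<lambda>z. Re (f z)) z = - Im f'"
    "(\<lambda>z. Re (f z)) differentiable (at z)"
    using pd_eqI unfolding differentiable_def by blast+
qed

text \<open>The induction closes because both partial derivatives are again real parts of
  holomorphic functions: Re f' and -Im f' = Re (i f').\<close>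

lemma Ck_on_Re_holomorphic: "open S \<Longrightarrow> f holomorphic_on S \<Longrightarrow> Ck_on k S (\<lambda>z. Re (f z))"
proof (induction k arbitrary: f)
  case 0
  then show ?case by (auto intro!: continuous_intros holomorphic_on_imp_continuous_on)
next
  case (Suc k)
  have d: "(f has_field_derivative deriv f z) (at z)" if "z \<in> S" for z
    using holomorphic_derivI[OF Suc.prems(2,1) that] .
  have h: "deriv f holomorphic_on S" by (rule holomorphic_deriv[OF Suc.prems(2,1)])
  then have "(\<lambda>z. \<i> * deriv f z) holomorphic_on S" by (intro holomorphic_on_mult holomorphic_on_const)
  note k = Suc.IH[OF Suc.prems(1) h] Suc.IH[OF Suc.prems(1) this]
  show ?case by (rule Ck_on_SucI[OF Suc.prems(1) _ _ _ k]) (simp_all add: pd_Re_holomorphic[OF d])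
qed

lemma laplacian_cong_open:
  assumes "open S" "z \<in> S" "\<And>w. w \<in> S \<Longrightarrow> f w = g w"
  shows "laplacian f z = laplacian g z"
proof -
  have "pdx (pdx f) z = pdx (pdx g) z" "pdy (pdy f) z = pdy (pdy g) z"
    using pd_cong_open[OF assms(1) _ assms(3)] by (auto intro!: pd_cong_open[OF assms(1,2)])
  then show ?thesis by (simp add: laplacian_def)
qed

lemma laplacian_const [simp]: "laplacian (\<lambda>z. c) z = 0"
  by (simp add: laplacian_def)

lemma Ck_2D:
  assumes "Ck_on 2 S f"
  shows "\<And>z. z \<in> S \<Longrightarrow> f differentiable (at z)"
    "\<And>z. z \<in> S \<Longrightarrow> pdx f differentiable (at z)" "\<And>z. z \<in> S \<Longrightarrow> pdy f differentiable (at z)"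
    "continuous_on S (pdx f)" "continuous_on S (pdy f)"
    "continuous_on S (pdx (pdx f))" "continuous_on S (pdy (pdy f))"
    "continuous_on S (pdx (pdy f))" "continuous_on S (pdy (pdx f))"
proof -
  have k: "Ck_on (Suc (Suc 0)) S f" using assms by (simp add: numeral_2_eq_2)
  then show "\<And>z. z \<in> S \<Longrightarrow> f differentiable (at z)"
    and d: "\<And>z. z \<in> S \<Longrightarrow> pdx f differentiable (at z)" "\<And>z. z \<in> S \<Longrightarrow> pdy f differentiable (at z)"
    and "continuous_on S (pdx (pdx f))" "continuous_on S (pdy (pdy f))"
    "continuous_on S (pdx (pdy f))" "continuous_on S (pdy (pdx f))"
    by simp_all
  from k have "Ck_on (Suc 0) S (pdx f)" "Ck_on (Suc 0) S (pdy f)" by simp_all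
  then show "continuous_on S (pdx f)" "continuous_on S (pdy f)"
    by (blast intro: Ck_on_continuous)+
qed

lemma continuous_on_laplacian: "Ck_on 2 S f \<Longrightarrow> continuous_on S (laplacian f)"
  unfolding laplacian_def[abs_def] by (intro continuous_intros Ck_2D)

lemma laplacian_add:
  assumes "open S" "Ck_on 2 S f" "Ck_on 2 S g" "z \<in> S"
  shows "laplacian (\<lambda>w. f w + g w) z = laplacian f z + laplacian g z"
proof -
  have "pdx (pdx (\<lambda>w. f w + g w)) z = pdx (\<lambda>w. pdx f w + pdx g w) z"
       "pdy (pdy (\<lambda>w. f w + g w)) z = pdy (\<lambda>w. pdy f w + pdy g w) z"
    using assms by (auto intro!: pd_cong_open[OF assms(1,4)] pd_add Ck_2D)
  then show ?thesis using assms by (simp add: laplacian_def pd_add Ck_2D)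
qed

lemma laplacian_compose_real:
  assumes "open S" "Ck_on 2 S f" "z \<in> S"
    "\<And>x. (k has_real_derivative k' x) (at x)" "\<And>x. (k' has_real_derivative k'' x) (at x)"
  shows "laplacian (\<lambda>w. k (f w)) z
    = k'' (f z) * ((pdx f z)\<^sup>2 + (pdy f z)\<^sup>2) + k' (f z) * laplacian f z"
proof -
  note d = Ck_2D[OF assms(2)]
  have "pdx (pdx (\<lambda>w. k (f w))) z = pdx (\<lambda>w. k' (f w) * pdx f w) z"
       "pdy (pdy (\<lambda>w. k (f w))) z = pdy (\<lambda>w. k' (f w) * pdy f w) z"
    by (auto intro!: pd_cong_open[OF assms(1,3)] pd_compose_real d assms)
  then show ?thesis
    using assms(3) by (simp add: laplacian_def pd_mult pd_compose_real[OF _ assms(5)] d power2_eq_square algebra_simps)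
qed

lemma laplacian_Re_holomorphic:
  assumes "open S" "f holomorphic_on S" "z \<in> S"
  shows "laplacian (\<lambda>z. Re (f z)) z = 0"
proof -
  have d: "(f has_field_derivative deriv f z) (at z)" if "z \<in> S" for z
    using holomorphic_derivI[OF assms(2,1) that] .
  have h: "deriv f holomorphic_on S" by (rule holomorphic_deriv[OF assms(2,1)])
  have d2: "(deriv f has_field_derivative deriv (deriv f) z) (at z)"
    using holomorphic_derivI[OF h assms(1) assms(3)] .
  have e: "(\<lambda>z. - Im (deriv f z)) = (\<lambda>z. Re (\<i> * deriv f z))" by auto
  have "pdx (pdx (\<lambda>w. Re (f w))) z = pdx (\<lambda>w. Re (deriv f w)) z"
       "pdy (pdy (\<lambda>w. Re (f w))) z = pdy (\<lambda>w. Re (\<i> * deriv f w)) z"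
    using pd_Re_holomorphic[OF d] by (auto intro!: pd_cong_open[OF assms(1,3)])
  moreover have "((\<lambda>w. \<i> * deriv f w) has_field_derivative \<i> * deriv (deriv f) z) (at z)"
    by (rule DERIV_cmult[OF d2])
  ultimately show ?thesis
    unfolding laplacian_def using pd_Re_holomorphic[OF d2] pd_Re_holomorphic(2) by fastforce
qed

section \<open>Harmonic functions as local real parts of holomorphic functions\<close>

lemma harmonic_on_subset: "harmonic_on S h \<Longrightarrow> T \<subseteq> S \<Longrightarrow> harmonic_on T h"
  unfolding harmonic_on_def using Ck_on_subset by blast

lemma harmonic_on_cong:
  assumes "open S" "harmonic_on S h" "\<And>w. w \<in> S \<Longrightarrow> h w = k w"
  shows "harmonic_on S k"
  using assms Ck_on_cong[OF assms(1,3)] laplacian_cong_open[OF assms(1) _ assms(3)]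
  unfolding harmonic_on_def by fastforce

lemma harmonic_on_Re: "open S \<Longrightarrow> f holomorphic_on S \<Longrightarrow> harmonic_on S (\<lambda>z. Re (f z))"
  unfolding harmonic_on_def by (simp add: Ck_on_Re_holomorphic laplacian_Re_holomorphic)

lemma harmonic_on_add:
  "open S \<Longrightarrow> harmonic_on S h \<Longrightarrow> harmonic_on S k \<Longrightarrow> harmonic_on S (\<lambda>z. h z + k z)"
  unfolding harmonic_on_def by (simp add: Ck_on_add laplacian_add)

lemma DERIV_pdx:
  assumes "f differentiable (at (z + of_real t))"
  shows "((\<lambda>t::real. f (z + of_real t)) has_real_derivative pdx f (z + of_real t)) (at t)"
proof -
  have "((\<lambda>t::real. z + of_real t) has_derivative (\<lambda>t. of_real t)) (at t)"
    by (auto intro!: derivative_eq_intros)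
  from has_derivative_compose[OF this has_derivative_pd[OF assms]] show ?thesis
    by (simp add: has_field_derivative_def mult.commute[of _ "pdx f (z + of_real t)"])
qed

lemma DERIV_pdy:
  assumes "f differentiable (at (z + \<i> * of_real t))"
  shows "((\<lambda>t::real. f (z + \<i> * of_real t)) has_real_derivative pdy f (z + \<i> * of_real t)) (at t)"
proof -
  have "((\<lambda>t::real. z + \<i> * of_real t) has_derivative (\<lambda>t. \<i> * of_real t)) (at t)"
    by (auto intro!: derivative_eq_intros)
  from has_derivative_compose[OF this has_derivative_pd[OF assms]] show ?thesis
    by (simp add: has_field_derivative_def mult.commute[of _ "pdy f (z + \<i> * of_real t)"])
qed

text \<open>Schwarz's theorem through the second difference of f over a square of side s: the mean
  value theorem, applied twice, expresses it as s^2 times a mixed derivative, and the order of the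
  two applications decides which one.\<close>

lemma mixed_partials_near:
  assumes "Ck_on 2 (ball z r) f" "0 < s" "2 * s < r"
  shows "\<exists>p q. dist z p < r \<and> dist z q < r \<and> dist z p \<le> 2 * s \<and> dist z q \<le> 2 * s \<and>
     pdy (pdx f) p = pdx (pdy f) q"
proof -
  note d = Ck_2D[OF assms(1)]
  have in_ball: "dist z (z + of_real a + \<i> * of_real b) \<le> 2 * s" if "0 \<le> a" "a \<le> s" "0 \<le> b" "b \<le> s" for a b
  proof -
    have "norm (of_real a + \<i> * of_real b) \<le> norm (of_real a :: complex) + norm (\<i> * of_real b)"
      by (rule norm_triangle_ineq)
    also have "\<dots> \<le> 2 * s" using that by (simp add: norm_mult)
    finally have "norm (- (of_real a + \<i> * of_real b)) \<le> 2 * s" by (simp only: norm_minus_cancel)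
    moreover have "z - (z + of_real a + \<i> * of_real b) = - (of_real a + \<i> * of_real b)" by simp
    ultimately show ?thesis by (simp only: dist_norm)
  qed
  define A where "A = (\<lambda>a. f (z + \<i> * of_real s + of_real a) - f (z + of_real a))"
  have "\<exists>a. 0 < a \<and> a < s \<and> A s - A 0 = (s - 0) * (pdx f (z + \<i> * of_real s + of_real a) - pdx f (z + of_real a))"
  proof (rule MVT2[OF assms(2)])
    fix a assume a: "0 \<le> a" "a \<le> s"
    have "z + \<i> * of_real s + of_real a \<in> ball z r" "z + of_real a \<in> ball z r"
      using in_ball[OF a, of s] in_ball[OF a, of 0] assms(2,3) by (simp_all add: add_ac)
    then show "(A has_real_derivative (pdx f (z + \<i> * of_real s + of_real a) - pdx f (z + of_real a))) (at a)"
      unfolding A_def by (intro DERIV_diff DERIV_pdx d)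
  qed
  then obtain a where a: "0 < a" "a < s"
    "A s - A 0 = s * (pdx f (z + \<i> * of_real s + of_real a) - pdx f (z + of_real a))" by auto
  have "\<exists>b. 0 < b \<and> b < s \<and> pdx f (z + of_real a + \<i> * of_real s) - pdx f (z + of_real a + \<i> * of_real 0)
      = (s - 0) * pdy (pdx f) (z + of_real a + \<i> * of_real b)"
  proof (rule MVT2[OF assms(2)])
    fix b assume b: "0 \<le> b" "b \<le> s"
    have "z + of_real a + \<i> * of_real b \<in> ball z r" using in_ball[of a b] a b assms(3) by simp
    then show "((\<lambda>b. pdx f (z + of_real a + \<i> * of_real b)) has_real_derivative
         pdy (pdx f) (z + of_real a + \<i> * of_real b)) (at b)" by (intro DERIV_pdy d)
  qed
  then obtain b where b: "0 < b" "b < s" "pdx f (z + of_real a + \<i> * of_real s) - pdx f (z + of_real a)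
      = s * pdy (pdx f) (z + of_real a + \<i> * of_real b)" by auto
  define B where "B = (\<lambda>b. f (z + of_real s + \<i> * of_real b) - f (z + \<i> * of_real b))"
  have "\<exists>b. 0 < b \<and> b < s \<and> B s - B 0 = (s - 0) * (pdy f (z + of_real s + \<i> * of_real b) - pdy f (z + \<i> * of_real b))"
  proof (rule MVT2[OF assms(2)])
    fix b assume b: "0 \<le> b" "b \<le> s"
    have "z + of_real s + \<i> * of_real b \<in> ball z r" "z + \<i> * of_real b \<in> ball z r"
      using in_ball[of s b] in_ball[of 0 b] b assms(2,3) by (simp_all add: add_ac)
    then show "(B has_real_derivative (pdy f (z + of_real s + \<i> * of_real b) - pdy f (z + \<i> * of_real b))) (at b)"
      unfolding B_def by (intro DERIV_diff DERIV_pdy d)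
  qed
  then obtain b' where b': "0 < b'" "b' < s"
    "B s - B 0 = s * (pdy f (z + of_real s + \<i> * of_real b') - pdy f (z + \<i> * of_real b'))" by auto
  have "\<exists>a. 0 < a \<and> a < s \<and> pdy f (z + \<i> * of_real b' + of_real s) - pdy f (z + \<i> * of_real b' + of_real 0)
      = (s - 0) * pdx (pdy f) (z + \<i> * of_real b' + of_real a)"
  proof (rule MVT2[OF assms(2)])
    fix a assume a: "0 \<le> a" "a \<le> s"
    have "z + \<i> * of_real b' + of_real a \<in> ball z r" using in_ball[of a b'] a b' assms(3) by (simp add: add_ac)
    then show "((\<lambda>a. pdy f (z + \<i> * of_real b' + of_real a)) has_real_derivative
         pdx (pdy f) (z + \<i> * of_real b' + of_real a)) (at a)" by (intro DERIV_pdx d)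
  qed
  then obtain a' where a': "0 < a'" "a' < s" "pdy f (z + \<i> * of_real b' + of_real s) - pdy f (z + \<i> * of_real b')
      = s * pdx (pdy f) (z + \<i> * of_real b' + of_real a')" by auto
  \<comment> \<open>Both sides are the same second difference over the four corners of the
    square.\<close>
  have "A s - A 0 = B s - B 0" by (simp add: A_def B_def add_ac)
  then have "s * (s * pdy (pdx f) (z + of_real a + \<i> * of_real b)) = s * (s * pdx (pdy f) (z + of_real a' + \<i> * of_real b'))"
    using a(3) b(3) b'(3) a'(3) by (simp add: add_ac)
  then have "pdy (pdx f) (z + of_real a + \<i> * of_real b) = pdx (pdy f) (z + of_real a' + \<i> * of_real b')"
    using assms(2) by simp
  moreover have "dist z (z + of_real a + \<i> * of_real b) \<le> 2 * s" "dist z (z + of_real a' + \<i> * of_real b') \<le> 2 * s"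
    using a b a' b' by (auto intro!: in_ball)
  ultimately show ?thesis using assms(3) by (meson le_less_trans)
qed

lemma mixed_partials_eq:
  assumes "open S" "Ck_on 2 S f" "z \<in> S"
  shows "pdy (pdx f) z = pdx (pdy f) z"
proof -
  obtain r where r: "0 < r" "ball z r \<subseteq> S" using assms(1,3) openE by blast
  have ck: "Ck_on 2 (ball z r) f" using Ck_on_subset[OF assms(2) r(2)] .
  define s where "s = (\<lambda>n. r / (4 * real (Suc n)))"
  have s: "0 < s n" "2 * s n < r" for n
    using r(1) by (auto simp: s_def field_simps add_pos_nonneg)
  have "\<forall>n. \<exists>p q. dist z p < r \<and> dist z q < r \<and> dist z p \<le> 2 * s n \<and> dist z q \<le> 2 * s n \<and>
     pdy (pdx f) p = pdx (pdy f) q" using mixed_partials_near[OF ck s] by blast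
  then obtain p q where pq: "\<And>n. dist z (p n) < r" "\<And>n. dist z (q n) < r" "\<And>n. dist z (p n) \<le> 2 * s n"
    "\<And>n. dist z (q n) \<le> 2 * s n" "\<And>n. pdy (pdx f) (p n) = pdx (pdy f) (q n)" by metis
  have s0: "(\<lambda>n. 2 * s n) \<longlonglongrightarrow> 0"
  proof -
    have "(\<lambda>n. (r / 2) * inverse (real (Suc n))) \<longlonglongrightarrow> (r / 2) * 0"
      by (intro tendsto_intros LIMSEQ_inverse_real_of_nat)
    moreover have "(\<lambda>n. 2 * s n) = (\<lambda>n. (r / 2) * inverse (real (Suc n)))"
    proof
      have "2 * (r / (4 * k)) = (r / 2) * inverse k" for k :: real by (simp add: divide_simps)
      then show "2 * s n = (r / 2) * inverse (real (Suc n))" for n unfolding s_def .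
    qed
    ultimately show ?thesis by (simp only: mult_zero_right)
  qed
  have "p \<longlonglongrightarrow> z" "q \<longlonglongrightarrow> z"
    by (rule tendsto_dist_iff[THEN iffD2], rule Lim_null_comparison[OF _ s0], use pq(3,4) in \<open>simp add: dist_commute\<close>)+
  moreover have "isCont (pdy (pdx f)) z" "isCont (pdx (pdy f)) z"
    using Ck_2D(8,9)[OF ck] r(1) by (auto simp: continuous_on_eq_continuous_at)
  ultimately have "(\<lambda>n. pdy (pdx f) (p n)) \<longlonglongrightarrow> pdy (pdx f) z" "(\<lambda>n. pdx (pdy f) (q n)) \<longlonglongrightarrow> pdx (pdy f) z"
    using isCont_tendsto_compose by blast+
  with pq(5) show ?thesis using LIMSEQ_unique by auto
qed

text \<open>The function h_x - i h_y is holomorphic: the Laplace equation and the symmetry of mixed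
  derivatives are its Cauchy-Riemann equations. Its primitive on the convex ball has real part h up
  to a constant.\<close>

lemma harmonic_on_ball_Re:
  assumes "harmonic_on (ball a r) h"
  shows "\<exists>f. f holomorphic_on ball a r \<and> (\<forall>z\<in>ball a r. h z = Re (f z))"
proof (cases "0 < r")
  case True
  have ck: "Ck_on 2 (ball a r) h" and lap: "\<And>z. z \<in> ball a r \<Longrightarrow> laplacian h z = 0"
    using assms by (auto simp: harmonic_on_def)
  note d = Ck_2D[OF ck]
  define G where "G = (\<lambda>z. complex_of_real (pdx h z) - \<i> * complex_of_real (pdy h z))"
  have G: "(G has_field_derivative Complex (pdx (pdx h) z) (- pdx (pdy h) z)) (at z)" if z: "z \<in> ball a r" for z
  proof -
    have e: "pdy (pdx h) z = pdx (pdy h) z" using mixed_partials_eq[OF _ ck z] by simp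
    have l: "pdy (pdy h) z = - pdx (pdx h) z" using lap[OF z] by (simp add: laplacian_def)
    have "(G has_derivative (\<lambda>v. complex_of_real (Re v * pdx (pdx h) z + Im v * pdy (pdx h) z)
        - \<i> * complex_of_real (Re v * pdx (pdy h) z + Im v * pdy (pdy h) z))) (at z)"
      unfolding G_def
      by (intro has_derivative_diff has_derivative_mult_right has_derivative_of_real has_derivative_pd d z)
    then show ?thesis unfolding has_field_derivative_def
      by (rule has_derivative_eq_rhs) (auto simp: e l complex_eq_iff algebra_simps)
  qed
  then have "G holomorphic_on ball a r" unfolding holomorphic_on_open[OF open_ball] by blast
  then obtain F where F: "\<And>x. x \<in> ball a r \<Longrightarrow> (F has_field_derivative G x) (at x within ball a r)"
    using holomorphic_convex_primitive'[of "ball a r" G] by auto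
  then have F': "(F has_field_derivative G x) (at x)" if "x \<in> ball a r" for x
    using that by (metis at_within_open open_ball)
  have "((\<lambda>z. h z - Re (F z)) has_derivative (\<lambda>v. 0)) (at z within ball a r)" if z: "z \<in> ball a r" for z
  proof -
    note R = pd_Re_holomorphic[OF F'[OF z]]
    have "((\<lambda>z. h z - Re (F z)) has_derivative (\<lambda>v. (Re v * pdx h z + Im v * pdy h z) -
        (Re v * pdx (\<lambda>z. Re (F z)) z + Im v * pdy (\<lambda>z. Re (F z)) z))) (at z)"
      by (intro has_derivative_diff has_derivative_pd d z R)
    then show ?thesis by (simp add: R(1,2) G_def has_derivative_at_withinI)
  qed
  then have "\<exists>c. \<forall>z\<in>ball a r. h z - Re (F z) = c" by (rule has_derivative_zero_constant[OF convex_ball])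
  then obtain c where c: "\<And>z. z \<in> ball a r \<Longrightarrow> h z - Re (F z) = c" by blast
  have "F holomorphic_on ball a r" unfolding holomorphic_on_open[OF open_ball] using F' by blast
  then have "(\<lambda>z. F z + of_real c) holomorphic_on ball a r"
    by (intro holomorphic_on_add holomorphic_on_const)
  moreover have "h z = Re (F z + of_real c)" if "z \<in> ball a r" for z using c[OF that] by simp
  ultimately show ?thesis by (intro exI[of _ "\<lambda>z. F z + of_real c"]) auto
qed (auto simp: ball_empty intro!: exI[of _ "\<lambda>_. 0"])

text \<open>Harmonicity is defined through C^2 only, whereas test functions need derivatives of all
  orders; the local representation as a real part supplies them.\<close>

lemma harmonic_on_smooth:
  assumes "open S" "harmonic_on S h"
  shows "Ck_on k S h"
proof (rule Ck_on_local)
  fix z assume "z \<in> S"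
  then obtain r where r: "0 < r" "ball z r \<subseteq> S" using assms(1) openE by blast
  obtain f where f: "f holomorphic_on ball z r" "\<forall>w\<in>ball z r. h w = Re (f w)"
    using harmonic_on_ball_Re[OF harmonic_on_subset[OF assms(2) r(2)]] by auto
  have "Ck_on k (ball z r) h"
    by (rule Ck_on_cong[OF _ _ Ck_on_Re_holomorphic[OF _ f(1)]]) (use f(2) in auto)
  then show "\<exists>U. open U \<and> z \<in> U \<and> Ck_on k U h" using r(1) by (intro exI[of _ "ball z r"]) auto
qed

text \<open>With h = Re f, the modulus of exp (-f) is exp (-h), so a minimum of h at the centre is a
  maximum of the modulus of a holomorphic function.\<close>

lemma harmonic_local_min:
  assumes "harmonic_on (ball a r) h" "\<And>z. z \<in> ball a r \<Longrightarrow> h a \<le> h z" "z \<in> ball a r"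
  shows "h z = h a"
proof -
  obtain f where f: "f holomorphic_on ball a r" "\<And>w. w \<in> ball a r \<Longrightarrow> h w = Re (f w)"
    using harmonic_on_ball_Re[OF assms(1)] by auto
  have r: "0 < r" using assms(3) by (metis mem_ball zero_le_dist le_less_trans)
  have "(\<lambda>z. exp (- f z)) constant_on ball a r"
  proof (rule maximum_modulus_principle[where U = "ball a r" and \<xi> = a])
    show "(\<lambda>z. exp (- f z)) holomorphic_on ball a r" by (intro holomorphic_intros f)
    show "cmod (exp (- f z)) \<le> cmod (exp (- f a))" if "z \<in> ball a r" for z
      using assms(2)[OF that] f(2)[OF that] f(2)[of a] r by simp
  qed (use r in auto)
  then obtain c where "\<And>z. z \<in> ball a r \<Longrightarrow> exp (- f z) = c" by (auto simp: constant_on_def)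
  then have "cmod (exp (- f z)) = cmod (exp (- f a))" using assms(3) r by simp
  then show ?thesis using f(2)[OF assms(3)] f(2)[of a] r by simp
qed

section \<open>Lebesgue measure of the plane: Fubini, change of variables, polar coordinates\<close>

text \<open>The complex numbers are not a product type, so Fubini is carried over by this identity,
  which is checked on boxes.\<close>

lemma lborel_complex: "(lborel :: complex measure) = distr (lborel \<Otimes>\<^sub>M lborel) borel (\<lambda>(x, y). Complex x y)"
proof (rule lborel_eqI)
  have m[measurable]: "(\<lambda>(x::real, y::real). Complex x y) \<in> lborel \<Otimes>\<^sub>M lborel \<rightarrow>\<^sub>M borel"
  proof -
    have "(\<lambda>p::real\<times>real. Complex (fst p) (snd p)) \<in> borel_measurable borel"
      unfolding Complex_eq by (intro borel_measurable_continuous_onI continuous_intros)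
    then show ?thesis by (simp add: lborel_prod case_prod_beta')
  qed
  fix l u :: complex assume lu: "\<And>b. b \<in> Basis \<Longrightarrow> l \<bullet> b \<le> u \<bullet> b"
  have le: "Re l \<le> Re u" "Im l \<le> Im u" using lu[of 1] lu[of \<i>] by (auto simp: Basis_complex_def)
  have "(\<lambda>(x, y). Complex x y) -` box l u \<inter> space (lborel \<Otimes>\<^sub>M lborel) = {Re l<..<Re u} \<times> {Im l<..<Im u}"
    by (auto simp: box_def Basis_complex_def space_pair_measure)
  then have "emeasure (distr (lborel \<Otimes>\<^sub>M lborel) borel (\<lambda>(x, y). Complex x y)) (box l u)
     = emeasure (lborel \<Otimes>\<^sub>M lborel) ({Re l<..<Re u} \<times> {Im l<..<Im u})"
    by (subst emeasure_distr) auto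
  also have "\<dots> = ennreal (Re u - Re l) * ennreal (Im u - Im l)"
    using le by (subst lborel.emeasure_pair_measure_Times) auto
  also have "\<dots> = ennreal (\<Prod>b\<in>Basis. (u - l) \<bullet> b)"
    using le by (simp add: Basis_complex_def ennreal_mult'')
  finally show "emeasure (distr (lborel \<Otimes>\<^sub>M lborel) borel (\<lambda>(x, y). Complex x y)) (box l u) = (\<Prod>b\<in>Basis. (u - l) \<bullet> b)" .
qed simp

lemma measurable_Complex_pair [measurable]: "(\<lambda>(x::real, y::real). Complex x y) \<in> borel \<Otimes>\<^sub>M borel \<rightarrow>\<^sub>M borel"
proof -
  have "(\<lambda>p::real\<times>real. Complex (fst p) (snd p)) \<in> borel_measurable borel"
    unfolding Complex_eq by (intro borel_measurable_continuous_onI continuous_intros)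
  then show ?thesis by (simp add: borel_prod case_prod_beta')
qed

lemma integral_complex:
  fixes f :: "complex \<Rightarrow> real"
  assumes "integrable lborel f"
  shows "(LINT z|lborel. f z) = (LINT x|lborel. LINT y|lborel. f (Complex x y))"
    "(LINT z|lborel. f z) = (LINT y|lborel. LINT x|lborel. f (Complex x y))"
proof -
  have [measurable]: "f \<in> borel_measurable borel" using borel_measurable_integrable[OF assms] by simp
  have i: "integrable (lborel \<Otimes>\<^sub>M lborel) (\<lambda>p. f (case p of (x, y) \<Rightarrow> Complex x y))"
    using assms by (subst (asm) lborel_complex) (simp add: integrable_distr_eq)
  then have i': "integrable (lborel \<Otimes>\<^sub>M lborel) (\<lambda>(x, y). f (Complex x y))" by (simp add: case_prod_beta')
  have e: "(LINT z|lborel. f z) = (LINT p|(lborel \<Otimes>\<^sub>M lborel). (case p of (x, y) \<Rightarrow> f (Complex x y)))"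
    by (subst lborel_complex) (simp add: integral_distr case_prod_beta')
  show "(LINT z|lborel. f z) = (LINT x|lborel. LINT y|lborel. f (Complex x y))"
    unfolding e using lborel_pair.integral_fst'[OF i'] by simp
  show "(LINT z|lborel. f z) = (LINT y|lborel. LINT x|lborel. f (Complex x y))"
    unfolding e using lborel_pair.integral_snd[OF i'] by simp
qed

lemma integrable_continuous_compact_support:
  fixes f :: "complex \<Rightarrow> real"
  assumes "continuous_on UNIV f" "compact K" "\<And>z. z \<notin> K \<Longrightarrow> f z = 0"
  shows "integrable lborel f"
proof -
  have "integrable lborel (\<lambda>z. indicator K z *\<^sub>R f z)"
    using borel_integrable_compact[OF assms(2) continuous_on_subset[OF assms(1) subset_UNIV]]
    by (simp add: set_integrable_def)
  moreover have "(\<lambda>z. indicator K z *\<^sub>R f z) = f"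
  proof
    show "indicator K z *\<^sub>R f z = f z" for z using assms(3)[of z] by (cases "z \<in> K") auto
  qed
  ultimately show ?thesis by simp
qed

lemma integral_DERIV_compact_support:
  fixes f :: "real \<Rightarrow> real"
  assumes "\<And>x. (f has_real_derivative f' x) (at x)" "continuous_on UNIV f'" "\<And>x. R < \<bar>x\<bar> \<Longrightarrow> f x = 0"
    "\<And>x. R < \<bar>x\<bar> \<Longrightarrow> f' x = 0"
  shows "(LINT x|lborel. f' x) = 0"
proof -
  \<comment> \<open>R may be negative; S and -S are points beyond R in any case, where f
    vanishes.\<close>
  define S where "S = \<bar>R\<bar> + 1"
  have "(LINT x|lborel. f' x) = (LINT x|lborel. f' x * indicator {-S..S} x)"
  proof (intro Bochner_Integration.integral_cong refl)
    show "f' x = f' x * indicator {-S..S} x" for x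
      using assms(4)[of x] by (cases "R < \<bar>x\<bar>") (auto simp: indicator_def S_def)
  qed
  also have "\<dots> = f S - f (- S)"
    by (rule integral_FTC_Icc_real)
      (use assms(1,2) in \<open>auto simp: S_def continuous_on_eq_continuous_at\<close>)
  also have "\<dots> = 0" using assms(3)[of S] assms(3)[of "-S"] by (simp add: S_def)
  finally show ?thesis .
qed

lemma pd_zero_outside:
  assumes "compact K" "\<And>z. z \<notin> K \<Longrightarrow> f z = 0" "z \<notin> K"
  shows "pdx f z = 0" "pdy f z = 0" "laplacian f z = 0"
proof -
  have o: "open (- K)" using assms(1) compact_imp_closed by blast
  show "pdx f z = 0" "pdy f z = 0" "laplacian f z = 0"
    using pd_cong_open[OF o, of z f "\<lambda>_. 0"] laplacian_cong_open[OF o, of z f "\<lambda>_. 0"] assms(2,3) by auto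
qed

lemma integral_pd_compact_support:
  assumes "\<And>z. f differentiable (at z)" "compact K" "\<And>z. z \<notin> K \<Longrightarrow> f z = 0"
  shows "continuous_on UNIV (pdx f) \<Longrightarrow> (LINT z|lborel. pdx f z) = 0"
    "continuous_on UNIV (pdy f) \<Longrightarrow> (LINT z|lborel. pdy f z) = 0"
proof -
  note z = pd_zero_outside[OF assms(2,3)]
  obtain R where R: "\<And>z. z \<in> K \<Longrightarrow> cmod z \<le> R" using compact_imp_bounded[OF assms(2)] bounded_iff by metis
  have out: "Complex x y \<notin> K" if "R < \<bar>x\<bar> \<or> R < \<bar>y\<bar>" for x y
    using R[of "Complex x y"] abs_Re_le_cmod[of "Complex x y"] abs_Im_le_cmod[of "Complex x y"] that by auto
  { assume c: "continuous_on UNIV (pdx f)"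
    have i: "integrable lborel (pdx f)"
      by (rule integrable_continuous_compact_support[OF c assms(2)]) (use z in auto)
    have "(LINT x|lborel. pdx f (Complex x y)) = 0" for y
    proof (rule integral_DERIV_compact_support[where R = R])
      show "((\<lambda>x. f (Complex x y)) has_real_derivative pdx f (Complex x y)) (at x)" for x
        using DERIV_pdx[OF assms(1), of "Complex 0 y" x] by (simp add: complex_eq_iff Complex_eq add.commute)
      have "continuous_on UNIV (\<lambda>x. Complex x y)" unfolding Complex_eq by (intro continuous_intros)
      then show "continuous_on UNIV (\<lambda>x. pdx f (Complex x y))" by (rule continuous_on_compose2[OF c]) auto
    qed (use z assms(3) out in auto)
    then show "(LINT z|lborel. pdx f z) = 0" using integral_complex(2)[OF i] by simp }
  { assume c: "continuous_on UNIV (pdy f)"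
    have i: "integrable lborel (pdy f)"
      by (rule integrable_continuous_compact_support[OF c assms(2)]) (use z in auto)
    have "(LINT y|lborel. pdy f (Complex x y)) = 0" for x
    proof (rule integral_DERIV_compact_support[where R = R])
      show "((\<lambda>y. f (Complex x y)) has_real_derivative pdy f (Complex x y)) (at y)" for y
        using DERIV_pdy[OF assms(1), of "Complex x 0" y] by (simp add: complex_eq_iff Complex_eq add.commute)
      have "continuous_on UNIV (\<lambda>y. Complex x y)" unfolding Complex_eq by (intro continuous_intros)
      then show "continuous_on UNIV (\<lambda>y. pdy f (Complex x y))" by (rule continuous_on_compose2[OF c]) auto
    qed (use z assms(3) out in auto)
    then show "(LINT z|lborel. pdy f z) = 0" using integral_complex(1)[OF i] by simp }
qed

text \<open>Each second derivative is integrated along its own direction, where it is the derivative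
  of a compactly supported function of one variable.\<close>

lemma integral_laplacian_compact_support:
  assumes "Ck_on 2 UNIV f" "compact K" "\<And>z. z \<notin> K \<Longrightarrow> f z = 0"
  shows "integrable lborel (laplacian f)" "(LINT z|lborel. laplacian f z) = 0"
proof -
  note d = Ck_2D[OF assms(1)] and z = pd_zero_outside[OF assms(2,3)]
  have i: "integrable lborel (pdx (pdx f))" "integrable lborel (pdy (pdy f))"
    using pd_zero_outside[OF assms(2), of "pdx f"] pd_zero_outside[OF assms(2), of "pdy f"] z
    by (auto intro!: integrable_continuous_compact_support[OF _ assms(2)] d)
  then show "integrable lborel (laplacian f)" unfolding laplacian_def[abs_def] by simp
  have "(LINT z|lborel. pdx (pdx f) z) = 0" "(LINT z|lborel. pdy (pdy f) z) = 0"
    using z by (auto intro!: integral_pd_compact_support[OF _ assms(2)] d)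
  then show "(LINT z|lborel. laplacian f z) = 0" using i by (simp add: laplacian_def)
qed

text \<open>The change of variables theorem is stated for \<open>real^2\<close> with determinants;
  \<open>c2v\<close> and \<open>v2c\<close> carry it to the complex plane.\<close>

definition c2v :: "complex \<Rightarrow> real^2" where "c2v z = (\<chi> i. if i = 1 then Re z else Im z)"
definition v2c :: "real^2 \<Rightarrow> complex" where "v2c v = Complex (v $ 1) (v $ 2)"

lemma c2v_nth [simp]: "c2v z $ 1 = Re z" "c2v z $ 2 = Im z"
  by (auto simp: c2v_def)

lemma v2c_c2v [simp]: "v2c (c2v z) = z" "c2v (v2c v) = v"
  by (auto simp: v2c_def c2v_def vec_eq_iff forall_2)

lemma bounded_linear_c2v: "bounded_linear c2v"
  by (rule linear_conv_bounded_linear[THEN iffD1])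
    (auto intro!: linearI simp: vec_eq_iff forall_2)

lemma bounded_linear_v2c: "bounded_linear v2c"
  by (rule linear_conv_bounded_linear[THEN iffD1])
    (auto intro!: linearI simp: v2c_def complex_eq_iff)

lemma v2c_measurable [measurable]: "v2c \<in> borel_measurable borel"
  by (intro borel_measurable_continuous_onI linear_continuous_on bounded_linear_v2c)

lemma lborel_complex_vec: "(lborel :: complex measure) = distr lborel borel v2c"
proof (rule lborel_eqI)
  fix l u :: complex assume lu: "\<And>b. b \<in> Basis \<Longrightarrow> l \<bullet> b \<le> u \<bullet> b"
  have le: "Re l \<le> Re u" "Im l \<le> Im u" using lu[of 1] lu[of \<i>] by (auto simp: Basis_complex_def)
  have b: "(Basis :: (real^2) set) = {axis 1 1, axis 2 1}"
    unfolding Basis_vec_def by (auto simp: UNIV_2)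
  have ne: "axis 1 1 \<noteq> (axis 2 1 :: real^2)" by (simp add: axis_eq_axis)
  have "v2c -` box l u \<inter> space lborel = box (c2v l) (c2v u)"
    by (auto simp: box_def Basis_complex_def b inner_axis v2c_def)
  then have "emeasure (distr lborel borel v2c) (box l u) = emeasure lborel (box (c2v l) (c2v u))"
    by (subst emeasure_distr) auto
  also have "\<dots> = ennreal (\<Prod>b\<in>Basis. (c2v u - c2v l) \<bullet> b)"
    by (rule emeasure_lborel_box) (use le in \<open>auto simp: b inner_axis\<close>)
  also have "\<dots> = ennreal (\<Prod>b\<in>Basis. (u - l) \<bullet> b)"
    using ne by (simp add: Basis_complex_def b inner_axis)
  finally show "emeasure (distr lborel borel v2c) (box l u) = (\<Prod>b\<in>Basis. (u - l) \<bullet> b)" .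
qed simp

lemma det_complex_mult: "det (matrix (\<lambda>v. c2v (c * v2c v))) = (cmod c)\<^sup>2"
proof -
  have "v2c (axis 1 1) = 1" "v2c (axis 2 1) = \<i>"
    by (auto simp: v2c_def axis_def complex_eq_iff)
  then show ?thesis by (simp add: det_2 matrix_def cmod_def power2_eq_square)
qed

text \<open>The Jacobian of a holomorphic map is the squared modulus of its derivative. Stated as an
  identity of measures, the substitution serves nonnegative and Bochner integrals at once; T need
  only cover almost all of the plane.\<close>

lemma lborel_holomorphic_image:
  fixes T T' :: "complex \<Rightarrow> complex"
  assumes S: "S \<in> sets borel" and T: "T \<in> borel_measurable borel" "T' \<in> borel_measurable borel"
    and der: "\<And>z. z \<in> S \<Longrightarrow> (T has_field_derivative T' z) (at z)"
    and inj: "inj_on T S" and null: "AE z in lborel. z \<in> T ` S"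
  shows "lborel = distr (density lborel (\<lambda>z. ennreal (indicator S z * (cmod (T' z))\<^sup>2))) borel T"
proof (rule lborel_eqI)
  note [measurable] = S T
  fix l u :: complex assume lu: "\<And>b. b \<in> Basis \<Longrightarrow> l \<bullet> b \<le> u \<bullet> b"
  define m where "m = (\<Prod>b\<in>Basis. (u - l) \<bullet> b)"
  have em: "emeasure lborel (box l u) = ennreal m" unfolding m_def using lu by simp
  have m0: "0 \<le> m" unfolding m_def using lu by (auto intro!: prod_nonneg simp: inner_diff_left)
  have Tb: "T -` box l u \<in> sets borel" using measurable_sets[OF T(1), of "box l u"] by simp
  define R where "R = {z \<in> S. T z \<in> box l u}"
  have R[measurable]: "R \<in> sets borel" unfolding R_def by measurable
  define Q where "Q = v2c -` R"
  have Q: "Q \<in> sets borel" unfolding Q_def using measurable_sets[OF v2c_measurable R] by simp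
  define g where "g = (\<lambda>v. c2v (T (v2c v)))"
  have gQ: "g ` Q = c2v ` (box l u \<inter> T ` S)"
    by (force simp: g_def Q_def R_def image_iff intro: exI[of _ "c2v _"])
  obtain N where N0: "{z \<in> space lborel. \<not> z \<in> T ` S} \<subseteq> N" "emeasure lborel N = 0" "N \<in> sets lborel"
    using AE_E[OF null] by metis
  then have N: "N \<in> sets lborel" "emeasure lborel N = 0" "- (T ` S) \<subseteq> N" by auto
  have v2cN: "v2c -` N \<in> null_sets lborel"
  proof (rule null_setsI)
    show "v2c -` N \<in> sets lborel" using measurable_sets[OF v2c_measurable, of N] N by simp
    have "emeasure lborel N = emeasure lborel (v2c -` N)"
      by (subst lborel_complex_vec, subst emeasure_distr) (use N in auto)
    with N show "emeasure lborel (v2c -` N) = 0" by simp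
  qed
  have bx: "v2c -` box l u \<in> sets borel" using measurable_sets[OF v2c_measurable, of "box l u"] by simp
  have ebx: "emeasure lborel (v2c -` box l u) = ennreal m"
    using em by (subst (asm) lborel_complex_vec, subst (asm) emeasure_distr) auto
  \<comment> \<open>The image of Q can miss points of the box only where T misses the plane, that is
    inside the null set N. So image and box have the same measure.\<close>
  have "g ` Q \<union> v2c -` N = v2c -` box l u \<union> v2c -` N" (is "?A \<union> ?N = ?B \<union> ?N")
  proof -
    have "x \<in> c2v ` (box l u \<inter> T ` S)" if "v2c x \<in> box l u" "v2c x \<notin> N" for x
    proof -
      have "v2c x \<in> T ` S" using that N(3) by blast
      then show ?thesis using that by (intro image_eqI[of _ _ "v2c x"]) auto
    qed
    then show ?thesis unfolding gQ by auto
  qed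
  have nl: "?N \<in> null_sets lebesgue" using null_sets_completionI[OF v2cN] by simp
  have Bl: "?B \<in> lmeasurable" "measure lebesgue ?B = m"
    using bx ebx m0 by (auto simp: fmeasurable_def measure_def)
  have "sym_diff ?B ?A \<subseteq> ?N" using \<open>?A \<union> ?N = ?B \<union> ?N\<close> by blast
  then have neg: "negligible (sym_diff ?B ?A)"
    using nl negligible_iff_null_sets negligible_subset by blast
  have "?A \<in> lmeasurable \<and> measure lebesgue ?A = m"
    using Bl lmeasurable_negligible_symdiff[OF Bl(1) neg] measure_negligible_symdiff[OF Bl(1) neg] by auto
  moreover have "(g has_derivative (\<lambda>v. c2v (T' (v2c x) * v2c v))) (at x within Q)" if "x \<in> Q" for x
  proof -
    have 1: "(v2c has_derivative v2c) (at x within Q)"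
      by (rule bounded_linear_imp_has_derivative[OF bounded_linear_v2c])
    have "(T has_derivative (\<lambda>h. T' (v2c x) * h)) (at (v2c x))"
      using der that by (auto simp: Q_def R_def has_field_derivative_def)
    from has_derivative_compose[OF 1 this]
    have "((\<lambda>v. T (v2c v)) has_derivative (\<lambda>v. T' (v2c x) * v2c v)) (at x within Q)" .
    from bounded_linear.has_derivative[OF bounded_linear_c2v this] show ?thesis unfolding g_def .
  qed
  moreover have "inj_on g Q"
  proof (rule inj_onI)
    fix x y assume xy: "x \<in> Q" "y \<in> Q" "g x = g y"
    then have "T (v2c x) = T (v2c y)" unfolding g_def by (metis v2c_c2v(1))
    then have "v2c x = v2c y" using inj xy by (auto simp: Q_def R_def inj_on_def)
    then show "x = y" by (metis v2c_c2v(2))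
  qed
  moreover have "Q \<in> sets lebesgue" using Q by simp
  ultimately have "((\<lambda>x. \<bar>det (matrix (\<lambda>v. c2v (T' (v2c x) * v2c v)))\<bar>) has_integral m) Q"
    using has_measure_differentiable_image[of Q g "\<lambda>x v. c2v (T' (v2c x) * v2c v)" m] by blast
  then have "((\<lambda>x. (cmod (T' (v2c x)))\<^sup>2) has_integral m) Q" by (simp add: det_complex_mult)
  then have "(\<integral>\<^sup>+ x. ennreal (indicator Q x * (cmod (T' (v2c x)))\<^sup>2) \<partial>lborel) = ennreal m"
    by (intro nn_integral_has_integral_lebesgue) auto
  moreover have "(\<integral>\<^sup>+ z. ennreal (indicator R z * (cmod (T' z))\<^sup>2) \<partial>lborel)
      = (\<integral>\<^sup>+ x. ennreal (indicator Q x * (cmod (T' (v2c x)))\<^sup>2) \<partial>lborel)"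
    by (subst lborel_complex_vec, subst nn_integral_distr) (auto simp: Q_def indicator_def)
  moreover have "emeasure (distr (density lborel (\<lambda>z. ennreal (indicator S z * (cmod (T' z))\<^sup>2))) borel T) (box l u)
     = (\<integral>\<^sup>+ z. ennreal (indicator R z * (cmod (T' z))\<^sup>2) \<partial>lborel)"
    using Tb by (subst emeasure_distr, simp, simp, subst emeasure_density)
      (auto intro!: nn_integral_cong simp: R_def indicator_def)
  ultimately show "emeasure (distr (density lborel (\<lambda>z. ennreal (indicator S z * (cmod (T' z))\<^sup>2))) borel T) (box l u)
     = (\<Prod>b\<in>Basis. (u - l) \<bullet> b)" by (simp add: m_def)
qed simp

lemma AE_lborel_Im_ne_0: "AE z in lborel. Im z \<noteq> 0"
proof -
  have "emeasure lborel {z::complex. Im z = 0} = 0"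
  proof -
    have "negligible {z::complex. \<i> \<bullet> z = 0}" by (rule negligible_hyperplane) auto
    then have n: "negligible {z::complex. Im z = 0}" by (simp add: inner_complex_def)
    have m: "{z::complex. Im z = 0} \<in> sets lborel"
      by (simp add: borel_closed closed_Collect_eq continuous_on_Im continuous_on_id continuous_on_const)
    have "emeasure lebesgue {z::complex. Im z = 0} = 0"
      using n negligible_iff_emeasure0[OF sets_completionI_sets[OF m]] by blast
    then show ?thesis using m by simp
  qed
  then show ?thesis
    by (intro AE_I[where N = "{z. Im z = 0}"])
      (auto simp: borel_closed closed_Collect_eq continuous_on_Im continuous_on_id continuous_on_const)
qed

lemma AE_lborel_ne_complex: "AE z in lborel. z \<noteq> (a::complex)"
  by (rule AE_lborel_singleton)

text \<open>The exponential is injective on the open strip and its image contains every point off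
  the real axis, which is a null set.\<close>

lemma lborel_exp:
  "(lborel :: complex measure) = distr (density lborel (\<lambda>z. ennreal (indicator {z. 0 < Im z \<and> Im z < 2 * pi} z * (exp (Re z))\<^sup>2))) borel exp"
proof -
  let ?S = "{z::complex. 0 < Im z \<and> Im z < 2 * pi}"
  have o: "open ?S" by (intro open_Collect_conj open_Collect_less continuous_intros)
  have "lborel = distr (density lborel (\<lambda>z. ennreal (indicator ?S z * (cmod (exp z))\<^sup>2))) borel (exp :: complex \<Rightarrow> complex)"
  proof (rule lborel_holomorphic_image)
    show "?S \<in> sets borel" using o by simp
    show "(exp :: complex \<Rightarrow> complex) \<in> borel_measurable borel"
      by (intro borel_measurable_continuous_onI continuous_intros)
    show "inj_on exp ?S"
    proof (rule inj_onI)
      fix x y :: complex assume xy: "x \<in> ?S" "y \<in> ?S" "exp x = exp y"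
      then have "exp (x - y) = 1" by (simp add: exp_diff)
      then obtain n :: int where n: "Re (x - y) = 0" "Im (x - y) = of_int (2 * n) * pi"
        by (auto simp: exp_eq_1)
      have "\<bar>Im x - Im y\<bar> < 2 * pi" using xy by auto
      then have "\<bar>of_int (2 * n) * pi\<bar> < 2 * pi" using n by simp
      then have "\<bar>real_of_int n\<bar> < 1" by (simp add: abs_mult)
      then have "n = 0" by linarith
      with n show "x = y" by (simp add: complex_eq_iff)
    qed
    show "AE z in lborel. z \<in> exp ` ?S"
    proof (rule AE_mp[OF AE_lborel_Im_ne_0], rule AE_I2, rule impI)
      fix z :: complex assume z: "Im z \<noteq> 0"
      then have "z \<noteq> 0" by auto
      have e: "exp (Complex (ln (cmod z)) (Arg2pi z)) = z"
      proof -
        have "z = of_real (cmod z) * exp (\<i> * of_real (Arg2pi z))" using Arg2pi_eq by blast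
        then show ?thesis using \<open>z \<noteq> 0\<close> by (simp add: Complex_eq exp_add exp_of_real)
      qed
      have "Arg2pi z \<noteq> 0" using z by (metis Arg2pi_eq_0 complex_is_Real_iff)
      then have "Complex (ln (cmod z)) (Arg2pi z) \<in> ?S"
        using Arg2pi_ge_0[of z] Arg2pi_lt_2pi[of z] by simp
      then have "exp (Complex (ln (cmod z)) (Arg2pi z)) \<in> exp ` ?S" by (rule imageI)
      then show "z \<in> exp ` ?S" using e by simp
    qed
  qed (auto intro!: derivative_eq_intros)
  then show ?thesis by simp
qed

text \<open>The anticonformal inversion is the holomorphic map 1 / z followed by conjugation, and
  conjugation preserves Lebesgue measure.\<close>

lemma lborel_inverse_complex:
  "(lborel :: complex measure) = distr (density lborel (\<lambda>z. ennreal (1 / cmod z ^ 4))) borel (\<lambda>z. 1 / cnj z)"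
proof -
  have i: "(lborel :: complex measure)
     = distr (density lborel (\<lambda>z. ennreal (indicator (-{0}) z * (cmod (- (1 / z\<^sup>2)))\<^sup>2))) borel (\<lambda>z. 1 / z)"
  proof (rule lborel_holomorphic_image)
    show "AE z in lborel. z \<in> (\<lambda>z. 1 / z) ` (- {0 :: complex})"
      using AE_lborel_ne_complex[of 0]
    proof eventually_elim
      case (elim z)
      then show ?case by (intro image_eqI[of _ _ "1 / z"]) auto
    qed
    show "inj_on (\<lambda>z. 1 / z) (- {0 :: complex})" by (simp add: inj_on_def)
  qed (auto intro!: derivative_eq_intros simp: power2_eq_square)
  have c: "(lborel :: complex measure) = distr lborel borel cnj"
  proof (rule lborel_eqI)
    fix l u :: complex assume lu: "\<And>b. b \<in> Basis \<Longrightarrow> l \<bullet> b \<le> u \<bullet> b"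
    have le: "Re l \<le> Re u" "Im l \<le> Im u" using lu[of 1] lu[of \<i>] by (auto simp: Basis_complex_def)
    have "cnj -` box l u \<inter> space lborel = box (Complex (Re l) (- Im u)) (Complex (Re u) (- Im l))"
      by (auto simp: box_def Basis_complex_def)
    then show "emeasure (distr lborel borel cnj) (box l u) = (\<Prod>b\<in>Basis. (u - l) \<bullet> b)"
      using le by (subst emeasure_distr) (auto simp: Basis_complex_def emeasure_lborel_box_eq intro!: borel_measurable_continuous_onI continuous_intros)
  qed simp
  have [measurable]: "cnj \<in> borel_measurable borel" by (intro borel_measurable_continuous_onI continuous_intros)
  show ?thesis
  proof (rule measure_eqI)
    fix A :: "complex set" assume "A \<in> sets lborel"
    then have A[measurable]: "A \<in> sets borel" by simp
    have "emeasure lborel A = (\<integral>\<^sup>+z. indicator A z \<partial>lborel)" by simp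
    also have "\<dots> = (\<integral>\<^sup>+z. indicator A (cnj z) \<partial>lborel)"
      by (subst c, subst nn_integral_distr) auto
    also have "\<dots> = (\<integral>\<^sup>+z. ennreal (indicator (-{0}) z * (cmod (- (1 / z\<^sup>2)))\<^sup>2) * indicator A (cnj (1 / z)) \<partial>lborel)"
      by (subst i, subst nn_integral_distr, simp, simp, subst nn_integral_density) auto
    also have "\<dots> = (\<integral>\<^sup>+z. ennreal (1 / cmod z ^ 4) * indicator A (1 / cnj z) \<partial>lborel)"
    proof (rule nn_integral_cong_AE, rule AE_mp[OF AE_lborel_ne_complex[of 0]], rule AE_I2, rule impI)
      fix z :: complex assume "z \<noteq> 0"
      then show "ennreal (indicator (-{0}) z * (cmod (- (1 / z\<^sup>2)))\<^sup>2) * indicator A (cnj (1 / z)) = ennreal (1 / cmod z ^ 4) * indicator A (1 / cnj z)"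
        by (simp add: norm_divide norm_power power_divide flip: power_mult)
    qed
    also have "\<dots> = emeasure (distr (density lborel (\<lambda>z. ennreal (1 / cmod z ^ 4))) borel (\<lambda>z. 1 / cnj z)) A"
      using measurable_sets[of "\<lambda>z. 1 / cnj z" borel borel A]
      by (subst emeasure_distr, simp, simp, subst emeasure_density) (auto intro!: nn_integral_cong simp: indicator_def)
    finally show "emeasure lborel A = emeasure (distr (density lborel (\<lambda>z. ennreal (1 / cmod z ^ 4))) borel (\<lambda>z. 1 / cnj z)) A" .
  qed simp
qed

text \<open>The weight is the factor that a Laplacian acquires under the inversion
  (\<open>laplacian_inversion\<close>). Hence a pairing of a function with a Laplacian has the same
  value in both charts.\<close>

lemma inversion_integral:
  fixes f :: "complex \<Rightarrow> real"
  assumes [measurable]: "f \<in> borel_measurable borel"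
  shows "integrable lborel (\<lambda>z. f (1 / cnj z) / cmod z ^ 4) \<longleftrightarrow> integrable lborel f"
    "(LINT z|lborel. f (1 / cnj z) / cmod z ^ 4) = (LINT z|lborel. f z)"
proof -
  have [measurable]: "cnj \<in> borel_measurable borel" by (intro borel_measurable_continuous_onI continuous_intros)
  show "integrable lborel (\<lambda>z. f (1 / cnj z) / cmod z ^ 4) \<longleftrightarrow> integrable lborel f"
    by (subst (2) lborel_inverse_complex, subst integrable_distr_eq, simp, simp, subst integrable_density) auto
  show "(LINT z|lborel. f (1 / cnj z) / cmod z ^ 4) = (LINT z|lborel. f z)"
    by (subst (2) lborel_inverse_complex, subst integral_distr, simp, simp, subst integral_density) auto
qed

lemma exp_Complex: "exp (Complex x t) = of_real (exp x) * cis t"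
  using exp_eq_polar[of "Complex x t"] by simp

text \<open>Polar coordinates with radius exp x: the strip of \<open>lborel_exp\<close> is the (x,
  t)-plane cut to one turn. In the variable x the logarithmic pole ln |w - a| is linear.\<close>

lemma log_polar_nn_integral:
  fixes f :: "complex \<Rightarrow> ennreal"
  assumes [measurable]: "f \<in> borel_measurable borel"
  shows "(\<integral>\<^sup>+z. f z \<partial>lborel)
    = (\<integral>\<^sup>+x. ennreal (exp (2 * x)) * (\<integral>\<^sup>+t\<in>{0<..<2*pi}. f (a + of_real (exp x) * cis t) \<partial>lborel) \<partial>lborel)"
proof -
  let ?S = "{z::complex. 0 < Im z \<and> Im z < 2 * pi}"
  have o: "open ?S" by (intro open_Collect_conj open_Collect_less continuous_intros)
  have [measurable]: "?S \<in> sets borel" using o by simp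
  have [measurable]: "(exp :: complex \<Rightarrow> complex) \<in> borel_measurable borel" "Re \<in> borel_measurable borel"
    by (intro borel_measurable_continuous_onI continuous_intros)+
  have "(\<integral>\<^sup>+z. f z \<partial>lborel) = (\<integral>\<^sup>+z. f (a + z) \<partial>lborel)"
    by (subst lborel_distr_plus[of a, symmetric], subst nn_integral_distr) auto
  also have "\<dots> = (\<integral>\<^sup>+z. ennreal (indicator ?S z * (exp (Re z))\<^sup>2) * f (a + exp z) \<partial>lborel)"
    by (subst lborel_exp, subst nn_integral_distr, simp, simp, subst nn_integral_density) auto
  also have "\<dots> = (\<integral>\<^sup>+p. (case p of (x, t) \<Rightarrow> ennreal (indicator ?S (Complex x t) * (exp x)\<^sup>2) * f (a + exp (Complex x t))) \<partial>(lborel \<Otimes>\<^sub>M lborel))"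
    by (subst lborel_complex, subst nn_integral_distr) (auto intro!: nn_integral_cong)
  also have "\<dots> = (\<integral>\<^sup>+x. (\<integral>\<^sup>+t. ennreal (indicator ?S (Complex x t) * (exp x)\<^sup>2) * f (a + exp (Complex x t)) \<partial>lborel) \<partial>lborel)"
    by (subst lborel.nn_integral_fst[symmetric]) auto
  also have "\<dots> = (\<integral>\<^sup>+x. ennreal (exp (2 * x)) * (\<integral>\<^sup>+t\<in>{0<..<2*pi}. f (a + of_real (exp x) * cis t) \<partial>lborel) \<partial>lborel)"
  proof (rule nn_integral_cong)
    fix x :: real
    have "(exp x)\<^sup>2 = exp (2 * x)" by (simp add: power2_eq_square flip: exp_add)
    moreover have "exp (Complex x t) = of_real (exp x) * cis t" for t by (rule exp_Complex)
    ultimately have "ennreal (indicator ?S (Complex x t) * (exp x)\<^sup>2) * f (a + exp (Complex x t))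
       = ennreal (exp (2 * x)) * (f (a + of_real (exp x) * cis t) * indicator {0<..<2*pi} t)" for t
      by (simp add: indicator_def)
    moreover have [measurable]: "(\<lambda>t. cis t) \<in> borel_measurable borel"
      by (intro borel_measurable_continuous_onI continuous_intros)
    ultimately show "(\<integral>\<^sup>+t. ennreal (indicator ?S (Complex x t) * (exp x)\<^sup>2) * f (a + exp (Complex x t)) \<partial>lborel)
      = ennreal (exp (2 * x)) * (\<integral>\<^sup>+t\<in>{0<..<2*pi}. f (a + of_real (exp x) * cis t) \<partial>lborel)"
      by (simp add: nn_integral_cmult)
  qed
  finally show ?thesis .
qed

text \<open>The last two conclusions are by-products of Fubini; they are needed because u is only
  locally integrable, so that its integral over an individual circle may fail to exist.\<close>

lemma log_polar_integral:
  fixes f :: "complex \<Rightarrow> real"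
  assumes f: "integrable lborel f"
  shows "(LINT z|lborel. f z)
    = (LINT x|lborel. exp (2 * x) * (LINT t|lborel. indicator {0<..<2*pi} t * f (a + of_real (exp x) * cis t)))"
    "AE x in lborel. integrable lborel (\<lambda>t. indicator {0<..<2*pi} t * f (a + of_real (exp x) * cis t))"    "integrable lborel (\<lambda>x. exp (2 * x) * (LINT t|lborel. indicator {0<..<2*pi} t * f (a + of_real (exp x) * cis t)))"
proof -
  let ?S = "{z::complex. 0 < Im z \<and> Im z < 2 * pi}"
  have o: "open ?S" by (intro open_Collect_conj open_Collect_less continuous_intros)
  have [measurable]: "?S \<in> sets borel" using o by simp
  have [measurable]: "f \<in> borel_measurable borel" using borel_measurable_integrable[OF f] by simp
  have [measurable]: "(exp :: complex \<Rightarrow> complex) \<in> borel_measurable borel" "Re \<in> borel_measurable borel"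
    by (intro borel_measurable_continuous_onI continuous_intros)+
  have f1: "integrable lborel (\<lambda>z. f (a + z))"
    using f by (subst (asm) lborel_distr_plus[of a, symmetric], subst (asm) integrable_distr_eq) auto
  have e1: "(LINT z|lborel. f z) = (LINT z|lborel. f (a + z))"
    by (subst lborel_distr_plus[of a, symmetric], subst integral_distr) auto
  have f2: "integrable lborel (\<lambda>z. (indicator ?S z * (exp (Re z))\<^sup>2) * f (a + exp z))"
    using f1 by (subst (asm) lborel_exp, subst (asm) integrable_distr_eq, simp, simp, subst (asm) integrable_density) auto
  have e2: "(LINT z|lborel. f (a + z)) = (LINT z|lborel. (indicator ?S z * (exp (Re z))\<^sup>2) * f (a + exp z))"
    by (subst lborel_exp, subst integral_distr, simp, simp, subst integral_density) auto
  let ?h = "\<lambda>x t. exp (2 * x) * (indicator {0<..<2*pi} t * f (a + of_real (exp x) * cis t))"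
  have h: "(indicator ?S (Complex x t) * (exp x)\<^sup>2) * f (a + exp (Complex x t)) = ?h x t" for x t
  proof -
    have "(exp x)\<^sup>2 = exp (2 * x)" by (simp add: power2_eq_square flip: exp_add)
    moreover have "exp (Complex x t) = of_real (exp x) * cis t" by (rule exp_Complex)
    ultimately show ?thesis by (simp add: indicator_def)
  qed
  have f3: "integrable (lborel \<Otimes>\<^sub>M lborel) (\<lambda>(x, t). ?h x t)"
    using f2 by (subst (asm) lborel_complex, subst (asm) integrable_distr_eq) (auto simp: case_prod_beta' h)
  have "(LINT z|lborel. (indicator ?S z * (exp (Re z))\<^sup>2) * f (a + exp z))
      = (LINT p|(lborel \<Otimes>\<^sub>M lborel). (case p of (x, t) \<Rightarrow> ?h x t))"
    by (subst lborel_complex, subst integral_distr) (auto simp: case_prod_beta' h)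
  also have "\<dots> = (LINT x|lborel. LINT t|lborel. ?h x t)"
    using lborel_pair.integral_fst'[OF f3] by simp
  finally show "(LINT z|lborel. f z)
    = (LINT x|lborel. exp (2 * x) * (LINT t|lborel. indicator {0<..<2*pi} t * f (a + of_real (exp x) * cis t)))"
    using e1 e2 by simp
  have "AE x in lborel. integrable lborel (\<lambda>t. ?h x t)"
    using lborel_pair.AE_integrable_fst'[OF f3] by simp
  then show "AE x in lborel. integrable lborel (\<lambda>t. indicator {0<..<2*pi} t * f (a + of_real (exp x) * cis t))"
    by simp
  show "integrable lborel (\<lambda>x. exp (2 * x) * (LINT t|lborel. indicator {0<..<2*pi} t * f (a + of_real (exp x) * cis t)))"
    using lborel_pair.integrable_fst'[OF f3] by simp
qed

section \<open>Smooth functions of one real variable: flat exponentials, steps and ramps\<close>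

lemma Ck_real_add: "Ck_real k f \<Longrightarrow> Ck_real k g \<Longrightarrow> Ck_real k (\<lambda>x. f x + g x)"
proof (induction k arbitrary: f g)
  case 0 then show ?case by (auto intro: continuous_intros)
next
  case (Suc k)
  then obtain f' g' where fg: "\<And>x. (f has_real_derivative f' x) (at x)" "\<And>x. (g has_real_derivative g' x) (at x)"
    "Ck_real k f'" "Ck_real k g'" by auto
  have "\<forall>x. ((\<lambda>x. f x + g x) has_real_derivative f' x + g' x) (at x)" using fg by (auto intro: DERIV_add)
  moreover have "Ck_real k (\<lambda>x. f' x + g' x)" using Suc.IH fg by blast
  ultimately show ?case unfolding Ck_real.simps by (intro exI[of _ "\<lambda>x. f' x + g' x"]) simp
qed

lemma Ck_real_mult: "Ck_real k f \<Longrightarrow> Ck_real k g \<Longrightarrow> Ck_real k (\<lambda>x. f x * g x)"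
proof (induction k arbitrary: f g)
  case 0 then show ?case by (auto intro: continuous_intros)
next
  case (Suc k)
  then obtain f' g' where fg: "\<And>x. (f has_real_derivative f' x) (at x)" "\<And>x. (g has_real_derivative g' x) (at x)"
    "Ck_real k f'" "Ck_real k g'" by auto
  have fg2: "Ck_real k f" "Ck_real k g" using Suc.prems Ck_real_SucD by blast+
  have "((\<lambda>x. f x * g x) has_real_derivative f' x * g x + g' x * f x) (at x)" for x using fg by (intro DERIV_mult)
  moreover have "Ck_real k (\<lambda>x. f' x * g x + g' x * f x)" using Suc.IH fg fg2 Ck_real_add by blast
  ultimately show ?case unfolding Ck_real.simps by (intro exI[of _ "\<lambda>x. f' x * g x + g' x * f x"]) simp
qed

lemma Ck_real_const [simp]: "Ck_real k (\<lambda>x. c)"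
  by (induction k arbitrary: c) (auto intro!: exI[of _ "\<lambda>_. 0"])

lemma Ck_real_id: "Ck_real k (\<lambda>x. x)"
  by (cases k) (auto intro!: exI[of _ "\<lambda>_. 1"])

lemma Ck_real_minus: "Ck_real k f \<Longrightarrow> Ck_real k (\<lambda>x. - f x)"
  using Ck_real_mult[of k "\<lambda>_. -1" f] by simp

lemma Ck_real_diff: "Ck_real k f \<Longrightarrow> Ck_real k g \<Longrightarrow> Ck_real k (\<lambda>x. f x - g x)"
  using Ck_real_add[of k f "\<lambda>x. - g x"] Ck_real_minus by simp

lemma Ck_real_affine: "Ck_real k f \<Longrightarrow> Ck_real k (\<lambda>x. f (c * x + d))"
proof (induction k arbitrary: f)
  case 0
  then have "continuous_on UNIV f" by simp
  moreover have "continuous_on UNIV (\<lambda>x. c * x + d)" by (intro continuous_intros)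
  ultimately show ?case using continuous_on_compose2[of UNIV f UNIV "\<lambda>x. c * x + d"] by simp
next
  case (Suc k)
  then obtain f' where f: "\<And>x. (f has_real_derivative f' x) (at x)" "Ck_real k f'" by auto
  have "((\<lambda>x. f (c * x + d)) has_real_derivative f' (c * x + d) * c) (at x)" for x
    by (rule DERIV_chain2[OF f(1)]) (auto intro!: derivative_eq_intros)
  moreover have "Ck_real k (\<lambda>x. f' (c * x + d) * c)" using Suc.IH[OF f(2)] by (intro Ck_real_mult) auto
  ultimately show ?case unfolding Ck_real.simps by (intro exI[of _ "\<lambda>x. f' (c * x + d) * c"]) simp
qed

text \<open>The derivative of \<open>p(1/x) exp(-1/x)\<close> is of the same form, so the functions
  \<open>flat_exp p\<close> are closed under differentiation.\<close>

definition flat_exp :: "real poly \<Rightarrow> real \<Rightarrow> real" where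
  "flat_exp p x = (if x \<le> 0 then 0 else poly p (1 / x) * exp (- (1 / x)))"

lemma poly_div_exp_tendsto_0: "((\<lambda>y::real. poly p y * exp (- y)) \<longlongrightarrow> 0) at_top"
proof -
  have "((\<lambda>y. \<Sum>i\<le>degree p. coeff p i * (y ^ i / exp y)) \<longlongrightarrow> (\<Sum>i\<le>degree p. coeff p i * 0)) at_top"
    by (intro tendsto_sum tendsto_mult tendsto_const tendsto_power_div_exp_0)
  then show ?thesis by (simp add: poly_altdef exp_minus sum_distrib_right divide_inverse mult.assoc)
qed

text \<open>This is the difference quotient at 0. In y = 1 / x, dividing by x multiplies the
  polynomial by y, and the exponential still wins.\<close>

lemma flat_exp_at_0: "((\<lambda>x. flat_exp p x / x) \<longlongrightarrow> 0) (at 0)"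
proof (rule filterlim_split_at)
  have "eventually (\<lambda>x. 0 = flat_exp p x / x) (at_left 0)"
    by (auto simp: flat_exp_def eventually_at_filter)
  then show "((\<lambda>x. flat_exp p x / x) \<longlongrightarrow> 0) (at_left 0)"
    by (rule Lim_transform_eventually[OF tendsto_const])
  have "((\<lambda>x. poly (pCons 0 p) (inverse x) * exp (- inverse x)) \<longlongrightarrow> 0) (at_right 0)"
    by (rule filterlim_compose[OF poly_div_exp_tendsto_0 filterlim_inverse_at_top_right])
  moreover have "eventually (\<lambda>x. poly (pCons 0 p) (inverse x) * exp (- inverse x) = flat_exp p x / x) (at_right 0)"
    by (auto simp: flat_exp_def eventually_at_filter divide_inverse)
  ultimately show "((\<lambda>x. flat_exp p x / x) \<longlongrightarrow> 0) (at_right 0)"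
    by (rule Lim_transform_eventually)
qed

text \<open>With y = 1 / x one has d/dx = -y^2 d/dy, and p(y) exp (-y) has y-derivative (p' - p) exp
  (-y).\<close>

lemma DERIV_flat_exp: "(flat_exp p has_real_derivative flat_exp (monom 1 2 * (p - pderiv p)) x) (at x)"
proof -
  consider "x < 0" | "x = 0" | "x > 0" by linarith
  then show ?thesis
  proof cases
    case 1
    have "((\<lambda>x. 0) has_real_derivative 0) (at x)" by simp
    then have "(flat_exp p has_real_derivative 0) (at x)"
      by (rule has_field_derivative_transform_within_open[where S = "{..<0}"]) (use 1 in \<open>auto simp: flat_exp_def\<close>)
    then show ?thesis using 1 by (simp add: flat_exp_def)
  next
    case 2
    then show ?thesis using flat_exp_at_0[of p] by (simp add: DERIV_def flat_exp_def[of _ 0])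
  next
    case 3
    have "((\<lambda>x. poly p (1 / x) * exp (- (1 / x))) has_real_derivative
      poly (monom 1 2 * (p - pderiv p)) (1 / x) * exp (- (1 / x))) (at x)"
      using 3 by (auto intro!: derivative_eq_intros DERIV_chain2[OF poly_DERIV]
        simp: poly_monom power2_eq_square field_simps)
    then have "(flat_exp p has_real_derivative
      poly (monom 1 2 * (p - pderiv p)) (1 / x) * exp (- (1 / x))) (at x)"
      by (rule has_field_derivative_transform_within_open[where S = "{0<..}"]) (use 3 in \<open>auto simp: flat_exp_def\<close>)
    then show ?thesis using 3 by (simp add: flat_exp_def)
  qed
qed

lemma Ck_real_flat_exp: "Ck_real k (flat_exp p)"
proof (induction k arbitrary: p)
  case 0
  then show ?case using DERIV_flat_exp by (auto intro!: continuous_at_imp_continuous_on intro: DERIV_isCont)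
next
  case (Suc k)
  then show ?case using DERIV_flat_exp by (auto intro!: exI[of _ "flat_exp (monom 1 2 * (p - pderiv p))"])
qed

lemma antiderivative_vanishing_left:
  fixes f :: "real \<Rightarrow> real"
  assumes "continuous_on UNIV f" "\<And>x. x \<le> a \<Longrightarrow> f x = 0"
  shows "\<exists>G. (\<forall>x. (G has_real_derivative f x) (at x)) \<and> (\<forall>x\<le>a. G x = 0)"
\<comment> \<open>Starting at a - 1 instead of a puts every x >= a in the interior of the interval
  of integration, so the one-sided derivative of the integral is two-sided.\<close>
proof (intro exI[of _ "\<lambda>x. integral {a - 1..x} f"] conjI allI impI)
  show z: "integral {a - 1..x} f = 0" if "x \<le> a" for x
    using assms(2) that by (intro integral_unique has_integral_is_0) auto
  show "((\<lambda>x. integral {a - 1..x} f) has_real_derivative f x) (at x)" for x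
  proof (cases "x < a")
    case True
    have "((\<lambda>x. 0) has_real_derivative 0) (at x)" by simp
    then have "((\<lambda>x. integral {a - 1..x} f) has_real_derivative 0) (at x)"
      by (rule has_field_derivative_transform_within_open[where S = "{..<a}"]) (use True z in auto)
    then show ?thesis using True assms(2) by simp
  next
    case False
    have "((\<lambda>u. integral {a - 1..u} f) has_real_derivative f x) (at x within {a - 1..x + 1})"
      using False by (intro integral_has_real_derivative continuous_on_subset[OF assms(1)]) auto
    moreover have "at x within {a - 1..x + 1} = at x" using False by (intro at_within_interior) auto
    ultimately show ?thesis by simp
  qed
qed

lemma DERIV_zero_interval_const:
  fixes f :: "real \<Rightarrow> real"
  assumes "\<And>x. x \<ge> b \<Longrightarrow> (f has_real_derivative 0) (at x)" "x \<ge> b"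
  shows "f x = f b"
proof (cases "x = b")
  case False
  have "continuous_on {b..x} f"
    using assms(1) by (intro continuous_at_imp_continuous_on ballI) (auto intro: DERIV_isCont)
  then show ?thesis using DERIV_isconst2[of b x f x] assms False by auto
qed auto

lemma DERIV_nonneg_mono:
  fixes f :: "real \<Rightarrow> real"
  assumes "\<And>x. (f has_real_derivative f' x) (at x)" "\<And>x. 0 \<le> f' x" "x \<le> y"
  shows "f x \<le> f y"
  by (rule DERIV_nonneg_imp_nondecreasing[OF assms(3)]) (use assms(1,2) in blast)

text \<open>The step is the normalised integral G / G b of a bump B that is positive exactly on (a,
  b).\<close>

lemma smooth_step:
  fixes a b :: real
  assumes "a < b"
  shows "\<exists>f f' f''. (\<forall>k. Ck_real k f) \<and> (\<forall>x. (f has_real_derivative f' x) (at x)) \<and>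
    (\<forall>x. (f' has_real_derivative f'' x) (at x)) \<and> continuous_on UNIV f'' \<and> (\<forall>x. 0 \<le> f' x) \<and>
    (\<forall>x. 0 \<le> f x \<and> f x \<le> 1) \<and> (\<forall>x\<le>a. f x = 0 \<and> f' x = 0 \<and> f'' x = 0) \<and>
    (\<forall>x\<ge>b. f x = 1 \<and> f' x = 0 \<and> f'' x = 0)"
proof -
  define B where "B = (\<lambda>x. flat_exp 1 (x - a) * flat_exp 1 (b - x))"
  have Ck: "Ck_real k B" for k
    using Ck_real_mult[OF Ck_real_affine[OF Ck_real_flat_exp, of k 1 1 "-a"] Ck_real_affine[OF Ck_real_flat_exp, of k 1 "-1" b]]
    by (simp add: B_def add.commute)
  have cont: "continuous_on UNIV B" using Ck[of 0] by simp
  have B0: "B x \<ge> 0" for x by (simp add: B_def flat_exp_def)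
  have Bz: "B x = 0" if "x \<le> a \<or> b \<le> x" for x using that by (auto simp: B_def flat_exp_def)
  have Bp: "B x > 0" if "a < x" "x < b" for x using that by (simp add: B_def flat_exp_def)
  obtain G where G: "\<And>x. (G has_real_derivative B x) (at x)" "\<And>x. x \<le> a \<Longrightarrow> G x = 0"
    using antiderivative_vanishing_left[OF cont, of a] Bz by auto
  have mono: "G x \<le> G y" if "x \<le> y" for x y
    using DERIV_nonneg_mono[of G B, OF G(1) B0 that] .
  have Gb: "G x = G b" if "b \<le> x" for x
    using DERIV_zero_interval_const[of b G x] G(1) Bz that by (metis (full_types))
  define c where "c = (a + b) / 2"
  have c: "a < c" "c < b" using assms by (auto simp: c_def)
  have "0 < G b"
  proof -
    have "\<exists>z. a < z \<and> z < b \<and> G b - G a = (b - a) * B z" using MVT2[OF assms, of G B] G(1) by blast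
    then show ?thesis using Bp G(2)[of a] assms by (metis diff_gt_0_iff_gt diff_zero order_refl mult_pos_pos)
  qed
  have dB: "\<exists>B'. (\<forall>x. (B has_real_derivative B' x) (at x)) \<and> continuous_on UNIV B'"
    using Ck[of 1] by simp
  then obtain B' where B': "\<And>x. (B has_real_derivative B' x) (at x)" "continuous_on UNIV B'" by blast
  have B'z: "B' x = 0" if "x \<le> a \<or> b \<le> x" for x
  proof -
    have "DERIV B x :> 0"
    proof -
      \<comment> \<open>Where B vanishes it attains its global minimum, so its derivative vanishes
        as well; no formula for B' is used.\<close>
      have "\<forall>y. B x \<le> B y" using B0 Bz that by simp
      then have "B' x = 0" using DERIV_local_min[OF B'(1), of 1 x] by simp
      then show ?thesis using B'(1)[of x] by simp
    qed
    then show ?thesis using B'(1) DERIV_unique by blast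
  qed
  have CkG: "Ck_real k G" for k
  proof (cases k)
    case 0 then show ?thesis using G(1) by (auto intro!: continuous_at_imp_continuous_on intro: DERIV_isCont)
  next
    case (Suc n) then show ?thesis using G(1) Ck[of n] by (auto intro!: exI[of _ B])
  qed
  let ?c = "1 / G b"
  define s0 s1 s2 where "s0 = (\<lambda>x. ?c * G x)" and "s1 = (\<lambda>x. ?c * B x)" and "s2 = (\<lambda>x. ?c * B' x)"
  have 1: "Ck_real k s0" for k unfolding s0_def using Ck_real_mult[OF Ck_real_const CkG] .
  have 2: "(s0 has_real_derivative s1 x) (at x)" for x unfolding s0_def s1_def using DERIV_cmult[OF G(1)] .
  have 3: "(s1 has_real_derivative s2 x) (at x)" for x unfolding s1_def s2_def using DERIV_cmult[OF B'(1)] .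
  have 4: "continuous_on UNIV s2" unfolding s2_def by (intro continuous_intros B')
  have Gpos: "0 \<le> G x" "G x \<le> G b" for x
  proof -
    show "0 \<le> G x" using mono[of a x] G(2)[of x] G(2)[of a] by (cases "x \<le> a") simp_all
    show "G x \<le> G b" using mono[of x b] Gb[of x] by (cases "x \<le> b") simp_all
  qed
  have z: "s0 x = 0" "s1 x = 0" "s2 x = 0" if "x \<le> a" for x
    using that G(2) Bz B'z by (simp_all add: s0_def s1_def s2_def)
  have o: "s0 x = 1" "s1 x = 0" "s2 x = 0" if "b \<le> x" for x
    using that Gb[OF that] Bz B'z \<open>0 < G b\<close> by (simp_all add: s0_def s1_def s2_def)
  have p: "0 \<le> s1 x" for x using B0 \<open>0 < G b\<close> by (simp add: s1_def)
  have q: "0 \<le> s0 x" "s0 x \<le> 1" for x using Gpos \<open>0 < G b\<close> by (simp_all add: s0_def divide_simps)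
  show ?thesis
    by (rule exI[of _ s0], rule exI[of _ s1], rule exI[of _ s2])
      (intro conjI allI impI 1 2 3 4 p q z o; assumption)
qed

text \<open>One more integration of the smooth step: convexity is the monotonicity of the step, and
  the step is the slope. The value c b is the area collected on [a, b]; only its sign is needed, for
  x - b <= c x.\<close>

lemma smooth_ramp:
  fixes a b :: real
  assumes "a < b"
  shows "\<exists>c c' c''. (\<forall>k. Ck_real k c) \<and> (\<forall>x. (c has_real_derivative c' x) (at x)) \<and>
    (\<forall>x. (c' has_real_derivative c'' x) (at x)) \<and> continuous_on UNIV c'' \<and> (\<forall>x. 0 \<le> c'' x) \<and>
    (\<forall>x. 0 \<le> c' x \<and> c' x \<le> 1) \<and> (\<forall>x. 0 \<le> c x \<and> x - b \<le> c x) \<and>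
    (\<forall>x\<le>a. c x = 0 \<and> c' x = 0 \<and> c'' x = 0) \<and>
    (\<forall>x\<ge>b. c x = x - b + c b \<and> c' x = 1 \<and> c'' x = 0)"
proof -
  obtain p p' p'' where s: "\<And>k. Ck_real k p" "\<And>x. (p has_real_derivative p' x) (at x)"
    "\<And>x. (p' has_real_derivative p'' x) (at x)" "continuous_on UNIV p''" "\<And>x. 0 \<le> p' x"
    "\<And>x. 0 \<le> p x \<and> p x \<le> 1" "\<And>x. x \<le> a \<Longrightarrow> p x = 0 \<and> p' x = 0 \<and> p'' x = 0"
    "\<And>x. x \<ge> b \<Longrightarrow> p x = 1 \<and> p' x = 0 \<and> p'' x = 0"
    using smooth_step[OF assms] by blast
  have cs: "continuous_on UNIV p" using s(1)[of 0] by simp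
  obtain G where G: "\<And>x. (G has_real_derivative p x) (at x)" "\<And>x. x \<le> a \<Longrightarrow> G x = 0"
    using antiderivative_vanishing_left[OF cs, of a] s(7) by auto
  have mono: "G x \<le> G y" if "x \<le> y" for x y
    using DERIV_nonneg_mono[of G p, OF G(1) _ that] s(6) by blast
  have CkG: "Ck_real k G" for k
  proof (cases k)
    case 0 then show ?thesis using G(1) by (auto intro!: continuous_at_imp_continuous_on intro: DERIV_isCont)
  next
    case (Suc n) then show ?thesis using G(1) s(1)[of n] by (auto intro!: exI[of _ p])
  qed
  have Gb: "G x = x - b + G b" if "b \<le> x" for x
  proof -
    have "G x - x = G b - b"
    proof (rule DERIV_zero_interval_const[of b "\<lambda>x. G x - x" x])
      show "((\<lambda>x. G x - x) has_real_derivative 0) (at y)" if "b \<le> y" for y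
        using DERIV_diff[OF G(1)[of y] DERIV_ident] s(8)[OF that] by simp
    qed (use that in auto)
    then show ?thesis by simp
  qed
  have G0: "0 \<le> G x" for x using mono[of a x] G(2)[of a] G(2)[of x] by (cases "x \<le> a") auto
  have Gl: "x - b \<le> G x" for x using G0[of x] G0[of b] Gb[of x] by (cases "x \<le> b") auto
  have cs': "continuous_on UNIV p'" using s(3) by (auto intro!: continuous_at_imp_continuous_on intro: DERIV_isCont)
  have r: "G x = x - b + G b" "p x = 1" "p' x = 0" if "b \<le> x" for x
    using that Gb s(8) by blast+
  have l: "G x = 0" "p x = 0" "p' x = 0" if "x \<le> a" for x
    using that G(2) s(7) by blast+
  have o: "0 \<le> p x" "p x \<le> 1" for x using s(6) by blast+
  show ?thesis
    by (rule exI[of _ G], rule exI[of _ p], rule exI[of _ p'])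
      (intro conjI allI impI CkG G(1) s(2) cs' s(5) r l o G0 Gl; assumption)
qed

lemma integral_second_derivative_step:
  fixes f f' f'' :: "real \<Rightarrow> real"
  assumes "\<And>x. (f has_real_derivative f' x) (at x)" "continuous_on UNIV f'" "a \<le> b"
    "\<And>x. x \<le> a \<or> b \<le> x \<Longrightarrow> f' x = 0"
  shows "(LINT x|lborel. f' x) = f b - f a" "integrable lborel f'"
proof -
  have e: "f' = (\<lambda>x. f' x * indicator {a..b} x)"
  proof
    show "f' x = f' x * indicator {a..b} x" for x using assms(4)[of x] by (cases "x \<in> {a..b}") auto
  qed
  have h: "has_bochner_integral lborel (\<lambda>x. f' x * indicator {a..b} x) (f b - f a)"
    by (rule has_bochner_integral_FTC_Icc_real[OF assms(3)])
      (use assms(1,2) in \<open>auto simp: continuous_on_eq_continuous_at\<close>)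
  then show "(LINT x|lborel. f' x) = f b - f a" "integrable lborel f'"
    by (subst e, simp add: has_bochner_integral_iff)+
qed

text \<open>Cauchy's formula at the centre: on the circle the factor 1 / (u - a) cancels the
  velocity of the parametrisation up to the constant i.\<close>

lemma mean_value_holomorphic:
  assumes f: "f holomorphic_on ball a R" and r: "0 < r" "r < R"
  shows "((\<lambda>t. f (a + of_real r * cis t)) has_integral 2 * of_real pi * f a) {0..2*pi}"
proof -
  have sub: "cball a r \<subseteq> ball a R" using r by auto
  have c: "continuous_on (cball a r) f"
    by (rule holomorphic_on_imp_continuous_on[OF holomorphic_on_subset[OF f sub]])
  have h: "f holomorphic_on ball a r"
    using holomorphic_on_subset[OF f] sub ball_subset_cball by blast
  have "((\<lambda>u. f u / (u - a)) has_contour_integral (2 * of_real pi * \<i> * f a)) (part_circlepath a r 0 (2*pi))"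
    using Cauchy_integral_circlepath[OF c h, of a] r by (simp add: circlepath_def)
  then have "((\<lambda>t. f (a + r * cis t) / (a + r * cis t - a) * r * \<i> * cis t) has_integral 2 * of_real pi * \<i> * f a) {0..2*pi}"
    by (subst (asm) has_contour_integral_part_circlepath_iff) auto
  then have "((\<lambda>t. \<i> * f (a + r * cis t)) has_integral \<i> * (2 * of_real pi * f a)) {0..2*pi}"
    using r by (simp add: mult_ac)
  then have "((\<lambda>t. - \<i> * (\<i> * f (a + r * cis t))) has_integral - \<i> * (\<i> * (2 * of_real pi * f a))) {0..2*pi}"
    by (rule has_integral_mult_right)
  then show ?thesis by simp
qed

lemma mean_value_Re_holomorphic:
  assumes "f holomorphic_on ball a R" "0 < r" "r < R"
  shows "((\<lambda>t. Re (f (a + of_real r * cis t))) has_integral 2 * pi * Re (f a)) {0..2*pi}"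
  using has_integral_Re[OF mean_value_holomorphic[OF assms]] by simp

section \<open>Isolated singularities of harmonic functions\<close>

text \<open>Cauchy's inequality is applied to exp f, whose modulus lies between exp (-B) and exp B,
  on the circle of radius s / 2; dividing by exp f recovers f'. Only the order 1 / s of the bound
  matters later.\<close>

lemma bounded_harmonic_gradient:
  assumes f: "f holomorphic_on ball z s" and s: "0 < s" and B: "\<And>w. w \<in> ball z s \<Longrightarrow> \<bar>Re (f w)\<bar> \<le> B"
  shows "cmod (deriv f z) \<le> 2 * exp (2 * B) / s"
proof -
  have sub: "cball z (s / 2) \<subseteq> ball z s" using s by auto
  have h: "(\<lambda>w. exp (f w)) holomorphic_on ball z s" by (intro holomorphic_intros f)
  have "norm ((deriv ^^ 1) (\<lambda>w. exp (f w)) z) \<le> fact 1 * exp B / (s / 2) ^ 1"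
  proof (rule Cauchy_inequality)
    show "(\<lambda>w. exp (f w)) holomorphic_on ball z (s / 2)"
      using h sub by (meson ball_subset_cball dual_order.trans holomorphic_on_subset)
    show "continuous_on (cball z (s / 2)) (\<lambda>w. exp (f w))"
      using h sub by (meson continuous_on_subset holomorphic_on_imp_continuous_on)
    show "norm (exp (f x)) \<le> exp B" if "norm (z - x) = s / 2" for x
    proof -
      have "x \<in> ball z s" using that s by (simp add: dist_norm)
      from B[OF this] show ?thesis by simp
    qed
  qed (use s in auto)
  moreover have "deriv (\<lambda>w. exp (f w)) z = exp (f z) * deriv f z"
    using holomorphic_derivI[OF f open_ball, of z] s
    by (intro DERIV_imp_deriv) (auto intro!: derivative_eq_intros)
  ultimately have 1: "exp (Re (f z)) * cmod (deriv f z) \<le> 2 * exp B / s" by (simp add: norm_mult mult.commute)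
  have "exp (- B) \<le> exp (Re (f z))" using B[of z] s by simp
  then have "exp (- B) * cmod (deriv f z) \<le> exp (Re (f z)) * cmod (deriv f z)" by (intro mult_right_mono) auto
  with 1 have "exp (- B) * cmod (deriv f z) \<le> 2 * exp B / s" by linarith
  then have "exp B * (exp (- B) * cmod (deriv f z)) \<le> exp B * (2 * exp B / s)" by (intro mult_left_mono) auto
  moreover have "exp B * (exp (- B) * cmod (deriv f z)) = cmod (deriv f z)"
    by (simp add: exp_minus)
  moreover have "exp B * (2 * exp B / s) = 2 * exp (2 * B) / s"
  proof -
    have "exp (2 * B) = exp B * exp B" by (metis exp_add mult_2)
    then show ?thesis by (simp add: mult_ac)
  qed
  ultimately show ?thesis by (simp only:)
qed

lemma bounded_harmonic_removable:
  assumes r: "0 < r" and h: "harmonic_on (ball a r - {a}) h"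
    and B: "\<And>z. z \<in> ball a r - {a} \<Longrightarrow> \<bar>h z\<bar> \<le> B"
  shows "\<exists>f. f holomorphic_on ball a r \<and> (\<forall>z\<in>ball a r - {a}. h z = Re (f z))"
proof -
  define U where "U = ball a r - {a}"
  have oU: "open U" by (auto simp: U_def)
  define G where "G = (\<lambda>z. complex_of_real (pdx h z) - \<i> * complex_of_real (pdy h z))"
  have loc: "\<exists>f. f holomorphic_on ball z \<rho> \<and> (\<forall>w\<in>ball z \<rho>. h w = Re (f w) \<and> G w = deriv f w)"
    if "ball z \<rho> \<subseteq> U" for z \<rho>
  proof -
    obtain f where f: "f holomorphic_on ball z \<rho>" "\<And>w. w \<in> ball z \<rho> \<Longrightarrow> h w = Re (f w)"
      using harmonic_on_ball_Re[OF harmonic_on_subset[OF h]] \<open>ball z \<rho> \<subseteq> U\<close> unfolding U_def by metis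
    have "G w = deriv f w" if w: "w \<in> ball z \<rho>" for w
    proof -
      have "pdx h w = pdx (\<lambda>w. Re (f w)) w" "pdy h w = pdy (\<lambda>w. Re (f w)) w"
        by (rule pd_cong_open[OF open_ball w], use f(2) in blast)+
      then show ?thesis
        using pd_Re_holomorphic[OF holomorphic_derivI[OF f(1) open_ball w]] by (simp add: G_def complex_eq_iff)
    qed
    with f show ?thesis by blast
  qed
  have holG: "G holomorphic_on U"
  proof -
    have "G field_differentiable at z" if z: "z \<in> U" for z
    proof -
      obtain \<rho> where \<rho>: "0 < \<rho>" "ball z \<rho> \<subseteq> U" using oU z openE by blast
      obtain f where f: "f holomorphic_on ball z \<rho>" "\<forall>w\<in>ball z \<rho>. h w = Re (f w) \<and> G w = deriv f w"
        using loc[OF \<rho>(2)] by blast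
      have "deriv f holomorphic_on ball z \<rho>" using f by (intro holomorphic_deriv) auto
      then have "G holomorphic_on ball z \<rho>" by (rule holomorphic_transform) (use f in auto)
      then show ?thesis using \<rho> by (auto intro: holomorphic_on_imp_differentiable_at)
    qed
    then show ?thesis by (auto simp: holomorphic_on_def intro: field_differentiable_at_within)
  qed
  have bound: "cmod ((z - a) * G z) \<le> 2 * exp (2 * B)" if z: "z \<noteq> a" "dist a z < r / 2" for z
  proof -
    let ?\<rho> = "dist a z"
    have sub: "ball z ?\<rho> \<subseteq> U"
    proof
      fix w assume w: "w \<in> ball z ?\<rho>"
      then have "dist a w < r" using dist_triangle[of a w z] z by simp
      moreover have "w \<noteq> a" using w by (auto simp: dist_commute)
      ultimately show "w \<in> U" by (simp add: U_def)
    qed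
    obtain f where f: "f holomorphic_on ball z ?\<rho>" "\<forall>w\<in>ball z ?\<rho>. h w = Re (f w) \<and> G w = deriv f w"
      using loc[OF sub] by blast
    have \<rho>: "0 < ?\<rho>" using z by simp
    have "\<bar>Re (f w)\<bar> \<le> B" if "w \<in> ball z ?\<rho>" for w
      using B[of w] f(2) that sub unfolding U_def by (metis subsetD)
    from bounded_harmonic_gradient[OF f(1) \<rho> this]
    have "cmod (G z) \<le> 2 * exp (2 * B) / ?\<rho>" using f(2) \<rho> by (metis centre_in_ball)
    then have "?\<rho> * cmod (G z) \<le> 2 * exp (2 * B)" using \<rho> by (simp add: field_simps)
    then show ?thesis by (simp add: norm_mult dist_norm norm_minus_commute)
  qed
  have "(\<lambda>z. (z - a) * G z) holomorphic_on ball a r - {a}"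
    using holG unfolding U_def by (intro holomorphic_intros)
  moreover have "eventually (\<lambda>z. cmod ((z - a) * G z) \<le> 2 * exp (2 * B)) (at a)"
    unfolding eventually_at using bound r by (intro exI[of _ "r / 2"]) (auto simp: dist_commute)
  ultimately obtain k where k: "k holomorphic_on ball a r" "\<And>z. z \<in> ball a r - {a} \<Longrightarrow> k z = (z - a) * G z"
    using holomorphic_on_extend_bounded[of "\<lambda>z. (z - a) * G z" "ball a r" a] r
    by (auto simp: interior_open)
  define c where "c = k a"
  define G2 where "G2 = (\<lambda>z. if z = a then deriv k a else G z - c / (z - a))"
  have "G2 holomorphic_on ball a r"
    unfolding G2_def c_def by (rule pole_theorem_open[OF k(1) open_ball]) (use k(2) in auto)
  then obtain F where F: "\<And>x. x \<in> ball a r \<Longrightarrow> (F has_field_derivative G2 x) (at x within ball a r)"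
    using holomorphic_convex_primitive'[of "ball a r" G2] by auto
  then have F': "(F has_field_derivative G2 x) (at x)" if "x \<in> ball a r" for x
    using that by (metis at_within_open open_ball)
  have holF: "F holomorphic_on ball a r" unfolding holomorphic_on_open[OF open_ball] using F' by blast
  define q where "q = (\<lambda>z. h z - Re (F z))"
  have dh: "h differentiable (at z)" if "z \<in> U" for z
    using Ck_2D(1)[of U h] h that by (simp add: harmonic_on_def U_def)
  have dq: "(q has_derivative (\<lambda>v. Re (c / (z - a) * v))) (at z)" if z: "z \<in> U" for z
  proof -
    have zb: "z \<in> ball a r" "z \<noteq> a" using z by (auto simp: U_def)
    note R = pd_Re_holomorphic[OF F'[OF zb(1)]]
    have "(q has_derivative (\<lambda>v. (Re v * pdx h z + Im v * pdy h z) -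
        (Re v * pdx (\<lambda>z. Re (F z)) z + Im v * pdy (\<lambda>z. Re (F z)) z))) (at z)"
      unfolding q_def by (intro has_derivative_diff has_derivative_pd dh z R)
    moreover define k where "k = c / (z - a)"
    have "G z = G2 z + k" using zb by (simp add: G2_def k_def)
    then have hxy: "pdx h z = Re (G2 z) + Re k" "pdy h z = - Im (G2 z) - Im k"
      by (simp_all add: G_def complex_eq_iff)
    have "(\<lambda>v. (Re v * pdx h z + Im v * pdy h z) -
        (Re v * pdx (\<lambda>z. Re (F z)) z + Im v * pdy (\<lambda>z. Re (F z)) z)) = (\<lambda>v. Re (k * v))"
      unfolding hxy R(1,2) by (intro ext) (simp add: algebra_simps)
    ultimately show ?thesis by (simp add: k_def)
  qed
  \<comment> \<open>The half plane W covers the punctured disc by y -> a + exp y, so that the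
    logarithm becomes the linear function c y on a convex set.\<close>
  define W where "W = {y::complex. Re y < ln r}"
  have convW: "convex W" unfolding W_def by (rule convex_halfspace_Re_lt)
  have expW: "a + exp y \<in> U" if "y \<in> W" for y
  proof -
    have "exp (Re y) < r" using that r by (simp add: W_def) (metis exp_less_cancel_iff exp_ln)
    then show ?thesis by (simp add: U_def dist_norm)
  qed
  have "((\<lambda>y. q (a + exp y) - Re (c * y)) has_derivative (\<lambda>v. 0)) (at y within W)" if z: "y \<in> W" for y
  proof -
    have 1: "((\<lambda>y. a + exp y) has_derivative (\<lambda>v. exp y * v)) (at y within W)"
    proof -
      have "((\<lambda>y. a + exp y) has_field_derivative exp y) (at y within W)"
        by (auto intro!: derivative_eq_intros)
      then show ?thesis by (simp add: has_field_derivative_def)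
    qed
    have 2: "((\<lambda>y. Re (c * y)) has_derivative (\<lambda>v. Re (c * v))) (at y within W)"
      by (intro has_derivative_Re has_derivative_mult_right has_derivative_ident)
    from has_derivative_diff[OF has_derivative_compose[OF 1 dq[OF expW[OF z]]] 2]
    show ?thesis by simp
  qed
  then have "\<exists>d. \<forall>y\<in>W. q (a + exp y) - Re (c * y) = d" by (rule has_derivative_zero_constant[OF convW])
  then obtain d where d: "\<And>y. y \<in> W \<Longrightarrow> q (a + exp y) = Re (c * y) + d" by (metis diff_add_cancel add.commute)
  \<comment> \<open>x0 and x0 + 2 pi i lie over the same point of the disc; the two values of Re (c
    y) differ by -2 pi Im c.\<close>
  define x0 where "x0 = complex_of_real (ln r - 1)"
  have "x0 \<in> W" "x0 + 2 * of_real pi * \<i> \<in> W" by (simp_all add: x0_def W_def)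
  from d[OF this(1)] d[OF this(2)] have "Re (c * x0) = Re (c * (x0 + 2 * of_real pi * \<i>))"
    by (simp add: exp_add exp_two_pi_i)
  then have "Im c = 0" by (simp add: algebra_simps)
  have "Re c = 0"
  proof (rule ccontr)
    assume c0: "Re c \<noteq> 0"
    have "continuous_on (cball a (r/2)) F"
    proof -
      have "cball a (r/2) \<subseteq> ball a r" using r by auto
      then show ?thesis using holF continuous_on_subset holomorphic_on_imp_continuous_on by blast
    qed
    then have "bounded (F ` cball a (r/2))" by (intro compact_imp_bounded compact_continuous_image compact_cball)
    then obtain M where M: "\<And>z. z \<in> cball a (r/2) \<Longrightarrow> cmod (F z) \<le> M" unfolding bounded_iff by blast
    \<comment> \<open>At y = -n the point a + exp y lies in the half disc on which F is bounded by
      M, while |Re c| n exceeds every bound available for Re (c y).\<close>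
    obtain n :: nat where n: "(B + M + \<bar>d\<bar>) / \<bar>Re c\<bar> + \<bar>ln (r/2)\<bar> < real n" using reals_Archimedean2 by blast
    have nn: "- real n < ln (r / 2)" "(B + M + \<bar>d\<bar>) / \<bar>Re c\<bar> < real n"
    proof -
      have "a + of_real (r/2) \<in> ball a r - {a}" using r by (simp add: dist_norm)
      then have "0 \<le> B" using B abs_ge_zero order_trans by blast
      moreover have "cmod (F a) \<le> M" using M[of a] r by simp
      then have "0 \<le> M" using norm_ge_zero order_trans by blast
      ultimately have "0 \<le> (B + M + \<bar>d\<bar>) / \<bar>Re c\<bar>" by simp
      then show "- real n < ln (r / 2)" using n by linarith
      show "(B + M + \<bar>d\<bar>) / \<bar>Re c\<bar> < real n" using n by linarith
    qed
    define y where "y = complex_of_real (- real n)"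
    have "ln (r / 2) < ln r" using r by simp
    then have y: "y \<in> W" using nn by (simp add: y_def W_def)
    have "exp (- real n) < r / 2" using nn(1) r by (metis exp_less_cancel_iff exp_ln half_gt_zero)
    then have "a + exp y \<in> cball a (r/2)" by (simp add: dist_norm y_def)
    from M[OF this] B[of "a + exp y"] expW[OF y]
    have "\<bar>q (a + exp y)\<bar> \<le> B + M" using abs_Re_le_cmod[of "F (a + exp y)"] by (simp add: q_def U_def)
    then have "\<bar>Re (c * y)\<bar> \<le> B + M + \<bar>d\<bar>" using d[OF y] by linarith
    then have "\<bar>Re c\<bar> * real n \<le> B + M + \<bar>d\<bar>" by (simp add: y_def abs_mult)
    then show False using nn(2) c0 by (simp add: divide_less_eq mult.commute)
  qed
  have c: "c = 0" using \<open>Re c = 0\<close> \<open>Im c = 0\<close> by (simp add: complex_eq_iff)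
  have "h z = Re (F z + of_real d)" if z: "z \<in> ball a r - {a}" for z
  proof -
    have "0 < cmod (z - a)" "cmod (z - a) < r" using z by (auto simp: dist_norm norm_minus_commute)
    then have "ln (cmod (z - a)) < ln r" using r by (subst ln_less_cancel_iff) auto
    then have "Ln (z - a) \<in> W" using z by (simp add: W_def)
    from d[OF this] show ?thesis using z c by (simp add: q_def)
  qed
  moreover have "(\<lambda>z. F z + of_real d) holomorphic_on ball a r" using holF by (intro holomorphic_intros)
  ultimately show ?thesis by blast
qed

section \<open>Subharmonic functions: comparison with circle integrals and local
  integrability\<close>

text \<open>\<open>circle_mean\<close> is a difference of two extended integrals, so the two parts
  are compared separately; finiteness of both parts of k makes the difference real.\<close>

lemma circle_mean_le:
  assumes le: "\<And>t. t \<in> {0..2*pi} \<Longrightarrow> u (z + of_real r * cis t) \<le> ereal (k t)"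
    and c: "continuous_on {0..2*pi} k"
  shows "circle_mean u z r \<le> ereal (integral {0..2*pi} k / (2 * pi))"
proof -
  let ?I = "indicator {0..2*pi} :: real \<Rightarrow> real"
  define P where "P = (\<integral>\<^sup>+t. ennreal (?I t * k t) \<partial>lborel)"
  define N where "N = (\<integral>\<^sup>+t. ennreal (- (?I t * k t)) \<partial>lborel)"
  have int: "integrable lborel (\<lambda>t. ?I t * k t)"
    using borel_integrable_compact[of "{0..2*pi}" k] c by (simp add: set_integrable_def)
  have I: "(LINT t|lborel. ?I t * k t) = integral {0..2*pi} k"
    using set_borel_integral_eq_integral(2)[of "{0..2*pi}" k] int by (simp add: set_integrable_def set_lebesgue_integral_def)
  have fin: "P < \<infinity>" "N < \<infinity>"
    using integrableD[OF int] unfolding P_def N_def by (auto simp: top.not_eq_extremum)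
  have "(\<integral>\<^sup>+t\<in>{0..2*pi}. e2ennreal (u (z + of_real r * cis t)) \<partial>lborel) \<le> P"
    unfolding P_def
  proof (rule nn_integral_mono)
    show "e2ennreal (u (z + of_real r * cis t)) * indicator {0..2*pi} t \<le> ennreal (?I t * k t)" for t
      using e2ennreal_mono[OF le[of t]] by (cases "t \<in> {0..2*pi}") auto
  qed
  moreover have "N \<le> (\<integral>\<^sup>+t\<in>{0..2*pi}. e2ennreal (- u (z + of_real r * cis t)) \<partial>lborel)"
    unfolding N_def
  proof (rule nn_integral_mono)
    fix t
    have "- ereal (k t) \<le> - u (z + of_real r * cis t)" if "t \<in> {0..2*pi}"
      using le[OF that] by (simp only: ereal_minus_le_minus)
    then show "ennreal (- (?I t * k t)) \<le> e2ennreal (- u (z + of_real r * cis t)) * indicator {0..2*pi} t"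
      using e2ennreal_mono[of "- ereal (k t)" "- u (z + of_real r * cis t)"] by (cases "t \<in> {0..2*pi}") auto
  qed
  ultimately have "enn2ereal (\<integral>\<^sup>+t\<in>{0..2*pi}. e2ennreal (u (z + of_real r * cis t)) \<partial>lborel)
    - enn2ereal (\<integral>\<^sup>+t\<in>{0..2*pi}. e2ennreal (- u (z + of_real r * cis t)) \<partial>lborel) \<le> enn2ereal P - enn2ereal N"
    by (intro ereal_minus_mono) (simp_all add: less_eq_ennreal.rep_eq)
  also have "enn2ereal P - enn2ereal N = ereal (enn2real P - enn2real N)"
    using fin by (cases P; cases N) auto
  also have "enn2real P - enn2real N = integral {0..2*pi} k"
    using real_lebesgue_integral_def[OF int] I by (simp add: P_def N_def)
  finally have "circle_mean u z r \<le> ereal (1 / (2 * pi)) * ereal (integral {0..2*pi} k)"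
    unfolding circle_mean_def by (intro ereal_mult_left_mono) auto
  then show ?thesis by simp
qed

text \<open>Without a maximum the open sets {w z < w y} cover K. In a finite subcover the centre y
  with the largest value is not covered.\<close>

lemma usc_attains_max:
  fixes w :: "complex \<Rightarrow> ereal"
  assumes K: "compact K" "K \<noteq> {}" "K \<subseteq> S" and o: "\<And>c. open {z \<in> S. w z < c}"
  shows "\<exists>x\<in>K. \<forall>y\<in>K. w y \<le> w x"
proof (rule ccontr)
  assume "\<not> ?thesis"
  then have n: "\<And>x. x \<in> K \<Longrightarrow> \<exists>y\<in>K. w x < w y" by (metis not_le)
  have cov: "K \<subseteq> (\<Union>y\<in>K. {z \<in> S. w z < w y})"
  proof
    fix x assume "x \<in> K"
    then show "x \<in> (\<Union>y\<in>K. {z \<in> S. w z < w y})" using n[of x] K(3) by blast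
  qed
  obtain C where C: "C \<subseteq> K" "finite C" "K \<subseteq> (\<Union>y\<in>C. {z \<in> S. w z < w y})"
    by (rule compactE_image[OF K(1) _ cov]) (use o in blast)+
  have "C \<noteq> {}" using C(3) K(2) by auto
  then have "Max (w ` C) \<in> w ` C" using C(2) by (intro Max_in) auto
  then obtain m where m: "m \<in> C" "w m = Max (w ` C)" by auto
  then have "\<forall>y\<in>C. w y \<le> w m" using C(2) by simp
  note m = m(1) this
  then obtain y where "y \<in> C" "w m < w y" using C(1,3) by blast
  with m show False by (meson not_le)
qed

lemma usc_open_sublevel:
  fixes u :: "complex \<Rightarrow> ereal" and k :: "complex \<Rightarrow> real"
  assumes S: "open S" and u: "\<forall>z\<in>S. \<forall>c. u z < c \<longrightarrow> (\<forall>\<^sub>F w in at z. u w < c)"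
    and fin: "\<forall>z\<in>S. u z < (\<infinity>::ereal)" and k: "continuous_on S k"
  shows "open {z \<in> S. u z + ereal (k z) < c}"
proof (subst open_subopen, rule ballI)
  fix z assume z: "z \<in> {z \<in> S. u z + ereal (k z) < c}"
  obtain e where e: "u z + ereal (k z) < ereal e" "ereal e < c" using ereal_dense2 z by blast
  have "u z < ereal (e - k z)" using e(1) by (cases "u z") auto
  then obtain e' where e': "u z < ereal e'" "ereal e' < ereal (e - k z)" using ereal_dense2 by blast
  have "eventually (\<lambda>w. w \<in> S) (nhds z)" using S z by (auto simp: eventually_nhds)
  moreover have "eventually (\<lambda>w. u w < ereal e') (nhds z)"
    using u e'(1) z by (auto simp: eventually_nhds_conv_at)
  moreover have "isCont k z" using k S z by (auto simp: continuous_on_eq_continuous_at)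
  then have "(k \<longlongrightarrow> k z) (nhds z)" by (simp add: isCont_def tendsto_nhds_iff)
  then have "eventually (\<lambda>w. k w < e - e') (nhds z)" by (rule order_tendstoD) (use e'(2) in simp)
  ultimately have "eventually (\<lambda>w. w \<in> {z \<in> S. u z + ereal (k z) < c}) (nhds z)"
  proof eventually_elim
    case (elim w)
    have "u w + ereal (k w) \<le> ereal e' + ereal (k w)" using elim(2) by (intro add_right_mono) auto
    also have "\<dots> < ereal e" using elim(3) by simp
    finally show ?case using elim(1) e(2) by auto
  qed
  then obtain T where "open T" "z \<in> T" "\<forall>w\<in>T. w \<in> {z \<in> S. u z + ereal (k z) < c}"
    by (auto simp: eventually_nhds)
  then show "\<exists>T. open T \<and> z \<in> T \<and> T \<subseteq> {z \<in> S. u z + ereal (k z) < c}" by blast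
qed

lemma subharmonic_open_sublevel:
  assumes "open S" "subharmonic_on S u"
  shows "open {z \<in> S. u z < c}"
  using usc_open_sublevel[of S u "\<lambda>_. 0" c] assms by (simp add: subharmonic_on_def zero_ereal_def[symmetric])

text \<open>The submean inequality is available on small circles only, so the comparison on a given
  disc goes through a maximum principle. Adding \<delta> |z - a|^2 makes it strict: at an interior
  maximum b the mean over a small circle would fall short of u b by \<delta> r^2.\<close>

lemma subharmonic_le_harmonic:
  assumes S: "open S" and u: "subharmonic_on S u" and R: "0 < R" "cball a R \<subseteq> S"
    and f: "f holomorphic_on UNIV" and le: "\<And>z. z \<in> sphere a R \<Longrightarrow> u z \<le> ereal (Re (f z))"
  shows "u a \<le> ereal (Re (f a))"
proof (rule ccontr)
  assume "\<not> ?thesis"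
  then have "ereal (Re (f a)) < u a" by simp
  then obtain e where e: "ereal (Re (f a)) < ereal e" "ereal e < u a" using ereal_dense2 by blast
  \<comment> \<open>\<delta> R^2 is half of the gap e - Re (f a), so the perturbation cannot move
    the maximum to the boundary circle.\<close>
  define \<delta> where "\<delta> = (e - Re (f a)) / (2 * R\<^sup>2)"
  have \<delta>: "0 < \<delta>" "\<delta> * R\<^sup>2 < e - Re (f a)" using e R by (auto simp: \<delta>_def)
  define k where "k = (\<lambda>z. \<delta> * (cmod (z - a))\<^sup>2 - Re (f z))"
  have contf: "continuous_on A f" for A using f holomorphic_on_imp_continuous_on continuous_on_subset by blast
  have contk: "continuous_on S k" unfolding k_def by (intro continuous_intros contf)
  have usc: "\<forall>z\<in>S. \<forall>c. u z < c \<longrightarrow> (\<forall>\<^sub>F w in at z. u w < c)" "\<forall>z\<in>S. u z < \<infinity>"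
    using u by (auto simp: subharmonic_on_def)
  have "\<exists>x\<in>cball a R. \<forall>y\<in>cball a R. u y + ereal (k y) \<le> u x + ereal (k x)"
    by (rule usc_attains_max[OF _ _ R(2) usc_open_sublevel[OF S usc contk]]) (use R in auto)
  then obtain b where b: "b \<in> cball a R" "\<And>y. y \<in> cball a R \<Longrightarrow> u y + ereal (k y) \<le> u b + ereal (k b)" by blast
  have ba: "ereal (e - Re (f a)) < u b + ereal (k b)"
  proof -
    have "ereal (e - Re (f a)) < u a + ereal (k a)" using e(2) by (cases "u a") (auto simp: k_def)
    also have "\<dots> \<le> u b + ereal (k b)" using b(2)[of a] R by simp
    finally show ?thesis .
  qed
  have "b \<notin> sphere a R"
  proof
    assume bs: "b \<in> sphere a R"
    have "u b + ereal (k b) \<le> ereal (Re (f b)) + ereal (k b)" using le[OF bs] by (rule add_right_mono)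
    also have "\<dots> = ereal (\<delta> * R\<^sup>2)" using bs by (simp add: k_def dist_norm norm_minus_commute)
    also have "\<dots> < ereal (e - Re (f a))" using \<delta> by simp
    finally show False using ba by simp
  qed
  then have bb: "b \<in> ball a R" "b \<in> S" using b(1) R(2) by auto
  have "u b < \<infinity>" using usc(2) bb by blast
  then obtain ub where ub: "u b = ereal ub" using ba by (cases "u b") auto
  define m where "m = ub + k b"
  obtain \<rho> where \<rho>: "0 < \<rho>" "\<And>r. 0 < r \<Longrightarrow> r < \<rho> \<Longrightarrow> u b \<le> circle_mean u b r"
    using u bb(2) by (auto simp: subharmonic_on_def)
  define r where "r = min (\<rho> / 2) ((R - dist a b) / 2)"
  have r: "0 < r" "r < \<rho>" "r < R - dist a b" using \<rho> bb(1) by (auto simp: r_def min_less_iff_disj)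
  \<comment> \<open>On the circle of radius r about b the function |z - a|^2 coincides with the real
    part of an affine function of z. So Re F = m - k there, and its mean is its value at b.\<close>
  define F where "F = (\<lambda>z. of_real m + f z - of_real \<delta> * (of_real ((cmod (b - a))\<^sup>2 + r\<^sup>2) + 2 * cnj (b - a) * (z - b)))"
  have holF: "F holomorphic_on ball b (r + 1)"
    unfolding F_def by (intro holomorphic_intros holomorphic_on_subset[OF f]) auto
  have sq: "(cmod (b + of_real r * cis t - a))\<^sup>2 = (cmod (b - a))\<^sup>2 + r\<^sup>2 + Re (2 * cnj (b - a) * (of_real r * cis t))" for t
  proof -
    have "(cmod (p + q))\<^sup>2 = (cmod p)\<^sup>2 + (cmod q)\<^sup>2 + Re (2 * cnj p * q)" for p q
      unfolding cmod_power2 by (simp add: power2_eq_square algebra_simps)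
    from this[of "b - a" "of_real r * cis t"] show ?thesis using r(1) by (simp add: norm_mult add_diff_eq[symmetric] diff_add_eq)
  qed
  have "u b \<le> circle_mean u b r" using \<rho>(2) r by blast
  also have "\<dots> \<le> ereal (integral {0..2*pi} (\<lambda>t. Re (F (b + of_real r * cis t))) / (2 * pi))"
  proof (rule circle_mean_le)
    fix t assume "t \<in> {0..2*pi}"
    let ?z = "b + of_real r * cis t"
    have "dist b ?z = r" using r(1) by (simp add: dist_norm norm_mult)
    then have "dist a ?z \<le> R" using dist_triangle[of a ?z b] r(3) by linarith
    then have "u ?z + ereal (k ?z) \<le> ereal m" using b(2)[of ?z] by (simp add: ub m_def)
    then have "u ?z \<le> ereal (m - k ?z)" by (cases "u ?z") auto
    also have "m - k ?z = Re (F ?z)" unfolding k_def F_def sq by (simp add: algebra_simps)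
    finally show "u ?z \<le> ereal (Re (F ?z))" .
  next
    show "continuous_on {0..2*pi} (\<lambda>t. Re (F (b + of_real r * cis t)))"
      unfolding F_def by (intro continuous_intros continuous_on_compose2[OF contf[of UNIV]]) auto
  qed
  also have "integral {0..2*pi} (\<lambda>t. Re (F (b + of_real r * cis t))) / (2 * pi) = Re (F b)"
    using integral_unique[OF mean_value_Re_holomorphic[OF holF r(1)]] by simp
  also have "Re (F b) = ub - \<delta> * r\<^sup>2" by (simp add: F_def m_def k_def algebra_simps)
  finally have "\<delta> * r\<^sup>2 \<le> 0" by (simp add: ub)
  moreover have "0 < \<delta> * r\<^sup>2" using \<delta>(1) r(1) by simp
  ultimately show False by linarith
qed

text \<open>On the unit circle v cnj v = 1, so one power of v cancels against one of cnj v.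
  Stripping a coefficient from each polynomial leaves pure powers of v, pure powers of cnj v, whose
  real part is that of a polynomial, and a smaller product.\<close>

lemma Re_poly_mult_cnj_on_circle:
  "\<exists>s. \<forall>v. cmod v = 1 \<longrightarrow> Re (poly p v * cnj (poly q v)) = Re (poly s v)"
proof (induction p arbitrary: q)
  case 0
  show ?case by (intro exI[of _ 0]) auto
next
  case (pCons a p)
  show ?case
  proof (induction q rule: pCons_induct)
    case 0
    show ?case by (intro exI[of _ 0]) auto
  next
    case (pCons b q)
    obtain s where s: "\<And>v. cmod v = 1 \<Longrightarrow> Re (poly p v * cnj (poly q v)) = Re (poly s v)"
      using pCons.IH \<open>\<And>q. \<exists>s. \<forall>v. cmod v = 1 \<longrightarrow> Re (poly p v * cnj (poly q v)) = Re (poly s v)\<close> by metis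
    show ?case
    proof (intro exI[of _ "[:a * cnj b:] + smult (cnj a) (pCons 0 q) + smult (cnj b) (pCons 0 p) + s"] allI impI)
      fix v :: complex assume z: "cmod v = 1"
      have zz: "v * cnj v = 1" using z by (simp add: complex_norm_square[symmetric])
      have "poly (pCons a p) v * cnj (poly (pCons b q) v)
        = a * cnj b + a * cnj (v * poly q v) + cnj b * (v * poly p v) + (v * cnj v) * (poly p v * cnj (poly q v))"
        by (simp add: algebra_simps)
      also have "Re \<dots> = Re (a * cnj b) + Re (a * cnj (v * poly q v)) + Re (cnj b * (v * poly p v)) + Re (poly s v)"
        by (simp only: zz mult_1 plus_complex.sel s[OF z])
      also have "Re (a * cnj (v * poly q v)) = Re (cnj (a * cnj (v * poly q v)))" by (simp only: cnj.sel)
      also have "cnj (a * cnj (v * poly q v)) = cnj a * (v * poly q v)" by simp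
      finally show "Re (poly (pCons a p) v * cnj (poly (pCons b q) v))
        = Re (poly ([:a * cnj b:] + smult (cnj a) (pCons 0 q) + smult (cnj b) (pCons 0 p) + s) v)"
        by (simp add: algebra_simps)
    qed
  qed
qed

text \<open>Stone-Weierstrass for real parts of polynomials. They form an algebra on the circle
  because Re x Re y is the mean of Re (x y) and Re (x cnj y). This takes the place of the Poisson
  integral: the approximants extend harmonically to the disc by themselves.\<close>

lemma circle_approx_harmonic_poly:
  fixes v :: "complex \<Rightarrow> real"
  assumes "continuous_on (sphere 0 1) v" "0 < e"
  shows "\<exists>p. \<forall>j\<in>sphere 0 1. \<bar>v j - Re (poly p j)\<bar> < e"
proof -
  define A where "A = {h. \<exists>p. \<forall>j::complex. cmod j = 1 \<longrightarrow> h j = Re (poly p j)}"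
  interpret function_ring_on A "sphere 0 1"
  proof
    show "continuous_on (sphere 0 1) f" if f: "f \<in> A" for f
    proof -
      obtain p where p: "\<forall>j. cmod j = 1 \<longrightarrow> f j = Re (poly p j)" using f by (auto simp: A_def)
      have "continuous_on (sphere 0 1) (\<lambda>j. Re (poly p j))" by (intro continuous_intros)
      then show ?thesis by (rule continuous_on_cong[THEN iffD1, rotated -1]) (use p in auto)
    qed
    show "(\<lambda>x. f x + g x) \<in> A" if fg: "f \<in> A" "g \<in> A" for f g
    proof -
      obtain p q where "\<forall>j. cmod j = 1 \<longrightarrow> f j = Re (poly p j)" "\<forall>j. cmod j = 1 \<longrightarrow> g j = Re (poly q j)"
        using fg by (auto simp: A_def)
      then show ?thesis unfolding A_def by (auto intro!: exI[of _ "p + q"])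
    qed
    show "(\<lambda>x. f x * g x) \<in> A" if fg: "f \<in> A" "g \<in> A" for f g
    proof -
      obtain p q where pq: "\<And>j. cmod j = 1 \<Longrightarrow> f j = Re (poly p j)" "\<And>j. cmod j = 1 \<Longrightarrow> g j = Re (poly q j)"
        using fg by (auto simp: A_def)
      obtain s where s: "\<And>j. cmod j = 1 \<Longrightarrow> Re (poly p j * cnj (poly q j)) = Re (poly s j)"
        using Re_poly_mult_cnj_on_circle by blast
      have "f j * g j = Re (poly (smult (1/2) (p * q + s)) j)" if z: "cmod j = 1" for j
      proof -
        have "Re x * Re y = (Re (x * y) + Re (x * cnj y)) / 2" for x y by simp
        then show ?thesis using s[OF z] pq[OF z] by simp
      qed
      then show ?thesis unfolding A_def by blast
    qed
    show "(\<lambda>_. c) \<in> A" for c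
      unfolding A_def by (auto intro!: exI[of _ "[:of_real c:]"])
    show "\<exists>f\<in>A. f x \<noteq> f y" if "x \<noteq> y" for x y
    proof (cases "Re x = Re y")
      case False
      have "Re \<in> A" unfolding A_def by (auto intro!: exI[of _ "[:0, 1:]"])
      then show ?thesis using False by blast
    next
      case True
      have "Im \<in> A" unfolding A_def by (auto intro!: exI[of _ "[:0, - \<i>:]"])
      then show ?thesis using True that complex_eq_iff by blast
    qed
  qed simp
  from Stone_Weierstrass_basic[OF assms] obtain g where "g \<in> A" "\<forall>x\<in>sphere 0 1. \<bar>v x - g x\<bar> < e" by blast
  then obtain p where "\<forall>j. cmod j = 1 \<longrightarrow> g j = Re (poly p j)" "\<forall>x\<in>sphere 0 1. \<bar>v x - g x\<bar> < e"
    unfolding A_def by blast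
  then show ?thesis by (metis mem_sphere_0)
qed

text \<open>The majorant is approximated on the circle by the real part of a polynomial within e / 2
  and raised by e / 2, so that it stays a majorant; the polynomial is harmonic inside, and its value
  at the centre is its circle mean. The radius is arbitrary, unlike in the definition of
  subharmonicity.\<close>

lemma subharmonic_le_circle_integral:
  assumes S: "open S" and u: "subharmonic_on S u" and R: "0 < R" "cball a R \<subseteq> S"
    and \<phi>: "continuous_on UNIV \<phi>" and le: "\<And>z. z \<in> sphere a R \<Longrightarrow> u z \<le> ereal (\<phi> z)"
  shows "u a \<le> ereal (integral {0..2*pi} (\<lambda>t. \<phi> (a + of_real R * cis t)) / (2 * pi))"
proof (rule ereal_le_epsilon2)
  fix e :: real assume e: "0 < e"
  have c: "continuous_on (sphere 0 1) (\<lambda>\<zeta>. \<phi> (a + of_real R * \<zeta>))"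
    by (intro continuous_on_compose2[OF \<phi>] continuous_intros) auto
  obtain p where p0: "\<forall>\<zeta>\<in>sphere 0 1. \<bar>\<phi> (a + of_real R * \<zeta>) - Re (poly p \<zeta>)\<bar> < e / 2"
    using circle_approx_harmonic_poly[OF c, of "e / 2"] e half_gt_zero by blast
  have p: "\<bar>\<phi> (a + of_real R * \<zeta>) - Re (poly p \<zeta>)\<bar> < e / 2" if "cmod \<zeta> = 1" for \<zeta>
    using p0 that by (metis mem_sphere_0)
  define f where "f = (\<lambda>z. poly p ((z - a) / of_real R) + of_real (e / 2))"
  have f: "f holomorphic_on UNIV" unfolding f_def using R by (intro holomorphic_intros) auto
  have 1: "\<phi> z \<le> Re (f z)" if "z \<in> sphere a R" for z
  proof -
    have "cmod ((z - a) / of_real R) = 1" using that R by (simp add: norm_divide dist_norm norm_minus_commute)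
    from p[OF this] R have "\<bar>\<phi> z - Re (poly p ((z - a) / of_real R))\<bar> < e / 2" by simp
    then show ?thesis by (simp add: f_def, linarith)
  qed
  have "u a \<le> ereal (Re (f a))"
    by (rule subharmonic_le_harmonic[OF S u R f]) (use le 1 in \<open>meson dual_order.trans ereal_less_eq(3)\<close>)
  also have "Re (f a) = integral {0..2*pi} (\<lambda>t. Re (f (a + of_real R * cis t))) / (2 * pi)"
    using integral_unique[OF mean_value_Re_holomorphic[of f a "R + 1" R]] holomorphic_on_subset[OF f] R by simp
  also have "integral {0..2*pi} (\<lambda>t. Re (f (a + of_real R * cis t))) \<le> integral {0..2*pi} (\<lambda>t. \<phi> (a + of_real R * cis t) + e)"
  proof (rule integral_le)
    have cf: "continuous_on UNIV f" using f by (rule holomorphic_on_imp_continuous_on)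
    show "(\<lambda>t. Re (f (a + of_real R * cis t))) integrable_on {0..2*pi}"
      by (intro integrable_continuous_interval continuous_intros continuous_on_compose2[OF cf]) auto
    show "(\<lambda>t. \<phi> (a + of_real R * cis t) + e) integrable_on {0..2*pi}"
      by (intro integrable_continuous_interval continuous_intros continuous_on_compose2[OF \<phi>]) auto
    show "Re (f (a + of_real R * cis t)) \<le> \<phi> (a + of_real R * cis t) + e" for t
    proof -
      have "\<bar>\<phi> (a + of_real R * cis t) - Re (poly p (cis t))\<bar> < e / 2" using p[of "cis t"] by simp
      then show ?thesis using R by (simp add: f_def, linarith)
    qed
  qed
  also have "integral {0..2*pi} (\<lambda>t. \<phi> (a + of_real R * cis t) + e) = integral {0..2*pi} (\<lambda>t. \<phi> (a + of_real R * cis t)) + 2 * pi * e"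
    by (subst integral_add) (auto intro!: integrable_continuous_interval continuous_intros continuous_on_compose2[OF \<phi>])
  finally show "u a \<le> ereal (integral {0..2*pi} (\<lambda>t. \<phi> (a + of_real R * cis t)) / (2 * pi)) + ereal e"
    by (simp add: divide_right_mono field_simps)
qed

lemma usc_borel_measurable:
  fixes u :: "complex \<Rightarrow> ereal"
  assumes S: "open S" and o: "\<And>c. open {z \<in> S. u z < c}"
  shows "(\<lambda>z. if z \<in> S then u z else 0) \<in> borel_measurable borel"
proof (rule borel_measurableI_less)
  fix y :: ereal
  have "{x \<in> space borel. (if x \<in> S then u x else 0) < y} = {z \<in> S. u z < y} \<union> (if 0 < y then - S else {})"
    by auto
  moreover have "\<dots> \<in> sets borel" using o[of y] S by (intro sets.Un) auto
  ultimately show "{x \<in> space borel. (if x \<in> S then u x else 0) < y} \<in> sets borel" by simp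
qed

text \<open>Inf-convolution: f n z is the infimum over y of min (v y) n + n |z - y|. It is
  n-Lipschitz, increases with n and lies below v; the truncation at n keeps it real where v is
  infinite.\<close>

lemma lsc_Lipschitz_approximation:
  fixes v :: "complex \<Rightarrow> ereal"
  assumes v0: "\<And>z. z \<in> K \<Longrightarrow> 0 \<le> v z" and K: "K \<noteq> {}"
    and lsc: "\<And>z c. z \<in> K \<Longrightarrow> ereal c < v z \<Longrightarrow> \<exists>\<rho>>0. \<forall>w\<in>K. dist w z < \<rho> \<longrightarrow> ereal c < v w"
  shows "\<exists>f :: nat \<Rightarrow> complex \<Rightarrow> real. (\<forall>n. continuous_on UNIV (f n)) \<and> (\<forall>n z. 0 \<le> f n z) \<and> incseq f \<and>
     (\<forall>z\<in>K. \<forall>n. ereal (f n z) \<le> v z) \<and> (\<forall>z\<in>K. (SUP n. ennreal (f n z)) = e2ennreal (v z))"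
proof -
  define t where "t = (\<lambda>n y. real_of_ereal (min (v y) (ereal (real n))))"
  have t0: "0 \<le> t n y" if "y \<in> K" for n y using v0[OF that] by (auto simp: t_def min_def real_of_ereal_pos)
  have te: "ereal (t n y) = min (v y) (ereal (real n))" if "y \<in> K" for n y
    using v0[OF that] by (cases "v y") (auto simp: t_def min_def)
  define f where "f = (\<lambda>n z. INF y\<in>K. t n y + real n * dist z y)"
  have bb: "bdd_below ((\<lambda>y. t n y + real n * dist z y) ` K)" for n z
    by (rule bdd_belowI[of _ 0]) (use t0 in \<open>auto intro!: add_nonneg_nonneg\<close>)
  have nn: "0 \<le> f n z" for n z
    unfolding f_def by (rule cINF_greatest[OF K]) (use t0 in \<open>auto intro!: add_nonneg_nonneg\<close>)
  have up: "f n z \<le> t n z" if "z \<in> K" for n z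
    unfolding f_def by (rule order_trans[OF cINF_lower[OF bb that]]) simp
  have Lip: "f n z \<le> f n w + real n * dist z w" for n z w
  proof -
    have "f n z - real n * dist z w \<le> f n w"
      unfolding f_def
    proof (rule cINF_greatest[OF K])
      fix y assume y: "y \<in> K"
      have "(INF y\<in>K. t n y + real n * dist z y) \<le> t n y + real n * dist z y" by (rule cINF_lower[OF bb y])
      moreover have "real n * dist z y \<le> real n * (dist z w + dist w y)" by (intro mult_left_mono dist_triangle) auto
      ultimately show "(INF y\<in>K. t n y + real n * dist z y) - real n * dist z w \<le> t n y + real n * dist w y"
        by (simp add: algebra_simps)
    qed
    then show ?thesis by simp
  qed
  have cont: "continuous_on UNIV (f n)" for n
  proof (rule continuous_at_imp_continuous_on, rule ballI)
    fix z
    have "((\<lambda>w. f n w - f n z) \<longlongrightarrow> 0) (at z)"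
    proof (rule Lim_null_comparison)
      have "norm (f n w - f n z) \<le> real n * dist w z" for w
        using Lip[of n w z] Lip[of n z w] by (simp add: abs_le_iff dist_commute)
      then show "eventually (\<lambda>w. norm (f n w - f n z) \<le> real n * dist w z) (at z)" by simp
      have "((\<lambda>w. real n * dist w z) \<longlongrightarrow> real n * dist z z) (at z)" by (intro tendsto_intros)
      then show "((\<lambda>w. real n * dist w z) \<longlongrightarrow> 0) (at z)" by simp
    qed
    then show "isCont (f n) z" by (simp add: isCont_def LIM_zero_iff)
  qed
  have inc: "incseq f"
  proof (rule incseq_SucI, rule le_funI)
    fix n z
    show "f n z \<le> f (Suc n) z" unfolding f_def
    proof (rule cINF_mono[OF K bb])
      fix y assume y: "y \<in> K"
      have "ereal (t n y) \<le> ereal (t (Suc n) y)" unfolding te[OF y] by (intro min.mono) auto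
      moreover have "real n * dist z y \<le> real (Suc n) * dist z y" by (intro mult_right_mono) auto
      ultimately show "\<exists>x\<in>K. t n x + real n * dist z x \<le> t (Suc n) y + real (Suc n) * dist z y"
        using y by (intro bexI[of _ y]) auto
    qed
  qed
  have le: "ereal (f n z) \<le> v z" if "z \<in> K" for n z
  proof -
    have "ereal (f n z) \<le> ereal (t n z)" using up[OF that] by simp
    also have "\<dots> \<le> v z" unfolding te[OF that] by simp
    finally show ?thesis .
  qed
  have sup: "(SUP n. ennreal (f n z)) = e2ennreal (v z)" if z: "z \<in> K" for z
  proof (rule antisym)
    show "(SUP n. ennreal (f n z)) \<le> e2ennreal (v z)"
      using e2ennreal_mono[OF le[OF z]] by (auto intro!: SUP_least)
    show "e2ennreal (v z) \<le> (SUP n. ennreal (f n z))"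
    proof (rule dense_le)
      fix y assume y: "y < e2ennreal (v z)"
      then have "y < top" using top.not_eq_extremum by fastforce
      then obtain c where c: "0 \<le> c" "y = ennreal c" by (cases y) auto
      have "ereal c < v z"
      proof (rule ccontr)
        assume "\<not> ?thesis"
        then have "e2ennreal (v z) \<le> ennreal c" using e2ennreal_mono[of "v z" "ereal c"] by simp
        then show False using y c by simp
      qed
      then obtain \<rho> where \<rho>: "0 < \<rho>" "\<And>w. w \<in> K \<Longrightarrow> dist w z < \<rho> \<Longrightarrow> ereal c < v w" using lsc[OF z] by blast
      \<comment> \<open>n > c serves the points within \<rho> of z, where v > c; n \<rho> > c serves
        the points farther away through the distance term.\<close>
      obtain n :: nat where n: "max c (c / \<rho>) < real n" using reals_Archimedean2 by blast
      have "c \<le> f n z" unfolding f_def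
      proof (rule cINF_greatest[OF K])
        fix w assume w: "w \<in> K"
        show "c \<le> t n w + real n * dist z w"
        proof (cases "dist w z < \<rho>")
          case True
          have "ereal c \<le> ereal (t n w)" unfolding te[OF w] using \<rho>(2)[OF w True] n by (auto simp: less_imp_le)
          then show ?thesis by (simp add: add_increasing2)
        next
          case False
          have "c / \<rho> * \<rho> \<le> real n * dist z w" using n False \<rho>(1) c(1) by (intro mult_mono) (auto simp: dist_commute)
          then show ?thesis using t0[OF w, of n] \<rho>(1) by simp
        qed
      qed
      then have "y \<le> ennreal (f n z)" using c by (simp add: ennreal_leI)
      also have "\<dots> \<le> (SUP n. ennreal (f n z))" by (rule SUP_upper) simp
      finally show "y \<le> (SUP n. ennreal (f n z))" .
    qed
  qed
  show ?thesis using cont nn inc le sup by blast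
qed

lemma cball_radial_subset: "exp x < R \<Longrightarrow> cball (a::complex) R \<subseteq> S \<Longrightarrow> cball a (exp x) \<subseteq> S"
  by (meson less_imp_le order_trans subset_cball)

text \<open>K - u is nonnegative and lower semicontinuous. The submean inequality at a bounds the
  circle integrals of its continuous minorants by 2 pi (K - u a), whatever the radius; polar
  coordinates and monotone convergence turn this into a bound on the ball.\<close>

lemma subharmonic_finite_on_ball:
  assumes S: "open S" and u: "subharmonic_on S u" and R: "0 < R" "cball a R \<subseteq> S" and ua: "u a \<noteq> -\<infinity>"
  shows "\<exists>K::real. (\<forall>z\<in>cball a R. u z \<le> ereal K) \<and> (\<integral>\<^sup>+z\<in>ball a R. e2ennreal (ereal K - u z) \<partial>lborel) < \<infinity>"
proof -
  have usc: "\<forall>z\<in>S. \<forall>c. u z < c \<longrightarrow> (\<forall>\<^sub>F w in at z. u w < c)" and fin: "\<forall>z\<in>S. u z < \<infinity>"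
    using u by (auto simp: subharmonic_on_def)
  obtain x where x: "x \<in> cball a R" "\<And>y. y \<in> cball a R \<Longrightarrow> u y \<le> u x"
    using usc_attains_max[OF compact_cball _ R(2) subharmonic_open_sublevel[OF S u]] R(1) by fastforce
  have "u x < \<infinity>" using fin x(1) R(2) by blast
  then obtain K where "u x < ereal K" using ereal_dense2 by blast
  then have K: "u y \<le> ereal K" if "y \<in> cball a R" for y using x(2)[OF that] by simp
  define v where "v = (\<lambda>z. ereal K - u z)"
  have v0: "0 \<le> v z" if "z \<in> cball a R" for z
    using K[OF that] fin that R(2) by (cases "u z") (auto simp: v_def)
  obtain ua' where ua': "u a = ereal ua'" using ua fin R by (cases "u a") (auto dest!: bspec[of S _ a])
  have lsc: "\<exists>\<rho>>0. \<forall>w\<in>cball a R. dist w z < \<rho> \<longrightarrow> ereal c < v w" if z: "z \<in> cball a R" "ereal c < v z" for z c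
  proof -
    have "u z < ereal (K - c)" using z(2) by (cases "u z") (auto simp: v_def)
    then have "eventually (\<lambda>w. u w < ereal (K - c)) (nhds z)"
      using usc z(1) R(2) by (auto simp: eventually_nhds_conv_at)
    then obtain \<rho> where \<rho>: "0 < \<rho>" "\<And>w. dist w z < \<rho> \<Longrightarrow> u w < ereal (K - c)" by (auto simp: eventually_nhds_metric)
    have "ereal c < v w" if "dist w z < \<rho>" for w using \<rho>(2)[OF that] by (cases "u w") (auto simp: v_def)
    then show ?thesis using \<rho>(1) by blast
  qed
  have "cball a R \<noteq> {}" using R by auto
  from lsc_Lipschitz_approximation[of "cball a R" v, OF v0 this lsc]
  obtain \<phi> :: "nat \<Rightarrow> complex \<Rightarrow> real" where \<phi>: "\<And>n. continuous_on UNIV (\<phi> n)" "\<And>n z. 0 \<le> \<phi> n z" "incseq \<phi>"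
    "\<And>z n. z \<in> cball a R \<Longrightarrow> ereal (\<phi> n z) \<le> v z" "\<And>z. z \<in> cball a R \<Longrightarrow> (SUP n. ennreal (\<phi> n z)) = e2ennreal (v z)" by metis
  have [measurable]: "\<phi> n \<in> borel_measurable borel" for n by (rule borel_measurable_continuous_onI[OF \<phi>(1)])
  have [measurable]: "cis \<in> borel_measurable borel" by (intro borel_measurable_continuous_onI continuous_intros)
  have [measurable]: "ball a R \<in> sets borel" by simp
  define C where "C = 2 * pi * (K - ua')"
  have C0: "0 \<le> C" using K[of a] R by (simp add: C_def ua')
  have circ: "(\<integral>\<^sup>+t\<in>{0<..<2*pi}. ennreal (\<phi> n (a + of_real (exp x) * cis t)) \<partial>lborel) \<le> ennreal C" if x: "exp x < R" for n x
  proof -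
    let ?f = "\<lambda>t. \<phi> n (a + of_real (exp x) * cis t)"
    have cf: "continuous_on A ?f" for A by (intro continuous_on_compose2[OF \<phi>(1)] continuous_intros) auto
    have "u a \<le> ereal (integral {0..2*pi} (\<lambda>t. K - \<phi> n (a + of_real (exp x) * cis t)) / (2 * pi))"
    proof (rule subharmonic_le_circle_integral[OF S u, where \<phi> = "\<lambda>z. K - \<phi> n z"])
      show "cball a (exp x) \<subseteq> S" using cball_radial_subset[OF x R(2)] .
      show "continuous_on UNIV (\<lambda>z. K - \<phi> n z)" by (intro continuous_intros \<phi>)
      show "u z \<le> ereal (K - \<phi> n z)" if "z \<in> sphere a (exp x)" for z
        using \<phi>(4)[of z n] that x by (cases "u z") (auto simp: v_def)
    qed auto
    also have "integral {0..2*pi} (\<lambda>t. K - ?f t) = 2 * pi * K - integral {0..2*pi} ?f"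
      using cf by (subst integral_diff) (auto intro!: integrable_continuous_interval)
    finally have "integral {0..2*pi} ?f \<le> C" by (simp add: ua' C_def field_simps)
    moreover have "(\<integral>\<^sup>+t. ennreal (?f t) * indicator {0..2*pi} t \<partial>lborel) = ennreal (integral {0..2*pi} ?f)"
      by (rule nn_integral_has_integral_lebesgue')
        (use \<phi>(2) cf in \<open>auto intro!: integrable_integral integrable_continuous_interval\<close>)
    moreover have "(\<integral>\<^sup>+t\<in>{0<..<2*pi}. ennreal (?f t) \<partial>lborel) \<le> (\<integral>\<^sup>+t. ennreal (?f t) * indicator {0..2*pi} t \<partial>lborel)"
      by (intro nn_integral_mono) (auto simp: indicator_def)
    ultimately show ?thesis using ennreal_leI[of "integral {0..2*pi} ?f" C] order_trans by simp
  qed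
  have bound: "(\<integral>\<^sup>+z. ennreal (\<phi> n z) * indicator (ball a R) z \<partial>lborel) \<le> ennreal C * emeasure lborel (ball a R)" for n
  proof -
    have ind: "indicator (ball a R) (a + of_real (exp x) * cis t) = (indicator {..<ln R} x :: ennreal)" for x t
    proof -
      have "exp x < R \<longleftrightarrow> x < ln R" using R(1) by (metis exp_less_cancel_iff exp_ln)
      then show ?thesis by (simp add: indicator_def dist_norm norm_mult)
    qed
    have "(\<integral>\<^sup>+z. ennreal (\<phi> n z) * indicator (ball a R) z \<partial>lborel)
      = (\<integral>\<^sup>+x. ennreal (exp (2 * x)) * (\<integral>\<^sup>+t\<in>{0<..<2*pi}. ennreal (\<phi> n (a + of_real (exp x) * cis t)) * indicator {..<ln R} x \<partial>lborel) \<partial>lborel)"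
      by (subst log_polar_nn_integral[of _ a]) (auto simp: ind)
    also have "\<dots> \<le> (\<integral>\<^sup>+x. ennreal (exp (2 * x)) * (\<integral>\<^sup>+t\<in>{0<..<2*pi}. ennreal C * indicator {..<ln R} x \<partial>lborel) \<partial>lborel)"
    proof (rule nn_integral_mono, rule mult_left_mono)
      fix x :: real
      show "(\<integral>\<^sup>+t\<in>{0<..<2*pi}. ennreal (\<phi> n (a + of_real (exp x) * cis t)) * indicator {..<ln R} x \<partial>lborel)
        \<le> (\<integral>\<^sup>+t\<in>{0<..<2*pi}. ennreal C * indicator {..<ln R} x \<partial>lborel)"
      proof (cases "x < ln R")
        case True
        then have "exp x < R" using R(1) by (metis exp_less_cancel_iff exp_ln)
        \<comment> \<open>Since 2 pi >= 1, the bound C for the circle integral is at most the circle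
          integral of the constant C. So polar coordinates can be undone afterwards.\<close>
        have "ennreal C \<le> ennreal C * ennreal (2 * pi)"
        proof -
          have "C * 1 \<le> C * (2 * pi)" using C0 pi_ge_two by (intro mult_left_mono) auto
          then show ?thesis using C0 by (simp add: ennreal_mult[symmetric] ennreal_leI)
        qed
        also have "\<dots> = (\<integral>\<^sup>+t\<in>{0<..<2*pi}. ennreal C \<partial>lborel)" by (simp add: nn_integral_cmult)
        finally show ?thesis using order_trans[OF circ[OF \<open>exp x < R\<close>]] True by (simp add: mult.assoc)
      qed simp
    qed auto
    also have "\<dots> = (\<integral>\<^sup>+z. ennreal C * indicator (ball a R) z \<partial>lborel)"
      by (subst log_polar_nn_integral[of "\<lambda>z. ennreal C * indicator (ball a R) z" a]) (auto simp: ind)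
    also have "\<dots> = ennreal C * emeasure lborel (ball a R)" by (subst nn_integral_cmult_indicator) auto
    finally show ?thesis .
  qed
  have "(\<integral>\<^sup>+z\<in>ball a R. e2ennreal (v z) \<partial>lborel) = (\<integral>\<^sup>+z. (SUP n. ennreal (\<phi> n z) * indicator (ball a R) z) \<partial>lborel)"
  proof (rule nn_integral_cong)
    fix z
    show "e2ennreal (v z) * indicator (ball a R) z = (SUP n. ennreal (\<phi> n z) * indicator (ball a R) z)"
      using \<phi>(5)[of z] by (cases "z \<in> ball a R") auto
  qed
  also have "\<dots> = (SUP n. \<integral>\<^sup>+z. ennreal (\<phi> n z) * indicator (ball a R) z \<partial>lborel)"
  proof (rule nn_integral_monotone_convergence_SUP)
    show "incseq (\<lambda>n z. ennreal (\<phi> n z) * indicator (ball a R) z)"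
      using \<phi>(3) by (auto simp: incseq_def le_fun_def intro!: mult_right_mono ennreal_leI)
  qed auto
  also have "\<dots> \<le> ennreal C * emeasure lborel (ball a R)" by (intro SUP_least bound)
  also have "\<dots> < \<infinity>" using emeasure_lborel_ball_finite[of a R] by (simp add: ennreal_mult_less_top)
  finally show ?thesis using K unfolding v_def by blast
qed

text \<open>The values \<open>-\<infinity>\<close> are sent to 0 by \<^const>\<open>real_of_ereal\<close>, which is harmless because
  they are shown to form a null set.\<close>

lemma subharmonic_dichotomy:
  assumes S: "open S" and u: "subharmonic_on S u" and z: "z \<in> S"
  shows "\<exists>r>0. ball z r \<subseteq> S \<and> ((\<forall>w\<in>ball z r. u w = -\<infinity>) \<or>
    (integrable lborel (\<lambda>w. indicator (ball z r) w * real_of_ereal (u w)) \<and> (AE w in lborel. w \<in> ball z r \<longrightarrow> u w \<noteq> -\<infinity>)))"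
proof -
  obtain e where e: "0 < e" "ball z e \<subseteq> S" using S z openE by blast
  \<comment> \<open>If a lies in the ball of radius r about z, the closed ball of radius 2 r about a
    stays within 3 r < e of z, and the open one contains the ball of radius r about z.\<close>
  define r where "r = e / 4"
  have r: "0 < r" "ball z r \<subseteq> S" using e by (auto simp: r_def)
  show ?thesis
  proof (cases "\<forall>w\<in>ball z r. u w = -\<infinity>")
    case False
    then obtain a where a: "a \<in> ball z r" "u a \<noteq> -\<infinity>" by blast
    have sub: "cball a (2 * r) \<subseteq> S"
    proof
      fix w assume "w \<in> cball a (2 * r)"
      then have "dist z w < e" using dist_triangle[of z w a] a(1) r(1) by (simp add: r_def)
      then show "w \<in> S" using e(2) by auto
    qed
    have sub2: "ball z r \<subseteq> ball a (2 * r)"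
    proof
      fix w assume "w \<in> ball z r"
      then show "w \<in> ball a (2 * r)" using dist_triangle[of a w z] a(1) by (simp add: dist_commute)
    qed
    obtain K :: real where K: "\<forall>w\<in>cball a (2 * r). u w \<le> ereal K"
      "(\<integral>\<^sup>+w\<in>ball a (2 * r). e2ennreal (ereal K - u w) \<partial>lborel) < \<infinity>"
      using subharmonic_finite_on_ball[OF S u _ sub a(2)] r(1) by auto
    define uS where "uS = (\<lambda>w. if w \<in> S then u w else 0)"
    have [measurable]: "uS \<in> borel_measurable borel"
      unfolding uS_def by (rule usc_borel_measurable[OF S subharmonic_open_sublevel[OF S u]])
    have eq: "uS w = u w" if "w \<in> ball a (2 * r)" for w
    proof -
      have "w \<in> S" using sub that ball_subset_cball[of a "2 * r"] by blast
      then show ?thesis by (simp add: uS_def)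
    qed
    have [measurable]: "ball a (2 * r) \<in> sets borel" "ball z r \<in> sets borel" by simp_all
    define V where "V = (\<lambda>w. e2ennreal (ereal K - uS w) * indicator (ball a (2 * r)) w)"
    have [measurable]: "V \<in> borel_measurable borel" unfolding V_def by measurable
    have Vfin: "integral\<^sup>N lborel V < \<infinity>"
    proof -
      have "integral\<^sup>N lborel V = (\<integral>\<^sup>+w\<in>ball a (2 * r). e2ennreal (ereal K - u w) \<partial>lborel)"
        unfolding V_def by (intro nn_integral_cong) (auto simp: indicator_def eq)
      then show ?thesis using K(2) by simp
    qed
    have ae: "AE w in lborel. V w \<noteq> \<infinity>" using nn_integral_PInf_AE[of V lborel] Vfin by auto
    have ae2: "AE w in lborel. w \<in> ball z r \<longrightarrow> u w \<noteq> -\<infinity>"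
      using ae
    proof eventually_elim
      case (elim w)
      show ?case
      proof
        assume "w \<in> ball z r"
        then have "w \<in> ball a (2 * r)" using sub2 by blast
        then show "u w \<noteq> -\<infinity>" using elim eq[of w] by (auto simp: V_def)
      qed
    qed
    have "integrable lborel (\<lambda>w. indicator (ball z r) w * real_of_ereal (uS w))"
    proof (rule integrableI_bounded)
      have "norm (indicator (ball z r) w * real_of_ereal (uS w)) \<le> \<bar>K\<bar> * indicator (ball z r) w + enn2real (V w)"
        for w
      proof (cases "w \<in> ball z r")
        case True
        then have wa: "w \<in> ball a (2 * r)" using sub2 by blast
        then have "uS w \<le> ereal K" using K(1) eq by auto
        then show ?thesis using True wa by (cases "uS w") (auto simp: V_def)
      qed auto
      then have "ennreal (norm (indicator (ball z r) w * real_of_ereal (uS w))) \<le> ennreal \<bar>K\<bar> * indicator (ball z r) w + V w" for w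
      proof -
        have "ennreal (norm (indicator (ball z r) w * real_of_ereal (uS w))) \<le> ennreal (\<bar>K\<bar> * indicator (ball z r) w + enn2real (V w))"
          using \<open>\<And>w. norm (indicator (ball z r) w * real_of_ereal (uS w)) \<le> \<bar>K\<bar> * indicator (ball z r) w + enn2real (V w)\<close> by (rule ennreal_leI)
        also have "\<dots> = ennreal (\<bar>K\<bar> * indicator (ball z r) w) + ennreal (enn2real (V w))" by (rule ennreal_plus) auto
        also have "\<dots> \<le> ennreal \<bar>K\<bar> * indicator (ball z r) w + V w"
          by (intro add_mono) (auto simp: indicator_def ennreal_enn2real_if)
        finally show ?thesis .
      qed
      then have "(\<integral>\<^sup>+w. ennreal (norm (indicator (ball z r) w * real_of_ereal (uS w))) \<partial>lborel)
        \<le> (\<integral>\<^sup>+w. ennreal \<bar>K\<bar> * indicator (ball z r) w + V w \<partial>lborel)" by (intro nn_integral_mono)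
      also have "\<dots> = ennreal \<bar>K\<bar> * emeasure lborel (ball z r) + integral\<^sup>N lborel V"
        by (subst nn_integral_add) (auto simp: nn_integral_cmult_indicator)
      also have "\<dots> < \<infinity>"
        using Vfin emeasure_lborel_ball_finite[of z r] by (simp add: ennreal_mult_less_top)
      finally show "(\<integral>\<^sup>+w. ennreal (norm (indicator (ball z r) w * real_of_ereal (uS w))) \<partial>lborel) < \<infinity>" .
    qed auto
    moreover have "(\<lambda>w. indicator (ball z r) w * real_of_ereal (uS w)) = (\<lambda>w. indicator (ball z r) w * real_of_ereal (u w))"
      using eq sub2 by (auto simp: indicator_def fun_eq_iff)
    ultimately show ?thesis using r ae2 by auto
  qed (use r in auto)
qed

section \<open>The extended plane in two charts\<close>

lemma topspace_riemann_sphere [simp]: "topspace riemann_sphere = UNIV"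
  by (auto simp: riemann_sphere_def) (metis option.exhaust rangeI)

lemma finite_part_Compl [simp]: "finite_part (- V) = - finite_part V"
  by (auto simp: finite_part_def)

text \<open>The working description of the topology: compact complements are replaced by a radius
  beyond which all points belong to V.\<close>

lemma openin_riemann_sphere_iff:
  "openin riemann_sphere V \<longleftrightarrow> open (finite_part V) \<and> (None \<in> V \<longrightarrow> (\<exists>R. \<forall>z. R < cmod z \<longrightarrow> Some z \<in> V))"
proof
  assume "openin riemann_sphere V"
  then consider U where "open U" "V = Some ` U" | C where "compact C" "V = insert None (Some ` (- C))"
    unfolding riemann_sphere_def openin_Alexandroff_compactification by (auto simp: Compl_eq_Diff_UNIV)
  then show "open (finite_part V) \<and> (None \<in> V \<longrightarrow> (\<exists>R. \<forall>z. R < cmod z \<longrightarrow> Some z \<in> V))"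
  proof cases
    case 1
    then have "finite_part V = U" by (auto simp: finite_part_def)
    with 1 show ?thesis by auto
  next
    case 2
    have "finite_part V = - C" using 2 by (auto simp: finite_part_def)
    moreover obtain R where "\<And>z. z \<in> C \<Longrightarrow> cmod z \<le> R" using compact_imp_bounded[OF 2(1)] bounded_iff by metis
    then have "\<forall>z. R < cmod z \<longrightarrow> Some z \<in> V" using 2(2) by force
    ultimately show ?thesis using compact_imp_closed[OF 2(1)] by (auto simp: open_closed)
  qed
next
  assume a: "open (finite_part V) \<and> (None \<in> V \<longrightarrow> (\<exists>R. \<forall>z. R < cmod z \<longrightarrow> Some z \<in> V))"
  show "openin riemann_sphere V"
  proof (cases "None \<in> V")
    case False
    have "V = Some ` finite_part V"
    proof (rule set_eqI)
      show "p \<in> V \<longleftrightarrow> p \<in> Some ` finite_part V" for p using False by (cases p) (auto simp: finite_part_def)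
    qed
    moreover have "openin riemann_sphere (Some ` finite_part V)" using a by (simp add: riemann_sphere_def)
    ultimately show ?thesis by simp
  next
    case True
    then obtain R where R: "\<And>z. R < cmod z \<Longrightarrow> Some z \<in> V" using a by blast
    have "bounded (- finite_part V)"
      unfolding bounded_iff using R by (intro exI[of _ R]) (auto simp: finite_part_def intro: leI)
    then have "compact (- finite_part V)" using a by (simp add: compact_eq_bounded_closed open_closed)
    moreover have "V = insert None (Some ` (UNIV - (- finite_part V)))"
    proof (rule set_eqI)
      show "p \<in> V \<longleftrightarrow> p \<in> insert None (Some ` (UNIV - (- finite_part V)))" for p
        using True by (cases p) (auto simp: finite_part_def)
    qed
    ultimately show ?thesis
      unfolding riemann_sphere_def openin_Alexandroff_compactification using compact_imp_closed by fastforce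
  qed
qed

lemma closedin_riemann_sphere_iff: "closedin riemann_sphere K \<longleftrightarrow> openin riemann_sphere (- K)"
  by (simp add: closedin_def Compl_eq_Diff_UNIV)

lemma compact_space_riemann_sphere: "compact_space riemann_sphere"
  by (simp add: riemann_sphere_def)

lemma closedin_imp_compactin_sphere: "closedin riemann_sphere K \<Longrightarrow> compactin riemann_sphere K"
  by (rule closedin_compact_space[OF compact_space_riemann_sphere])

lemma sphere_inv_simps [simp]:
  "sphere_inv None = Some 0" "sphere_inv (Some 0) = None" "z \<noteq> 0 \<Longrightarrow> sphere_inv (Some z) = Some (1 / cnj z)"
  by (auto simp: sphere_inv_def)

lemma sphere_inv_sphere_inv [simp]: "sphere_inv (sphere_inv p) = p"
proof (cases p)
  case (Some z) then show ?thesis by (cases "z = 0") auto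
qed auto

lemma finite_part_sphere_inv: "finite_part (sphere_inv ` V) = {w. sphere_inv (Some w) \<in> V}"
  unfolding finite_part_def by (auto simp: image_iff) (metis sphere_inv_sphere_inv)

lemma compact_finite_part:
  assumes "closedin riemann_sphere K" "None \<notin> K"
  shows "compact (finite_part K)"
proof -
  have o: "open (finite_part (- K))" "\<exists>R. \<forall>z. R < cmod z \<longrightarrow> Some z \<in> - K"
    using assms unfolding closedin_riemann_sphere_iff openin_riemann_sphere_iff by auto
  then obtain R where "\<And>z. R < cmod z \<Longrightarrow> Some z \<notin> K" by auto
  then have "bounded (finite_part K)"
    unfolding bounded_iff by (intro exI[of _ R]) (auto simp: finite_part_def intro: leI)
  then show ?thesis using o(1) by (simp add: compact_eq_bounded_closed open_closed)
qed

lemma closed_finite_part: "closedin riemann_sphere K \<Longrightarrow> closed (finite_part K)"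
  unfolding closedin_riemann_sphere_iff openin_riemann_sphere_iff by (simp add: open_closed)

lemma open_finite_part: "openin riemann_sphere V \<Longrightarrow> open (finite_part V)"
  by (simp add: openin_riemann_sphere_iff)

lemma sphere_chart_inf:
  assumes "openin riemann_sphere V" "None \<in> V"
  shows "\<exists>r>0. \<forall>w\<in>ball 0 r. sphere_inv (Some w) \<in> V"
proof -
  obtain R where R: "\<And>z. R < cmod z \<Longrightarrow> Some z \<in> V" using assms by (auto simp: openin_riemann_sphere_iff)
  define r where "r = 1 / (\<bar>R\<bar> + 1)"
  have r: "0 < r" by (simp add: r_def add_nonneg_pos)
  have "sphere_inv (Some w) \<in> V" if "w \<in> ball 0 r" for w
  proof (cases "w = 0")
    case False
    have "cmod w < r" using that by simp
    then have "1 / r < 1 / cmod w" using False r by (simp add: field_simps)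
    then have "R < cmod (1 / cnj w)" by (simp add: r_def norm_divide)
    with R False show ?thesis by simp
  qed (use assms in auto)
  with r show ?thesis by blast
qed

lemma open_chart_inf:
  assumes "openin riemann_sphere V"
  shows "open {w. sphere_inv (Some w) \<in> V}"
proof (subst open_subopen, rule ballI)
  fix w assume w: "w \<in> {w. sphere_inv (Some w) \<in> V}"
  show "\<exists>T. open T \<and> w \<in> T \<and> T \<subseteq> {w. sphere_inv (Some w) \<in> V}"
  proof (cases "w = 0")
    case True
    then obtain r where "0 < r" "\<forall>w\<in>ball 0 r. sphere_inv (Some w) \<in> V"
      using sphere_chart_inf[OF assms] w by auto
    then show ?thesis using True by (intro exI[of _ "ball 0 r"]) auto
  next
    case False
    let ?T = "(\<lambda>w. 1 / cnj w) -` finite_part V \<inter> (- {0})"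
    have "open ?T"
    proof (rule continuous_on_open_vimage[THEN iffD1, rule_format])
      show "continuous_on (- {0}) (\<lambda>w. 1 / cnj w)" by (intro continuous_intros) auto
    qed (use open_finite_part[OF assms] in auto)
    then show ?thesis using w False by (intro exI[of _ ?T]) (auto simp: finite_part_def)
  qed
qed

lemma openin_chart_inf_image:
  assumes "open U" shows "openin riemann_sphere {p. \<exists>w\<in>U. p = sphere_inv (Some w)}"
proof -
  let ?V = "{p. \<exists>w\<in>U. p = sphere_inv (Some w)}"
  have "finite_part ?V = (\<lambda>w. 1 / cnj w) -` U \<inter> (- {0})"
  proof (rule set_eqI)
    fix z
    have "z \<in> finite_part ?V \<longleftrightarrow> (\<exists>w\<in>U. sphere_inv (Some z) = Some w)"
      by (auto simp: finite_part_def) (metis sphere_inv_sphere_inv)+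
    then show "z \<in> finite_part ?V \<longleftrightarrow> z \<in> (\<lambda>w. 1 / cnj w) -` U \<inter> (- {0})" by (cases "z = 0") auto
  qed
  moreover have "open ((\<lambda>w. 1 / cnj w) -` U \<inter> (- {0}))"
  proof (rule continuous_on_open_vimage[THEN iffD1, rule_format])
    show "continuous_on (- {0}) (\<lambda>w. 1 / cnj w)" by (intro continuous_intros) auto
  qed (use assms in auto)
  moreover have "\<exists>R. \<forall>z. R < cmod z \<longrightarrow> Some z \<in> ?V" if "None \<in> ?V"
  proof -
    have "0 \<in> U"
    proof -
      obtain w where "w \<in> U" "None = sphere_inv (Some w)" using \<open>None \<in> ?V\<close> by blast
      then show ?thesis by (cases "w = 0") auto
    qed
    then obtain r where r: "0 < r" "ball 0 r \<subseteq> U" using assms openE by blast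
    have "Some z \<in> ?V" if z: "1 / r < cmod z" for z
    proof -
      have z0: "z \<noteq> 0" using z r(1) by auto
      then have "1 / cmod z < r" using z r(1) by (simp add: field_simps)
      then have "1 / cnj z \<in> U" using r(2) by (auto simp: norm_divide)
      then show ?thesis using z0 by (intro CollectI bexI[of _ "1 / cnj z"]) auto
    qed
    then show ?thesis by blast
  qed
  ultimately show ?thesis by (simp add: openin_riemann_sphere_iff)
qed

section \<open>Inversion of smooth functions\<close>

text \<open>The derivative of 1 / cnj w in direction v is -cnj (v / w^2); the two formulas are the
  chain rule with k = 1 / w^2.\<close>

lemma pd_inversion:
  assumes "w \<noteq> 0" "f differentiable (at (1 / cnj w))"
  shows "pdx (\<lambda>w. f (1 / cnj w)) w = - pdx f (1 / cnj w) * Re (1 / w\<^sup>2) + pdy f (1 / cnj w) * Im (1 / w\<^sup>2)"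
    "pdy (\<lambda>w. f (1 / cnj w)) w = pdx f (1 / cnj w) * Im (1 / w\<^sup>2) + pdy f (1 / cnj w) * Re (1 / w\<^sup>2)"
    "(\<lambda>w. f (1 / cnj w)) differentiable (at w)"
proof -
  have "((\<lambda>w. 1 / w) has_field_derivative - (1 / w\<^sup>2)) (at w)"
    using assms(1) by (auto intro!: derivative_eq_intros simp: power2_eq_square)
  then have "((\<lambda>w. 1 / w) has_derivative (\<lambda>v. - (1 / w\<^sup>2) * v)) (at w)" by (simp only: has_field_derivative_def)
  from has_derivative_cnj[OF this]
  have 1: "((\<lambda>w. 1 / cnj w) has_derivative (\<lambda>v. cnj (- (1 / w\<^sup>2) * v))) (at w)" by (simp only: complex_cnj_divide complex_cnj_one)
  define k where "k = 1 / w\<^sup>2"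
  have D: "((\<lambda>w. f (1 / cnj w)) has_derivative
     (\<lambda>v. Re v * (- pdx f (1 / cnj w) * Re k + pdy f (1 / cnj w) * Im k)
        + Im v * (pdx f (1 / cnj w) * Im k + pdy f (1 / cnj w) * Re k))) (at w)"
    using has_derivative_compose[OF 1 has_derivative_pd[OF assms(2)]]
    unfolding k_def[symmetric] by (rule has_derivative_eq_rhs) (auto simp: algebra_simps)
  from pd_eqI[OF D] show "pdx (\<lambda>w. f (1 / cnj w)) w = - pdx f (1 / cnj w) * Re (1 / w\<^sup>2) + pdy f (1 / cnj w) * Im (1 / w\<^sup>2)"
    "pdy (\<lambda>w. f (1 / cnj w)) w = pdx f (1 / cnj w) * Im (1 / w\<^sup>2) + pdy f (1 / cnj w) * Re (1 / w\<^sup>2)"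
    by (simp_all only: k_def)
  show "(\<lambda>w. f (1 / cnj w)) differentiable (at w)" using D unfolding differentiable_def by blast
qed

lemma Im_eq_Re: "Im z = Re (- \<i> * z)" by simp

lemma Ck_on_Re_inverse_square: "open S \<Longrightarrow> 0 \<notin> S \<Longrightarrow> Ck_on k S (\<lambda>w. Re (1 / w\<^sup>2))"
  "open S \<Longrightarrow> 0 \<notin> S \<Longrightarrow> Ck_on k S (\<lambda>w. Im (1 / w\<^sup>2))"
proof -
  assume S: "open S" "0 \<notin> S"
  then have h: "(\<lambda>w. 1 / w\<^sup>2) holomorphic_on S" by (intro holomorphic_intros) auto
  show "Ck_on k S (\<lambda>w. Re (1 / w\<^sup>2))" by (rule Ck_on_Re_holomorphic[OF S(1) h])
  show "Ck_on k S (\<lambda>w. Im (1 / w\<^sup>2))"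
    unfolding Im_eq_Re by (rule Ck_on_Re_holomorphic[OF S(1)]) (intro holomorphic_on_mult holomorphic_on_const h)
qed

lemma Ck_on_inversion:
  assumes "open S" "0 \<notin> S" "\<And>w. w \<in> S \<Longrightarrow> 1 / cnj w \<in> U"
  shows "Ck_on k U f \<Longrightarrow> Ck_on k S (\<lambda>w. f (1 / cnj w))"
proof (induction k arbitrary: f)
  case 0
  have "continuous_on S (\<lambda>w. 1 / cnj w)" using assms(2) by (intro continuous_intros) auto
  then show ?case using 0 assms(3) continuous_on_compose2[of U f S "\<lambda>w. 1 / cnj w"] by auto
next
  case (Suc k)
  have "Ck_on k S (\<lambda>w. - pdx f (1 / cnj w) * Re (1 / w\<^sup>2) + pdy f (1 / cnj w) * Im (1 / w\<^sup>2))"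
       "Ck_on k S (\<lambda>w. pdx f (1 / cnj w) * Im (1 / w\<^sup>2) + pdy f (1 / cnj w) * Re (1 / w\<^sup>2))"
  proof -
    have "Ck_on k S (\<lambda>w. pdx f (1 / cnj w))" "Ck_on k S (\<lambda>w. pdy f (1 / cnj w))"
      using Suc.prems by (auto intro!: Suc.IH)
    note X = this and E = Ck_on_Re_inverse_square[OF assms(1,2), of k]
    show "Ck_on k S (\<lambda>w. - pdx f (1 / cnj w) * Re (1 / w\<^sup>2) + pdy f (1 / cnj w) * Im (1 / w\<^sup>2))"
      by (rule Ck_on_add[OF assms(1) Ck_on_mult[OF assms(1) Ck_on_minus[OF assms(1) X(1)] E(1)] Ck_on_mult[OF assms(1) X(2) E(2)]])
    show "Ck_on k S (\<lambda>w. pdx f (1 / cnj w) * Im (1 / w\<^sup>2) + pdy f (1 / cnj w) * Re (1 / w\<^sup>2))"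
      by (rule Ck_on_add[OF assms(1) Ck_on_mult[OF assms(1) X(1) E(2)] Ck_on_mult[OF assms(1) X(2) E(1)]])
  qed
  note PQ = this
  have d: "f differentiable (at (1 / cnj w))" if "w \<in> S" for w using Suc.prems assms(3)[OF that] by simp
  have w0: "w \<noteq> 0" if "w \<in> S" for w using that assms(2) by auto
  show ?case
    by (rule Ck_on_SucI[OF assms(1) _ _ _ PQ]) (simp_all only: pd_inversion[OF w0 d])
qed

text \<open>The factor is the squared modulus of the derivative of the anticonformal inversion. The
  mixed second derivatives of f cancel in pairs, and so do the first-order terms, by the
  Cauchy-Riemann equations of E = 1 / w^2.\<close>

lemma laplacian_inversion:
  assumes "open U" "Ck_on 2 U f" "1 / cnj w \<in> U" "w \<noteq> 0"
  shows "laplacian (\<lambda>w. f (1 / cnj w)) w = laplacian f (1 / cnj w) / cmod w ^ 4"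
proof -
  note d = Ck_2D[OF assms(2)]
  define S where "S = (\<lambda>w. 1 / cnj w) -` U \<inter> (- {0})"
  have S: "open S" unfolding S_def
  proof (rule continuous_on_open_vimage[THEN iffD1, rule_format])
    show "continuous_on (- {0}) (\<lambda>w. 1 / cnj w)" by (intro continuous_intros) auto
  qed (use assms in auto)
  have wS: "w \<in> S" using assms by (auto simp: S_def)
  have SU: "1 / cnj v \<in> U" "v \<noteq> 0" if "v \<in> S" for v using that by (auto simp: S_def)
  define E where "E = (\<lambda>w::complex. 1 / w\<^sup>2)"
  define X where "X = (\<lambda>w. pdx f (1 / cnj w))"
  define Y where "Y = (\<lambda>w. pdy f (1 / cnj w))"
  have E: "(E has_field_derivative deriv E w) (at w)"
  proof -
    have "E holomorphic_on - {0}" unfolding E_def by (intro holomorphic_intros) auto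
    then show ?thesis using holomorphic_derivI[of E "- {0}" w] assms(4) by auto
  qed
  have iE: "((\<lambda>w. - \<i> * E w) has_field_derivative - \<i> * deriv E w) (at w)" by (rule DERIV_cmult[OF E])
  note RE = pd_Re_holomorphic[OF E]
  have IE: "pdx (\<lambda>w. Im (E w)) w = Im (deriv E w)" "pdy (\<lambda>w. Im (E w)) w = Re (deriv E w)"
     "(\<lambda>w. Im (E w)) differentiable (at w)"
    using pd_Re_holomorphic[OF iE] by simp_all
  have X: "pdx X w = - pdx (pdx f) (1 / cnj w) * Re (E w) + pdy (pdx f) (1 / cnj w) * Im (E w)"
     "pdy X w = pdx (pdx f) (1 / cnj w) * Im (E w) + pdy (pdx f) (1 / cnj w) * Re (E w)" "X differentiable (at w)"
    unfolding X_def E_def using pd_inversion[OF assms(4) d(2)[OF assms(3)]] by auto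
  have Y: "pdx Y w = - pdx (pdy f) (1 / cnj w) * Re (E w) + pdy (pdy f) (1 / cnj w) * Im (E w)"
     "pdy Y w = pdx (pdy f) (1 / cnj w) * Im (E w) + pdy (pdy f) (1 / cnj w) * Re (E w)" "Y differentiable (at w)"
    unfolding Y_def E_def using pd_inversion[OF assms(4) d(3)[OF assms(3)]] by auto
  have mX: "(\<lambda>w. - X w) differentiable (at w)" "pdx (\<lambda>w. - X w) w = - pdx X w" "pdy (\<lambda>w. - X w) w = - pdy X w"
    using pd_mult[OF _ X(3), of "\<lambda>_. -1"] X(3) by auto
  have "pdx (pdx (\<lambda>w. f (1 / cnj w))) w = pdx (\<lambda>w. - X w * Re (E w) + Y w * Im (E w)) w"
    unfolding X_def Y_def E_def using pd_inversion(1) SU d(1) by (intro pd_cong_open[OF S wS]) auto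
  also have "\<dots> = (- pdx X w * Re (E w) + - X w * Re (deriv E w)) + (pdx Y w * Im (E w) + Y w * Im (deriv E w))"
    by (simp only: pd_add(1)[OF differentiable_mult[OF mX(1) RE(3)] differentiable_mult[OF Y(3) IE(3)]]
        pd_mult(1)[OF mX(1) RE(3)] pd_mult(1)[OF Y(3) IE(3)] mX(2) RE(1) IE(1))
  finally have 1: "pdx (pdx (\<lambda>w. f (1 / cnj w))) w
     = (- pdx X w * Re (E w) + - X w * Re (deriv E w)) + (pdx Y w * Im (E w) + Y w * Im (deriv E w))" .
  have "pdy (pdy (\<lambda>w. f (1 / cnj w))) w = pdy (\<lambda>w. X w * Im (E w) + Y w * Re (E w)) w"
    unfolding X_def Y_def E_def using pd_inversion(2) SU d(1) by (intro pd_cong_open[OF S wS]) auto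
  also have "\<dots> = (pdy X w * Im (E w) + X w * Re (deriv E w)) + (pdy Y w * Re (E w) + Y w * - Im (deriv E w))"
    by (simp only: pd_add(2)[OF differentiable_mult[OF X(3) IE(3)] differentiable_mult[OF Y(3) RE(3)]]
        pd_mult(2)[OF X(3) IE(3)] pd_mult(2)[OF Y(3) RE(3)] RE(2) IE(2))
  finally have 2: "pdy (pdy (\<lambda>w. f (1 / cnj w))) w
     = (pdy X w * Im (E w) + X w * Re (deriv E w)) + (pdy Y w * Re (E w) + Y w * - Im (deriv E w))" .
  have "laplacian (\<lambda>w. f (1 / cnj w)) w
      = (pdx (pdx f) (1 / cnj w) + pdy (pdy f) (1 / cnj w)) * ((Re (E w))\<^sup>2 + (Im (E w))\<^sup>2)"
    unfolding laplacian_def 1 2 X(1,2) Y(1,2) by (simp add: power2_eq_square algebra_simps)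
  also have "(Re (E w))\<^sup>2 + (Im (E w))\<^sup>2 = 1 / cmod w ^ 4"
  proof -
    have "(Re (E w))\<^sup>2 + (Im (E w))\<^sup>2 = (cmod (E w))\<^sup>2" by (simp add: cmod_power2)
    also have "\<dots> = 1 / cmod w ^ 4" by (simp add: E_def norm_divide norm_power power_divide flip: power_mult)
    finally show ?thesis .
  qed
  finally show ?thesis by (simp add: laplacian_def)
qed

text \<open>The tests in \<open>is_riesz_measure\<close> live in one chart at a time. This class
  admits functions that are nonzero both at infinity and at finite points, such as a function of the
  smoothed Green function. K is closed in a compact space, hence compact.\<close>

definition sphere_test :: "csphere set \<Rightarrow> (csphere \<Rightarrow> real) \<Rightarrow> bool" where
  "sphere_test D \<Phi> \<longleftrightarrow> (\<forall>k. Ck_on k UNIV (\<lambda>z. \<Phi> (Some z))) \<and>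
     (None \<in> D \<longrightarrow> (\<exists>r>0. \<forall>k. Ck_on k (ball 0 r) (\<lambda>w. \<Phi> (sphere_inv (Some w))))) \<and>
     (\<exists>K. closedin riemann_sphere K \<and> K \<subseteq> D \<and> (\<forall>p. p \<notin> K \<longrightarrow> \<Phi> p = 0))"

text \<open>A partition of unity: with a cutoff equal to 1 near infinity and 0 on a large disc, g is
  F times the cutoff, f0 = F - g has compact support in the plane, and f1 is g read in the inversion
  chart.\<close>

lemma sphere_test_split:
  assumes D: "openin riemann_sphere D" and F: "sphere_test D F"
  shows "\<exists>f0 f1. test_function (finite_part D) f0 \<and> (None \<in> D \<longrightarrow> test_function (finite_part (sphere_inv ` D)) f1) \<and>
    (None \<notin> D \<longrightarrow> f1 = (\<lambda>_. 0)) \<and> (\<forall>p. F p = extend_zero f0 p + extend_zero f1 (sphere_inv p)) \<and>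
    (\<forall>z. z \<noteq> 0 \<longrightarrow> laplacian (\<lambda>z. F (Some z)) z = laplacian f0 z + laplacian f1 (1 / cnj z) / cmod z ^ 4)"
proof -
  obtain K where K: "closedin riemann_sphere K" "K \<subseteq> D" "\<And>p. p \<notin> K \<Longrightarrow> F p = 0"
    using F by (auto simp: sphere_test_def)
  have sm: "Ck_on k UNIV (\<lambda>z. F (Some z))" for k using F by (auto simp: sphere_test_def)
  show ?thesis
  proof (cases "None \<in> D")
    case False
    then have "None \<notin> K" using K(2) by blast
    then have "compact (finite_part K)" by (rule compact_finite_part[OF K(1)])
    moreover have "finite_part K \<subseteq> finite_part D" using K(2) by (auto simp: finite_part_def)
    ultimately have t: "test_function (finite_part D) (\<lambda>z. F (Some z))"
      unfolding test_function_def using sm K(3) by (auto intro!: exI[of _ "finite_part K"] simp: finite_part_def)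
    have e: "F p = extend_zero (\<lambda>z. F (Some z)) p + extend_zero (\<lambda>_. 0) (sphere_inv p)" for p
      using K(3)[of None] \<open>None \<notin> K\<close> by (cases p) (auto simp: extend_zero_def split: option.split)
    show ?thesis
    proof (rule exI[of _ "\<lambda>z. F (Some z)"], rule exI[of _ "\<lambda>_. 0"], intro conjI impI allI)
      show "F p = extend_zero (\<lambda>z. F (Some z)) p + extend_zero (\<lambda>_. 0) (sphere_inv p)" for p by (rule e)
    qed (use t False in simp_all)
  next
    case True
    obtain r where r: "0 < r" "\<And>k. Ck_on k (ball 0 r) (\<lambda>w. F (sphere_inv (Some w)))"
      using F True by (auto simp: sphere_test_def)
    obtain R where R: "\<And>z. R < cmod z \<Longrightarrow> Some z \<in> D" using D True by (auto simp: openin_riemann_sphere_iff)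
    \<comment> \<open>Beyond R all points belong to D, so the support of f1 does too; beyond 1 / r
      the function F is smooth in the chart at infinity.\<close>
    define s where "s = max \<bar>R\<bar> (1 / r) + 1"
    have s: "1 \<le> s" "R < s" "1 / r < s" by (auto simp: s_def)
    have "s\<^sup>2 < (s + 1)\<^sup>2" using s(1) by (simp add: power2_eq_square algebra_simps)
    from smooth_step[OF this] obtain \<sigma> where \<sigma>: "\<And>k. Ck_real k \<sigma>" "\<And>x. x \<le> s\<^sup>2 \<Longrightarrow> \<sigma> x = 0" "\<And>x. (s + 1)\<^sup>2 \<le> x \<Longrightarrow> \<sigma> x = 1"
      by blast
    \<comment> \<open>The cutoff depends on |z|^2 rather than |z|, which would not be smooth at
      0.\<close>
    define \<eta> where "\<eta> = (\<lambda>z. \<sigma> (Re z * Re z + Im z * Im z))"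
    have cm: "Re z * Re z + Im z * Im z = (cmod z)\<^sup>2" for z
      using cmod_power2[of z] by (simp only: power2_eq_square)
    have \<eta>0: "\<eta> z = 0" if "cmod z \<le> s" for z
      using that \<sigma>(2)[of "(cmod z)\<^sup>2"] power_mono[of "cmod z" s 2] by (simp add: \<eta>_def cm)
    have \<eta>1: "\<eta> z = 1" if "s + 1 \<le> cmod z" for z
      using that s(1) \<sigma>(3)[of "(cmod z)\<^sup>2"] power_mono[of "s + 1" "cmod z" 2] by (simp add: \<eta>_def cm)
    have ReIm: "Ck_on k UNIV Re" "Ck_on k UNIV Im" for k
      using Ck_on_Re_holomorphic[OF open_UNIV, of "\<lambda>z. z" k] Ck_on_Re_holomorphic[OF open_UNIV, of "\<lambda>z. - \<i> * z" k]
      by (simp_all add: holomorphic_intros)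
    have "Ck_on k UNIV (\<lambda>z. Re z * Re z + Im z * Im z)" for k
      by (rule Ck_on_add[OF open_UNIV Ck_on_mult[OF open_UNIV ReIm(1) ReIm(1)] Ck_on_mult[OF open_UNIV ReIm(2) ReIm(2)]])
    from Ck_on_compose_real[OF open_UNIV \<sigma>(1) this] have Ck\<eta>: "Ck_on k UNIV \<eta>" for k
      unfolding \<eta>_def .
    define g where "g = (\<lambda>z. \<eta> z * F (Some z))"
    have Ckg: "Ck_on k UNIV g" for k unfolding g_def by (rule Ck_on_mult[OF open_UNIV Ck\<eta> sm])
    define f0 where "f0 = (\<lambda>z. F (Some z) - g z)"
    have Ck0: "Ck_on k UNIV f0" for k unfolding f0_def by (rule Ck_on_diff[OF open_UNIV sm Ckg])
    define f1 where "f1 = (\<lambda>w. if w = 0 then F None else g (1 / cnj w))"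
    have near: "f1 w = F (sphere_inv (Some w))" if "w \<in> ball 0 (1 / (s + 1))" for w
    proof (cases "w = 0")
      case False
      have "cmod w < 1 / (s + 1)" using that by simp
      then have "s + 1 \<le> cmod (1 / cnj w)" using False s(1) by (simp add: norm_divide field_simps)
      from \<eta>1[OF this] show ?thesis using False by (simp add: f1_def g_def)
    qed (auto simp: f1_def)
    have Ck1: "Ck_on k UNIV f1" for k
    proof (rule Ck_on_local)
      fix w :: complex
      show "\<exists>U. open U \<and> w \<in> U \<and> Ck_on k U f1"
      proof (cases "w = 0")
        case True
        have "1 / (s + 1) \<le> r" using s r(1) by (simp add: field_simps)
        then have "ball 0 (1 / (s + 1)) \<subseteq> (ball 0 r :: complex set)" by auto
        from Ck_on_cong[OF open_ball _ Ck_on_subset[OF r(2) this]] near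
        have "Ck_on k (ball 0 (1 / (s + 1))) f1" by metis
        then show ?thesis using True s(1) by (intro exI[of _ "ball 0 (1 / (s + 1))"]) auto
      next
        case False
        have "Ck_on k (- {0}) (\<lambda>w. g (1 / cnj w))" by (rule Ck_on_inversion[OF _ _ _ Ckg]) auto
        then have "Ck_on k (- {0}) f1" by (rule Ck_on_cong[rotated 2]) (auto simp: f1_def)
        then show ?thesis using False by (intro exI[of _ "- {0}"]) auto
      qed
    qed
    have t0: "test_function (finite_part D) f0"
      unfolding test_function_def
    proof (intro conjI allI Ck0 exI[of _ "finite_part K \<inter> cball 0 (s + 1)"] impI)
      show "compact (finite_part K \<inter> cball 0 (s + 1))" using closed_finite_part[OF K(1)] by (intro closed_Int_compact) auto
      show "finite_part K \<inter> cball 0 (s + 1) \<subseteq> finite_part D" using K(2) by (auto simp: finite_part_def)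
      show "f0 z = 0" if "z \<notin> finite_part K \<inter> cball 0 (s + 1)" for z
      proof (cases "Some z \<in> K")
        case True
        then have "s + 1 \<le> cmod z" using that by (simp add: finite_part_def)
        from \<eta>1[OF this] show ?thesis by (simp add: f0_def g_def)
      qed (simp add: f0_def g_def K(3))
    qed
    have t1: "test_function (finite_part (sphere_inv ` D)) f1"
      unfolding test_function_def finite_part_sphere_inv
    proof (intro conjI allI Ck1 exI[of _ "cball 0 (1 / s)"] impI)
      show "cball 0 (1 / s) \<subseteq> {w. sphere_inv (Some w) \<in> D}"
      proof
        fix w :: complex assume w: "w \<in> cball 0 (1 / s)"
        show "w \<in> {w. sphere_inv (Some w) \<in> D}"
        proof (cases "w = 0")
          case False
          then have "s \<le> cmod (1 / cnj w)" using w s(1) by (simp add: norm_divide field_simps)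
          then show ?thesis using R[of "1 / cnj w"] s(2) False by simp
        qed (use True in simp)
      qed
      show "f1 w = 0" if "w \<notin> cball 0 (1 / s)" for w
      proof -
        have w: "1 / s < cmod w" using that by simp
        then have w0: "w \<noteq> 0" using s(1) by auto
        have "cmod (1 / cnj w) \<le> s" using w w0 s(1) by (simp add: norm_divide field_simps)
        from \<eta>0[OF this] show ?thesis using w0 by (simp add: f1_def g_def)
      qed
    qed simp
    have sum: "F p = extend_zero f0 p + extend_zero f1 (sphere_inv p)" for p
    proof (cases p)
      case None then show ?thesis by (simp add: extend_zero_def f1_def)
    next
      case (Some z)
      then show ?thesis using \<eta>0[of 0] s(1)
        by (cases "z = 0") (auto simp: extend_zero_def f0_def f1_def g_def)
    qed
    have lap: "laplacian (\<lambda>z. F (Some z)) z = laplacian f0 z + laplacian f1 (1 / cnj z) / cmod z ^ 4" if z: "z \<noteq> 0" for z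
    proof -
      have "laplacian (\<lambda>z. F (Some z)) z = laplacian (\<lambda>z. f0 z + g z) z" by (simp add: f0_def)
      also have "\<dots> = laplacian f0 z + laplacian g z" by (rule laplacian_add[OF open_UNIV Ck0 Ckg]) simp
      also have "laplacian f1 (1 / cnj z) = laplacian (\<lambda>w. g (1 / cnj w)) (1 / cnj z)"
        by (rule laplacian_cong_open[of "- {0}"]) (use z in \<open>auto simp: f1_def\<close>)
      then have "laplacian f1 (1 / cnj z) = laplacian g z * cmod z ^ 4"
        using laplacian_inversion[OF open_UNIV Ckg, of "1 / cnj z"] z by (simp add: norm_divide power_divide)
      then have "laplacian g z = laplacian f1 (1 / cnj z) / cmod z ^ 4" using z by simp
      finally show ?thesis .
    qed
    show ?thesis using t0 t1 sum lap True by blast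
  qed
qed

section \<open>Borel sets of the sphere and integrability against a Riesz measure\<close>

lemma space_riemann_sphere_borel [simp]: "space riemann_sphere_borel = UNIV"
  by (simp add: riemann_sphere_borel_def)

lemma openin_sets_riemann_sphere_borel: "openin riemann_sphere V \<Longrightarrow> V \<in> sets riemann_sphere_borel"
  unfolding riemann_sphere_borel_def by (intro in_measure_of) auto

lemma closedin_sets_riemann_sphere_borel: "closedin riemann_sphere K \<Longrightarrow> K \<in> sets riemann_sphere_borel"
  using openin_sets_riemann_sphere_borel[of "- K"] sets.compl_sets[of "- K" riemann_sphere_borel]
  by (simp add: closedin_riemann_sphere_iff Compl_eq_Diff_UNIV double_diff)

lemma closedin_singleton_sphere: "closedin riemann_sphere {p}"
proof (cases p)
  case None
  then show ?thesis by (auto simp: closedin_riemann_sphere_iff openin_riemann_sphere_iff finite_part_def)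
next
  case (Some z)
  have "finite_part (- {p}) = - {z}" using Some by (auto simp: finite_part_def)
  moreover have "\<exists>R. \<forall>w. R < cmod w \<longrightarrow> Some w \<in> - {p}" using Some by (intro exI[of _ "cmod z"]) auto
  ultimately show ?thesis by (simp add: closedin_riemann_sphere_iff openin_riemann_sphere_iff open_Compl)
qed

definition finite_point :: "csphere \<Rightarrow> complex" where
  "finite_point p = (case p of None \<Rightarrow> 0 | Some z \<Rightarrow> z)"

lemma measurable_finite_point: "finite_point \<in> borel_measurable riemann_sphere_borel"
proof (rule borel_measurableI)
  fix S :: "complex set" assume S: "open S"
  have "openin riemann_sphere (Some ` S)" using S by (simp add: riemann_sphere_def)
  then have 1: "Some ` S \<in> sets riemann_sphere_borel" by (rule openin_sets_riemann_sphere_borel)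
  have 2: "{None} \<in> sets riemann_sphere_borel" by (rule closedin_sets_riemann_sphere_borel[OF closedin_singleton_sphere])
  have "finite_point -` S \<inter> space riemann_sphere_borel = Some ` S \<union> (if 0 \<in> S then {None} else {})"
    by (auto simp: finite_point_def image_iff split: option.splits)
  also have "\<dots> \<in> sets riemann_sphere_borel" using 1 sets.Un[OF 1 2] by (cases "0 \<in> S") simp_all
  finally show "finite_point -` S \<inter> space riemann_sphere_borel \<in> sets riemann_sphere_borel" .
qed

text \<open>The single point at infinity is a Borel set, so the value there is arbitrary.\<close>

lemma sphere_borel_measurableI:
  fixes f :: "csphere \<Rightarrow> 'b::topological_space"
  assumes "(\<lambda>z. f (Some z)) \<in> borel_measurable borel"
  shows "f \<in> borel_measurable riemann_sphere_borel"
proof -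
  have 2: "{None} \<in> sets riemann_sphere_borel" by (rule closedin_sets_riemann_sphere_borel[OF closedin_singleton_sphere])
  have m: "(\<lambda>p. f (Some (finite_point p))) \<in> borel_measurable riemann_sphere_borel"
    using measurable_compose[OF measurable_finite_point assms] .
  have "(\<lambda>p. if p \<in> {None} then f None else f (Some (finite_point p))) \<in> borel_measurable riemann_sphere_borel"
    by (rule measurable_If_set[OF measurable_const m]) (use 2 in auto)
  also have "(\<lambda>p. if p \<in> {None} then f None else f (Some (finite_point p))) = f"
    by (rule ext) (auto simp: finite_point_def split: option.splits)
  finally show ?thesis .
qed

lemma riesz_space:
  assumes "sets \<nu> = sets (restrict_space riemann_sphere_borel D)"
  shows "space \<nu> = D"
  using sets_eq_imp_space_eq[OF assms] by (simp add: space_restrict_space)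

lemma riesz_sets:
  assumes s: "sets \<nu> = sets (restrict_space riemann_sphere_borel D)"
    and A: "A \<in> sets riemann_sphere_borel" "A \<subseteq> D"
  shows "A \<in> sets \<nu>"
  using A by (auto simp: s sets_restrict_space)

lemma riesz_integrable:
  fixes f :: "csphere \<Rightarrow> real"
  assumes s: "sets \<nu> = sets (restrict_space riemann_sphere_borel D)"
    and fin: "\<forall>K. compactin riemann_sphere K \<and> K \<subseteq> D \<longrightarrow> emeasure \<nu> K < \<infinity>"
    and f: "(\<lambda>z. f (Some z)) \<in> borel_measurable borel"
    and K: "closedin riemann_sphere K" "K \<subseteq> D" "\<And>p. p \<notin> K \<Longrightarrow> f p = 0" and B: "\<And>p. \<bar>f p\<bar> \<le> B"
  shows "integrable \<nu> f"
proof (rule integrableI_bounded_set[of K])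
  show "K \<in> sets \<nu>" by (rule riesz_sets[OF s closedin_sets_riemann_sphere_borel[OF K(1)] K(2)])
  show "f \<in> borel_measurable \<nu>"
    unfolding measurable_cong_sets[OF s refl] by (intro measurable_restrict_space1 sphere_borel_measurableI f)
  show "emeasure \<nu> K < \<infinity>" using fin closedin_imp_compactin_sphere[OF K(1)] K(2) by blast
  show "AE x in \<nu>. x \<in> K \<longrightarrow> norm (f x) \<le> B" using B by auto
  show "AE x in \<nu>. x \<notin> K \<longrightarrow> f x = 0" using K(3) by auto
qed

lemma test_function_bounded:
  assumes "test_function S h"
  shows "\<exists>B\<ge>0. \<forall>z. \<bar>h z\<bar> \<le> B" "\<exists>B\<ge>0. \<forall>z. \<bar>laplacian h z\<bar> \<le> B"
proof -
  obtain K where K: "compact K" "\<And>z. z \<notin> K \<Longrightarrow> h z = 0" using assms by (auto simp: test_function_def)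
  have b: "\<exists>B\<ge>0. \<forall>z. \<bar>f z\<bar> \<le> B" if "continuous_on UNIV f" "\<And>z. z \<notin> K \<Longrightarrow> f z = 0" for f :: "complex \<Rightarrow> real"
  proof -
    have "compact (f ` K)" using K(1) that(1) by (intro compact_continuous_image) (auto intro: continuous_on_subset)
    then have "bounded (f ` K)" by (rule compact_imp_bounded)
    then have "\<exists>B. \<forall>y\<in>f ` K. norm y \<le> B" unfolding bounded_iff .
    then obtain B where B: "\<And>z. z \<in> K \<Longrightarrow> \<bar>f z\<bar> \<le> B" by auto
    have "\<bar>f z\<bar> \<le> max B 0" for z using B[of z] that(2)[of z] by (cases "z \<in> K") auto
    then show ?thesis by (intro exI[of _ "max B 0"]) auto
  qed
  have ck: "Ck_on k UNIV h" for k using assms by (auto simp: test_function_def)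
  show "\<exists>B\<ge>0. \<forall>z. \<bar>h z\<bar> \<le> B" by (rule b[OF Ck_on_continuous[OF ck[of 0]] K(2)])
  show "\<exists>B\<ge>0. \<forall>z. \<bar>laplacian h z\<bar> \<le> B"
    by (rule b[OF continuous_on_laplacian[OF ck]]) (rule pd_zero_outside(3)[OF K])
qed

lemma extend_zero_simps [simp]: "extend_zero f None = 0" "extend_zero f (Some z) = f z"
  by (auto simp: extend_zero_def)

lemma riesz_integrable_test:
  assumes s: "sets \<nu> = sets (restrict_space riemann_sphere_borel D)"
    and fin: "\<forall>K. compactin riemann_sphere K \<and> K \<subseteq> D \<longrightarrow> emeasure \<nu> K < \<infinity>"
  shows "test_function (finite_part D) f \<Longrightarrow> integrable \<nu> (extend_zero f)"
    "test_function (finite_part (sphere_inv ` D)) f \<Longrightarrow> integrable \<nu> (\<lambda>p. extend_zero f (sphere_inv p))"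
proof -
  have [measurable]: "cnj \<in> borel_measurable borel" by (intro borel_measurable_continuous_onI continuous_intros)
  { assume t: "test_function (finite_part D) f"
    then obtain K where K: "compact K" "K \<subseteq> finite_part D" "\<And>z. z \<notin> K \<Longrightarrow> f z = 0" by (auto simp: test_function_def)
    obtain B where B: "0 \<le> B" "\<And>z. \<bar>f z\<bar> \<le> B" using test_function_bounded(1)[OF t] by blast
    have "continuous_on UNIV f" using t Ck_on_continuous by (auto simp: test_function_def)
    then have m: "f \<in> borel_measurable borel" by (rule borel_measurable_continuous_onI)
    show "integrable \<nu> (extend_zero f)"
    proof (rule riesz_integrable[OF s fin, where K = "Some ` K" and B = B])
      show "closedin riemann_sphere (Some ` K)" using K(1) compact_imp_closed by (simp add: riemann_sphere_def)
      show "Some ` K \<subseteq> D" using K(2) by (auto simp: finite_part_def)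
      show "extend_zero f p = 0" if "p \<notin> Some ` K" for p using that K(3) by (cases p) auto
      show "\<bar>extend_zero f p\<bar> \<le> B" for p using B by (cases p) auto
    qed (use m in simp) }
  { assume t: "test_function (finite_part (sphere_inv ` D)) f"
    then obtain K where K: "compact K" "K \<subseteq> {w. sphere_inv (Some w) \<in> D}" "\<And>z. z \<notin> K \<Longrightarrow> f z = 0"
      by (auto simp: test_function_def finite_part_sphere_inv)
    obtain B where B: "0 \<le> B" "\<And>z. \<bar>f z\<bar> \<le> B" using test_function_bounded(1)[OF t] by blast
    have "continuous_on UNIV f" using t Ck_on_continuous by (auto simp: test_function_def)
    then have m: "f \<in> borel_measurable borel" by (rule borel_measurable_continuous_onI)
    show "integrable \<nu> (\<lambda>p. extend_zero f (sphere_inv p))"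
    proof (rule riesz_integrable[OF s fin, where K = "{p. \<exists>w\<in>K. p = sphere_inv (Some w)}" and B = B])
      \<comment> \<open>The chart misses exactly one point of the sphere, \<open>Some 0\<close>. The
        support is closed because it also stays away from that point: near 0 the chart coordinate
        leaves the bounded set K.\<close>
      have "{p. \<exists>w\<in>K. p = sphere_inv (Some w)} = - {p. \<exists>w\<in>-K. p = sphere_inv (Some w)} - {p. sphere_inv p = None}"
      proof (rule set_eqI)
        fix p
        have *: "p = sphere_inv (Some w) \<longleftrightarrow> sphere_inv p = Some w" for w by (metis sphere_inv_sphere_inv)
        show "p \<in> {p. \<exists>w\<in>K. p = sphere_inv (Some w)} \<longleftrightarrow> p \<in> - {p. \<exists>w\<in>-K. p = sphere_inv (Some w)} - {p. sphere_inv p = None}"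
          unfolding mem_Collect_eq * by (cases "sphere_inv p") (auto simp: *)
      qed
      moreover have "openin riemann_sphere (- {p. \<exists>w\<in>K. p = sphere_inv (Some w)})"
      proof (subst openin_subopen, intro ballI)
        fix p assume p: "p \<in> - {p. \<exists>w\<in>K. p = sphere_inv (Some w)}"
        show "\<exists>T. openin riemann_sphere T \<and> p \<in> T \<and> T \<subseteq> - {p. \<exists>w\<in>K. p = sphere_inv (Some w)}"
        proof (cases "sphere_inv p")
          case None
          then have "p = Some 0" by (metis sphere_inv_simps(1) sphere_inv_sphere_inv)
          obtain R where R: "\<And>w. w \<in> K \<Longrightarrow> cmod w \<le> R" using compact_imp_bounded[OF K(1)] bounded_iff by metis
          let ?T = "Some ` ball 0 (1 / (\<bar>R\<bar> + 1))"
          have "openin riemann_sphere ?T" by (simp add: riemann_sphere_def)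
          moreover have "Some z \<noteq> sphere_inv (Some w)" if "z \<in> ball 0 (1 / (\<bar>R\<bar> + 1))" "w \<in> K" for z w
          proof
            assume e: "Some z = sphere_inv (Some w)"
            then have w: "w \<noteq> 0" by auto
            then have "z = 1 / cnj w" using e by simp
            then have "1 / cmod w < 1 / (\<bar>R\<bar> + 1)" using that(1) by (simp add: norm_divide)
            then have "\<bar>R\<bar> + 1 < cmod w" using w by (simp add: field_simps)
            then show False using R[OF that(2)] by linarith
          qed
          ultimately show ?thesis using \<open>p = Some 0\<close>
            by (intro exI[of _ ?T]) (auto simp: add_nonneg_pos)
        next
          case (Some w)
          then have pw: "p = sphere_inv (Some w)" by (metis sphere_inv_sphere_inv)
          have "w \<in> - K" using p pw by auto
          moreover have "openin riemann_sphere {p. \<exists>w\<in>-K. p = sphere_inv (Some w)}"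
            using compact_imp_closed[OF K(1)] by (intro openin_chart_inf_image) auto
          moreover have "{p. \<exists>w\<in>-K. p = sphere_inv (Some w)} \<subseteq> - {p. \<exists>w\<in>K. p = sphere_inv (Some w)}"
            by auto (metis option.inject sphere_inv_sphere_inv)
          ultimately show ?thesis using pw by blast
        qed
      qed
      ultimately show "closedin riemann_sphere {p. \<exists>w\<in>K. p = sphere_inv (Some w)}"
        by (simp add: closedin_riemann_sphere_iff)
      show "{p. \<exists>w\<in>K. p = sphere_inv (Some w)} \<subseteq> D" using K(2) by auto
      show "extend_zero f (sphere_inv p) = 0" if "p \<notin> {p. \<exists>w\<in>K. p = sphere_inv (Some w)}" for p
      proof (cases "sphere_inv p")
        case (Some w)
        then have "p = sphere_inv (Some w)" by (metis sphere_inv_sphere_inv)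
        then have "w \<notin> K" using that by auto
        then show ?thesis using K(3) Some by simp
      qed simp
      show "\<bar>extend_zero f (sphere_inv p)\<bar> \<le> B" for p using B by (cases "sphere_inv p") auto
      have "(\<lambda>z. extend_zero f (sphere_inv (Some z))) = (\<lambda>z. if z = 0 then 0 else f (1 / cnj z))" by auto
      then show "(\<lambda>z. extend_zero f (sphere_inv (Some z))) \<in> borel_measurable borel" using m by simp
    qed }
qed

section \<open>Local integrability of subharmonic functions\<close>

definition loc_integrable :: "complex set \<Rightarrow> (complex \<Rightarrow> real) \<Rightarrow> bool" where
  "loc_integrable S f \<longleftrightarrow> (\<forall>z\<in>S. \<exists>r>0. set_integrable lborel (ball z r) f)"

lemma loc_integrable_compact:
  assumes "loc_integrable S f" "compact K" "K \<subseteq> S"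
  shows "set_integrable lborel K f"
proof -
  obtain r where r: "\<And>z. z \<in> S \<Longrightarrow> r z > 0" "\<And>z. z \<in> S \<Longrightarrow> set_integrable lborel (ball z (r z)) f"
    using assms(1) unfolding loc_integrable_def by metis
  obtain C where C: "C \<subseteq> K" "finite C" "K \<subseteq> (\<Union>z\<in>C. ball z (r z))"
  proof (rule compactE_image[OF assms(2), of K "\<lambda>z. ball z (r z)"])
    show "K \<subseteq> (\<Union>z\<in>K. ball z (r z))"
    proof
      fix z assume "z \<in> K"
      then show "z \<in> (\<Union>z\<in>K. ball z (r z))" using r(1)[of z] assms(3) by (intro UN_I[of z]) auto
    qed
  qed auto
  have "set_integrable lborel (\<Union>z\<in>C. ball z (r z)) f"
    by (rule set_integrable_UN[OF C(2)]) (use r C(1) assms(3) in auto)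
  then show ?thesis by (rule set_integrable_subset) (use C(3) compact_imp_closed[OF assms(2)] in auto)
qed

lemma loc_integrable_test:
  assumes f: "loc_integrable S f" and g: "continuous_on UNIV g" and K: "compact K" "K \<subseteq> S" "\<And>z. z \<notin> K \<Longrightarrow> g z = (0::real)"
  shows "integrable lborel (\<lambda>z. f z * g z)"
proof -
  have "compact (g ` K)" using K(1) g by (intro compact_continuous_image) (auto intro: continuous_on_subset)
    then have "bounded (g ` K)" by (rule compact_imp_bounded)
    then have "\<exists>B. \<forall>y\<in>g ` K. norm y \<le> B" unfolding bounded_iff .
    then obtain B where B: "\<And>z. z \<in> K \<Longrightarrow> \<bar>g z\<bar> \<le> B" by auto
  have i: "integrable lborel (\<lambda>z. indicator K z * f z)"
    using loc_integrable_compact[OF f K(1,2)] by (simp add: set_integrable_def)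
  have [measurable]: "g \<in> borel_measurable borel" by (rule borel_measurable_continuous_onI[OF g])
  have [measurable]: "(\<lambda>z. indicator K z * f z) \<in> borel_measurable borel" using borel_measurable_integrable[OF i] by simp
  have "integrable lborel (\<lambda>z. (indicator K z * f z) * g z)"
  proof (rule Bochner_Integration.integrable_bound[OF integrable_mult_right[OF i, of B]])
    show "AE z in lborel. norm ((indicator K z * f z) * g z) \<le> norm (B * (indicator K z * f z))"
    proof (rule AE_I2)
      fix z
      show "norm ((indicator K z * f z) * g z) \<le> norm (B * (indicator K z * f z))"
      proof (cases "z \<in> K")
        case True
        then have "\<bar>f z\<bar> * \<bar>g z\<bar> \<le> \<bar>f z\<bar> * \<bar>B\<bar>" using B[OF True] by (intro mult_left_mono) auto
        then show ?thesis using True by (simp add: abs_mult mult.commute)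
      qed simp
    qed
  qed measurable
  moreover have "(\<lambda>z. (indicator K z * f z) * g z) = (\<lambda>z. f z * g z)"
  proof
    show "(indicator K z * f z) * g z = f z * g z" for z using K(3)[of z] by (cases "z \<in> K") auto
  qed
  ultimately show ?thesis by simp
qed

lemma loc_integrable_laplacian:
  assumes f: "loc_integrable S f" and t: "test_function S h"
  shows "integrable lborel (\<lambda>z. f z * laplacian h z)"
proof -
  obtain K where K: "compact K" "K \<subseteq> S" "\<And>z. z \<notin> K \<Longrightarrow> h z = 0" using t by (auto simp: test_function_def)
  have ck: "Ck_on 2 UNIV h" using t by (auto simp: test_function_def)
  show ?thesis
    by (rule loc_integrable_test[OF f continuous_on_laplacian[OF ck] K(1,2)]) (rule pd_zero_outside(3)[OF K(1,3)])
qed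

text \<open>The splitting of F turns one integral over the plane into one integral per chart: the
  weight that the second Laplacian carries is the Jacobian of the inversion. U is general because it
  is used both for u and for the constant 1.\<close>

lemma sphere_pairing_general:
  fixes U :: "csphere \<Rightarrow> real"
  assumes D: "openin riemann_sphere D" and F: "sphere_test D F"
    and li: "loc_integrable (finite_part D) (\<lambda>z. U (Some z))"
    "None \<in> D \<longrightarrow> loc_integrable (finite_part (sphere_inv ` D)) (\<lambda>w. U (sphere_inv (Some w)))"
  shows "\<exists>h0 h1. test_function (finite_part D) h0 \<and> (None \<in> D \<longrightarrow> test_function (finite_part (sphere_inv ` D)) h1) \<and>
    (None \<notin> D \<longrightarrow> h1 = (\<lambda>_. 0)) \<and> (\<forall>p. F p = extend_zero h0 p + extend_zero h1 (sphere_inv p)) \<and>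
    integrable lborel (\<lambda>z. U (Some z) * laplacian (\<lambda>z. F (Some z)) z) \<and>
    (LINT z|lborel. U (Some z) * laplacian (\<lambda>z. F (Some z)) z)
      = (LINT z|lborel. U (Some z) * laplacian h0 z) + (LINT w|lborel. U (sphere_inv (Some w)) * laplacian h1 w)"
proof -
  obtain h0 h1 where s: "test_function (finite_part D) h0" "None \<in> D \<longrightarrow> test_function (finite_part (sphere_inv ` D)) h1"
    "None \<notin> D \<longrightarrow> h1 = (\<lambda>_. 0)" "\<forall>p. F p = extend_zero h0 p + extend_zero h1 (sphere_inv p)"
    "\<forall>z. z \<noteq> 0 \<longrightarrow> laplacian (\<lambda>z. F (Some z)) z = laplacian h0 z + laplacian h1 (1 / cnj z) / cmod z ^ 4"
    using sphere_test_split[OF D F] by - (elim exE conjE, rule that)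
  have i0: "integrable lborel (\<lambda>z. U (Some z) * laplacian h0 z)" by (rule loc_integrable_laplacian[OF li(1) s(1)])
  define f where "f = (\<lambda>w. U (sphere_inv (Some w)) * laplacian h1 w)"
  have i1: "integrable lborel f"
  proof (cases "None \<in> D")
    case True
    then show ?thesis unfolding f_def using loc_integrable_laplacian[OF li(2)[rule_format]] s(2) by blast
  next
    case False
    then show ?thesis unfolding f_def using s(3) by simp
  qed
  then have m: "f \<in> borel_measurable borel" using borel_measurable_integrable by simp
  have i2: "integrable lborel (\<lambda>z. f (1 / cnj z) / cmod z ^ 4)" using inversion_integral(1)[OF m] i1 by simp
  have ae: "AE z in lborel. U (Some z) * laplacian (\<lambda>z. F (Some z)) z = U (Some z) * laplacian h0 z + f (1 / cnj z) / cmod z ^ 4"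
    using AE_lborel_ne_complex[of 0]
  proof eventually_elim
    case (elim z)
    then show ?case using s(5)[rule_format, OF elim] by (simp add: f_def algebra_simps)
  qed
  have sm: "continuous_on UNIV (laplacian (\<lambda>z. F (Some z)))"
    by (rule continuous_on_laplacian) (use F in \<open>auto simp: sphere_test_def\<close>)
  obtain g where g: "g = (\<lambda>z. U (Some z) * laplacian h0 z + f (1 / cnj z) / cmod z ^ 4)" by blast
  have ig: "integrable lborel g" unfolding g by (intro Bochner_Integration.integrable_add i0 i2)
  show ?thesis
  proof (rule exI[of _ h0], rule exI[of _ h1], intro conjI)
    define c where "c = U (Some 0) * laplacian (\<lambda>z. F (Some z)) 0"
    \<comment> \<open>The splitting of the Laplacian is known for z other than 0. For measurability
      the value at 0 is carried along as a constant.\<close>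
    have eq: "U (Some z) * laplacian (\<lambda>z. F (Some z)) z = (if z = 0 then c else g z)" for z
      unfolding c_def using s(5)[rule_format, of z] by (simp add: g f_def algebra_simps)
    have mg: "g \<in> borel_measurable borel" using borel_measurable_integrable[OF ig] by simp
    have mm: "(\<lambda>z. U (Some z) * laplacian (\<lambda>z. F (Some z)) z) \<in> borel_measurable lborel"
      unfolding eq using mg by simp
    show "integrable lborel (\<lambda>z. U (Some z) * laplacian (\<lambda>z. F (Some z)) z)"
      by (rule integrable_cong_AE_imp[OF ig mm]) (use ae g in \<open>auto elim: eventually_mono\<close>)
    have "(LINT z|lborel. U (Some z) * laplacian (\<lambda>z. F (Some z)) z) = (LINT z|lborel. g z)"
      by (rule integral_cong_AE[OF mm]) (use mg ae g in auto)
    also have "\<dots> = (LINT z|lborel. U (Some z) * laplacian h0 z) + (LINT z|lborel. f (1 / cnj z) / cmod z ^ 4)"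
      unfolding g by (rule Bochner_Integration.integral_add[OF i0 i2])
    also have "(LINT z|lborel. f (1 / cnj z) / cmod z ^ 4) = (LINT z|lborel. f z)" by (rule inversion_integral(2)[OF m])
    finally show "(LINT z|lborel. U (Some z) * laplacian (\<lambda>z. F (Some z)) z)
      = (LINT z|lborel. U (Some z) * laplacian h0 z) + (LINT w|lborel. U (sphere_inv (Some w)) * laplacian h1 w)"
      unfolding f_def .
  qed (use s in blast)+
qed

text \<open>The two chart integrals are the two test formulas in \<open>is_riesz_measure\<close>;
  their sum is the formula for a function on the sphere.\<close>

lemma riesz_pairing:
  assumes D: "openin riemann_sphere D" and \<nu>: "is_riesz_measure D u \<nu>" and F: "sphere_test D F"
    and li: "loc_integrable (finite_part D) (\<lambda>z. real_of_ereal (u (Some z)))"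
    "None \<in> D \<Longrightarrow> loc_integrable (finite_part (sphere_inv ` D)) (\<lambda>w. real_of_ereal (u (sphere_inv (Some w))))"
  shows "integrable lborel (\<lambda>z. real_of_ereal (u (Some z)) * laplacian (\<lambda>z. F (Some z)) z)"
    "integrable \<nu> F"
    "(LINT p|\<nu>. F p) = 1 / (2 * pi) * (LINT z|lborel. real_of_ereal (u (Some z)) * laplacian (\<lambda>z. F (Some z)) z)"
proof -
  have li2: "None \<in> D \<longrightarrow> loc_integrable (finite_part (sphere_inv ` D)) (\<lambda>w. real_of_ereal (u (sphere_inv (Some w))))"
    using li(2) by blast
  obtain f0 f1 where s: "test_function (finite_part D) f0" "None \<in> D \<longrightarrow> test_function (finite_part (sphere_inv ` D)) f1"
    "None \<notin> D \<longrightarrow> f1 = (\<lambda>_. 0)" "\<forall>p. F p = extend_zero f0 p + extend_zero f1 (sphere_inv p)"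
    and i: "integrable lborel (\<lambda>z. real_of_ereal (u (Some z)) * laplacian (\<lambda>z. F (Some z)) z)"
    and e: "(LINT z|lborel. real_of_ereal (u (Some z)) * laplacian (\<lambda>z. F (Some z)) z)
      = (LINT z|lborel. real_of_ereal (u (Some z)) * laplacian f0 z)
      + (LINT w|lborel. real_of_ereal (u (sphere_inv (Some w))) * laplacian f1 w)"
    using sphere_pairing_general[OF D F, of "\<lambda>p. real_of_ereal (u p)", OF li(1) li2] by - (elim exE conjE, rule that)
  show "integrable lborel (\<lambda>z. real_of_ereal (u (Some z)) * laplacian (\<lambda>z. F (Some z)) z)" by (rule i)
  have S: "sets \<nu> = sets (restrict_space riemann_sphere_borel D)"
    "\<forall>K. compactin riemann_sphere K \<and> K \<subseteq> D \<longrightarrow> emeasure \<nu> K < \<infinity>" using \<nu> by (auto simp: is_riesz_measure_def)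
  have i0: "integrable \<nu> (extend_zero f0)" by (rule riesz_integrable_test(1)[OF S s(1)])
  have e0: "(LINT p|\<nu>. extend_zero f0 p) = 1 / (2 * pi) * (LINT z|lborel. real_of_ereal (u (Some z)) * laplacian f0 z)"
    using \<nu> s(1) by (auto simp: is_riesz_measure_def)
  have "integrable \<nu> (\<lambda>p. extend_zero f1 (sphere_inv p)) \<and>
    (LINT p|\<nu>. extend_zero f1 (sphere_inv p)) = 1 / (2 * pi) * (LINT w|lborel. real_of_ereal (u (sphere_inv (Some w))) * laplacian f1 w)"
  proof (cases "None \<in> D")
    case True
    then show ?thesis using riesz_integrable_test(2)[OF S] s(2) \<nu> by (auto simp: is_riesz_measure_def)
  next
    case False
    then have z: "f1 = (\<lambda>_. 0)" using s(3) by blast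
    have "extend_zero (\<lambda>_. 0) p = 0" for p by (cases p) auto
    then show ?thesis unfolding z by simp
  qed
  note i1 = conjunct1[OF this] and e1 = conjunct2[OF this]
  have Fe: "F = (\<lambda>p. extend_zero f0 p + extend_zero f1 (sphere_inv p))" using s(4) by auto
  show "integrable \<nu> F" unfolding Fe by (intro Bochner_Integration.integrable_add i0 i1)
  have "(LINT p|\<nu>. F p) = (LINT p|\<nu>. extend_zero f0 p) + (LINT p|\<nu>. extend_zero f1 (sphere_inv p))"
    unfolding Fe by (rule Bochner_Integration.integral_add[OF i0 i1])
  then show "(LINT p|\<nu>. F p) = 1 / (2 * pi) * (LINT z|lborel. real_of_ereal (u (Some z)) * laplacian (\<lambda>z. F (Some z)) z)"
    unfolding e e0 e1 by (simp add: distrib_left)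
qed

text \<open>The pairing with U = 1: in each chart the Laplacian of a compactly supported function
  has integral 0.\<close>

lemma sphere_integral_laplacian_zero:
  assumes D: "openin riemann_sphere D" and F: "sphere_test D F"
  shows "integrable lborel (laplacian (\<lambda>z. F (Some z)))" "(LINT z|lborel. laplacian (\<lambda>z. F (Some z)) z) = 0"
proof -
  have li: "loc_integrable S (\<lambda>z. 1)" for S
  proof -
    have "set_integrable lborel (ball z 1) (\<lambda>z. 1::real)" for z :: complex
      using emeasure_lborel_ball_finite[of z 1] by (simp add: set_integrable_def)
    then show ?thesis unfolding loc_integrable_def by (intro ballI exI[of _ 1]) auto
  qed
  obtain f0 f1 where s: "test_function (finite_part D) f0" "None \<in> D \<longrightarrow> test_function (finite_part (sphere_inv ` D)) f1"
    "None \<notin> D \<longrightarrow> f1 = (\<lambda>_. 0)"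
    and i: "integrable lborel (\<lambda>z. 1 * laplacian (\<lambda>z. F (Some z)) z)"
    and e: "(LINT z|lborel. 1 * laplacian (\<lambda>z. F (Some z)) z)
      = (LINT z|lborel. 1 * laplacian f0 z) + (LINT w|lborel. 1 * laplacian f1 w)"
    using sphere_pairing_general[OF D F, of "\<lambda>p. 1", OF li impI[OF li]] by - (elim exE conjE, rule that)
  show "integrable lborel (laplacian (\<lambda>z. F (Some z)))" using i by simp
  have z: "(LINT z|lborel. laplacian f z) = 0" if "test_function S f" for S f
    using that integral_laplacian_compact_support(2) by (auto simp: test_function_def)
  have "(LINT w|lborel. laplacian f1 w) = 0" using z s(2,3) by (cases "None \<in> D") auto
  then show "(LINT z|lborel. laplacian (\<lambda>z. F (Some z)) z) = 0" using e z[OF s(1)] by simp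
qed

lemma not_AE_avoid_open:
  assumes "open U" "U \<noteq> ({} :: complex set)" shows "\<not> (AE w in lborel. w \<notin> U)"
proof
  assume "AE w in lborel. w \<notin> U"
  then have "U \<in> null_sets lborel" using AE_iff_null_sets[of U lborel] assms(1) by simp
  then have "negligible U" using null_sets_completionI negligible_iff_null_sets by blast
  then show False using open_not_negligible[OF assms] by blast
qed

definition ae_finite_near :: "(complex \<Rightarrow> ereal) \<Rightarrow> complex \<Rightarrow> real \<Rightarrow> bool" where
  "ae_finite_near v z r \<longleftrightarrow> 0 < r \<and> set_integrable lborel (ball z r) (\<lambda>w. real_of_ereal (v w)) \<and>
     (AE w in lborel. w \<in> ball z r \<longrightarrow> v w \<noteq> -\<infinity>)"

text \<open>A connectedness argument. The set E of points near which u is identically minus infinity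
  is open, and by \<open>subharmonic_dichotomy\<close> a point of D outside E has a neighbourhood
  where u is finite almost everywhere, hence one that misses E. As u is not identically minus
  infinity, E is empty.\<close>

lemma sphere_subharmonic_finite_near:
  assumes D: "sphere_domain D" and u: "sphere_subharmonic_on D u" and ne: "\<exists>p\<in>D. u p \<noteq> -\<infinity>"
  shows "z \<in> finite_part D \<Longrightarrow> \<exists>r. ae_finite_near (\<lambda>z. u (Some z)) z r"
    "None \<in> D \<Longrightarrow> w \<in> finite_part (sphere_inv ` D) \<Longrightarrow> \<exists>r. ae_finite_near (\<lambda>w. u (sphere_inv (Some w))) w r"
proof -
  have oD: "openin riemann_sphere D" and cD: "connectedin riemann_sphere D" using D by (auto simp: sphere_domain_def)
  define E where "E = {p \<in> D. \<exists>V. openin riemann_sphere V \<and> p \<in> V \<and> (\<forall>q\<in>V. u q = -\<infinity>)}"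
  \<comment> \<open>The properties shared by the two charts \<open>Some\<close> and w ->
    \<open>sphere_inv (Some w)\<close>, so that each local argument is made once.\<close>
  define good where "good = (\<lambda>\<iota>::complex \<Rightarrow> csphere. (\<forall>U. open U \<longrightarrow> openin riemann_sphere (\<iota> ` U)) \<and>
     (\<forall>V. openin riemann_sphere V \<longrightarrow> open {w. \<iota> w \<in> V}) \<and> subharmonic_on {w. \<iota> w \<in> D} (\<lambda>w. u (\<iota> w)))"
  have g0: "good Some"
    using u open_finite_part by (auto simp: good_def sphere_subharmonic_on_def finite_part_def riemann_sphere_def)
  have g1: "good (\<lambda>w. sphere_inv (Some w))" if "None \<in> D"
  proof -
    have "(\<lambda>w. sphere_inv (Some w)) ` U = {p. \<exists>w\<in>U. p = sphere_inv (Some w)}" for U by auto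
    then show ?thesis using u that openin_chart_inf_image open_chart_inf
      by (auto simp: good_def sphere_subharmonic_on_def finite_part_sphere_inv)
  qed
  have dich: "\<exists>r>0. ball w r \<subseteq> {w. \<iota> w \<in> D} \<and> ((\<forall>v\<in>ball w r. u (\<iota> v) = -\<infinity>) \<or> ae_finite_near (\<lambda>w. u (\<iota> w)) w r)"
    if "good \<iota>" "\<iota> w \<in> D" for \<iota> w
  proof -
    have "open {w. \<iota> w \<in> D}" "subharmonic_on {w. \<iota> w \<in> D} (\<lambda>w. u (\<iota> w))" "w \<in> {w. \<iota> w \<in> D}"
      using that oD by (auto simp: good_def)
    from subharmonic_dichotomy[OF this] show ?thesis
      by (auto simp: ae_finite_near_def set_integrable_def)
  qed
  have near: "\<exists>N. openin riemann_sphere N \<and> \<iota> w \<in> N \<and> N \<inter> E = {}"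
    if gd: "good \<iota>" and wD: "\<iota> w \<in> D" and nE: "\<iota> w \<notin> E" for \<iota> w
  proof -
    obtain r where r: "0 < r" "ball w r \<subseteq> {w. \<iota> w \<in> D}"
      "(\<forall>v\<in>ball w r. u (\<iota> v) = -\<infinity>) \<or> ae_finite_near (\<lambda>w. u (\<iota> w)) w r" using dich[OF gd wD] by blast
    have oN: "openin riemann_sphere (\<iota> ` ball w r)" using gd by (auto simp: good_def)
    have "\<not> (\<forall>v\<in>ball w r. u (\<iota> v) = -\<infinity>)"
    proof
      assume "\<forall>v\<in>ball w r. u (\<iota> v) = -\<infinity>"
      then have "\<iota> w \<in> E" unfolding E_def using wD oN r(1) by (auto intro!: exI[of _ "\<iota> ` ball w r"])
      then show False using nE by blast
    qed
    then have ae: "AE v in lborel. v \<in> ball w r \<longrightarrow> u (\<iota> v) \<noteq> -\<infinity>" using r(3) by (auto simp: ae_finite_near_def)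
    have "\<iota> ` ball w r \<inter> E = {}"
    proof (rule ccontr)
      assume "\<iota> ` ball w r \<inter> E \<noteq> {}"
      then obtain v V where v: "v \<in> ball w r" "openin riemann_sphere V" "\<iota> v \<in> V" "\<forall>q\<in>V. u q = -\<infinity>"
        unfolding E_def by blast
      let ?U = "ball w r \<inter> {w. \<iota> w \<in> V}"
      have "open ?U" "?U \<noteq> {}" using gd v by (auto simp: good_def)
      moreover have "AE v in lborel. v \<notin> ?U" using ae v(4) by (auto elim: eventually_mono)
      ultimately show False using not_AE_avoid_open by blast
    qed
    then show ?thesis using oN r(1) by (intro exI[of _ "\<iota> ` ball w r"]) auto
  qed
  have E0: "E = {}"
  proof (rule ccontr)
    assume "E \<noteq> {}"
    define E1 where "E1 = \<Union>{V. openin riemann_sphere V \<and> (\<forall>q\<in>V. u q = -\<infinity>)}"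
    define E2 where "E2 = \<Union>{N. openin riemann_sphere N \<and> N \<inter> E = {}}"
    have 1: "openin riemann_sphere E1" "openin riemann_sphere E2" by (auto simp: E1_def E2_def)
    have 2: "E1 \<inter> D = E" by (auto simp: E1_def E_def)
    have 3: "D - E \<subseteq> E2"
    proof
      fix p assume p: "p \<in> D - E"
      have "\<exists>N. openin riemann_sphere N \<and> p \<in> N \<and> N \<inter> E = {}"
      proof (cases p)
        case None
        then show ?thesis using near[OF g1, of 0] p by auto
      next
        case (Some z)
        then show ?thesis using near[OF g0, of z] p by auto
      qed
      then show "p \<in> E2" by (auto simp: E2_def)
    qed
    have 4: "E2 \<inter> E = {}" by (auto simp: E2_def)
    obtain p where p: "p \<in> D" "u p \<noteq> -\<infinity>" using ne by blast
    then have "p \<in> D - E" by (auto simp: E_def)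
    then have "E2 \<inter> D \<noteq> {}" using 3 p by blast
    moreover have "D \<subseteq> E1 \<union> E2" "E1 \<inter> E2 \<inter> D = {}" "E1 \<inter> D \<noteq> {}" using 2 3 4 \<open>E \<noteq> {}\<close> by auto
    ultimately show False using cD 1 unfolding connectedin by blast
  qed
  have fin: "\<exists>r. ae_finite_near (\<lambda>w. u (\<iota> w)) w r" if gd: "good \<iota>" and wD: "\<iota> w \<in> D" for \<iota> w
  proof -
    obtain r where r: "0 < r" "ball w r \<subseteq> {w. \<iota> w \<in> D}"
      "(\<forall>v\<in>ball w r. u (\<iota> v) = -\<infinity>) \<or> ae_finite_near (\<lambda>w. u (\<iota> w)) w r" using dich[OF gd wD] by blast
    have "openin riemann_sphere (\<iota> ` ball w r)" using gd by (auto simp: good_def)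
    then have oN: "openin riemann_sphere (\<iota> ` ball w r)" .
    have "\<not> (\<forall>v\<in>ball w r. u (\<iota> v) = -\<infinity>)"
    proof
      assume "\<forall>v\<in>ball w r. u (\<iota> v) = -\<infinity>"
      then have "\<iota> w \<in> E" unfolding E_def using wD oN r(1) by (auto intro!: exI[of _ "\<iota> ` ball w r"])
      then show False using E0 by blast
    qed
    then show ?thesis using r(3) by blast
  qed
  show "z \<in> finite_part D \<Longrightarrow> \<exists>r. ae_finite_near (\<lambda>z. u (Some z)) z r"
    using fin[OF g0, of z] by (simp add: finite_part_def)
  show "None \<in> D \<Longrightarrow> w \<in> finite_part (sphere_inv ` D) \<Longrightarrow> \<exists>r. ae_finite_near (\<lambda>w. u (sphere_inv (Some w))) w r"
    using fin[OF g1, of w] by (simp add: finite_part_sphere_inv)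
qed

lemma sphere_subharmonic_loc_integrable:
  assumes "sphere_domain D" "sphere_subharmonic_on D u" "\<exists>p\<in>D. u p \<noteq> -\<infinity>"
  shows "loc_integrable (finite_part D) (\<lambda>z. real_of_ereal (u (Some z)))"
    "None \<in> D \<Longrightarrow> loc_integrable (finite_part (sphere_inv ` D)) (\<lambda>w. real_of_ereal (u (sphere_inv (Some w))))"
  using sphere_subharmonic_finite_near[OF assms] unfolding loc_integrable_def ae_finite_near_def by blast+

text \<open>Lindelof reduces the local statements to countably many discs, over which null sets may
  be united.\<close>

lemma sphere_subharmonic_AE_finite:
  assumes "sphere_domain D" "sphere_subharmonic_on D u" "\<exists>p\<in>D. u p \<noteq> -\<infinity>"
  shows "AE z in lborel. Some z \<in> D \<longrightarrow> u (Some z) \<noteq> -\<infinity>"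
proof -
  obtain r where r: "\<And>z. z \<in> finite_part D \<Longrightarrow> ae_finite_near (\<lambda>z. u (Some z)) z (r z)"
    using sphere_subharmonic_finite_near(1)[OF assms] by metis
  define F where "F = (\<lambda>z. ball z (r z)) ` finite_part D"
  have "\<And>S. S \<in> F \<Longrightarrow> open S" by (auto simp: F_def)
  then obtain F' where F': "F' \<subseteq> F" "countable F'" "\<Union>F' = \<Union>F" using Lindelof[of F] by metis
  have "AE z in lborel. \<forall>S\<in>F'. z \<in> S \<longrightarrow> u (Some z) \<noteq> -\<infinity>"
    unfolding AE_ball_countable[OF F'(2)]
  proof
    fix S assume "S \<in> F'"
    then obtain z where "z \<in> finite_part D" "S = ball z (r z)" using F'(1) by (auto simp: F_def)
    then show "AE z in lborel. z \<in> S \<longrightarrow> u (Some z) \<noteq> -\<infinity>" using r[of z] by (auto simp: ae_finite_near_def)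
  qed
  then show ?thesis
  proof eventually_elim
    case (elim z)
    show ?case
    proof
      assume "Some z \<in> D"
      then have "z \<in> ball z (r z)" "ball z (r z) \<in> F" using r[of z] by (auto simp: F_def finite_part_def ae_finite_near_def)
      then have "z \<in> \<Union>F'" using F'(3) by blast
      then show "u (Some z) \<noteq> -\<infinity>" using elim by blast
    qed
  qed
qed

section \<open>Radial kernels\<close>

text \<open>The Laplacian of \<tau>(ln |w - a|) when k is the second derivative of \<tau>, see
  \<open>laplacian_radial\<close>. In all uses k vanishes near minus infinity, which makes 0 the
  natural value at a.\<close>

definition radial_kernel :: "(real \<Rightarrow> real) \<Rightarrow> complex \<Rightarrow> complex \<Rightarrow> real" where
  "radial_kernel k a w = (if w = a then 0 else k (ln (cmod (w - a))) / (cmod (w - a))\<^sup>2)"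

lemma radial_kernel_polar:
  "radial_kernel k a (a + of_real (exp x) * cis t) = k x * exp (- 2 * x)"
proof -
  have "a + of_real (exp x) * cis t \<noteq> a" by simp
  moreover have "(exp x)\<^sup>2 = exp (2 * x)" by (simp add: power2_eq_square flip: exp_add)
  ultimately show ?thesis by (simp add: radial_kernel_def norm_mult exp_minus divide_inverse)
qed

lemma radial_kernel_zero:
  assumes "\<And>x. x \<le> A \<or> B \<le> x \<Longrightarrow> k x = 0" "cmod (w - a) \<le> exp A \<or> exp B \<le> cmod (w - a)"
  shows "radial_kernel k a w = 0"
proof (cases "w = a")
  case False
  then have p: "0 < cmod (w - a)" by simp
  have "ln (cmod (w - a)) \<le> A \<or> B \<le> ln (cmod (w - a))"
    using assms(2) p by (metis ln_ge_iff exp_le_cancel_iff exp_ln)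
  then show ?thesis using assms(1) by (simp add: radial_kernel_def)
qed (simp add: radial_kernel_def)

lemma continuous_radial_kernel:
  assumes k: "continuous_on UNIV k" "\<And>x. x \<le> A \<or> B \<le> x \<Longrightarrow> k x = (0::real)"
  shows "continuous_on UNIV (radial_kernel k a)"
proof -
  have 1: "continuous_on (- {a}) (radial_kernel k a)"
  proof -
    have "continuous_on (- {a}) (\<lambda>w. k (ln (cmod (w - a))) / (cmod (w - a))\<^sup>2)"
      by (intro continuous_intros continuous_on_compose2[OF k(1)]) auto
    then show ?thesis by (rule continuous_on_cong[THEN iffD1, rotated 2]) (auto simp: radial_kernel_def)
  qed
  have 2: "continuous_on (ball a (exp A)) (radial_kernel k a)"
  proof -
    have "continuous_on (ball a (exp A)) (\<lambda>_. 0::real)" by (rule continuous_on_const)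
    then show ?thesis
      by (rule continuous_on_cong[THEN iffD1, rotated 2])
        (use radial_kernel_zero[where k=k and a=a and A=A and B=B, OF k(2)] in \<open>auto simp: dist_norm norm_minus_commute\<close>)
  qed
  have "continuous_on (- {a} \<union> ball a (exp A)) (radial_kernel k a)"
    by (rule continuous_on_open_Un[OF _ _ 1 2]) auto
  moreover have "- {a} \<union> ball a (exp A) = UNIV" by auto
  ultimately show ?thesis by simp
qed

text \<open>The factor 1 / |w - a|^2 cancels the weight exp (2 x) of the polar coordinates, which
  leaves k as density in the logarithm of the radius.\<close>

lemma radial_kernel_integral:
  assumes i: "integrable lborel (\<lambda>w. h w * radial_kernel k a w)"
  shows "(LINT w|lborel. h w * radial_kernel k a w)
      = (LINT x|lborel. k x * (LINT t|lborel. indicator {0<..<2*pi} t * h (a + of_real (exp x) * cis t)))"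
    "AE x in lborel. k x \<noteq> 0 \<longrightarrow> integrable lborel (\<lambda>t. indicator {0<..<2*pi} t * h (a + of_real (exp x) * cis t))"
proof -
  have e: "exp (2 * x) * (LINT t|lborel. indicator {0<..<2*pi} t * (h (a + of_real (exp x) * cis t) * radial_kernel k a (a + of_real (exp x) * cis t)))
    = k x * (LINT t|lborel. indicator {0<..<2*pi} t * h (a + of_real (exp x) * cis t))" for x
  proof -
    have "exp (2 * x) * (LINT t|lborel. indicator {0<..<2*pi} t * (h (a + of_real (exp x) * cis t) * (k x * exp (- 2 * x))))
      = (LINT t|lborel. (exp (2 * x) * (k x * exp (- 2 * x))) * (indicator {0<..<2*pi} t * h (a + of_real (exp x) * cis t)))"
      by (subst integral_mult_right_zero[symmetric]) (simp add: mult_ac)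
    also have "exp (2 * x) * (k x * exp (- 2 * x)) = k x" by (simp add: exp_minus)
    finally show ?thesis unfolding radial_kernel_polar by simp
  qed
  show "(LINT w|lborel. h w * radial_kernel k a w)
      = (LINT x|lborel. k x * (LINT t|lborel. indicator {0<..<2*pi} t * h (a + of_real (exp x) * cis t)))"
    unfolding log_polar_integral(1)[OF i, of a] e ..
  show "AE x in lborel. k x \<noteq> 0 \<longrightarrow> integrable lborel (\<lambda>t. indicator {0<..<2*pi} t * h (a + of_real (exp x) * cis t))"
    using log_polar_integral(2)[OF i, of a]
  proof eventually_elim
    case (elim x)
    show ?case
    proof
      assume kx: "k x \<noteq> 0"
      have "integrable lborel (\<lambda>t. (1 / (k x * exp (- 2 * x))) * (indicator {0<..<2*pi} t * (h (a + of_real (exp x) * cis t) * radial_kernel k a (a + of_real (exp x) * cis t))))"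
        by (rule integrable_mult_right[OF elim])
      moreover have "(\<lambda>t. (1 / (k x * exp (- 2 * x))) * (indicator {0<..<2*pi} t * (h (a + of_real (exp x) * cis t) * radial_kernel k a (a + of_real (exp x) * cis t))))
        = (\<lambda>t. indicator {0<..<2*pi} t * h (a + of_real (exp x) * cis t))"
        unfolding radial_kernel_polar using kx by (intro ext) (simp add: field_simps)
      ultimately show "integrable lborel (\<lambda>t. indicator {0<..<2*pi} t * h (a + of_real (exp x) * cis t))" by simp
    qed
  qed
qed

lemma integrable_radial_kernel:
  assumes k: "continuous_on UNIV k" "\<And>x. x \<le> A \<or> B \<le> x \<Longrightarrow> k x = (0::real)"
    and h: "loc_integrable S h" and sub: "cball a (exp B) \<subseteq> S"
  shows "integrable lborel (\<lambda>w. h w * radial_kernel k a w)"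
proof (rule loc_integrable_test[OF h continuous_radial_kernel[OF k] compact_cball sub])
  show "radial_kernel k a z = 0" if "z \<notin> cball a (exp B)" for z
    using that by (intro radial_kernel_zero[OF k(2)]) (auto simp: dist_norm norm_minus_commute)
qed

lemma loc_integrable_continuous: "open S \<Longrightarrow> continuous_on S f \<Longrightarrow> loc_integrable S f"
  unfolding loc_integrable_def
proof
  fix z assume S: "open S" "continuous_on S f" "z \<in> S"
  then obtain r where r: "0 < r" "cball z r \<subseteq> S" using open_contains_cball by blast
  have "set_integrable lborel (cball z r) f"
    using borel_integrable_compact[OF compact_cball continuous_on_subset[OF S(2) r(2)]] by (simp add: set_integrable_def)
  then have "set_integrable lborel (ball z r) f" by (rule set_integrable_subset) auto
  then show "\<exists>r>0. set_integrable lborel (ball z r) f" using r(1) by blast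
qed

lemma radial_kernel_total:
  assumes k: "continuous_on UNIV k" "\<And>x. x \<le> A \<or> B \<le> x \<Longrightarrow> k x = (0::real)"
  shows "integrable lborel (radial_kernel k a)" "(LINT w|lborel. radial_kernel k a w) = 2 * pi * (LINT x|lborel. k x)"
proof -
  have i: "integrable lborel (\<lambda>w. 1 * radial_kernel k a w)"
    by (rule integrable_radial_kernel[OF k loc_integrable_continuous[OF open_UNIV]]) auto
  then show "integrable lborel (radial_kernel k a)" by simp
  have "(LINT w|lborel. 1 * radial_kernel k a w) = (LINT x|lborel. k x * (2 * pi))"
    unfolding radial_kernel_integral(1)[OF i] by simp
  then show "(LINT w|lborel. radial_kernel k a w) = 2 * pi * (LINT x|lborel. k x)"
    by (simp add: mult.commute)
qed

text \<open>Polar coordinates produce the open interval, \<open>circle_mean\<close> uses the closed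
  one. The two integrands differ at two points; without integrability both integrals are 0 by
  convention.\<close>

lemma integral_open_interval_eq:
  fixes f :: "real \<Rightarrow> real"
  shows "(LINT t|lborel. indicator {0<..<2*pi} t * f t) = (LINT t|lborel. indicator {0..2*pi} t * f t)"
    "integrable lborel (\<lambda>t. indicator {0<..<2*pi} t * f t) \<longleftrightarrow> integrable lborel (\<lambda>t. indicator {0..2*pi} t * f t)"
proof -
  let ?F = "\<lambda>t. indicator {0<..<2*pi} t * f t" and ?G = "\<lambda>t. indicator {0..2*pi} t * f t"
  have m: "?F \<in> borel_measurable lborel \<longleftrightarrow> ?G \<in> borel_measurable lborel"
    by (rule iffI; erule measurable_discrete_difference[where X = "{0, 2*pi}"]) (auto simp: indicator_def)
  have ae: "AE t in lborel. ?F t = ?G t"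
    using AE_lborel_singleton[of 0] AE_lborel_singleton[of "2*pi"]
    by eventually_elim (auto simp: indicator_def)
  have "(integrable lborel ?F \<longleftrightarrow> integrable lborel ?G) \<and> integral\<^sup>L lborel ?F = integral\<^sup>L lborel ?G"
  proof (cases "?F \<in> borel_measurable lborel")
    case True
    then show ?thesis using m integrable_cong_AE[OF _ _ ae] integral_cong_AE[OF _ _ ae] by blast
  next
    case False
    then have "\<not> integrable lborel ?F" "\<not> integrable lborel ?G" using m borel_measurable_integrable by blast+
    then show ?thesis by (simp add: not_integrable_integral_eq)
  qed
  then show "integral\<^sup>L lborel ?F = integral\<^sup>L lborel ?G" "integrable lborel ?F \<longleftrightarrow> integrable lborel ?G" by blast+
qed

text \<open>\<open>real_of_ereal\<close> sends minus infinity to 0, which can only raise the mean;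
  the inequality points in the direction that tolerates this.\<close>

lemma circle_mean_eq_integral:
  assumes i: "integrable lborel (\<lambda>t. indicator {0..2*pi} t * real_of_ereal (u (a + of_real r * cis t)))"
    and le: "ereal c \<le> circle_mean u a r"
    and up: "\<And>t. u (a + of_real r * cis t) < \<infinity>"
  shows "2 * pi * c \<le> (LINT t|lborel. indicator {0..2*pi} t * real_of_ereal (u (a + of_real r * cis t)))"
proof -
  let ?v = "\<lambda>t. u (a + of_real r * cis t)"
  let ?f = "\<lambda>t. indicator {0..2*pi} t * real_of_ereal (?v t)"
  define P where "P = (\<integral>\<^sup>+t. ennreal (?f t) \<partial>lborel)"
  define N where "N = (\<integral>\<^sup>+t. ennreal (- ?f t) \<partial>lborel)"
  have fin: "P < \<infinity>" "N < \<infinity>"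
    using integrableD[OF i] unfolding P_def N_def by (auto simp: top.not_eq_extremum)
  have p: "(\<integral>\<^sup>+t\<in>{0..2*pi}. e2ennreal (?v t) \<partial>lborel) = P"
    unfolding P_def
  proof (rule nn_integral_cong)
    fix t
    show "e2ennreal (?v t) * indicator {0..2*pi} t = ennreal (?f t)"
      using up[of t] by (cases "?v t") (auto simp: indicator_def e2ennreal_neg)
  qed
  have n: "N \<le> (\<integral>\<^sup>+t\<in>{0..2*pi}. e2ennreal (- ?v t) \<partial>lborel)"
    unfolding N_def
  proof (rule nn_integral_mono)
    fix t
    show "ennreal (- ?f t) \<le> e2ennreal (- ?v t) * indicator {0..2*pi} t"
      using up[of t] by (cases "?v t") (auto simp: indicator_def)
  qed
  have "circle_mean u a r \<le> ereal (1 / (2 * pi)) * (enn2ereal P - enn2ereal N)"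
    unfolding circle_mean_def p using n
    by (intro ereal_mult_left_mono ereal_minus_mono) (simp_all add: less_eq_ennreal.rep_eq)
  also have "enn2ereal P - enn2ereal N = ereal (enn2real P - enn2real N)"
    using fin by (cases P; cases N) auto
  also have "enn2real P - enn2real N = (LINT t|lborel. ?f t)"
    using real_lebesgue_integral_def[OF i] by (simp add: P_def N_def)
  finally have "ereal c \<le> ereal ((LINT t|lborel. ?f t) / (2 * pi))" using le order_trans by fastforce
  then show ?thesis by (simp add: field_simps)
qed

text \<open>The submean inequality on the circle of radius exp x, averaged with the weight k of
  total mass 1. Where k x = 0 nothing has to be known about the circle.\<close>

lemma radial_kernel_subharmonic:
  assumes k: "continuous_on UNIV k" "\<And>x. x \<le> A \<or> B \<le> x \<Longrightarrow> k x = (0::real)" "\<And>x. 0 \<le> k x"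
    "(LINT x|lborel. k x) = 1" "integrable lborel k"
    and i: "integrable lborel (\<lambda>w. real_of_ereal (u w) * radial_kernel k a w)"
    and c: "\<And>r. 0 < r \<Longrightarrow> r < exp B \<Longrightarrow> ereal c \<le> circle_mean u a r"
    and up: "\<And>w. w \<in> ball a (exp B) \<Longrightarrow> u w < \<infinity>"
  shows "2 * pi * c \<le> (LINT w|lborel. real_of_ereal (u w) * radial_kernel k a w)"
proof -
  let ?I = "\<lambda>x. LINT t|lborel. indicator {0<..<2*pi} t * real_of_ereal (u (a + of_real (exp x) * cis t))"
  have ae: "AE x in lborel. k x * (2 * pi * c) \<le> k x * ?I x"
    using radial_kernel_integral(2)[OF i]
  proof eventually_elim
    case (elim x)
    show ?case
    proof (cases "k x = 0")
      case False
      then have xB: "exp x < exp B" using k(2)[of x] by force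
      have "2 * pi * c \<le> ?I x"
        unfolding integral_open_interval_eq(1)
      proof (rule circle_mean_eq_integral)
        show "integrable lborel (\<lambda>t. indicator {0..2*pi} t * real_of_ereal (u (a + of_real (exp x) * cis t)))"
          using elim False unfolding integral_open_interval_eq(2) by blast
        show "ereal c \<le> circle_mean u a (exp x)" using c[of "exp x"] xB by simp
        show "u (a + of_real (exp x) * cis t) < \<infinity>" for t
          using xB by (intro up) (simp add: dist_norm norm_mult)
      qed
      then show ?thesis using k(3)[of x] by (intro mult_left_mono)
    qed simp
  qed
  have "integrable lborel (\<lambda>x. k x * ?I x)"
  proof -
    have "integrable lborel (\<lambda>w. real_of_ereal (u w) * radial_kernel k a w)" by (rule i)
    have "integrable lborel (\<lambda>x. exp (2 * x) * (LINT t|lborel. indicator {0<..<2*pi} t * (real_of_ereal (u (a + of_real (exp x) * cis t)) * radial_kernel k a (a + of_real (exp x) * cis t))))"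
      by (rule log_polar_integral(3)[OF i])
    then show ?thesis unfolding radial_kernel_polar
    proof (rule Bochner_Integration.integrable_cong[THEN iffD1, rotated 2])
      fix x
      have "(LINT t|lborel. indicator {0<..<2*pi} t * (real_of_ereal (u (a + of_real (exp x) * cis t)) * (k x * exp (- 2 * x))))
        = (k x * exp (- 2 * x)) * ?I x"
        by (subst integral_mult_right_zero[symmetric]) (simp add: mult_ac)
      then show "exp (2 * x) * (LINT t|lborel. indicator {0<..<2*pi} t * (real_of_ereal (u (a + of_real (exp x) * cis t)) * (k x * exp (- 2 * x)))) = k x * ?I x"
        by (simp add: exp_minus)
    qed simp
  qed
  from integral_mono_AE[OF _ this ae] have "(LINT x|lborel. k x * (2 * pi * c)) \<le> (LINT x|lborel. k x * ?I x)"
    using k(5) by simp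
  then show ?thesis unfolding radial_kernel_integral(1)[OF i] using k(4) by simp
qed

section \<open>Truncation of a logarithmic pole\<close>

text \<open>On the disc about z that reaches to a, the quotient (w - a) / (z - a) stays in the right
  half plane. There ln |w - a| is the real part of its principal logarithm plus a constant.\<close>

lemma harmonic_on_ln_norm: "harmonic_on (- {a}) (\<lambda>w. ln (cmod (w - a)))"
proof -
  have "\<exists>U. open U \<and> z \<in> U \<and> harmonic_on U (\<lambda>w. ln (cmod (w - a)))" if z: "z \<in> - {a}" for z
  proof -
    let ?U = "ball z (cmod (z - a))"
    have za: "z - a \<noteq> 0" using z by simp
    have re: "0 < Re ((w - a) / (z - a))" if w: "w \<in> ?U" for w
    proof -
      have "(w - a) / (z - a) = 1 + (w - z) / (z - a)" using za by (simp add: field_simps)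
      moreover have "cmod ((w - z) / (z - a)) < 1" using w za by (simp add: norm_divide dist_norm norm_minus_commute field_simps)
      ultimately show ?thesis using abs_Re_le_cmod[of "(w - z) / (z - a)"] by simp
    qed
    have "(\<lambda>w. Ln ((w - a) / (z - a)) + of_real (ln (cmod (z - a)))) holomorphic_on ?U"
      using za re by (intro holomorphic_intros) (auto simp: complex_nonpos_Reals_iff not_le)
    then have "harmonic_on ?U (\<lambda>w. Re (Ln ((w - a) / (z - a)) + of_real (ln (cmod (z - a)))))"
      by (rule harmonic_on_Re[OF open_ball])
    moreover have "Re (Ln ((w - a) / (z - a)) + of_real (ln (cmod (z - a)))) = ln (cmod (w - a))" if w: "w \<in> ?U" for w
    proof -
      have "w - a \<noteq> 0" using re[OF w] by auto
      then show ?thesis using za by (simp add: norm_divide ln_div)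
    qed
    ultimately have "harmonic_on ?U (\<lambda>w. ln (cmod (w - a)))" by (rule harmonic_on_cong[OF open_ball])
    then show ?thesis using za by (intro exI[of _ ?U]) auto
  qed
  then show ?thesis unfolding harmonic_on_def
  proof (intro conjI ballI Ck_on_local)
    show "\<exists>U. open U \<and> z \<in> U \<and> Ck_on 2 U (\<lambda>w. ln (cmod (w - a)))" if "z \<in> - {a}" for z
      using \<open>\<And>z. z \<in> - {a} \<Longrightarrow> \<exists>U. open U \<and> z \<in> U \<and> harmonic_on U (\<lambda>w. ln (cmod (w - a)))\<close>[OF that]
      by (auto simp: harmonic_on_def)
    show "laplacian (\<lambda>w. ln (cmod (w - a))) z = 0" if "z \<in> - {a}" for z
      using \<open>\<And>z. z \<in> - {a} \<Longrightarrow> \<exists>U. open U \<and> z \<in> U \<and> harmonic_on U (\<lambda>w. ln (cmod (w - a)))\<close>[OF that]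
      by (auto simp: harmonic_on_def)
  qed
qed

lemma gradient_ln_norm:
  assumes "z \<noteq> a"
  shows "(pdx (\<lambda>w. ln (cmod (w - a))) z)\<^sup>2 + (pdy (\<lambda>w. ln (cmod (w - a))) z)\<^sup>2 = 1 / (cmod (z - a))\<^sup>2"
proof -
  let ?U = "ball z (cmod (z - a))"
  have za: "z - a \<noteq> 0" using assms by simp
  have "((\<lambda>w. ln (cmod (w - a))) has_derivative (\<lambda>v. Re (v / (z - a)))) (at z)"
  proof -
    define f where "f = (\<lambda>w. Ln ((w - a) / (z - a)))"
    have "(f has_field_derivative 1 / (z - a)) (at z)"
      unfolding f_def using za by (auto intro!: derivative_eq_intros)
    then have "((\<lambda>w. Re (f w) + ln (cmod (z - a))) has_derivative (\<lambda>v. Re (1 / (z - a) * v))) (at z)"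
      unfolding has_field_derivative_def by (auto intro!: derivative_eq_intros)
    then have "((\<lambda>w. ln (cmod (w - a))) has_derivative (\<lambda>v. Re (1 / (z - a) * v))) (at z)"
    proof (rule has_derivative_transform_within_open[of _ _ _ _ "- {a}"])
      show "Re (f w) + ln (cmod (z - a)) = ln (cmod (w - a))" if "w \<in> - {a}" for w
        using that za by (simp add: f_def norm_divide ln_div)
    qed (use assms in auto)
    then show ?thesis by (simp add: mult.commute)
  qed
  from pd_derivative[OF this] have "pdx (\<lambda>w. ln (cmod (w - a))) z = Re (1 / (z - a))" "pdy (\<lambda>w. ln (cmod (w - a))) z = - Im (1 / (z - a))"
    using Re_i_times[of "1 / (z - a)"] by simp_all
  then have "(pdx (\<lambda>w. ln (cmod (w - a))) z)\<^sup>2 + (pdy (\<lambda>w. ln (cmod (w - a))) z)\<^sup>2 = (cmod (1 / (z - a)))\<^sup>2"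
    by (simp only: cmod_power2 power2_minus)
  then show ?thesis by (simp add: norm_divide power_divide)
qed

lemma laplacian_radial:
  assumes "z \<noteq> a" "\<And>x. (\<tau> has_real_derivative \<tau>' x) (at x)" "\<And>x. (\<tau>' has_real_derivative k x) (at x)"
  shows "laplacian (\<lambda>w. \<tau> (ln (cmod (w - a)))) z = radial_kernel k a z"
proof -
  have h: "Ck_on 2 (- {a}) (\<lambda>w. ln (cmod (w - a)))" "laplacian (\<lambda>w. ln (cmod (w - a))) z = 0"
    using harmonic_on_ln_norm[of a] assms(1) by (auto simp: harmonic_on_def)
  have o: "open (- {a})" by auto
  show ?thesis
    using laplacian_compose_real[OF o h(1) _ assms(2,3), of z] assms(1) h(2) gradient_ln_norm[OF assms(1)]
    by (simp add: radial_kernel_def)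
qed

lemma Ck_on_ln_norm: "Ck_on k (- {a}) (\<lambda>w. ln (cmod (w - a)))"
  by (rule harmonic_on_smooth[OF _ harmonic_on_ln_norm]) auto

text \<open>The pole of \<open>Re f - ln |w - a|\<close> is replaced by a smooth function that agrees with it outside
  a small disc; its Laplacian is minus a radial probability kernel (times \<open>2 \<pi>\<close>).\<close>

lemma truncate_log_pole:
  assumes f: "f holomorphic_on ball a r" and r: "0 < r" and \<epsilon>: "0 < \<epsilon>"
  shows "\<exists>B k q. exp B < \<epsilon> \<and> exp B < r \<and> continuous_on UNIV k \<and> (\<forall>x. x \<le> B - 1 \<or> B \<le> x \<longrightarrow> k x = 0) \<and> (\<forall>x. 0 \<le> k x) \<and>
     (LINT x|lborel. k x) = 1 \<and> integrable lborel k \<and>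
     (\<forall>n. Ck_on n (ball a r) q) \<and> (\<forall>w\<in>ball a r. exp B \<le> cmod (w - a) \<longrightarrow> q w = Re (f w) - ln (cmod (w - a))) \<and>
     (\<forall>w\<in>cball a (exp B). t < q w) \<and> (\<forall>w\<in>cball a (exp B) - {a}. t < Re (f w) - ln (cmod (w - a))) \<and>
     (\<forall>w\<in>ball a r. laplacian q w = - radial_kernel k a w)"
proof -
  have "cball a (r/2) \<subseteq> ball a r" using r by auto
  then have "continuous_on (cball a (r/2)) f" using f continuous_on_subset holomorphic_on_imp_continuous_on by blast
  then have "bounded (f ` cball a (r/2))" by (intro compact_imp_bounded compact_continuous_image compact_cball)
  then obtain M where M: "\<And>z. z \<in> cball a (r/2) \<Longrightarrow> cmod (f z) \<le> M" unfolding bounded_iff by blast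
  \<comment> \<open>T is the height at which the pole is cut. The first two entries make the radius
    exp (-T) smaller than \<epsilon> and r / 2; the third makes T - M, a lower bound for the
    function on the small disc, exceed t.\<close>
  define T where "T = max (max (1 - ln \<epsilon>) (1 - ln (r/2))) (M + t + 1)"
  have T: "1 - ln \<epsilon> \<le> T" "1 - ln (r/2) \<le> T" "M + t + 1 \<le> T" by (auto simp: T_def)
  define B where "B = - T"
  have B: "exp B < \<epsilon>" "exp B < r / 2"
  proof -
    have "B < ln \<epsilon>" "B < ln (r/2)" using T by (auto simp: B_def)
    then show "exp B < \<epsilon>" "exp B < r / 2" using r \<epsilon> by (metis exp_less_cancel_iff exp_ln half_gt_zero)+
  qed
  obtain j j' j'' where k: "\<And>k. Ck_real k j" "\<And>x. (j has_real_derivative j' x) (at x)"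
    "\<And>x. (j' has_real_derivative j'' x) (at x)" "continuous_on UNIV j''" "\<And>x. 0 \<le> j'' x"
    "\<And>x. 0 \<le> j' x \<and> j' x \<le> 1" "\<And>x. x \<le> T \<Longrightarrow> j x = 0 \<and> j' x = 0 \<and> j'' x = 0"
    "\<And>x. T + 1 \<le> x \<Longrightarrow> j x = x - (T + 1) + j (T + 1) \<and> j' x = 1 \<and> j'' x = 0"
  proof -
    have "T < T + 1" by simp
    from smooth_ramp[OF this] show thesis by (elim exE conjE, intro that) blast+
  qed
  \<comment> \<open>\<tau> equals -x for x >= B and the constant c for x <= B - 1. Its second
    derivative is minus that of the ramp at -x, so k is the density of a smooth step of total mass
    1.\<close>
  define \<tau> where "\<tau> = (\<lambda>x. - x - j (- x))"
  define \<tau>' where "\<tau>' = (\<lambda>x. - 1 + j' (- x))"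
  define c where "c = T + 1 - j (T + 1)"
  have d1: "(\<tau> has_real_derivative \<tau>' x) (at x)" for x
    unfolding \<tau>_def \<tau>'_def by (auto intro!: derivative_eq_intros DERIV_chain2[OF k(2)])
  have d2: "(\<tau>' has_real_derivative - j'' (- x)) (at x)" for x
    unfolding \<tau>'_def by (auto intro!: derivative_eq_intros DERIV_chain2[OF k(3)])
  have Ck: "Ck_real n \<tau>" for n
    using Ck_real_diff[OF Ck_real_affine[OF Ck_real_id, of n "-1" 0] Ck_real_affine[OF k(1), of n "-1" 0]]
    by (simp add: \<tau>_def)
  have \<tau>c: "\<tau> x = c" if "x \<le> B - 1" for x using k(8)[of "- x"] that by (simp add: \<tau>_def c_def B_def)
  have \<tau>m: "\<tau> x = - x" if "B \<le> x" for x using k(7)[of "- x"] that by (simp add: \<tau>_def B_def)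
  have \<tau>T: "T \<le> \<tau> x" if "x \<le> B" for x
  proof -
    have "- \<tau> x \<le> - \<tau> B"
    proof (rule DERIV_nonneg_mono[of "\<lambda>x. - \<tau> x" "\<lambda>x. - \<tau>' x"])
      show "((\<lambda>x. - \<tau> x) has_real_derivative - \<tau>' x) (at x)" for x by (rule DERIV_minus[OF d1])
      show "0 \<le> - \<tau>' x" for x using k(6)[of "- x"] by (simp add: \<tau>'_def)
    qed (rule that)
    then show ?thesis using \<tau>m[of B] by (simp add: B_def)
  qed
  define q where "q = (\<lambda>w. Re (f w) + (if w = a then c else \<tau> (ln (cmod (w - a)))))"
  have R: "Ck_on n (ball a r) (\<lambda>w. Re (f w))" for n by (rule Ck_on_Re_holomorphic[OF open_ball f])
  have inner: "(if w = a then c else \<tau> (ln (cmod (w - a)))) = c" if "w \<in> ball a (exp (B - 1))" for w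
  proof (cases "w = a")
    case False
    have "cmod (w - a) < exp (B - 1)" using that by (simp add: dist_norm norm_minus_commute)
    then have "ln (cmod (w - a)) \<le> B - 1" using False by (metis exp_le_cancel_iff exp_ln less_imp_le right_minus_eq zero_less_norm_iff)
    then show ?thesis using \<tau>c by simp
  qed simp
  have Ckt: "Ck_on n UNIV (\<lambda>w. if w = a then c else \<tau> (ln (cmod (w - a))))" for n
  proof (rule Ck_on_local)
    fix z
    show "\<exists>U. open U \<and> z \<in> U \<and> Ck_on n U (\<lambda>w. if w = a then c else \<tau> (ln (cmod (w - a))))"
    proof (cases "z = a")
      case True
      have "Ck_on n (ball a (exp (B - 1))) (\<lambda>w. if w = a then c else \<tau> (ln (cmod (w - a))))"
        by (rule Ck_on_cong[OF open_ball _ Ck_on_const[of n _ c]]) (use inner in auto)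
      then show ?thesis using True by (intro exI[of _ "ball a (exp (B - 1))"]) auto
    next
      case False
      have o: "open (- {a})" by auto
      have "Ck_on n (- {a}) (\<lambda>w. if w = a then c else \<tau> (ln (cmod (w - a))))"
        by (rule Ck_on_cong[OF o _ Ck_on_compose_real[OF o Ck Ck_on_ln_norm]]) auto
      then show ?thesis using False by (intro exI[of _ "- {a}"]) auto
    qed
  qed
  note Ckb = Ck_on_subset[OF Ckt subset_UNIV]
  have Ckq: "Ck_on n (ball a r) q" for n
    unfolding q_def by (rule Ck_on_add[OF open_ball R Ckb])
  have lap: "laplacian q w = - radial_kernel (\<lambda>x. j'' (- x)) a w" if w: "w \<in> ball a r" for w
  proof -
    have "laplacian q w = laplacian (\<lambda>w. Re (f w)) w + laplacian (\<lambda>w. if w = a then c else \<tau> (ln (cmod (w - a)))) w"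
      unfolding q_def by (rule laplacian_add[OF open_ball R Ckb w])
    also have "laplacian (\<lambda>w. Re (f w)) w = 0" by (rule laplacian_Re_holomorphic[OF open_ball f w])
    also have "laplacian (\<lambda>w. if w = a then c else \<tau> (ln (cmod (w - a)))) w = - radial_kernel (\<lambda>x. j'' (- x)) a w"
    proof (cases "w = a")
      case True
      have "laplacian (\<lambda>w. if w = a then c else \<tau> (ln (cmod (w - a)))) w = laplacian (\<lambda>_. c) w"
        by (rule laplacian_cong_open[of "ball a (exp (B - 1))"]) (use True inner in auto)
      then show ?thesis using True by (simp add: radial_kernel_def)
    next
      case False
      have "laplacian (\<lambda>w. if w = a then c else \<tau> (ln (cmod (w - a)))) w = laplacian (\<lambda>w. \<tau> (ln (cmod (w - a)))) w"
        by (rule laplacian_cong_open[of "- {a}"]) (use False in auto)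
      also have "\<dots> = radial_kernel (\<lambda>x. - j'' (- x)) a w" by (rule laplacian_radial[OF False d1 d2])
      finally show ?thesis using False by (simp add: radial_kernel_def)
    qed
    finally show ?thesis by simp
  qed
  have ki: "(LINT x|lborel. j'' (- x)) = 1" "integrable lborel (\<lambda>x. j'' (- x))"
  proof -
    have c: "continuous_on UNIV (\<lambda>x. - j'' (- x))"
      by (intro continuous_intros continuous_on_compose2[OF k(4)]) auto
    have z: "- j'' (- x) = 0" if "x \<le> B - 1 \<or> B \<le> x" for x
      using that k(7)[of "- x"] k(8)[of "- x"] by (auto simp: B_def)
    have "(LINT x|lborel. - j'' (- x)) = \<tau>' B - \<tau>' (B - 1)"
      by (rule integral_second_derivative_step(1)[OF d2 c _ z]) auto
    also have "\<dots> = - 1" using k(7)[of T] k(8)[of "T + 1"] by (simp add: \<tau>'_def B_def add.commute[of 1])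
    finally show "(LINT x|lborel. j'' (- x)) = 1" by simp
    have "integrable lborel (\<lambda>x. - j'' (- x))"
      by (rule integral_second_derivative_step(2)[OF d2 c _ z]) auto
    then show "integrable lborel (\<lambda>x. j'' (- x))" by simp
  qed
  show ?thesis
  proof (rule exI[of _ B], rule exI[of _ "\<lambda>x. j'' (- x)"], rule exI[of _ q], intro conjI allI impI ballI Ckq lap ki)
    show "exp B < r" using B(2) r by simp
    show "continuous_on UNIV (\<lambda>x. j'' (- x))" by (intro continuous_on_compose2[OF k(4)] continuous_intros) auto
    show "j'' (- x) = 0" if "x \<le> B - 1 \<or> B \<le> x" for x
      using that k(7)[of "- x"] k(8)[of "- x"] by (auto simp: B_def)
    show "0 \<le> j'' (- x)" for x by (rule k(5))
    show "q w = Re (f w) - ln (cmod (w - a))" if w: "w \<in> ball a r" "exp B \<le> cmod (w - a)" for w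
    proof -
      have "w \<noteq> a" using w(2) by auto
      then have "B \<le> ln (cmod (w - a))" using w(2) by (metis exp_le_cancel_iff exp_ln right_minus_eq zero_less_norm_iff)
      then show ?thesis using \<tau>m \<open>w \<noteq> a\<close> by (simp add: q_def)
    qed
    show "t < Re (f w) - ln (cmod (w - a))" if w: "w \<in> cball a (exp B) - {a}" for w
    proof -
      have "w \<in> cball a (r / 2)" using w B(2) by auto
      then have "- M \<le> Re (f w)" using M[of w] abs_Re_le_cmod[of "f w"] by (smt (verit))
      moreover have "cmod (w - a) \<le> exp B" using w by (simp add: dist_norm norm_minus_commute)
      then have "ln (cmod (w - a)) \<le> B" using w by (metis DiffD2 exp_le_cancel_iff exp_ln right_minus_eq singletonI zero_less_norm_iff)
      ultimately show ?thesis using T(3) by (simp add: B_def)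
    qed
    show "t < q w" if w: "w \<in> cball a (exp B)" for w
    proof -
      have "w \<in> cball a (r / 2)" using w B(2) by auto
      then have "- M \<le> Re (f w)" using M[of w] abs_Re_le_cmod[of "f w"] by (smt (verit))
      moreover have "T \<le> (if w = a then c else \<tau> (ln (cmod (w - a))))"
      proof (cases "w = a")
        case True
        then show ?thesis using \<tau>c[of "B - 1"] \<tau>T[of "B - 1"] by simp
      next
        case False
        have "cmod (w - a) \<le> exp B" using w by (simp add: dist_norm norm_minus_commute)
        then have "ln (cmod (w - a)) \<le> B" using False by (metis exp_le_cancel_iff exp_ln right_minus_eq zero_less_norm_iff)
        then show ?thesis using False \<tau>T by simp
      qed
      ultimately show ?thesis using T(3) by (simp add: q_def)
    qed
  qed (rule B(1))
qed

section \<open>The Green function\<close>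

locale green_domain =
  fixes D :: "csphere set" and z0 :: csphere and g :: "csphere \<Rightarrow> ereal"
  assumes dom: "sphere_domain D" and z0D: "z0 \<in> D" and gr: "is_green_function D z0 g"
    and lev: "green_level_condition D g"
begin

abbreviation G :: "csphere \<Rightarrow> real" where "G p \<equiv> real_of_ereal (g p)"

lemma oD: "openin riemann_sphere D" and cD: "connectedin riemann_sphere D"
  using dom by (auto simp: sphere_domain_def)

lemma g_z0: "g z0 = \<infinity>"
  using gr by (auto simp: is_green_function_def)

lemma g_real: "p \<in> D \<Longrightarrow> p \<noteq> z0 \<Longrightarrow> g p = ereal (G p)"
  using gr by (auto simp: is_green_function_def ereal_real)

lemma harm0: "harmonic_on (finite_part (D - {z0})) (\<lambda>z. G (Some z))"
  using gr by (auto simp: is_green_function_def sphere_harmonic_on_def)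

lemma harm1: "None \<in> D \<Longrightarrow> z0 \<noteq> None \<Longrightarrow> harmonic_on (finite_part (sphere_inv ` (D - {z0}))) (\<lambda>w. G (sphere_inv (Some w)))"
  using gr by (auto simp: is_green_function_def sphere_harmonic_on_def)

lemma open_minus_pole: "openin riemann_sphere (D - {z0})"
  using oD closedin_singleton_sphere[of z0] by (simp add: openin_diff)

lemma open_G:
  assumes U: "open U" shows "openin riemann_sphere {p \<in> D - {z0}. G p \<in> U}"
  unfolding openin_riemann_sphere_iff
proof (intro conjI impI)
  have "continuous_on (finite_part (D - {z0})) (\<lambda>z. G (Some z))"
    using harm0 Ck_on_continuous by (auto simp: harmonic_on_def)
  from continuous_open_preimage[OF this open_finite_part[OF open_minus_pole] U]
  have "open (finite_part (D - {z0}) \<inter> (\<lambda>z. G (Some z)) -` U)" .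
  moreover have "finite_part {p \<in> D - {z0}. G p \<in> U} = finite_part (D - {z0}) \<inter> (\<lambda>z. G (Some z)) -` U"
    by (auto simp: finite_part_def)
  ultimately show "open (finite_part {p \<in> D - {z0}. G p \<in> U})" by simp
next
  assume n: "None \<in> {p \<in> D - {z0}. G p \<in> U}"
  let ?S = "{w. sphere_inv (Some w) \<in> D - {z0}}"
  have "None \<in> D" using n by simp
  moreover have "z0 \<noteq> None" using n by (cases z0) auto
  ultimately have nz: "None \<in> D" "z0 \<noteq> None" .
  from harm1[OF nz] have "harmonic_on ?S (\<lambda>w. G (sphere_inv (Some w)))"
    unfolding finite_part_sphere_inv .
  then have "continuous_on ?S (\<lambda>w. G (sphere_inv (Some w)))"
    using Ck_on_continuous by (auto simp: harmonic_on_def)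
  from continuous_open_preimage[OF this open_chart_inf[OF open_minus_pole] U]
  have "open (?S \<inter> (\<lambda>w. G (sphere_inv (Some w))) -` U)" .
  moreover have "0 \<in> ?S \<inter> (\<lambda>w. G (sphere_inv (Some w))) -` U" using n by simp
  ultimately obtain r where r: "0 < r" "ball 0 r \<subseteq> ?S \<inter> (\<lambda>w. G (sphere_inv (Some w))) -` U" using openE by blast
  show "\<exists>R. \<forall>z. R < cmod z \<longrightarrow> Some z \<in> {p \<in> D - {z0}. G p \<in> U}"
  proof (intro exI[of _ "1 / r"] allI impI)
    fix z assume z: "1 / r < cmod z"
    then have z0: "z \<noteq> 0" using r(1) by auto
    then have "1 / cnj z \<in> ball 0 r" using z r(1) by (simp add: norm_divide field_simps)
    then have "1 / cnj z \<in> ?S \<inter> (\<lambda>w. G (sphere_inv (Some w))) -` U" using r(2) by blast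
    then show "Some z \<in> {p \<in> D - {z0}. G p \<in> U}" using z0 by simp
  qed
qed

text \<open>The minimum principle for harmonic functions, read in whichever chart contains q at its
  centre.\<close>

lemma local_min_constant:
  assumes q: "q \<in> D" "q \<noteq> z0" and min: "\<And>p. p \<in> D \<Longrightarrow> p \<noteq> z0 \<Longrightarrow> G q \<le> G p"
  shows "\<exists>V. openin riemann_sphere V \<and> q \<in> V \<and> V \<subseteq> {p \<in> D - {z0}. G p = G q}"
proof (cases q)
  case (Some a)
  have "a \<in> finite_part (D - {z0})" using q Some by (auto simp: finite_part_def)
  then obtain r where r: "0 < r" "ball a r \<subseteq> finite_part (D - {z0})"
    using open_finite_part[OF open_minus_pole] openE by blast
  have sub: "Some w \<in> D - {z0}" if "w \<in> ball a r" for w using r(2) that by (auto simp: finite_part_def)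
  have c: "G (Some w) = G (Some a)" if w: "w \<in> ball a r" for w
  proof (rule harmonic_local_min[OF harmonic_on_subset[OF harm0 r(2)] _ w])
    show "G (Some a) \<le> G (Some z)" if "z \<in> ball a r" for z using min[of "Some z"] sub[OF that] Some by auto
  qed
  have "Some ` ball a r \<subseteq> {p \<in> D - {z0}. G p = G q}"
  proof (rule image_subsetI)
    fix w assume w: "w \<in> ball a r"
    show "Some w \<in> {p \<in> D - {z0}. G p = G q}" using sub[OF w] c[OF w] Some by simp
  qed
  moreover have "openin riemann_sphere (Some ` ball a r)" by (simp add: riemann_sphere_def)
  ultimately show ?thesis using Some r(1) by (intro exI[of _ "Some ` ball a r"]) auto
next
  case None
  let ?S = "{w. sphere_inv (Some w) \<in> D - {z0}}"
  have "None \<in> D" "z0 \<noteq> None" using q None by auto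
  from harm1[OF this] have h: "harmonic_on ?S (\<lambda>w. G (sphere_inv (Some w)))"
    unfolding finite_part_sphere_inv .
  have "0 \<in> ?S" using q None by simp
  then obtain r where r: "0 < r" "ball 0 r \<subseteq> ?S" using open_chart_inf[OF open_minus_pole] openE by blast
  have sub: "sphere_inv (Some w) \<in> D - {z0}" if "w \<in> ball 0 r" for w using r(2) that by auto
  have c: "G (sphere_inv (Some w)) = G (sphere_inv (Some 0))" if w: "w \<in> ball 0 r" for w
  proof (rule harmonic_local_min[OF harmonic_on_subset[OF h r(2)] _ w])
    show "G (sphere_inv (Some 0)) \<le> G (sphere_inv (Some z))" if "z \<in> ball 0 r" for z
      using min[of "sphere_inv (Some z)"] sub[OF that] None by simp
  qed
  let ?V = "{p. \<exists>w\<in>ball 0 r. p = sphere_inv (Some w)}"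
  have "?V \<subseteq> {p \<in> D - {z0}. G p = G q}"
  proof
    fix p assume "p \<in> ?V"
    then obtain w where w: "w \<in> ball 0 r" "p = sphere_inv (Some w)" by blast
    show "p \<in> {p \<in> D - {z0}. G p = G q}" using sub[OF w(1)] c[OF w(1)] w(2) None by simp
  qed
  moreover have "openin riemann_sphere ?V" by (rule openin_chart_inf_image) auto
  moreover have "q \<in> ?V" using None r(1) by (intro CollectI bexI[of _ 0]) auto
  ultimately show ?thesis by blast
qed

definition level :: "real \<Rightarrow> csphere set" where "level t = {p \<in> D. g p > ereal t}"

lemma level_facts:
  "\<exists>ts>0. \<forall>t. 0 < t \<and> t \<le> ts \<longrightarrow> sphere_domain (level t) \<and> riemann_sphere closure_of (level t) \<subseteq> D \<and>
     riemann_sphere frontier_of (level t) = {p \<in> D. g p = ereal t}"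
  using lev unfolding green_level_condition_def level_def rel_compact_in_def Let_def by blast

text \<open>Nonpositive values of g could only occur in the compact part K of D, away from the pole
  and from the boundary. Then G attains its minimum over the punctured domain, the set of minimum
  points is open, and so is the rest of D, which contains the pole; this contradicts
  connectedness.\<close>

lemma green_positive:
  assumes D1: "riemann_sphere closure_of D1 \<subseteq> D" and pos: "\<And>p. p \<in> D - D1 \<Longrightarrow> 0 < g p"
  shows "p \<in> D \<Longrightarrow> 0 < g p"
proof (rule ccontr)
  assume p: "p \<in> D" "\<not> 0 < g p"
  obtain ts where ts: "0 < ts" "\<And>t. 0 < t \<Longrightarrow> t \<le> ts \<Longrightarrow> sphere_domain (level t)" using level_facts by blast
  have oL: "openin riemann_sphere (level ts)" using ts by (auto simp: sphere_domain_def)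
  \<comment> \<open>Outside D1 the function g is positive by assumption, and on the level set it
    exceeds ts > 0. Removing the level set also removes the pole.\<close>
  define K where "K = riemann_sphere closure_of D1 - level ts"
  have K: "compactin riemann_sphere K"
    unfolding K_def by (intro closedin_imp_compactin_sphere closedin_diff closedin_closure_of oL)
  have D1c: "D1 \<subseteq> riemann_sphere closure_of D1" by (rule closure_of_subset) simp
  have z0K: "z0 \<notin> K" using g_z0 z0D by (simp add: K_def level_def)
  have KD: "K \<subseteq> D - {z0}" using z0K D1 by (auto simp: K_def)
  have inK: "q \<in> K" if "q \<in> D" "g q \<le> 0" for q
  proof -
    have "q \<in> D1" using pos[of q] that by fastforce
    moreover have "q \<notin> level ts" using that ts(1) by (cases "g q") (auto simp: level_def)
    ultimately show ?thesis using D1c by (auto simp: K_def)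
  qed
  have cont: "continuous_map (subtopology riemann_sphere (D - {z0})) euclideanreal G"
    unfolding continuous_map_def
  proof (intro conjI allI impI)
    fix U :: "real set" assume "openin euclideanreal U"
    then have o: "openin riemann_sphere {p \<in> D - {z0}. G p \<in> U}" by (intro open_G) simp
    have eq: "{x \<in> topspace (subtopology riemann_sphere (D - {z0})). G x \<in> U} = (D - {z0}) \<inter> {p \<in> D - {z0}. G p \<in> U}" by auto
    show "openin (subtopology riemann_sphere (D - {z0})) {x \<in> topspace (subtopology riemann_sphere (D - {z0})). G x \<in> U}"
      unfolding eq by (rule openin_subtopology_Int2[OF o])
  qed simp
  have "compactin (subtopology riemann_sphere (D - {z0})) K" using K KD by (simp add: compactin_subtopology)
  from image_compactin[OF this cont] have cK: "compact (G ` K)" by simp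
  have "K \<noteq> {}" using inK p by force
  with cK obtain q where q: "q \<in> K" "\<And>p. p \<in> K \<Longrightarrow> G q \<le> G p"
    using compact_attains_inf[of "G ` K"] by auto
  have pz: "p \<noteq> z0" using p g_z0 by auto
  have qD: "q \<in> D" "q \<noteq> z0" using q(1) KD by auto
  have Gp: "G p \<le> 0" using p g_real[OF p(1) pz] by (metis ereal_less(2) not_le)
  have "p \<in> K" using inK p by force
  then have Gq0: "G q \<le> 0" using q(2)[of p] Gp by linarith
  have min: "G q \<le> G p'" if "p' \<in> D" "p' \<noteq> z0" for p'
  proof (cases "p' \<in> K")
    case False
    then have "\<not> g p' \<le> 0" using inK that by blast
    then have "0 < G p'" using g_real[OF that] by (metis ereal_less(2) not_le)
    then show ?thesis using Gq0 by linarith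
  qed (use q(2) in blast)
  define Z where "Z = {p \<in> D - {z0}. G p = G q}"
  have "openin riemann_sphere Z"
  proof (subst openin_subopen, rule ballI)
    fix x assume x: "x \<in> Z"
    then have "x \<in> D" "x \<noteq> z0" "\<And>p. p \<in> D \<Longrightarrow> p \<noteq> z0 \<Longrightarrow> G x \<le> G p" using min by (auto simp: Z_def)
    from local_min_constant[OF this] x show "\<exists>T. openin riemann_sphere T \<and> x \<in> T \<and> T \<subseteq> Z" by (auto simp: Z_def)
  qed
  moreover define E2 where "E2 = {p \<in> D - {z0}. G p \<in> {G q<..}} \<union> level ts"
  have "openin riemann_sphere E2" unfolding E2_def by (intro openin_Un open_G oL) auto
  moreover have "D \<subseteq> Z \<union> E2"
  proof
    fix p assume "p \<in> D"
    then show "p \<in> Z \<union> E2"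
      using min[of p] g_z0 by (cases "p = z0") (auto simp: Z_def E2_def level_def)
  qed
  moreover have "Z \<inter> E2 \<inter> D = {}"
  proof -
    have "G p \<noteq> G q" if "p \<in> level ts" "p \<noteq> z0" for p
    proof -
      have "ereal ts < ereal (G p)" using that g_real[of p] by (simp add: level_def)
      then have "ts < G p" by (simp only: less_ereal.simps)
      then show ?thesis using Gq0 ts(1) by linarith
    qed
    then show ?thesis by (auto simp: Z_def E2_def)
  qed
  moreover have "Z \<inter> D \<noteq> {}" "E2 \<inter> D \<noteq> {}"
    using qD z0D g_z0 by (auto simp: Z_def E2_def level_def)
  ultimately show False using cD unfolding connectedin by blast
qed

text \<open>By definition g + ln |w - a| is bounded and harmonic near the pole, so its singularity
  is removable.\<close>

lemma pole_finite:
  assumes z: "z0 = Some a"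
  shows "\<exists>r f. 0 < r \<and> ball a r \<subseteq> finite_part D \<and> f holomorphic_on ball a r \<and>
    (\<forall>w\<in>ball a r - {a}. G (Some w) = Re (f w) - ln (cmod (w - a)))"
proof -
  obtain B where "\<forall>\<^sub>F w in at a. \<bar>G (Some w) + ln (cmod (w - a))\<bar> \<le> B"
    using gr z by (auto simp: is_green_function_def)
  then obtain d where d: "0 < d" "\<And>w. w \<noteq> a \<Longrightarrow> dist w a < d \<Longrightarrow> \<bar>G (Some w) + ln (cmod (w - a))\<bar> \<le> B"
    by (auto simp: eventually_at)
  have "a \<in> finite_part D" using z0D z by (simp add: finite_part_def)
  then obtain e where e: "0 < e" "ball a e \<subseteq> finite_part D" using open_finite_part[OF oD] openE by blast
  define r where "r = min d e"
  have r: "0 < r" "ball a r \<subseteq> finite_part D" using d e by (auto simp: r_def)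
  have o: "open (ball a r - {a})" by auto
  have "ball a r - {a} \<subseteq> finite_part (D - {z0})" using r z by (auto simp: finite_part_def)
  from harmonic_on_add[OF o harmonic_on_subset[OF harm0 this] harmonic_on_subset[OF harmonic_on_ln_norm[of a]]]
  have h: "harmonic_on (ball a r - {a}) (\<lambda>w. G (Some w) + ln (cmod (w - a)))" by auto
  have "\<bar>G (Some w) + ln (cmod (w - a))\<bar> \<le> B" if "w \<in> ball a r - {a}" for w
    using d(2)[of w] that by (auto simp: r_def dist_commute)
  from bounded_harmonic_removable[OF r(1) h this] obtain f where
    "f holomorphic_on ball a r" "\<forall>w\<in>ball a r - {a}. G (Some w) + ln (cmod (w - a)) = Re (f w)" by blast
  then show ?thesis using r by (intro exI[of _ r] exI[of _ f]) (auto simp: algebra_simps)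
qed

text \<open>As for a finite pole, with ln |z| = -ln |w| in the inversion chart. The form w - 0 is
  kept so that \<open>truncate_log_pole\<close> applies with a = 0.\<close>

lemma pole_infinite:
  assumes z: "z0 = None"
  shows "\<exists>r f. 0 < r \<and> (\<forall>w\<in>ball 0 r. sphere_inv (Some w) \<in> D) \<and> f holomorphic_on ball 0 r \<and>
    (\<forall>w\<in>ball 0 r - {0}. G (sphere_inv (Some w)) = Re (f w) - ln (cmod (w - 0)))"
proof -
  obtain B where "\<forall>\<^sub>F w in at_infinity. \<bar>G (Some w) - ln (cmod w)\<bar> \<le> B"
    using gr z by (auto simp: is_green_function_def)
  then obtain R where R: "\<And>w. R \<le> cmod w \<Longrightarrow> \<bar>G (Some w) - ln (cmod w)\<bar> \<le> B"
    by (auto simp: eventually_at_infinity)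
  obtain e where e: "0 < e" "\<forall>w\<in>ball 0 e. sphere_inv (Some w) \<in> D" using sphere_chart_inf[OF oD] z0D z by blast
  define r where "r = min e (1 / (\<bar>R\<bar> + 1))"
  have r: "0 < r" "r \<le> e" "r \<le> 1 / (\<bar>R\<bar> + 1)" using e by (auto simp: r_def add_nonneg_pos)
  let ?P = "ball 0 r - {0 :: complex}"
  have o: "open ?P" by auto
  have im: "1 / cnj w \<in> finite_part (D - {z0})" if "w \<in> ?P" for w
    using e(2) that r(2) z by (auto simp: finite_part_def dest!: bspec[of _ _ w])
  have h0: "harmonic_on ?P (\<lambda>w. G (Some (1 / cnj w)))"
    unfolding harmonic_on_def
  proof (intro conjI ballI)
    have ck: "Ck_on 2 (finite_part (D - {z0})) (\<lambda>z. G (Some z))"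
      and l: "\<And>z. z \<in> finite_part (D - {z0}) \<Longrightarrow> laplacian (\<lambda>z. G (Some z)) z = 0"
      using harm0 by (auto simp: harmonic_on_def)
    show "Ck_on 2 ?P (\<lambda>w. G (Some (1 / cnj w)))" by (rule Ck_on_inversion[OF o _ im ck]) auto
    fix w assume w: "w \<in> ?P"
    then show "laplacian (\<lambda>w. G (Some (1 / cnj w))) w = 0"
      using laplacian_inversion[OF open_finite_part[OF open_minus_pole] ck im[OF w]] l[OF im[OF w]] by auto
  qed
  have "harmonic_on ?P (\<lambda>w. G (sphere_inv (Some w)))"
    by (rule harmonic_on_cong[OF o h0]) auto
  from harmonic_on_add[OF o this harmonic_on_subset[OF harmonic_on_ln_norm[of 0]]]
  have h: "harmonic_on ?P (\<lambda>w. G (sphere_inv (Some w)) + ln (cmod (w - 0)))" by auto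
  have "\<bar>G (sphere_inv (Some w)) + ln (cmod (w - 0))\<bar> \<le> B" if w: "w \<in> ?P" for w
  proof -
    have w0: "w \<noteq> 0" "cmod w < 1 / (\<bar>R\<bar> + 1)" using w r(3) by auto
    then have "\<bar>R\<bar> + 1 < 1 / cmod w" by (simp add: field_simps)
    then have "R \<le> cmod (1 / cnj w)" by (simp add: norm_divide)
    from R[OF this] show ?thesis using w0 by (simp add: norm_divide ln_div)
  qed
  from bounded_harmonic_removable[OF r(1) h this] obtain f where
    "f holomorphic_on ball 0 r" "\<forall>w\<in>?P. G (sphere_inv (Some w)) + ln (cmod (w - 0)) = Re (f w)" by blast
  then have "\<forall>w\<in>?P. G (sphere_inv (Some w)) = Re (f w) - ln (cmod (w - 0))" by (simp add: eq_diff_eq)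
  then show ?thesis using r e \<open>f holomorphic_on ball 0 r\<close> by (intro exI[of _ r], intro exI[of _ f]) simp
qed

end

section \<open>Smoothing the pole of the Green function, and the inequality on a collar\<close>

context green_domain
begin

text \<open>q is G with the pole smoothed. Where q differs from G both exceed t, so collars below t
  do not see the change. L is minus 2 pi times a probability density near z0, in both charts
  expressed as a function on the plane; the last clause is the submean inequality of u at z0. It
  depends on u through the radius up to which that inequality is known.\<close>

definition regularized :: "real \<Rightarrow> (csphere \<Rightarrow> ereal) \<Rightarrow> (csphere \<Rightarrow> real) \<Rightarrow> bool" where
  "regularized t u q \<longleftrightarrow> (\<forall>n. Ck_on n (finite_part D) (\<lambda>z. q (Some z))) \<and>
     (None \<in> D \<longrightarrow> (\<exists>r>0. (\<forall>w\<in>ball 0 r. sphere_inv (Some w) \<in> D) \<and> (\<forall>n. Ck_on n (ball 0 r) (\<lambda>w. q (sphere_inv (Some w)))))) \<and>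
     (\<forall>p\<in>D. (p \<noteq> z0 \<and> q p = G p) \<or> (t < q p \<and> ereal t < g p)) \<and>
     (\<forall>z. Some z \<in> D \<and> g (Some z) \<le> ereal t \<longrightarrow> laplacian (\<lambda>z. q (Some z)) z = 0) \<and>
     (let L = (\<lambda>z. if Some z \<in> D then laplacian (\<lambda>z. q (Some z)) z else 0) in
       integrable lborel L \<and> (LINT z|lborel. L z) = - 2 * pi \<and>
       integrable lborel (\<lambda>z. real_of_ereal (u (Some z)) * L z) \<and>
       (u z0 \<noteq> -\<infinity> \<longrightarrow> (LINT z|lborel. real_of_ereal (u (Some z)) * L z) \<le> - 2 * pi * real_of_ereal (u z0)))"

lemma green_smooth_finite: "S \<subseteq> finite_part (D - {z0}) \<Longrightarrow> Ck_on n S (\<lambda>z. G (Some z))"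
  using Ck_on_subset[OF harmonic_on_smooth[OF open_finite_part[OF open_minus_pole] harm0]] .

lemma green_laplacian_zero: "Some z \<in> D \<Longrightarrow> Some z \<noteq> z0 \<Longrightarrow> laplacian (\<lambda>z. G (Some z)) z = 0"
  using harm0 by (auto simp: harmonic_on_def finite_part_def)

lemma regularized_exists_finite:
  assumes u: "sphere_subharmonic_on D u" "\<exists>p\<in>D. u p \<noteq> -\<infinity>" and z: "z0 = Some a"
  shows "\<exists>q. regularized t u q"
proof -
  obtain r f where r: "0 < r" "ball a r \<subseteq> finite_part D" and f: "f holomorphic_on ball a r"
    and Gf: "\<And>w. w \<in> ball a r - {a} \<Longrightarrow> G (Some w) = Re (f w) - ln (cmod (w - a))"
    using pole_finite[OF z] by blast
  have us: "subharmonic_on (finite_part D) (\<lambda>z. u (Some z))" using u by (auto simp: sphere_subharmonic_on_def)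
  have aD: "a \<in> finite_part D" using z z0D by (simp add: finite_part_def)
  obtain \<rho> where \<rho>: "0 < \<rho>" "\<And>r. 0 < r \<Longrightarrow> r < \<rho> \<Longrightarrow> u (Some a) \<le> circle_mean (\<lambda>z. u (Some z)) a r"
    using us aD by (auto simp: subharmonic_on_def)
  obtain B k qq where B: "exp B < \<rho>" "exp B < r" and k: "continuous_on UNIV k" "\<And>x. x \<le> B - 1 \<or> B \<le> x \<Longrightarrow> k x = 0"
    "\<And>x. 0 \<le> k x" "(LINT x|lborel. k x) = 1" "integrable lborel k"
    and qq: "\<And>n. Ck_on n (ball a r) qq" "\<And>w. w \<in> ball a r \<Longrightarrow> exp B \<le> cmod (w - a) \<Longrightarrow> qq w = Re (f w) - ln (cmod (w - a))"
    "\<And>w. w \<in> cball a (exp B) \<Longrightarrow> t < qq w" "\<And>w. w \<in> cball a (exp B) - {a} \<Longrightarrow> t < Re (f w) - ln (cmod (w - a))"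
    "\<And>w. w \<in> ball a r \<Longrightarrow> laplacian qq w = - radial_kernel k a w"
    using truncate_log_pole[OF f r(1) \<rho>(1), of t] by - (elim exE conjE, rule that;
      (assumption | (erule bspec, assumption) | (erule allE, erule mp, assumption) | (drule (1) bspec, erule (1) mp) | (erule spec)))
  have sub: "cball a (exp B) \<subseteq> ball a r" using B(2) by auto
  define q where "q = (\<lambda>p. if p \<in> Some ` cball a (exp B) then qq (finite_point p) else G p)"
  have qb: "q (Some w) = qq w" if w: "w \<in> ball a r" for w
  proof (cases "w \<in> cball a (exp B)")
    case True then show ?thesis by (simp add: q_def finite_point_def)
  next
    case False
    then have "exp B < cmod (w - a)" by (simp add: dist_norm norm_minus_commute)
    moreover from this have "w \<noteq> a" by auto
    ultimately show ?thesis using False qq(2)[OF w] Gf[of w] w by (auto simp: q_def)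
  qed
  have qG: "q p = G p" if "p \<notin> Some ` cball a (exp B)" for p using that by (simp add: q_def)
  \<comment> \<open>W and the ball of radius r about a are open and cover D: on W the function q is
    the harmonic G, on the ball it is the truncated pole.\<close>
  define W where "W = finite_part (D - {z0}) - cball a (exp B)"
  have W: "open W" using open_finite_part[OF open_minus_pole] unfolding W_def by (intro open_Diff) auto
  have qW: "q (Some w) = G (Some w)" if "w \<in> W" for w using that by (intro qG) (auto simp: W_def)
  have cover: "z \<in> ball a r \<or> z \<in> W" if "z \<in> finite_part D" for z
    using that sub z r(1) by (auto simp: W_def finite_part_def)
  have CkW: "Ck_on n W (\<lambda>z. q (Some z))" for n
    by (rule Ck_on_cong[OF W _ green_smooth_finite]) (use qW in \<open>auto simp: W_def\<close>)
  have Ckb: "Ck_on n (ball a r) (\<lambda>z. q (Some z))" for n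
    by (rule Ck_on_cong[OF open_ball _ qq(1)]) (use qb in auto)
  have Ck: "Ck_on n (finite_part D) (\<lambda>z. q (Some z))" for n
  proof (rule Ck_on_local)
    fix z assume "z \<in> finite_part D"
    from cover[OF this] show "\<exists>U. open U \<and> z \<in> U \<and> Ck_on n U (\<lambda>z. q (Some z))"
      using CkW Ckb W open_ball by blast
  qed
  have inf: "\<exists>r>0. (\<forall>w\<in>ball 0 r. sphere_inv (Some w) \<in> D) \<and> (\<forall>n. Ck_on n (ball 0 r) (\<lambda>w. q (sphere_inv (Some w))))"
    if n: "None \<in> D"
  proof -
    have "closedin riemann_sphere (Some ` cball a (exp B))" by (simp add: riemann_sphere_def)
    then have oV: "openin riemann_sphere (D - {z0} - Some ` cball a (exp B))" using open_minus_pole by (rule openin_diff[rotated])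
    have "None \<in> D - {z0} - Some ` cball a (exp B)" using n z by auto
    then obtain r1 where r1: "0 < r1" "\<And>w. w \<in> ball 0 r1 \<Longrightarrow> sphere_inv (Some w) \<in> D - {z0} - Some ` cball a (exp B)"
      using sphere_chart_inf[OF oV] by blast
    have s: "ball 0 r1 \<subseteq> finite_part (sphere_inv ` (D - {z0}))" unfolding finite_part_sphere_inv using r1(2) by blast
    have "z0 \<noteq> None" using z by simp
    from harmonic_on_smooth[OF open_ball harmonic_on_subset[OF harm1[OF n this] s]]
    have h: "Ck_on n (ball 0 r1) (\<lambda>w. G (sphere_inv (Some w)))" for n .
    have "Ck_on n (ball 0 r1) (\<lambda>w. q (sphere_inv (Some w)))" for n
      by (rule Ck_on_cong[OF open_ball _ h]) (use r1(2) qG in auto)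
    then show ?thesis using r1 by blast
  qed
  define L where "L = (\<lambda>z. if Some z \<in> D then laplacian (\<lambda>z. q (Some z)) z else 0)"
  have lapW: "laplacian (\<lambda>z. q (Some z)) w = 0" if "w \<in> W" for w
    using laplacian_cong_open[OF W that qW] green_laplacian_zero[of w] that by (auto simp: W_def finite_part_def)
  have lapb: "laplacian (\<lambda>z. q (Some z)) w = - radial_kernel k a w" if "w \<in> ball a r" for w
    using laplacian_cong_open[OF open_ball that qb] qq(5)[OF that] by simp
  have rk0: "radial_kernel k a w = 0" if "w \<notin> cball a (exp B)" for w
    using that by (intro radial_kernel_zero[OF k(2)]) (auto simp: dist_norm norm_minus_commute)
  have Lk: "L = (\<lambda>w. - radial_kernel k a w)"
  proof
    fix w show "L w = - radial_kernel k a w"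
    proof (cases "Some w \<in> D")
      case True
      then have "w \<in> ball a r \<or> w \<in> W" using cover by (simp add: finite_part_def)
      then show ?thesis using lapb[of w] lapW[of w] rk0[of w] True by (auto simp: L_def W_def)
    next
      case False
      then have "w \<notin> cball a (exp B)" using sub r(2) by (auto simp: finite_part_def)
      then show ?thesis using rk0 False by (simp add: L_def)
    qed
  qed
  note tot = radial_kernel_total[OF k(1,2)]
  have li: "loc_integrable (finite_part D) (\<lambda>z. real_of_ereal (u (Some z)))"
    by (rule sphere_subharmonic_loc_integrable(1)[OF dom u])
  have iu: "integrable lborel (\<lambda>z. real_of_ereal (u (Some z)) * radial_kernel k a z)"
    by (rule integrable_radial_kernel[OF k(1,2) li]) (use sub r(2) in auto)
  have mean: "2 * pi * real_of_ereal (u z0) \<le> (LINT z|lborel. real_of_ereal (u (Some z)) * radial_kernel k a z)"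
    if "u z0 \<noteq> -\<infinity>"
  proof (rule radial_kernel_subharmonic[OF k iu])
    have "u (Some a) < \<infinity>" using us aD by (auto simp: subharmonic_on_def)
    then have e: "ereal (real_of_ereal (u z0)) = u (Some a)" using that z by (cases "u (Some a)") auto
    show "ereal (real_of_ereal (u z0)) \<le> circle_mean (\<lambda>z. u (Some z)) a r" if "0 < r" "r < exp B" for r
      unfolding e using \<rho>(2) that B by simp
    show "u (Some w) < \<infinity>" if "w \<in> ball a (exp B)" for w
    proof -
      have "w \<in> finite_part D" using that sub r(2) ball_subset_cball by blast
      then show ?thesis using us by (auto simp: subharmonic_on_def)
    qed
  qed
  have dich: "(p \<noteq> z0 \<and> q p = G p) \<or> (t < q p \<and> ereal t < g p)" if p: "p \<in> D" for p
  proof (cases "p \<in> Some ` cball a (exp B)")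
    case True
    then obtain w where w: "w \<in> cball a (exp B)" "p = Some w" by blast
    have "t < q p" using qq(3)[OF w(1)] qb[of w] w sub by auto
    moreover have "ereal t < g p"
    proof (cases "w = a")
      case True then show ?thesis using g_z0 z w by simp
    next
      case False
      then have "t < G p" using qq(4)[of w] Gf[of w] w sub by auto
      moreover have "g p = ereal (G p)" using g_real[OF p] False w z by auto
      ultimately show ?thesis by (metis less_ereal.simps(1))
    qed
    ultimately show ?thesis by blast
  next
    case False
    then show ?thesis using qG[OF False] z by auto
  qed
  have lap0: "laplacian (\<lambda>z. q (Some z)) w = 0" if w: "Some w \<in> D" "g (Some w) \<le> ereal t" for w
  proof -
    have "w \<notin> cball a (exp B)"
    proof
      assume wc: "w \<in> cball a (exp B)"
      show False
      proof (cases "w = a")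
        case True then show False using g_z0 z w by simp
      next
        case False
        then have "t < G (Some w)" using qq(4)[of w] Gf[of w] wc sub by auto
        moreover have "g (Some w) = ereal (G (Some w))" using g_real[OF w(1)] False z by auto
        ultimately show False using w(2) by (metis ereal_less_eq(3) not_le)
      qed
    qed
    moreover have "Some w \<noteq> z0" using w(2) g_z0 by auto
    ultimately show ?thesis using w lapW[of w] by (auto simp: W_def finite_part_def)
  qed
  have "regularized t u q"
    unfolding regularized_def Let_def L_def[symmetric]
  proof (intro conjI allI impI ballI)
    show "integrable lborel L" "(LINT z|lborel. L z) = - 2 * pi"
      unfolding Lk using tot k(4) by auto
    show "integrable lborel (\<lambda>z. real_of_ereal (u (Some z)) * L z)" unfolding Lk using iu by simp
    show "(LINT z|lborel. real_of_ereal (u (Some z)) * L z) \<le> - 2 * pi * real_of_ereal (u z0)" if "u z0 \<noteq> -\<infinity>"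
      unfolding Lk using mean[OF that] by simp
  qed (use Ck inf dich lap0 in blast)+
  then show ?thesis by blast
qed

text \<open>The construction for a finite pole, carried out at 0 in the inversion chart;
  \<open>laplacian_inversion\<close> and \<open>inversion_integral\<close> return the results to the
  plane, where \<open>regularized\<close> states them.\<close>

lemma regularized_exists_infinite:
  assumes u: "sphere_subharmonic_on D u" "\<exists>p\<in>D. u p \<noteq> -\<infinity>" and z: "z0 = None"
  shows "\<exists>q. regularized t u q"
proof -
  obtain r f where r: "0 < r" "\<And>w. w \<in> ball 0 r \<Longrightarrow> sphere_inv (Some w) \<in> D" and f: "f holomorphic_on ball 0 r"
    and Gf: "\<And>w. w \<in> ball 0 r - {0} \<Longrightarrow> G (sphere_inv (Some w)) = Re (f w) - ln (cmod (w - 0))"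
    using pole_infinite[OF z] by blast
  have nD: "None \<in> D" using z z0D by simp
  have us: "subharmonic_on {w. sphere_inv (Some w) \<in> D} (\<lambda>w. u (sphere_inv (Some w)))"
    using u nD by (auto simp: sphere_subharmonic_on_def finite_part_sphere_inv)
  have aD: "0 \<in> {w. sphere_inv (Some w) \<in> D}" using nD by simp
  obtain \<rho> where \<rho>: "0 < \<rho>" "\<And>r. 0 < r \<Longrightarrow> r < \<rho> \<Longrightarrow> u None \<le> circle_mean (\<lambda>w. u (sphere_inv (Some w))) 0 r"
    using us aD unfolding subharmonic_on_def by (metis sphere_inv_simps(2))
  obtain B k qq where B: "exp B < \<rho>" "exp B < r" and k: "continuous_on UNIV k" "\<And>x. x \<le> B - 1 \<or> B \<le> x \<Longrightarrow> k x = 0"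
    "\<And>x. 0 \<le> k x" "(LINT x|lborel. k x) = 1" "integrable lborel k"
    and qq: "\<And>n. Ck_on n (ball 0 r) qq" "\<And>w. w \<in> ball 0 r \<Longrightarrow> exp B \<le> cmod (w - 0) \<Longrightarrow> qq w = Re (f w) - ln (cmod (w - 0))"
    "\<And>w. w \<in> cball 0 (exp B) \<Longrightarrow> t < qq w" "\<And>w. w \<in> cball 0 (exp B) - {0} \<Longrightarrow> t < Re (f w) - ln (cmod (w - 0))"
    "\<And>w. w \<in> ball 0 r \<Longrightarrow> laplacian qq w = - radial_kernel k 0 w"
    using truncate_log_pole[OF f r(1) \<rho>(1), of t] by - (elim exE conjE, rule that;
      (assumption | (erule bspec, assumption) | (erule allE, erule mp, assumption) | (drule (1) bspec, erule (1) mp) | (erule spec)))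
  have sub: "cball 0 (exp B) \<subseteq> (ball 0 r :: complex set)" using B(2) by auto
  \<comment> \<open>The inverse of \<open>Some 0\<close> is infinity, to which
    \<open>finite_point\<close> assigns the dummy value 0. Without the second condition the origin
    would be mistaken for the pole.\<close>
  define q where "q = (\<lambda>p. if finite_point (sphere_inv p) \<in> cball 0 (exp B) \<and> p \<noteq> Some 0 then qq (finite_point (sphere_inv p)) else G p)"
  have fp: "finite_point (sphere_inv (sphere_inv (Some w))) = w" "sphere_inv (Some w) \<noteq> Some 0" for w
    by (simp add: finite_point_def, cases "w = 0", auto)
  have fpw [simp]: "finite_point (Some w) = w" for w by (simp add: finite_point_def)
  have fps: "finite_point (sphere_inv (Some v)) = 1 / cnj v" for v
    by (cases "v = 0") (auto simp: finite_point_def)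
  have qb: "q (sphere_inv (Some w)) = qq w" if w: "w \<in> ball 0 r" for w
  proof (cases "w \<in> cball 0 (exp B)")
    case True then show ?thesis using fp[of w] by (simp only: q_def) simp
  next
    case False
    then have "exp B < cmod (w - 0)" by simp
    moreover from this have "w \<noteq> 0" by auto
    ultimately show ?thesis using False qq(2)[OF w] Gf[of w] w by (auto simp: q_def fp)
  qed
  define K where "K = {w. w \<noteq> 0 \<and> 1 / cnj w \<in> cball 0 (exp B)}"
  have Kc: "K = - ball 0 (exp (- B))"
  proof (rule set_eqI)
    fix w :: complex
    show "w \<in> K \<longleftrightarrow> w \<in> - ball 0 (exp (- B))"
      by (cases "w = 0") (auto simp: K_def norm_divide exp_minus field_simps not_less)
  qed
  have qG: "q (Some w) = G (Some w)" if "w \<notin> K" for w using that by (auto simp: q_def fps K_def)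
  define W where "W = finite_part (D - {z0}) - K"
  have W: "open W" using open_finite_part[OF open_minus_pole] unfolding W_def Kc by (intro open_Diff) auto
  have qW: "q (Some w) = G (Some w)" if "w \<in> W" for w using that by (intro qG) (auto simp: W_def)
  define V where "V = - cball (0::complex) (1 / r)"
  have V: "open V" by (auto simp: V_def)
  have Vr: "1 / cnj w \<in> ball 0 r" "w \<noteq> 0" if "w \<in> V" for w
  proof -
    have w: "1 / r < cmod w" using that by (simp add: V_def)
    then show w0: "w \<noteq> 0" using r(1) by auto
    show "1 / cnj w \<in> ball 0 r" using w w0 r(1) by (simp add: norm_divide field_simps)
  qed
  have KV: "K \<subseteq> V"
  proof
    fix w assume w: "w \<in> K"
    then have "w \<noteq> 0" "1 / cmod w < r" using B(2) by (auto simp: K_def norm_divide)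
    then show "w \<in> V" using r(1) by (simp add: V_def field_simps not_le)
  qed
  have qV: "q (Some w) = qq (1 / cnj w)" if "w \<in> V" for w
    using qb[OF Vr(1)[OF that]] Vr(2)[OF that] by simp
  have cover: "z \<in> V \<or> z \<in> W" if "z \<in> finite_part D" for z
    using that KV z by (auto simp: W_def finite_part_def)
  have CkW: "Ck_on n W (\<lambda>z. q (Some z))" for n
    by (rule Ck_on_cong[OF W _ green_smooth_finite]) (use qW in \<open>auto simp: W_def\<close>)
  have "0 \<notin> V" using r(1) by (simp add: V_def)
  have CkV: "Ck_on n V (\<lambda>z. q (Some z))" for n
    by (rule Ck_on_cong[OF V _ Ck_on_inversion[OF V \<open>0 \<notin> V\<close> Vr(1) qq(1)]]) (use qV in auto)
  have Ck: "Ck_on n (finite_part D) (\<lambda>z. q (Some z))" for n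
  proof (rule Ck_on_local)
    fix z assume "z \<in> finite_part D"
    from cover[OF this] show "\<exists>U. open U \<and> z \<in> U \<and> Ck_on n U (\<lambda>z. q (Some z))"
      using CkW CkV W V by blast
  qed
  have inf: "\<exists>r>0. (\<forall>w\<in>ball 0 r. sphere_inv (Some w) \<in> D) \<and> (\<forall>n. Ck_on n (ball 0 r) (\<lambda>w. q (sphere_inv (Some w))))"
  proof -
    have "Ck_on n (ball 0 r) (\<lambda>w. q (sphere_inv (Some w)))" for n
      by (rule Ck_on_cong[OF open_ball _ qq(1)]) (use qb in auto)
    then show ?thesis using r by blast
  qed
  define L where "L = (\<lambda>z. if Some z \<in> D then laplacian (\<lambda>z. q (Some z)) z else 0)"
  have lapW: "laplacian (\<lambda>z. q (Some z)) w = 0" if "w \<in> W" for w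
    using laplacian_cong_open[OF W that qW] green_laplacian_zero[of w] that by (auto simp: W_def finite_part_def)
  have lapV: "laplacian (\<lambda>z. q (Some z)) w = - radial_kernel k 0 (1 / cnj w) / cmod w ^ 4" if w: "w \<in> V" for w
    using laplacian_cong_open[OF V w qV] laplacian_inversion[OF open_ball qq(1) Vr[OF w]] qq(5)[OF Vr(1)[OF w]] by simp
  have rk0: "radial_kernel k 0 (1 / cnj w) = 0" if "w \<notin> K" for w
  proof (cases "w = 0")
    case True then show ?thesis by (simp add: radial_kernel_def)
  next
    case False
    then show ?thesis using that by (intro radial_kernel_zero[OF k(2)]) (auto simp: K_def)
  qed
  have Lk: "L = (\<lambda>w. - radial_kernel k 0 (1 / cnj w) / cmod w ^ 4)"
  proof
    fix w show "L w = - radial_kernel k 0 (1 / cnj w) / cmod w ^ 4"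
    proof (cases "Some w \<in> D")
      case True
      then have "w \<in> V \<or> w \<in> W" using cover by (simp add: finite_part_def)
      then show ?thesis using lapV[of w] lapW[of w] rk0[of w] True by (auto simp: L_def W_def)
    next
      case False
      have "w \<notin> K"
      proof
        assume "w \<in> K"
        then have "sphere_inv (Some (1 / cnj w)) \<in> D" using KV Vr by (intro r(2)) blast
        then show False using False \<open>w \<in> K\<close> by (simp add: K_def)
      qed
      then show ?thesis using rk0 False by (simp add: L_def)
    qed
  qed
  note tot = radial_kernel_total[OF k(1,2)]
  have mk: "(\<lambda>w. - radial_kernel k 0 w) \<in> borel_measurable borel"
    by (intro borel_measurable_continuous_onI continuous_on_minus continuous_radial_kernel[OF k(1,2)])
  have li: "loc_integrable {w. sphere_inv (Some w) \<in> D} (\<lambda>w. real_of_ereal (u (sphere_inv (Some w))))"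
    using sphere_subharmonic_loc_integrable(2)[OF dom u nD] unfolding finite_part_sphere_inv .
  have iu: "integrable lborel (\<lambda>w. real_of_ereal (u (sphere_inv (Some w))) * radial_kernel k 0 w)"
    by (rule integrable_radial_kernel[OF k(1,2) li]) (use sub r(2) in auto)
  define fu where "fu = (\<lambda>w. real_of_ereal (u (sphere_inv (Some w))) * - radial_kernel k 0 w)"
  have ifu: "integrable lborel fu" "(LINT w|lborel. fu w) = - (LINT w|lborel. real_of_ereal (u (sphere_inv (Some w))) * radial_kernel k 0 w)"
    unfolding fu_def using iu by simp_all
  have mfu: "fu \<in> borel_measurable borel" using borel_measurable_integrable[OF ifu(1)] by simp
  have uL: "real_of_ereal (u (Some z)) * L z = fu (1 / cnj z) / cmod z ^ 4" for z
    unfolding Lk fu_def by (cases "z = 0") simp_all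
  have mean: "2 * pi * real_of_ereal (u z0) \<le> (LINT w|lborel. real_of_ereal (u (sphere_inv (Some w))) * radial_kernel k 0 w)"
    if "u z0 \<noteq> -\<infinity>"
  proof (rule radial_kernel_subharmonic[OF k iu])
    have "u (sphere_inv (Some 0)) < \<infinity>" using us aD unfolding subharmonic_on_def by blast
    then have e: "ereal (real_of_ereal (u z0)) = u None" using that z by (cases "u None") auto
    show "ereal (real_of_ereal (u z0)) \<le> circle_mean (\<lambda>w. u (sphere_inv (Some w))) 0 r" if "0 < r" "r < exp B" for r
      unfolding e using \<rho>(2) that B by simp
    show "u (sphere_inv (Some w)) < \<infinity>" if "w \<in> ball 0 (exp B)" for w
    proof -
      have "w \<in> {w. sphere_inv (Some w) \<in> D}" using that sub r(2) ball_subset_cball by blast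
      then show ?thesis using us unfolding subharmonic_on_def by blast
    qed
  qed
  have big: "t < q p \<and> ereal t < g p" if p: "p \<in> D" "p = sphere_inv (Some w)" "w \<in> cball 0 (exp B)" for p w
  proof
    show "t < q p" using qq(3)[OF p(3)] qb[of w] p sub by auto
    show "ereal t < g p"
    proof (cases "w = 0")
      case True then show ?thesis using g_z0 z p by simp
    next
      case False
      then have "t < G p" using qq(4)[of w] Gf[of w] p sub by auto
      moreover have "g p = ereal (G p)" using g_real[OF p(1)] False p(2) z by auto
      ultimately show ?thesis by (metis less_ereal.simps(1))
    qed
  qed
  have dich: "(p \<noteq> z0 \<and> q p = G p) \<or> (t < q p \<and> ereal t < g p)" if p: "p \<in> D" for p
  proof (cases p)
    case None
    then show ?thesis using big[OF p, of 0] by simp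
  next
    case (Some w)
    show ?thesis
    proof (cases "w \<in> K")
      case True
      then show ?thesis using big[OF p, of "1 / cnj w"] Some by (simp add: K_def)
    next
      case False
      then show ?thesis using qG[OF False] z Some by auto
    qed
  qed
  have lap0: "laplacian (\<lambda>z. q (Some z)) w = 0" if w: "Some w \<in> D" "g (Some w) \<le> ereal t" for w
  proof -
    have "w \<notin> K" using big[OF w(1), of "1 / cnj w"] w(2) by (auto simp: K_def)
    then show ?thesis using w z lapW[of w] by (auto simp: W_def finite_part_def)
  qed
  have "regularized t u q"
    unfolding regularized_def Let_def L_def[symmetric]
  proof (intro conjI allI impI ballI)
    show "integrable lborel L"
      unfolding Lk using inversion_integral(1)[OF mk] tot(1) by simp
    show "(LINT z|lborel. L z) = - 2 * pi"
      unfolding Lk using inversion_integral(2)[OF mk] tot(2) k(4) by simp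
    show "integrable lborel (\<lambda>z. real_of_ereal (u (Some z)) * L z)"
      unfolding uL using inversion_integral(1)[OF mfu] ifu(1) by simp
    show "(LINT z|lborel. real_of_ereal (u (Some z)) * L z) \<le> - 2 * pi * real_of_ereal (u z0)" if "u z0 \<noteq> -\<infinity>"
      unfolding uL using inversion_integral(2)[OF mfu] ifu(2) mean[OF that] by simp
  qed (use Ck inf dich lap0 in blast)+
  then show ?thesis by blast
qed

lemma regularized_exists:
  assumes "sphere_subharmonic_on D u" "\<exists>p\<in>D. u p \<noteq> -\<infinity>"
  shows "\<exists>q. regularized t u q"
  using regularized_exists_finite[OF assms] regularized_exists_infinite[OF assms] by (cases z0) auto

text \<open>Jensen's inequality for the smoothed function \<open>c \<circ> q\<close>, c the smooth ramp: the mass of the Laplacian on the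
  collar \<open>s \<le> g \<le> s'\<close> equals \<open>2 \<pi>\<close> because the total integral of a Laplacian vanishes.\<close>

lemma collar_estimate:
  assumes u: "sphere_subharmonic_on D u" "\<exists>p\<in>D. u p \<noteq> -\<infinity>" and \<nu>: "is_riesz_measure D u \<nu>"
    and q: "regularized t u q" and s: "0 < s" "s < s'" "s' \<le> t"
    and K: "riemann_sphere closure_of (level (s / 2)) \<subseteq> D"
    and m: "\<And>p. p \<in> D \<Longrightarrow> ereal s \<le> g p \<Longrightarrow> g p \<le> ereal s' \<Longrightarrow> u p \<le> ereal m"
  defines "U \<equiv> 1 / (2 * pi) * (LINT z|lborel. real_of_ereal (u (Some z)) * (if Some z \<in> D then laplacian (\<lambda>z. q (Some z)) z else 0))"
  shows "0 \<le> m + U" "(\<integral>\<^sup>+p\<in>D - level t. ennreal (G p - s') \<partial>\<nu>) \<le> ennreal (m + U)"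
proof -
  define L where "L = (\<lambda>z. if Some z \<in> D then laplacian (\<lambda>z. q (Some z)) z else 0)"
  have Ck: "\<And>n. Ck_on n (finite_part D) (\<lambda>z. q (Some z))"
    and inf: "None \<in> D \<Longrightarrow> \<exists>r>0. (\<forall>w\<in>ball 0 r. sphere_inv (Some w) \<in> D) \<and> (\<forall>n. Ck_on n (ball 0 r) (\<lambda>w. q (sphere_inv (Some w))))"
    and dich: "\<And>p. p \<in> D \<Longrightarrow> (p \<noteq> z0 \<and> q p = G p) \<or> (t < q p \<and> ereal t < g p)"
    and lap0: "\<And>z. Some z \<in> D \<Longrightarrow> g (Some z) \<le> ereal t \<Longrightarrow> laplacian (\<lambda>z. q (Some z)) z = 0"
    and L: "integrable lborel L" "(LINT z|lborel. L z) = - 2 * pi"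
    "integrable lborel (\<lambda>z. real_of_ereal (u (Some z)) * L z)"
    using q unfolding regularized_def Let_def L_def[symmetric] by blast+
  obtain c c' c'' where k: "\<And>k. Ck_real k c" "\<And>x. (c has_real_derivative c' x) (at x)"
    "\<And>x. (c' has_real_derivative c'' x) (at x)" "\<And>x. 0 \<le> c'' x"
    "\<And>x. 0 \<le> c x \<and> x - s' \<le> c x" "\<And>x. x \<le> s \<Longrightarrow> c x = 0 \<and> c' x = 0 \<and> c'' x = 0"
    "\<And>x. s' \<le> x \<Longrightarrow> c x = x - s' + c s' \<and> c' x = 1 \<and> c'' x = 0"
    using smooth_ramp[OF s(2)] by (elim exE conjE, intro that) blast+
  define F where "F = (\<lambda>p. if p \<in> D then c (q p) else 0)"
  \<comment> \<open>Outside the level set of s / 2 one has q = G <= s / 2 < s, where the ramp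
    vanishes. The closure is a compact support inside D, with room below s.\<close>
  define K' where "K' = riemann_sphere closure_of (level (s / 2))"
  have K': "closedin riemann_sphere K'" "K' \<subseteq> D" "level (s / 2) \<subseteq> K'"
    using K closure_of_subset[of "level (s / 2)" riemann_sphere] by (auto simp: K'_def)
  have F0: "F p = 0" if "p \<notin> K'" for p
  proof (cases "p \<in> D")
    case True
    then have "g p \<le> ereal (s / 2)" using that K'(3) by (auto simp: level_def not_less)
    then have gs: "g p \<le> ereal s" "\<not> ereal t < g p"
    proof -
      have "ereal (s / 2) \<le> ereal s" "ereal (s / 2) \<le> ereal t" using s by auto
      then show "g p \<le> ereal s" "\<not> ereal t < g p" using \<open>g p \<le> ereal (s / 2)\<close> by (auto simp: not_less intro: order_trans)
    qed
    then have pz: "p \<noteq> z0" "q p = G p" using dich[OF True] by auto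
    then have "q p \<le> s" using gs(1) g_real[OF True pz(1)] by (metis ereal_less_eq(3))
    then show ?thesis using k(6) by (simp add: F_def)
  qed (simp add: F_def)
  have oC: "open (- finite_part K')" using closed_finite_part[OF K'(1)] by auto
  have oF: "open (finite_part D)" by (rule open_finite_part[OF oD])
  have out: "F (Some z) = 0" if "z \<in> - finite_part K'" for z using that F0 by (simp add: finite_part_def)
  have inn: "F (Some z) = c (q (Some z))" if "z \<in> finite_part D" for z using that by (simp add: F_def finite_part_def)
  have test: "sphere_test D F"
    unfolding sphere_test_def
  proof (intro conjI allI impI)
    show "Ck_on n UNIV (\<lambda>z. F (Some z))" for n
    proof (rule Ck_on_local)
      fix z
      show "\<exists>U. open U \<and> z \<in> U \<and> Ck_on n U (\<lambda>z. F (Some z))"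
      proof (cases "z \<in> finite_part D")
        case True
        have "Ck_on n (finite_part D) (\<lambda>z. F (Some z))"
          by (rule Ck_on_cong[OF oF _ Ck_on_compose_real[OF oF k(1) Ck]]) (use inn in auto)
        then show ?thesis using True oF by blast
      next
        case False
        then have "z \<in> - finite_part K'" using K'(2) by (auto simp: finite_part_def)
        moreover have "Ck_on n (- finite_part K') (\<lambda>z. F (Some z))"
          by (rule Ck_on_cong[OF oC _ Ck_on_const[of n _ 0]]) (use out in auto)
        ultimately show ?thesis using oC by blast
      qed
    qed
    show "\<exists>r>0. \<forall>n. Ck_on n (ball 0 r) (\<lambda>w. F (sphere_inv (Some w)))" if nD: "None \<in> D"
    proof -
      obtain r where r: "0 < r" "\<And>w. w \<in> ball 0 r \<Longrightarrow> sphere_inv (Some w) \<in> D" "\<And>n. Ck_on n (ball 0 r) (\<lambda>w. q (sphere_inv (Some w)))"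
        using inf[OF nD] by blast
      have "Ck_on n (ball 0 r) (\<lambda>w. F (sphere_inv (Some w)))" for n
        by (rule Ck_on_cong[OF open_ball _ Ck_on_compose_real[OF open_ball k(1) r(3)]]) (use r(2) in \<open>auto simp: F_def\<close>)
      then show ?thesis using r(1) by blast
    qed
    show "\<exists>K. closedin riemann_sphere K \<and> K \<subseteq> D \<and> (\<forall>p. p \<notin> K \<longrightarrow> F p = 0)" using K' F0 by blast
  qed
  \<comment> \<open>The part of the Laplacian of c(q) that carries the second derivative of the
    ramp. It is nonnegative and lives where s < q < s', that is on the collar.\<close>
  define A where "A = (\<lambda>z. if Some z \<in> D then c'' (q (Some z)) * ((pdx (\<lambda>z. q (Some z)) z)\<^sup>2 + (pdy (\<lambda>z. q (Some z)) z)\<^sup>2) else 0)"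
  have A0: "0 \<le> A z" for z using k(4) by (simp add: A_def)
  have lap: "laplacian (\<lambda>z. F (Some z)) z = A z + L z" for z
  proof (cases "Some z \<in> D")
    case True
    then have zD: "z \<in> finite_part D" by (simp add: finite_part_def)
    have "laplacian (\<lambda>z. F (Some z)) z = laplacian (\<lambda>z. c (q (Some z))) z"
      by (rule laplacian_cong_open[OF oF zD inn])
    also have "\<dots> = A z + c' (q (Some z)) * L z"
      using laplacian_compose_real[OF oF Ck zD k(2,3)] True by (simp add: A_def L_def)
    \<comment> \<open>L is nonzero only where the pole was altered, hence where q > t >= s' and the
      ramp has slope 1.\<close>
    also have "c' (q (Some z)) * L z = L z"
    proof (cases "s' \<le> q (Some z)")
      case True then show ?thesis using k(7) by simp
    next
      case False
      then have "\<not> t < q (Some z)" using s(3) by simp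
      then have pz: "Some z \<noteq> z0" "q (Some z) = G (Some z)" using dich[OF True] by auto
      have "g (Some z) \<le> ereal t" using g_real[OF True pz(1)] pz(2) \<open>\<not> t < q (Some z)\<close> by (metis ereal_less_eq(3) not_less)
      then show ?thesis using lap0[OF True] by (simp add: L_def)
    qed
    finally show ?thesis .
  next
    case False
    then have "z \<in> - finite_part K'" using K'(2) by (auto simp: finite_part_def)
    then have "laplacian (\<lambda>z. F (Some z)) z = 0" using laplacian_cong_open[OF oC _ out] by simp
    then show ?thesis using False by (simp add: A_def L_def)
  qed
  note li = sphere_subharmonic_loc_integrable[OF dom u]
  note pair = riesz_pairing[OF oD \<nu> test li]
  note zero = sphere_integral_laplacian_zero[OF oD test]
  have Ae: "A = (\<lambda>z. laplacian (\<lambda>z. F (Some z)) z - L z)" using lap by (intro ext) simp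
  have iA: "integrable lborel A" unfolding Ae by (rule Bochner_Integration.integrable_diff[OF zero(1) L(1)])
  \<comment> \<open>The total Laplacian A + L has integral 0, and L has integral -2 pi.\<close>
  have A2: "(LINT z|lborel. A z) = 2 * pi"
    unfolding Ae using Bochner_Integration.integral_diff[OF zero(1) L(1)] zero(2) L(2) by simp
  let ?u = "\<lambda>z. real_of_ereal (u (Some z))"
  have uAe: "(\<lambda>z. ?u z * A z) = (\<lambda>z. ?u z * laplacian (\<lambda>z. F (Some z)) z - ?u z * L z)"
    unfolding lap by (simp add: algebra_simps)
  have iuA: "integrable lborel (\<lambda>z. ?u z * A z)"
    unfolding uAe by (rule Bochner_Integration.integrable_diff[OF pair(1) L(3)])
  have uA: "(LINT z|lborel. ?u z * A z) = (LINT z|lborel. ?u z * laplacian (\<lambda>z. F (Some z)) z) - (LINT z|lborel. ?u z * L z)"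
    unfolding uAe by (rule Bochner_Integration.integral_diff[OF pair(1) L(3)])
  \<comment> \<open>The bound can fail where u is minus infinity, because the value 0 put in its
    place may exceed m; hence only almost everywhere.\<close>
  have ae: "AE z in lborel. ?u z * A z \<le> m * A z"
    using sphere_subharmonic_AE_finite[OF dom u]
  proof eventually_elim
    case (elim z)
    show ?case
    proof (cases "A z = 0")
      case False
      then have zD: "Some z \<in> D" and k0: "c'' (q (Some z)) \<noteq> 0" by (auto simp: A_def split: if_splits)
      then have qs: "s < q (Some z)" "q (Some z) < s'" using k(6,7)[of "q (Some z)"] by force+
      then have "\<not> t < q (Some z)" using s(3) by simp
      then have pz: "Some z \<noteq> z0" "q (Some z) = G (Some z)" using dich[OF zD] by auto
      have ge: "g (Some z) = ereal (q (Some z))" using g_real[OF zD pz(1)] pz(2) by simp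
      have "u (Some z) \<le> ereal m" by (rule m[OF zD]) (use qs ge in simp_all)
      then have "?u z \<le> m" using elim zD by (cases "u (Some z)") auto
      then show ?thesis using A0 by (rule mult_right_mono)
    qed simp
  qed
  have "(LINT z|lborel. ?u z * A z) \<le> (LINT z|lborel. m * A z)"
    by (rule integral_mono_AE[OF iuA _ ae]) (use iA in simp)
  then have bound: "(LINT p|\<nu>. F p) \<le> m + U"
  proof -
    have Ue: "U = 1 / (2 * pi) * (LINT z|lborel. ?u z * L z)" unfolding U_def L_def ..
    show ?thesis unfolding Ue using pair(3) uA A2 pi_gt_zero \<open>(LINT z|lborel. ?u z * A z) \<le> (LINT z|lborel. m * A z)\<close>
      by (simp add: field_simps)
  qed
  have Fnn: "0 \<le> F p" for p using k(5) by (simp add: F_def)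
  then have "0 \<le> (LINT p|\<nu>. F p)" by simp
  then show "0 \<le> m + U" using bound by linarith
  have "(\<integral>\<^sup>+p\<in>D - level t. ennreal (G p - s') \<partial>\<nu>) \<le> (\<integral>\<^sup>+p. ennreal (F p) \<partial>\<nu>)"
  proof (rule nn_integral_mono)
    fix p
    show "ennreal (G p - s') * indicator (D - level t) p \<le> ennreal (F p)"
    proof (cases "p \<in> D - level t")
      case True
      then have "q p = G p" using dich[of p] by (auto simp: level_def)
      then show ?thesis using True k(5) by (simp add: F_def ennreal_leI)
    qed simp
  qed
  also have "\<dots> = ennreal (LINT p|\<nu>. F p)" by (intro nn_integral_eq_integral pair(2) AE_I2 Fnn) assumption?
  also have "\<dots> \<le> ennreal (m + U)" using bound by (rule ennreal_leI)
  finally show "(\<integral>\<^sup>+p\<in>D - level t. ennreal (G p - s') \<partial>\<nu>) \<le> ennreal (m + U)" .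
qed

end

section \<open>Convex functions on the line\<close>

lemma convex_on_deriv_mono:
  assumes c: "convex_on S (f :: real \<Rightarrow> real)" and S: "open S" "connected S" and x: "x \<in> S" "y \<in> S" "x \<le> y"
    and d: "(f has_real_derivative a) (at x)" "(f has_real_derivative b) (at y)"
  shows "a \<le> b"
proof (cases "x = y")
  case True then show ?thesis using DERIV_unique d by blast
next
  case False
  have i: "x \<in> interior S" "y \<in> interior S" using x S by (simp_all add: interior_open)
  have d': "(f has_real_derivative a) (at x within S)" "(f has_real_derivative b) (at y within S)"
    using d has_field_derivative_at_within by blast+
  have "a * (y - x) \<le> f y - f x"
    by (rule convex_on_imp_above_tangent[OF c S(2) i(1) x(2) d'(1)])
  moreover have "b * (x - y) \<le> f x - f y"
    by (rule convex_on_imp_above_tangent[OF c S(2) i(2) x(1) d'(2)])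
  ultimately have "a * (y - x) \<le> b * (y - x)" by (simp add: algebra_simps)
  then show ?thesis using False x(3) by simp
qed

lemma convex_on_second_deriv_nonneg:
  assumes c: "convex_on S (f :: real \<Rightarrow> real)" and S: "open S" "connected S" and x: "x \<in> S"
    and d: "\<And>y. y \<in> S \<Longrightarrow> (f has_real_derivative f' y) (at y)" "(f' has_real_derivative e) (at x)"
  shows "0 \<le> e"
proof (rule ccontr)
  assume "\<not> 0 \<le> e"
  then obtain r where r: "0 < r" "\<And>h. 0 < h \<Longrightarrow> h < r \<Longrightarrow> f' (x + h) < f' x" using DERIV_neg_dec_right[OF d(2)] by auto
  obtain q where q: "0 < q" "ball x q \<subseteq> S" using S(1) x openE by blast
  define h where "h = min r q / 2"
  have h: "0 < h" "h < r" "x + h \<in> S" using r q by (auto simp: h_def dist_real_def subset_eq)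
  have "f' x \<le> f' (x + h)" by (rule convex_on_deriv_mono[OF c S x h(3) _ d(1)[OF x] d(1)[OF h(3)]]) (use h in simp)
  with r(2)[OF h(1,2)] show False by linarith
qed

text \<open>Kinks at \<open>j h\<close>, shifted to the right by one step so that the function stays below f.\<close>

definition kink_slope :: "(real \<Rightarrow> real) \<Rightarrow> real \<Rightarrow> nat \<Rightarrow> real" where
  "kink_slope f h j = (f (real j * h) - f (real (j - 1) * h)) / h"

definition kink_coeff :: "(real \<Rightarrow> real) \<Rightarrow> real \<Rightarrow> nat \<Rightarrow> real" where
  "kink_coeff f h j = kink_slope f h j - kink_slope f h (j - 1)"

definition kink_fun :: "(real \<Rightarrow> real) \<Rightarrow> real \<Rightarrow> nat \<Rightarrow> real \<Rightarrow> real" where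
  "kink_fun f h n x = (\<Sum>j=1..n. kink_coeff f h j * max 0 (x - real j * h))"

text \<open>The sum telescopes down to the slope with index 0, which is 0 because 0 - 1 = 0 on
  natural numbers. So the first kink carries the full first slope.\<close>

lemma sum_kink_coeff: "(\<Sum>j=1..n. kink_coeff f h j) = kink_slope f h n"
  by (induction n) (simp_all add: kink_coeff_def kink_slope_def)

lemma kink_coeff_nonneg:
  assumes f: "convex_on {0..} f" "mono_on {0..} f" and h: "0 < h" and j: "1 \<le> j"
  shows "0 \<le> kink_coeff f h j"
proof (cases "j = 1")
  case True
  have "f 0 \<le> f h" by (rule mono_onD[OF f(2)]) (use h in auto)
  then show ?thesis using True h by (simp add: kink_coeff_def kink_slope_def)
next
  case False
  then obtain i where i: "j = Suc (Suc i)" using j by (metis One_nat_def Suc_le_D old.nat.exhaust)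
  have "f ((1 - 1/2) *\<^sub>R (real i * h) + (1/2) *\<^sub>R (real (i + 2) * h)) \<le> (1 - 1/2) * f (real i * h) + (1/2) * f (real (i + 2) * h)"
    by (rule convex_onD[OF f(1)]) (use h in auto)
  also have "(1 - 1/2) *\<^sub>R (real i * h) + (1/2) *\<^sub>R (real (i + 2) * h) = real (Suc i) * h" by (simp add: field_simps)
  finally have "2 * f (real (Suc i) * h) \<le> f (real i * h) + f (real (Suc (Suc i)) * h)" by simp
  then have "(f (real (Suc i) * h) - f (real i * h)) / h \<le> (f (real (Suc (Suc i)) * h) - f (real (Suc i) * h)) / h"
    using h by (intro divide_right_mono) auto
  then show ?thesis unfolding i kink_coeff_def kink_slope_def by simp
qed

text \<open>Between the nodes (k + 1) h and (k + 2) h the kinks j <= k + 1 are active, and their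
  coefficients sum to the slope of f on the preceding step. The function is the linear interpolation
  of f delayed by one step.\<close>

lemma kink_fun_grid:
  assumes f: "f 0 = 0" and h: "0 < h" and k: "k \<le> n"
  shows "kink_fun f h n (real (Suc k) * h) = f (real k * h)"
  using k
proof (induction k)
  case 0
  have "kink_coeff f h j * max 0 (real (Suc 0) * h - real j * h) = 0" if "j \<in> {1..n}" for j
    using that h by (simp add: max_def)
  then have "kink_fun f h n (real (Suc 0) * h) = 0" unfolding kink_fun_def by (intro sum.neutral ballI)
  then show ?case using f by simp
next
  case (Suc k)
  have "kink_fun f h n (real (Suc (Suc k)) * h) - kink_fun f h n (real (Suc k) * h)
      = (\<Sum>j=1..n. if j \<le> Suc k then kink_coeff f h j * h else 0)"
    unfolding kink_fun_def sum_subtractf[symmetric]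
  proof (rule sum.cong[OF refl])
    fix j assume "j \<in> {1..n}"
    show "kink_coeff f h j * max 0 (real (Suc (Suc k)) * h - real j * h) - kink_coeff f h j * max 0 (real (Suc k) * h - real j * h)
      = (if j \<le> Suc k then kink_coeff f h j * h else 0)"
    proof (cases "j \<le> Suc k")
      case True
      then have "real j * h \<le> real (Suc k) * h" using h by (intro mult_right_mono) auto
      moreover have "real (Suc (Suc k)) * h = real (Suc k) * h + h" by (simp add: algebra_simps)
      ultimately show ?thesis using True h by (simp add: max_def algebra_simps)
    next
      case False
      then have "real (Suc (Suc k)) * h \<le> real j * h" using h by (intro mult_right_mono) auto
      moreover have "real (Suc (Suc k)) * h = real (Suc k) * h + h" by (simp add: algebra_simps)
      ultimately have "max 0 (real (Suc (Suc k)) * h - real j * h) = 0" "max 0 (real (Suc k) * h - real j * h) = 0"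
        using h by linarith+
      then show ?thesis using False by simp
    qed
  qed
  also have "\<dots> = (\<Sum>j\<in>{1..Suc k}. kink_coeff f h j * h)"
    using Suc.prems by (intro sum.mono_neutral_cong_right) auto
  also have "\<dots> = kink_slope f h (Suc k) * h" using sum_kink_coeff[of f h "Suc k"] by (simp add: sum_distrib_right[symmetric])
  also have "\<dots> = f (real (Suc k) * h) - f (real k * h)" using h by (simp add: kink_slope_def)
  finally show ?case using Suc by simp
qed

lemma kink_fun_mono:
  assumes f: "convex_on {0..} f" "mono_on {0..} f" and h: "0 < h" and x: "x \<le> y"
  shows "kink_fun f h n x \<le> kink_fun f h n y"
  unfolding kink_fun_def
  by (intro sum_mono mult_left_mono kink_coeff_nonneg[OF f h]) (use x in auto)

text \<open>With k the integer part of x / h, monotonicity reduces both bounds to nodes: the delay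
  by one step gives f(k h) from above and f((k - 1) h) from below, and k h <= x < (k + 1) h.\<close>

lemma kink_fun_bounds:
  assumes f: "convex_on {0..} f" "mono_on {0..} f" "f 0 = 0" "\<And>x. 0 \<le> x \<Longrightarrow> 0 \<le> f x" and h: "0 < h"
    and x: "0 \<le> x" "x \<le> real (Suc n) * h"
  shows "kink_fun f h n x \<le> f x" "f (max 0 (x - 2 * h)) \<le> kink_fun f h n x"
proof -
  define k where "k = nat \<lfloor>x / h\<rfloor>"
  have k: "real k * h \<le> x" "x < real (Suc k) * h"
  proof -
    have "0 \<le> x / h" using x h by simp
    then have "real k = of_int \<lfloor>x / h\<rfloor>" by (simp add: k_def)
    then have "real k \<le> x / h" "x / h < real k + 1" by linarith+
    then show "real k * h \<le> x" "x < real (Suc k) * h" using h by (simp_all add: field_simps)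
  qed
  have nn: "0 \<le> kink_fun f h n y" for y
    unfolding kink_fun_def by (intro sum_nonneg mult_nonneg_nonneg kink_coeff_nonneg[OF f(1,2) h]) auto
  show "kink_fun f h n x \<le> f x"
  proof (cases "k \<le> n")
    case True
    have "kink_fun f h n x \<le> kink_fun f h n (real (Suc k) * h)" using k by (intro kink_fun_mono[OF f(1,2) h]) simp
    also have "\<dots> = f (real k * h)" by (rule kink_fun_grid[where f = f, OF f(3) h True])
    also have "\<dots> \<le> f x" by (rule mono_onD[OF f(2)]) (use h k(1) x in auto)
    finally show ?thesis .
  next
    case False
    have "kink_fun f h n x \<le> kink_fun f h n (real (Suc n) * h)" using x by (intro kink_fun_mono[OF f(1,2) h]) simp
    also have "\<dots> = f (real n * h)" by (rule kink_fun_grid[where f = f, OF f(3) h order_refl])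
    also have "\<dots> \<le> f x"
    proof (rule mono_onD[OF f(2)])
      have "real n * h \<le> real k * h" using False h by (intro mult_right_mono) auto
      then show "real n * h \<le> x" using k by simp
    qed (use h x in auto)
    finally show ?thesis .
  qed
  show "f (max 0 (x - 2 * h)) \<le> kink_fun f h n x"
  proof (cases k)
    case 0
    then have "max 0 (x - 2 * h) = 0" using k h by simp
    then show ?thesis using nn f(3) by simp
  next
    case (Suc i)
    have i: "i \<le> n"
    proof (rule ccontr)
      assume "\<not> i \<le> n"
      then have "real (Suc n) * h < real k * h" using Suc h by (intro mult_strict_right_mono) auto
      then show False using k x by linarith
    qed
    have "x - 2 * h \<le> real i * h" using k Suc by (simp add: algebra_simps)
    then have "f (max 0 (x - 2 * h)) \<le> f (real i * h)" using h by (intro mono_onD[OF f(2)]) auto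
    also have "\<dots> = kink_fun f h n (real (Suc i) * h)" by (rule kink_fun_grid[where f = f, OF f(3) h i, symmetric])
    also have "\<dots> \<le> kink_fun f h n x" using k Suc by (intro kink_fun_mono[OF f(1,2) h]) simp
    finally show ?thesis .
  qed
qed

lemma convex_slope_bound:
  assumes f: "convex_on {0..} f" "\<And>x. 0 \<le> x \<Longrightarrow> 0 \<le> f x" and x: "0 \<le> x" "x < y" "y < z" and b: "f z \<le> b"
  shows "(f y - f x) / (y - x) \<le> b / (z - y)"
proof -
  note a = convex_on_slope_le[OF f(1), of x z y]
  have "(f x - f y) / (x - y) \<le> (f y - f z) / (y - z)" using a x by fastforce
  moreover have "(f x - f y) / (x - y) = (f y - f x) / (y - x)" using x by (simp add: field_simps)
  moreover have "(f y - f z) / (y - z) = (f z - f y) / (z - y)" using x by (simp add: field_simps)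
  moreover have "(f z - f y) / (z - y) \<le> b / (z - y)" using b f(2)[of y] x by (intro divide_right_mono) auto
  ultimately show ?thesis by linarith
qed

section \<open>From the kernels \<open>(g - s)\<^sup>+\<close> to convex functions\<close>

lemma ennreal_add_le: "0 \<le> x \<Longrightarrow> ennreal (x + y) \<le> ennreal x + ennreal y"
  by (cases "0 \<le> y") (auto simp: ennreal_neg intro: ennreal_leI)

text \<open>Taylor's formula with integral remainder, expanded at the right end a. The
  antiderivative of (r - s) h'' is (r - s) h' - h.\<close>

lemma taylor_nn_integral:
  fixes h h' h'' :: "real \<Rightarrow> real"
  assumes d: "\<And>r. s \<le> r \<Longrightarrow> r \<le> a \<Longrightarrow> (h has_real_derivative h' r) (at r)"
    "\<And>r. s \<le> r \<Longrightarrow> r \<le> a \<Longrightarrow> (h' has_real_derivative h'' r) (at r)"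
    and nn: "\<And>r. s \<le> r \<Longrightarrow> r \<le> a \<Longrightarrow> 0 \<le> h'' r" and c: "continuous_on {s..a} h''" and s: "s \<le> a"
  shows "ennreal (h s - h a + (a - s) * h' a) = (\<integral>\<^sup>+r\<in>{s..a}. ennreal ((r - s) * h'' r) \<partial>lborel)"
proof -
  let ?f = "\<lambda>r. indicator {s..a} r *\<^sub>R ((r - s) * h'' r)"
  let ?P = "\<lambda>r. (r - s) * h' r - h r"
  have m: "?f \<in> borel_measurable borel"
    by (rule borel_measurable_continuous_on_indicator) (auto intro!: continuous_intros c)
  have "(\<integral>\<^sup>+r. ennreal (?f r) * indicator {s..a} r \<partial>lborel) = ennreal (?P a - ?P s)"
  proof (rule nn_integral_FTC_Icc[OF m])
    fix r assume "r \<in> {s..a}"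
    then have r: "s \<le> r" "r \<le> a" by auto
    have "(?P has_real_derivative ((r - s) * h'' r)) (at r)"
      by (rule derivative_eq_intros d[OF r] | simp)+
    then show "(?P has_real_derivative ?f r) (at r)" using r by simp
    show "0 \<le> ?f r" using nn[OF r] r by simp
  qed (rule s)
  moreover have "(\<integral>\<^sup>+r. ennreal (?f r) * indicator {s..a} r \<partial>lborel) = (\<integral>\<^sup>+r\<in>{s..a}. ennreal ((r - s) * h'' r) \<partial>lborel)"
    by (intro nn_integral_cong) (auto simp: indicator_def)
  ultimately show ?thesis by (simp add: algebra_simps)
qed

text \<open>For a sum of kinks the hypothesis is applied at each node j h and \<phi>(j h) is
  expanded about a = t / 2; the remainders add up to the integral of the kink function against
  \<phi>'', which is at most that of f. Fatou removes the mesh. The expansion stops at t / 2 because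
  only there does f t <= b control the slope of f, by 2 b / t. The constant 6 b / t collects this
  slope and the factor 4 b / t for the values of \<gamma> above t / 2; b A' comes from f a <=
  b.\<close>

lemma convex_kernel_estimate:
  fixes \<gamma> :: "'a \<Rightarrow> real" and \<phi> \<phi>' \<phi>'' :: "real \<Rightarrow> real"
  assumes \<gamma>: "\<gamma> \<in> borel_measurable \<nu>" "\<And>x. x \<in> space \<nu> \<Longrightarrow> 0 \<le> \<gamma> x" "\<And>x. x \<in> space \<nu> \<Longrightarrow> \<gamma> x \<le> t" and t: "0 < t"
    and N: "\<And>r. 0 < r \<Longrightarrow> r < t \<Longrightarrow> 0 \<le> \<phi> r + c" "\<And>r. 0 < r \<Longrightarrow> r < t \<Longrightarrow> (\<integral>\<^sup>+x. ennreal (\<gamma> x - r) \<partial>\<nu>) \<le> ennreal (\<phi> r + c)"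
    and d: "\<And>r. 0 < r \<Longrightarrow> (\<phi> has_real_derivative \<phi>' r) (at r)" "\<And>r. 0 < r \<Longrightarrow> (\<phi>' has_real_derivative \<phi>'' r) (at r)"
    and nn: "\<And>r. 0 < r \<Longrightarrow> 0 \<le> \<phi>'' r" and cont: "continuous_on {0<..} \<phi>''"
    and f: "convex_on {0..} f" "mono_on {0..} f" "f 0 = 0" "\<And>x. 0 \<le> x \<Longrightarrow> 0 \<le> f x" "f t \<le> b"
    and A: "\<phi> (t / 2) + c \<le> A" "\<phi> (t / 4) + c \<le> A" "- \<phi>' (t / 2) \<le> A'" "0 \<le> A'"
  shows "(\<integral>\<^sup>+x. ennreal (f (\<gamma> x)) \<partial>\<nu>) \<le> ennreal (6 * b / t * A + b * A') + (\<integral>\<^sup>+r\<in>{0<..t}. ennreal (f r * \<phi>'' r) \<partial>lborel)"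
proof -
  define a where "a = t / 2"
  have a: "0 < a" "a < t" "t - a = t / 2" using t by (auto simp: a_def)
  have b0: "0 \<le> b" using f(4)[of t] f(5) t by simp
  have A0: "0 \<le> A" using N(1)[of a] A(1) a by (simp add: a_def)
  have fa: "f a \<le> b" using mono_onD[OF f(2), of a t] a f(5) by simp
  define J where "J = (\<integral>\<^sup>+r\<in>{0<..t}. ennreal (f r * \<phi>'' r) \<partial>lborel)"
  have mg: "(\<lambda>x. ennreal (\<gamma> x - r)) \<in> borel_measurable \<nu>" for r using \<gamma>(1) by measurable
  have kink: "(\<integral>\<^sup>+x. ennreal (kink_fun f h n (\<gamma> x)) \<partial>\<nu>) \<le> ennreal (2 * b / t * A + b * A') + J"
    if n: "1 \<le> n" and h: "h = a / real n" for n h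
  proof -
    have h0: "0 < h" using n a h by simp
    have nh: "real n * h = a" using n h by simp
    note c0 = kink_coeff_nonneg[OF f(1,2) h0]
    let ?c = "kink_coeff f h"
    have jh: "0 < real j * h" "real j * h \<le> a" if "j \<in> {1..n}" for j
      using that h0 nh mult_right_mono[of "real j" "real n" h] by auto
    let ?T = "\<lambda>j r. ennreal (?c j) * (ennreal ((r - real j * h) * \<phi>'' r) * indicator {real j * h..a} r)"
    have mT: "?T j \<in> borel_measurable borel" if "j \<in> {1..n}" for j
    proof -
      have "(\<lambda>r. indicator {real j * h..a} r *\<^sub>R ((r - real j * h) * \<phi>'' r)) \<in> borel_measurable borel"
        using jh[OF that] by (intro borel_measurable_continuous_on_indicator) (auto intro!: continuous_intros continuous_on_subset[OF cont])
      then have "(\<lambda>r. ennreal (?c j) * ennreal (indicator {real j * h..a} r *\<^sub>R ((r - real j * h) * \<phi>'' r))) \<in> borel_measurable borel"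
        by measurable
      moreover have "(\<lambda>r. ennreal (?c j) * ennreal (indicator {real j * h..a} r *\<^sub>R ((r - real j * h) * \<phi>'' r))) = ?T j"
        by (auto simp: fun_eq_iff indicator_def)
      ultimately show ?thesis by simp
    qed
    have step: "ennreal (?c j) * ennreal (\<phi> (real j * h) + c) \<le> ennreal (?c j * (A + (a - real j * h) * A')) + (\<integral>\<^sup>+r. ?T j r \<partial>lborel)"
      if j: "j \<in> {1..n}" for j
    proof -
      note jh = jh[OF j]
      have e: "ennreal (\<phi> (real j * h) - \<phi> a + (a - real j * h) * \<phi>' a) = (\<integral>\<^sup>+r\<in>{real j * h..a}. ennreal ((r - real j * h) * \<phi>'' r) \<partial>lborel)"
        by (rule taylor_nn_integral) (use jh in \<open>auto intro!: d nn continuous_on_subset[OF cont]\<close>)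
      have "(a - real j * h) * (- \<phi>' a) \<le> (a - real j * h) * A'" using jh A(3) by (intro mult_left_mono) (auto simp: a_def)
      then have "\<phi> (real j * h) + c \<le> (A + (a - real j * h) * A') + (\<phi> (real j * h) - \<phi> a + (a - real j * h) * \<phi>' a)"
        using A(1) by (simp add: a_def)
      then have "ennreal (\<phi> (real j * h) + c) \<le> ennreal ((A + (a - real j * h) * A') + (\<phi> (real j * h) - \<phi> a + (a - real j * h) * \<phi>' a))"
        by (rule ennreal_leI)
      also have "\<dots> \<le> ennreal (A + (a - real j * h) * A') + ennreal (\<phi> (real j * h) - \<phi> a + (a - real j * h) * \<phi>' a)"
        by (rule ennreal_add_le) (use jh A0 A(4) in auto)
      finally have "ennreal (?c j) * ennreal (\<phi> (real j * h) + c) \<le> ennreal (?c j) *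
          (ennreal (A + (a - real j * h) * A') + (\<integral>\<^sup>+r\<in>{real j * h..a}. ennreal ((r - real j * h) * \<phi>'' r) \<partial>lborel))"
        unfolding e by (rule mult_left_mono) simp
      also have "\<dots> = ennreal (?c j * (A + (a - real j * h) * A')) + ennreal (?c j) * (\<integral>\<^sup>+r\<in>{real j * h..a}. ennreal ((r - real j * h) * \<phi>'' r) \<partial>lborel)"
        using c0[of j] j jh A0 A(4) by (simp add: distrib_left ennreal_mult)
      also have "ennreal (?c j) * (\<integral>\<^sup>+r\<in>{real j * h..a}. ennreal ((r - real j * h) * \<phi>'' r) \<partial>lborel) = (\<integral>\<^sup>+r. ?T j r \<partial>lborel)"
      proof (rule nn_integral_cmult[symmetric])
        have "(\<lambda>r. indicator {real j * h..a} r *\<^sub>R ((r - real j * h) * \<phi>'' r)) \<in> borel_measurable borel"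
          using jh by (intro borel_measurable_continuous_on_indicator) (auto intro!: continuous_intros continuous_on_subset[OF cont])
        then have "(\<lambda>r. ennreal (indicator {real j * h..a} r *\<^sub>R ((r - real j * h) * \<phi>'' r))) \<in> borel_measurable borel" by measurable
        moreover have "(\<lambda>r. ennreal (indicator {real j * h..a} r *\<^sub>R ((r - real j * h) * \<phi>'' r))) = (\<lambda>r. ennreal ((r - real j * h) * \<phi>'' r) * indicator {real j * h..a} r)"
          by (auto simp: fun_eq_iff indicator_def)
        ultimately show "(\<lambda>r. ennreal ((r - real j * h) * \<phi>'' r) * indicator {real j * h..a} r) \<in> borel_measurable lborel" by simp
      qed
      finally show ?thesis .
    qed
    have "(\<integral>\<^sup>+x. ennreal (kink_fun f h n (\<gamma> x)) \<partial>\<nu>) = (\<integral>\<^sup>+x. (\<Sum>j=1..n. ennreal (?c j) * ennreal (\<gamma> x - real j * h)) \<partial>\<nu>)"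
    proof (rule nn_integral_cong)
      fix x
      have "ennreal (kink_fun f h n (\<gamma> x)) = (\<Sum>j=1..n. ennreal (?c j * max 0 (\<gamma> x - real j * h)))"
        unfolding kink_fun_def using c0 by (intro sum_ennreal[symmetric]) auto
      also have "\<dots> = (\<Sum>j=1..n. ennreal (?c j) * ennreal (\<gamma> x - real j * h))"
        using c0 by (intro sum.cong refl) (auto simp: ennreal_mult max_def ennreal_neg)
      finally show "ennreal (kink_fun f h n (\<gamma> x)) = (\<Sum>j=1..n. ennreal (?c j) * ennreal (\<gamma> x - real j * h))" .
    qed
    also have "\<dots> = (\<Sum>j=1..n. \<integral>\<^sup>+x. ennreal (?c j) * ennreal (\<gamma> x - real j * h) \<partial>\<nu>)"
      by (intro nn_integral_sum borel_measurable_times_ennreal mg) simp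
    also have "\<dots> = (\<Sum>j=1..n. ennreal (?c j) * (\<integral>\<^sup>+x. ennreal (\<gamma> x - real j * h) \<partial>\<nu>))"
      by (intro sum.cong refl nn_integral_cmult mg)
    also have "\<dots> \<le> (\<Sum>j=1..n. ennreal (?c j) * ennreal (\<phi> (real j * h) + c))"
      using jh a by (intro sum_mono mult_left_mono N(2)) force+
    also have "\<dots> \<le> (\<Sum>j=1..n. ennreal (?c j * (A + (a - real j * h) * A')) + (\<integral>\<^sup>+r. ?T j r \<partial>lborel))"
      by (rule sum_mono[OF step])
    also have "\<dots> = (\<Sum>j=1..n. ennreal (?c j * (A + (a - real j * h) * A'))) + (\<Sum>j=1..n. \<integral>\<^sup>+r. ?T j r \<partial>lborel)"
      by (rule sum.distrib)
    also have "(\<Sum>j=1..n. ennreal (?c j * (A + (a - real j * h) * A'))) = ennreal (\<Sum>j=1..n. ?c j * (A + (a - real j * h) * A'))"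
      using c0 jh A0 A(4) by (intro sum_ennreal) auto
    \<comment> \<open>The coefficients alone sum to the last slope; weighted with a - j h they sum
      to the value of the kink function at a.\<close>
    also have "(\<Sum>j=1..n. ?c j * (A + (a - real j * h) * A')) = (\<Sum>j=1..n. ?c j) * A + kink_fun f h n a * A'"
      unfolding kink_fun_def sum_distrib_right sum.distrib[symmetric] using jh
      by (intro sum.cong refl) (auto simp: max_def algebra_simps)
    also have "(\<Sum>j=1..n. \<integral>\<^sup>+r. ?T j r \<partial>lborel) = (\<integral>\<^sup>+r. (\<Sum>j=1..n. ?T j r) \<partial>lborel)"
      using mT by (intro nn_integral_sum[symmetric]) simp
    also have "\<dots> \<le> J"
      unfolding J_def
    proof (rule nn_integral_mono)
      fix r
      show "(\<Sum>j=1..n. ?T j r) \<le> ennreal (f r * \<phi>'' r) * indicator {0<..t} r"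
      proof (cases "0 < r \<and> r \<le> a")
        case True
        have T: "?T j r = ennreal (?c j * max 0 (r - real j * h) * \<phi>'' r)" if "j \<in> {1..n}" for j
          using True c0[of j] that nn[of r] by (cases "real j * h \<le> r") (auto simp: ennreal_mult max_def mult.assoc)
        have "(\<Sum>j=1..n. ?T j r) = ennreal (\<Sum>j=1..n. ?c j * max 0 (r - real j * h) * \<phi>'' r)"
          using T c0 True nn[of r] by (simp only: T cong: sum.cong) (intro sum_ennreal, auto)
        also have "\<dots> = ennreal (kink_fun f h n r * \<phi>'' r)" by (simp add: kink_fun_def sum_distrib_right)
        also have "\<dots> \<le> ennreal (f r * \<phi>'' r)"
        proof (intro ennreal_leI mult_right_mono kink_fun_bounds(1)[OF f(1-4) h0])
          show "r \<le> real (Suc n) * h" using True nh h0 by (simp add: algebra_simps)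
        qed (use True nn in auto)
        finally show ?thesis using True a by simp
      next
        case False
        have "?T j r = 0" if "j \<in> {1..n}" for j using False jh[OF that] by (auto simp: indicator_def)
        then have "(\<Sum>j=1..n. ?T j r) = 0" by (intro sum.neutral ballI)
        then show ?thesis by (simp only: zero_le)
      qed
    qed
    finally have "(\<integral>\<^sup>+x. ennreal (kink_fun f h n (\<gamma> x)) \<partial>\<nu>) \<le> ennreal ((\<Sum>j=1..n. ?c j) * A + kink_fun f h n a * A') + J"
      by (simp add: add_left_mono)
    also have "\<dots> \<le> ennreal (2 * b / t * A + b * A') + J"
    proof (intro add_right_mono ennreal_leI add_mono mult_right_mono)
      have "kink_slope f h n = (f a - f (a - h)) / (a - (a - h))"
        using n nh by (simp add: kink_slope_def of_nat_diff algebra_simps)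
      also have "\<dots> \<le> b / (t - a)"
      proof (rule convex_slope_bound[OF f(1,4)])
        have "1 * h \<le> real n * h" using n h0 by (intro mult_right_mono) auto
        then show "0 \<le> a - h" using nh by simp
      qed (use h0 a f(5) in auto)
      finally show "(\<Sum>j=1..n. ?c j) \<le> 2 * b / t" using sum_kink_coeff[of f h n] a(3) by simp
      have "kink_fun f h n a \<le> f a" by (rule kink_fun_bounds(1)[OF f(1-4) h0]) (use a nh h0 in \<open>auto simp: algebra_simps\<close>)
      then show "kink_fun f h n a \<le> b" using fa by linarith
    qed (use A0 A(4) in auto)
    finally show ?thesis .
  qed
  let ?h = "\<lambda>n. a / real (Suc n)"
  let ?a = "\<lambda>n x. ennreal (kink_fun f (?h n) (Suc n) (\<gamma> x))"
  have ma: "?a n \<in> borel_measurable \<nu>" for n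
    unfolding kink_fun_def using \<gamma>(1) by measurable
  \<comment> \<open>Up to t / 2 the kink functions converge to f by its continuity on the open half
    line, with 0 treated apart. Above t / 2 the crude bound f <= b = (4 b / t) (t / 4) is absorbed
    by a single kernel at t / 4.\<close>
  have pt: "ennreal (f (\<gamma> x)) \<le> liminf (\<lambda>n. ?a n x) + ennreal (4 * b / t) * ennreal (\<gamma> x - t / 4)" if x: "x \<in> space \<nu>" for x
  proof (cases "\<gamma> x \<le> a")
    case True
    have "ennreal (f (\<gamma> x)) \<le> liminf (\<lambda>n. ?a n x)"
    proof (cases "\<gamma> x = 0")
      case False
      then have g0: "0 < \<gamma> x" using \<gamma>(2)[OF x] by simp
      have "continuous_on {0<..} f" by (rule convex_on_continuous[OF _ convex_on_subset[OF f(1)]]) auto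
      then have "isCont f (\<gamma> x)" using g0 by (simp add: continuous_on_eq_continuous_at)
      moreover have "(\<lambda>n. max 0 (\<gamma> x - 2 * ?h n)) \<longlonglongrightarrow> max 0 (\<gamma> x - 2 * 0)"
        by (intro tendsto_intros lim_const_over_n LIMSEQ_Suc[of "\<lambda>n. a / real n"])
      ultimately have "(\<lambda>n. f (max 0 (\<gamma> x - 2 * ?h n))) \<longlonglongrightarrow> f (\<gamma> x)"
        using g0 isCont_tendsto_compose[of "\<gamma> x" f] by simp
      then have "(\<lambda>n. ennreal (f (max 0 (\<gamma> x - 2 * ?h n)))) \<longlonglongrightarrow> ennreal (f (\<gamma> x))"
        by (rule tendsto_ennrealI)
      then have "ennreal (f (\<gamma> x)) = liminf (\<lambda>n. ennreal (f (max 0 (\<gamma> x - 2 * ?h n))))"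
        by (rule lim_imp_Liminf[symmetric, rotated]) simp
      also have "\<dots> \<le> liminf (\<lambda>n. ?a n x)"
      proof (intro Liminf_mono always_eventually allI ennreal_leI)
        fix n
        have h0: "0 < ?h n" using a by simp
        have "real (Suc (Suc n)) * ?h n = a + ?h n" by (simp add: field_simps)
        then have "\<gamma> x \<le> real (Suc (Suc n)) * ?h n" using True h0 by linarith
        then show "f (max 0 (\<gamma> x - 2 * ?h n)) \<le> kink_fun f (?h n) (Suc n) (\<gamma> x)"
          using g0 h0 by (intro kink_fun_bounds(2)[OF f(1-4)]) auto
      qed
      finally show ?thesis .
    qed (use f(3) in simp)
    then show ?thesis using add_increasing2[of "ennreal (4 * b / t) * ennreal (\<gamma> x - t / 4)"] by simp
  next
    case False
    have "f (\<gamma> x) \<le> f t" by (rule mono_onD[OF f(2)]) (use \<gamma>(2,3)[OF x] t in auto)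
    also have "\<dots> \<le> 4 * b / t * (t / 4)" using f(5) t by simp
    also have "\<dots> \<le> 4 * b / t * (\<gamma> x - t / 4)" using False b0 t by (intro mult_left_mono) (auto simp: a_def)
    finally have "ennreal (f (\<gamma> x)) \<le> ennreal (4 * b / t * (\<gamma> x - t / 4))" by (rule ennreal_leI)
    also have "\<dots> = ennreal (4 * b / t) * ennreal (\<gamma> x - t / 4)" using b0 t False by (intro ennreal_mult) (auto simp: a_def)
    finally show ?thesis by (simp add: add_increasing)
  qed
  have "(\<integral>\<^sup>+x. ennreal (f (\<gamma> x)) \<partial>\<nu>) \<le> (\<integral>\<^sup>+x. liminf (\<lambda>n. ?a n x) + ennreal (4 * b / t) * ennreal (\<gamma> x - t / 4) \<partial>\<nu>)"
    by (rule nn_integral_mono[OF pt])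
  also have "\<dots> = (\<integral>\<^sup>+x. liminf (\<lambda>n. ?a n x) \<partial>\<nu>) + (\<integral>\<^sup>+x. ennreal (4 * b / t) * ennreal (\<gamma> x - t / 4) \<partial>\<nu>)"
    by (intro nn_integral_add borel_measurable_liminf borel_measurable_times_ennreal mg ma) simp
  also have "\<dots> \<le> (ennreal (2 * b / t * A + b * A') + J) + ennreal (4 * b / t) * ennreal A"
  proof (rule add_mono)
    have "(\<integral>\<^sup>+x. liminf (\<lambda>n. ?a n x) \<partial>\<nu>) \<le> liminf (\<lambda>n. \<integral>\<^sup>+x. ?a n x \<partial>\<nu>)"
      by (rule nn_integral_liminf[OF ma])
    also have "\<dots> \<le> liminf (\<lambda>n::nat. ennreal (2 * b / t * A + b * A') + J)"
      by (intro Liminf_mono always_eventually allI kink) auto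
    also have "\<dots> = ennreal (2 * b / t * A + b * A') + J" by (simp add: Liminf_const)
    finally show "(\<integral>\<^sup>+x. liminf (\<lambda>n. ?a n x) \<partial>\<nu>) \<le> ennreal (2 * b / t * A + b * A') + J" .
    have "(\<integral>\<^sup>+x. ennreal (4 * b / t) * ennreal (\<gamma> x - t / 4) \<partial>\<nu>) = ennreal (4 * b / t) * (\<integral>\<^sup>+x. ennreal (\<gamma> x - t / 4) \<partial>\<nu>)"
      by (intro nn_integral_cmult mg)
    also have "\<dots> \<le> ennreal (4 * b / t) * ennreal A"
      using N(2)[of "t / 4"] t ennreal_leI[OF A(2)] by (intro mult_left_mono) auto
    finally show "(\<integral>\<^sup>+x. ennreal (4 * b / t) * ennreal (\<gamma> x - t / 4) \<partial>\<nu>) \<le> ennreal (4 * b / t) * ennreal A" .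
  qed
  also have "ennreal (4 * b / t) * ennreal A = ennreal (4 * b / t * A)" using b0 t A0 by (intro ennreal_mult[symmetric]) auto
  also have "(ennreal (2 * b / t * A + b * A') + J) + ennreal (4 * b / t * A) = ennreal (2 * b / t * A + b * A' + 4 * b / t * A) + J"
    using b0 t A0 A(4) by (subst ennreal_plus) (auto simp: add_ac)
  also have "2 * b / t * A + b * A' + 4 * b / t * A = 6 * b / t * A + b * A'" using t by (simp add: field_simps)
  finally show ?thesis unfolding J_def .
qed

section \<open>The distance to the complement\<close>

lemma compl_dist_nonneg: "0 \<le> compl_dist D p"
  unfolding compl_dist_def by (intro INF_greatest) (auto simp: sphere_edist_def split: option.splits)

lemma compl_dist_attained:
  assumes D: "openin riemann_sphere D" and p: "Some z \<in> D" "compl_dist D (Some z) \<noteq> \<infinity>"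
  shows "\<exists>w. Some w \<notin> D \<and> compl_dist D (Some z) = ereal (dist z w)"
proof -
  let ?K = "finite_part (- D)"
  have "?K \<noteq> {}"
  proof
    assume e: "?K = {}"
    have "sphere_edist (Some z) q = \<infinity>" if "q \<in> - D" for q
      using that e by (cases q) (auto simp: sphere_edist_def finite_part_def)
    then have "compl_dist D (Some z) = (INF q\<in>-D. \<infinity>)" unfolding compl_dist_def by (intro INF_cong refl)
    then show False using p(2) by (cases "- D = {}") (auto simp: top_ereal_def)
  qed
  moreover have "closed ?K" using D by (intro closed_finite_part) (simp add: closedin_riemann_sphere_iff)
  ultimately obtain w where w: "w \<in> ?K" "\<And>v. v \<in> ?K \<Longrightarrow> dist z w \<le> dist z v"
    using distance_attains_inf by metis
  have "compl_dist D (Some z) = ereal (dist z w)"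
    unfolding compl_dist_def
  proof (rule antisym)
    show "(INF q\<in>-D. sphere_edist (Some z) q) \<le> ereal (dist z w)"
      using w(1) by (intro INF_lower2[of "Some w"]) (auto simp: finite_part_def sphere_edist_def)
    show "ereal (dist z w) \<le> (INF q\<in>-D. sphere_edist (Some z) q)"
    proof (rule INF_greatest)
      fix q assume "q \<in> - D"
      then show "ereal (dist z w) \<le> sphere_edist (Some z) q"
        using w(2) by (cases q) (auto simp: sphere_edist_def finite_part_def)
    qed
  qed
  then show ?thesis using w(1) by (auto simp: finite_part_def)
qed

lemma compl_dist_None: "None \<in> D \<Longrightarrow> compl_dist D None = \<infinity>"
proof -
  assume n: "None \<in> D"
  have "sphere_edist None q = \<infinity>" if "q \<in> - D" for q
    using that n by (cases q) (auto simp: sphere_edist_def)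
  then have "\<infinity> \<le> compl_dist D None" unfolding compl_dist_def by (intro INF_greatest) simp
  then show ?thesis by simp
qed

text \<open>Along the segment from p to a nearest point of the complement the distance is linear.\<close>

lemma compl_dist_takes_values:
  assumes D: "openin riemann_sphere D" and p: "p \<in> D" "compl_dist D p = ereal s" and x: "0 < x" "x \<le> s"
  shows "\<exists>p'\<in>D. compl_dist D p' = ereal x"
proof -
  obtain z where z: "p = Some z" using p compl_dist_None[of D] by (cases p) auto
  obtain w where w: "Some w \<notin> D" "s = dist z w" using compl_dist_attained[OF D] p z by (metis PInfty_neq_ereal(1) ereal.inject)
  have low: "s \<le> dist z v" if "Some v \<notin> D" for v
  proof -
    have "compl_dist D (Some z) \<le> sphere_edist (Some z) (Some v)" unfolding compl_dist_def using that by (intro INF_lower) simp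
    then show ?thesis using p z by (simp add: sphere_edist_def)
  qed
  define v where "v = w + (x / s) *\<^sub>R (z - w)"
  have s0: "0 < s" using x by linarith
  have vw: "dist v w = x"
    using w(2) x s0 by (simp add: v_def dist_norm)
  have "z - v = (1 - x / s) *\<^sub>R (z - w)" by (simp add: v_def algebra_simps)
  then have "dist z v = \<bar>1 - x / s\<bar> * s" using w(2) by (simp only: dist_norm norm_scaleR)
  moreover have "\<bar>1 - x / s\<bar> = 1 - x / s" using x s0 by simp
  ultimately have zv: "dist z v = s - x" using s0 by (simp add: left_diff_distrib)
  have "Some v \<in> D" using low[of v] zv x by fastforce
  moreover have "compl_dist D (Some v) = ereal x"
    unfolding compl_dist_def
  proof (rule antisym)
    show "(INF q\<in>-D. sphere_edist (Some v) q) \<le> ereal x"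
      using w(1) vw by (intro INF_lower2[of "Some w"]) (auto simp: sphere_edist_def)
    show "ereal x \<le> (INF q\<in>-D. sphere_edist (Some v) q)"
    proof (rule INF_greatest)
      fix q assume q: "q \<in> - D"
      show "ereal x \<le> sphere_edist (Some v) q"
      proof (cases q)
        case (Some y)
        then have "s \<le> dist z y" using low q by simp
        also have "\<dots> \<le> dist z v + dist v y" by (rule dist_triangle)
        finally show ?thesis using zv Some by (simp add: sphere_edist_def)
      qed (simp add: sphere_edist_def)
    qed
  qed
  ultimately show ?thesis by blast
qed

text \<open>The finite part of E is clopen in the plane, and the point at infinity is not
  isolated.\<close>

lemma clopen_riemann_sphere:
  assumes E: "openin riemann_sphere E" "openin riemann_sphere (- E)"
  shows "E = {} \<or> E = UNIV"
proof -
  have far: "V \<noteq> {None}" if V: "openin riemann_sphere V" for V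
  proof
    assume e: "V = {None}"
    then obtain R where "\<And>z. R < cmod z \<Longrightarrow> Some z \<in> V" using V by (auto simp: openin_riemann_sphere_iff)
    moreover have "R < cmod (of_real (\<bar>R\<bar> + 1))" unfolding norm_of_real by linarith
    ultimately have "Some (of_real (\<bar>R\<bar> + 1)) \<in> V" by blast
    then show False using e by simp
  qed
  have "open (finite_part E)" "closed (finite_part E)"
    using open_finite_part[OF E(1)] open_finite_part[OF E(2)] by (simp_all add: open_closed)
  then have "finite_part E = {} \<or> finite_part E = UNIV" by (simp add: clopen[symmetric])
  then consider "finite_part E = {}" | "finite_part E = UNIV" by (elim disjE)
  then show ?thesis
  proof cases
    case 1
    have "p = None" if "p \<in> E" for p using that 1 by (cases p) (auto simp: finite_part_def)
    then show ?thesis using far[OF E(1)] by blast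
  next
    case 2
    have "p = None" if "p \<in> - E" for p
    proof (cases p)
      case (Some z)
      have "z \<in> finite_part E" using 2 by simp
      then show ?thesis using that Some by (simp add: finite_part_def)
    qed
    then show ?thesis using far[OF E(2)] by blast
  qed
qed

text \<open>It ensures that the supremum of d over the boundary of D0 is taken over a nonempty
  set.\<close>

lemma sphere_domain_frontier_nonempty: "sphere_domain E \<Longrightarrow> riemann_sphere frontier_of E \<noteq> {}"
proof
  assume E: "sphere_domain E" and f: "riemann_sphere frontier_of E = {}"
  have o: "openin riemann_sphere E" "E \<noteq> {}" "E \<noteq> UNIV" using E by (auto simp: sphere_domain_def)
  have "closedin riemann_sphere E" using f by (simp add: frontier_of_eq_empty)
  then show False using o clopen_riemann_sphere[of E] by (simp add: closedin_riemann_sphere_iff)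
qed

section \<open>The collar inequality integrated against convex weights\<close>

context green_domain
begin

lemma collar_measurable:
  assumes \<nu>: "is_riesz_measure D u \<nu>" and t: "0 < t" "openin riemann_sphere (level t)"
  shows "(\<lambda>p. if p \<in> D - level t then G p else 0) \<in> borel_measurable \<nu>" "D - level t \<in> sets \<nu>"
proof -
  have s: "sets \<nu> = sets (restrict_space riemann_sphere_borel D)" using \<nu> by (simp add: is_riesz_measure_def)
  note sp = riesz_space[OF s]
  have zl: "z0 \<in> level t" using z0D g_z0 by (simp add: level_def)
  have lm: "level t \<in> sets \<nu>"
    by (rule riesz_sets[OF s openin_sets_riemann_sphere_borel[OF t(2)]]) (auto simp: level_def)
  then show "D - level t \<in> sets \<nu>" using sp by (metis sets.compl_sets)
  have om: "{p \<in> D - {z0}. G p \<in> {a<..}} \<in> sets \<nu>" for a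
    by (rule riesz_sets[OF s openin_sets_riemann_sphere_borel[OF open_G]]) auto
  have "(\<lambda>p. if p \<in> D - level t then G p else 0) \<in> borel_measurable \<nu>"
    unfolding borel_measurable_iff_greater
  proof
    fix a
    have "{p \<in> space \<nu>. a < (if p \<in> D - level t then G p else 0)}
      = ({p \<in> D - {z0}. G p \<in> {a<..}} - level t) \<union> (if a < 0 then level t else {})"
      unfolding sp using zl by (auto simp: level_def)
    then show "{p \<in> space \<nu>. a < (if p \<in> D - level t then G p else 0)} \<in> sets \<nu>"
      using om[of a] lm by auto
  qed
  then show "(\<lambda>p. if p \<in> D - level t then G p else 0) \<in> borel_measurable \<nu>" .
qed

text \<open>U is obtained before the weight K and the bound b, so one constant serves all convex
  functions. The error e in the majorant accounts for an F that does not increase.\<close>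

lemma collar_convex_estimate:
  assumes u: "sphere_subharmonic_on D u" "\<exists>p\<in>D. u p \<noteq> -\<infinity>" and \<nu>: "is_riesz_measure D u \<nu>"
    and t: "0 < t" "\<And>s. 0 < s \<Longrightarrow> s \<le> t \<Longrightarrow> openin riemann_sphere (level s) \<and> riemann_sphere closure_of (level s) \<subseteq> D"
    and pos: "\<And>p. p \<in> D \<Longrightarrow> 0 < g p"
    and maj: "\<And>p s. p \<in> D \<Longrightarrow> 0 < s \<Longrightarrow> ereal s \<le> g p \<Longrightarrow> g p \<le> ereal t \<Longrightarrow> u p \<le> ereal (\<phi> s + e)"
    and d: "\<And>r. 0 < r \<Longrightarrow> (\<phi> has_real_derivative \<phi>' r) (at r)" "\<And>r. 0 < r \<Longrightarrow> (\<phi>' has_real_derivative \<phi>'' r) (at r)"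
    and nn: "\<And>r. 0 < r \<Longrightarrow> 0 \<le> \<phi>'' r" and cont: "continuous_on {0<..} \<phi>''"
    and \<phi>A: "\<phi> (t / 2) + e \<le> A" "\<phi> (t / 4) + e \<le> A" "- \<phi>' (t / 2) \<le> A'" "0 \<le> A'"
  shows "\<exists>U. 0 \<le> A + U \<and> (u z0 \<noteq> -\<infinity> \<longrightarrow> U \<le> - real_of_ereal (u z0)) \<and>
    (\<forall>K b. convex_on {0..} K \<longrightarrow> mono_on {0..} K \<longrightarrow> K 0 = 0 \<longrightarrow> (\<forall>x\<ge>0. 0 \<le> K x) \<longrightarrow> K t \<le> b \<longrightarrow>
       (\<integral>\<^sup>+p\<in>D - level t. ennreal (K (G p)) \<partial>\<nu>)
         \<le> ennreal (6 * b / t * (A + U) + b * A') + (\<integral>\<^sup>+r\<in>{0<..t}. ennreal (K r * \<phi>'' r) \<partial>lborel))"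
proof -
  obtain q where q: "regularized t u q" using regularized_exists[OF u] by blast
  define U where "U = 1 / (2 * pi) * (LINT z|lborel. real_of_ereal (u (Some z)) * (if Some z \<in> D then laplacian (\<lambda>z. q (Some z)) z else 0))"
  have U: "U \<le> - real_of_ereal (u z0)" if "u z0 \<noteq> -\<infinity>"
  proof -
    have "(LINT z|lborel. real_of_ereal (u (Some z)) * (if Some z \<in> D then laplacian (\<lambda>z. q (Some z)) z else 0)) \<le> - 2 * pi * real_of_ereal (u z0)"
      using q that unfolding regularized_def Let_def by blast
    then show ?thesis unfolding U_def using pi_gt_zero by (simp add: field_simps)
  qed
  have est: "0 \<le> \<phi> s + e + U" "(\<integral>\<^sup>+p\<in>D - level t. ennreal (G p - s') \<partial>\<nu>) \<le> ennreal (\<phi> s + e + U)"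
    if s: "0 < s" "s < s'" "s' \<le> t" for s s'
  proof -
    have K: "riemann_sphere closure_of (level (s / 2)) \<subseteq> D" using t(2)[of "s / 2"] s by simp
    have m: "u p \<le> ereal (\<phi> s + e)" if "p \<in> D" "ereal s \<le> g p" "g p \<le> ereal s'" for p
    proof (rule maj[OF that(1) s(1) that(2)])
      have "ereal s' \<le> ereal t" using s by simp
      then show "g p \<le> ereal t" using that(3) by (rule order_trans[rotated])
    qed
    show "0 \<le> \<phi> s + e + U" "(\<integral>\<^sup>+p\<in>D - level t. ennreal (G p - s') \<partial>\<nu>) \<le> ennreal (\<phi> s + e + U)"
      using collar_estimate[OF u \<nu> q s K m, folded U_def] by simp_all
  qed
  \<comment> \<open>Off the collar the value 0 contributes nothing, since K 0 = 0 and the kernels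
    have r > 0.\<close>
  define \<gamma> where "\<gamma> = (\<lambda>p. if p \<in> D - level t then G p else 0)"
  note meas = collar_measurable[OF \<nu> t(1)]
  have "openin riemann_sphere (level t)" using t by simp
  note meas = meas[OF this, folded \<gamma>_def]
  have GX: "0 < G p \<and> G p \<le> t" if p: "p \<in> D - level t" for p
  proof -
    have "p \<noteq> z0" using p g_z0 by (auto simp: level_def)
    then have ge: "g p = ereal (G p)" using p g_real by simp
    have "0 < ereal (G p)" "ereal (G p) \<le> ereal t" using p pos[of p] ge by (auto simp: level_def not_less)
    then show ?thesis by simp
  qed
  have \<gamma>: "0 \<le> \<gamma> p" "\<gamma> p \<le> t" for p using GX[of p] t(1) by (auto simp: \<gamma>_def)
  have N1: "0 \<le> \<phi> r + (e + U)" if r: "0 < r" "r < t" for r using est(1)[OF r order_refl] by (simp add: add.assoc)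
  \<comment> \<open>The smoothed ramp needs a collar of positive width and yields the bound with
    \<phi> s for every s < r; continuity of \<phi> lets s tend to r.\<close>
  have N2: "(\<integral>\<^sup>+p. ennreal (\<gamma> p - r) \<partial>\<nu>) \<le> ennreal (\<phi> r + (e + U))" if r: "0 < r" "r < t" for r
  proof (rule tendsto_le[of "at_left r"])
    have "\<forall>\<^sub>F s in at_left r. 0 < s \<and> s < r" using r(1) by (simp add: eventually_at_left) blast
    then show "\<forall>\<^sub>F s in at_left r. (\<integral>\<^sup>+p. ennreal (\<gamma> p - r) \<partial>\<nu>) \<le> ennreal (\<phi> s + (e + U))"
    proof eventually_elim
      case (elim s)
      have "(\<integral>\<^sup>+p. ennreal (\<gamma> p - r) \<partial>\<nu>) = (\<integral>\<^sup>+p\<in>D - level t. ennreal (G p - r) \<partial>\<nu>)"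
        using r(1) by (intro nn_integral_cong) (auto simp: \<gamma>_def indicator_def ennreal_neg)
      also have "\<dots> \<le> ennreal (\<phi> s + e + U)" using elim r by (intro est(2)) auto
      finally show ?case by (simp add: add.assoc)
    qed
    have "isCont \<phi> r" using d(1)[OF r(1)] DERIV_isCont by blast
    then have "(\<phi> \<longlongrightarrow> \<phi> r) (at_left r)" by (simp add: isCont_def filterlim_at_split)
    then show "((\<lambda>s. ennreal (\<phi> s + (e + U))) \<longlongrightarrow> ennreal (\<phi> r + (e + U))) (at_left r)"
      by (intro tendsto_intros)
  qed auto
  have A: "\<phi> (t / 2) + (e + U) \<le> A + U" "\<phi> (t / 4) + (e + U) \<le> A + U" using \<phi>A by auto
  have "(\<integral>\<^sup>+p\<in>D - level t. ennreal (K (G p)) \<partial>\<nu>)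
         \<le> ennreal (6 * b / t * (A + U) + b * A') + (\<integral>\<^sup>+r\<in>{0<..t}. ennreal (K r * \<phi>'' r) \<partial>lborel)"
    if K: "convex_on {0..} K" "mono_on {0..} K" "K 0 = 0" "\<forall>x\<ge>0. 0 \<le> K x" "K t \<le> b" for K b
  proof -
    have "(\<integral>\<^sup>+p\<in>D - level t. ennreal (K (G p)) \<partial>\<nu>) = (\<integral>\<^sup>+p. ennreal (K (\<gamma> p)) \<partial>\<nu>)"
      using K(3) by (intro nn_integral_cong) (auto simp: \<gamma>_def indicator_def)
    also have "\<dots> \<le> ennreal (6 * b / t * (A + U) + b * A') + (\<integral>\<^sup>+r\<in>{0<..t}. ennreal (K r * \<phi>'' r) \<partial>lborel)"
      by (rule convex_kernel_estimate[where \<phi>' = \<phi>' and c = "e + U", OF meas(1) \<gamma> t(1) N1 N2 d nn cont K(1-3) _ K(5) A \<phi>A(3,4)])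
         (use K(4) in auto)
    finally show ?thesis .
  qed
  moreover have "0 \<le> A + U" using N1[of "t / 2"] A t by simp
  ultimately show ?thesis using U by (intro exI[of _ U]) blast
qed

end

section \<open>The substitution s f(1 / s) that reduces (b) to (a)\<close>

text \<open>For positive x and y and S = (1 - t) x + t y, the number 1 / S is the convex combination
  of 1 / x and 1 / y with weights (1 - t) x / S and t y / S. At x = 0, where the product is 0,
  monotonicity of f takes over.\<close>

lemma convex_on_perspective:
  assumes f: "convex_on {0..} f" "antimono_on {0..} f"
  shows "convex_on {0..} (\<lambda>s::real. s * f (1 / s))"
proof (rule convex_on_linorderI)
  fix t x y :: real
  assume t: "0 < t" "t < 1" and xy: "x \<in> {0..}" "y \<in> {0..}" "x < y"
  define S where "S = (1 - t) * x + t * y"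
  have y0: "0 < y" "0 \<le> x" using xy by auto
  have S0: "0 < S" unfolding S_def using t y0 by (intro add_nonneg_pos) auto
  have "S * f (1 / S) \<le> (1 - t) * (x * f (1 / x)) + t * (y * f (1 / y))"
  proof (cases "x = 0")
    case True
    then have S: "S = t * y" by (simp add: S_def)
    have "1 / y \<le> 1 / S" using S S0 y0 t by (intro divide_left_mono) (auto simp: mult_le_cancel_right1)
    then have "f (1 / S) \<le> f (1 / y)" using S0 y0 by (intro monotone_onD[OF f(2)]) auto
    then have "t * y * f (1 / S) \<le> t * y * f (1 / y)" using t y0 by (intro mult_left_mono) auto
    then show ?thesis using True S by (simp add: mult.assoc)
  next
    case False
    then have x0: "0 < x" using y0 by simp
    have a: "0 \<le> t * y / S" "t * y / S \<le> 1" using S0 t y0 x0 by (auto simp: S_def)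
    have e: "(1 - t * y / S) = (1 - t) * x / S" using S0 by (simp add: S_def field_simps)
    have "f ((1 - t * y / S) *\<^sub>R (1 / x) + (t * y / S) *\<^sub>R (1 / y)) \<le> (1 - t * y / S) * f (1 / x) + (t * y / S) * f (1 / y)"
      by (rule convex_onD[OF f(1) a]) (use x0 y0 in auto)
    moreover have "(1 - t * y / S) *\<^sub>R (1 / x) + (t * y / S) *\<^sub>R (1 / y) = 1 / S"
      unfolding e using x0 y0 S0 by (simp add: field_simps)
    ultimately have "S * f (1 / S) \<le> S * ((1 - t) * x / S * f (1 / x) + (t * y / S) * f (1 / y))"
      using S0 e by (intro mult_left_mono) auto
    also have "\<dots> = (1 - t) * (x * f (1 / x)) + t * (y * f (1 / y))" using S0 by (simp add: field_simps)
    finally show ?thesis .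
  qed
  then show "((1 - t) *\<^sub>R x + t *\<^sub>R y) * f (1 / ((1 - t) *\<^sub>R x + t *\<^sub>R y)) \<le> (1 - t) * (x * f (1 / x)) + t * (y * f (1 / y))"
    by (simp add: S_def)
qed simp

lemma mono_on_perspective:
  assumes f: "antimono_on {0..} f" "\<And>x. 0 \<le> x \<Longrightarrow> 0 \<le> f x"
  shows "mono_on {0..} (\<lambda>s::real. s * f (1 / s))"
proof (rule mono_onI)
  fix x y :: real assume xy: "x \<in> {0..}" "y \<in> {0..}" "x \<le> y"
  show "x * f (1 / x) \<le> y * f (1 / y)"
  proof (cases "x = 0")
    case False
    then have x0: "0 < x" "0 < y" using xy by auto
    have "1 / y \<le> 1 / x" using x0 xy by (intro divide_left_mono) auto
    then have "f (1 / x) \<le> f (1 / y)" using x0 by (intro monotone_onD[OF f(1)]) auto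
    then show ?thesis using x0 xy f(2)[of "1 / x"] by (intro mult_mono) auto
  qed (use xy f(2)[of "1 / y"] in auto)
qed

section \<open>The estimate for the Riesz measure\<close>

text \<open>The \<delta> in which the constants are expressed: it is a function of D and D0 alone,
  unlike t, b0 and B0.\<close>

definition frontier_dist :: "csphere set \<Rightarrow> csphere set \<Rightarrow> real" where
  "frontier_dist D D0 = real_of_ereal (SUP p\<in>riemann_sphere frontier_of D0. compl_dist D p)"

text \<open>The constants may depend on F only through M, so F is recovered from M by choice. The choice matters
  only left of \<open>- \<delta>\<close>, \<open>\<delta> = frontier_dist D D0\<close>: the distance d takes all values in \<open>(0, \<delta>)\<close>.\<close>

definition majorant_fun :: "csphere set \<Rightarrow> (csphere \<Rightarrow> ereal) \<Rightarrow> real \<Rightarrow> real" where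
  "majorant_fun D M = (SOME F. convex_on {..<0} F \<and> C2_on_reals {..<0} F \<and> majorant D F = M)"

text \<open>The factor 6 b / t of \<open>convex_kernel_estimate\<close> with t replaced by its lower
  bound \<delta>^3, which also absorbs the factor 1 / b0 of (b). The absolute values give a
  nonnegative constant for every argument.\<close>

definition estimate_const :: "csphere \<Rightarrow> csphere set \<Rightarrow> csphere set \<Rightarrow> real \<Rightarrow> real" where
  "estimate_const z0 D D0 b = 6 * \<bar>b\<bar> / \<bar>frontier_dist D D0\<bar> ^ 3"

text \<open>For a convex F this bounds F(-y) and F'(-y) whenever \<delta>^3 / 4 <= y <= 1. The
  quarter comes from the point t / 4 in \<open>convex_kernel_estimate\<close>.\<close>

definition majorant_const :: "csphere set \<Rightarrow> csphere set \<Rightarrow> (csphere \<Rightarrow> ereal) \<Rightarrow> real" where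
  "majorant_const D D0 M = (let F = majorant_fun D M in
     \<bar>F (-1)\<bar> + \<bar>deriv F (-1)\<bar> + \<bar>deriv F (- (\<bar>frontier_dist D D0\<bar> ^ 3 / 4))\<bar>)"

definition majorized :: "csphere set \<Rightarrow> (real \<Rightarrow> real) \<Rightarrow> (csphere \<Rightarrow> ereal) \<Rightarrow> csphere measure \<Rightarrow> real \<Rightarrow> bool" where
  "majorized D F u \<nu> b \<longleftrightarrow> convex_on {..<0} F \<and> C2_on_reals {..<0} F \<and>
     sphere_subharmonic_on D u \<and> (\<exists>p\<in>D. u p \<noteq> -\<infinity>) \<and> is_riesz_measure D u \<nu> \<and>
     (\<forall>p\<in>D. u p \<le> majorant D F p) \<and> 0 \<le> b"

definition convex_weight :: "(real \<Rightarrow> real) \<Rightarrow> real \<Rightarrow> real \<Rightarrow> bool" where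
  "convex_weight K t b \<longleftrightarrow>
     convex_on {0..} K \<and> mono_on {0..} K \<and> K 0 = 0 \<and> (\<forall>x\<ge>0. 0 \<le> K x) \<and> K t \<le> b"

lemma C2_on_reals_deriv:
  assumes "C2_on_reals {..<0} F" "x < 0"
  shows "(F has_real_derivative deriv F x) (at x)" "(deriv F has_real_derivative deriv (deriv F) x) (at x)"
  using assms by (auto simp: C2_on_reals_def DERIV_deriv_iff_real_differentiable)

lemma majorant_finite: "p \<in> D \<Longrightarrow> compl_dist D p = ereal x \<Longrightarrow> majorant D F p = ereal (F (- x))"
  by (simp add: majorant_def)

lemma sphere_subharmonic_lt_top:
  assumes u: "sphere_subharmonic_on D u" and p: "p \<in> D" shows "u p < \<infinity>"
proof (cases p)
  case (Some z)
  then show ?thesis using u p by (simp add: sphere_subharmonic_on_def subharmonic_on_def finite_part_def)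
next
  case None
  then have "subharmonic_on {w. sphere_inv (Some w) \<in> D} (\<lambda>w. u (sphere_inv (Some w)))"
    using u p by (simp add: sphere_subharmonic_on_def finite_part_sphere_inv)
  then have "0 \<in> {w. sphere_inv (Some w) \<in> D} \<Longrightarrow> u (sphere_inv (Some 0)) < \<infinity>"
    unfolding subharmonic_on_def by blast
  then show ?thesis using None p by simp
qed

context green_domain
begin

text \<open>The level sets exhaust D, so one of them contains the compact closure of D1; outside it
  the two-sided bound of g by d holds. The bounds of t by the squares of b0 and 1 / B0 are there
  only to free the constants from b0 and B0.\<close>

lemma collar_exists:
  assumes bd: "green_dist_bounds D z0 g b0 B0"
  shows "\<exists>t. 0 < t \<and> t \<le> b0\<^sup>2 \<and> t \<le> 1 / B0\<^sup>2 \<and> sphere_domain (level t) \<and> rel_compact_in (level t) D \<and>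
    (\<forall>s. 0 < s \<and> s \<le> t \<longrightarrow> openin riemann_sphere (level s) \<and> riemann_sphere closure_of (level s) \<subseteq> D) \<and>
    (\<forall>p\<in>D. 0 < g p) \<and>
    (\<forall>p\<in>D - level t. \<exists>x. compl_dist D p = ereal x \<and> 0 < x \<and> x \<le> t / b0 \<and> b0 * x \<le> G p \<and> G p \<le> B0 * x) \<and>
    (\<exists>p\<in>D. \<exists>x. compl_dist D p = ereal x \<and> t / B0 \<le> x) \<and>
    (SUP p\<in>riemann_sphere frontier_of (level t). compl_dist D p) = ereal (frontier_dist D (level t)) \<and>
    t / B0 \<le> frontier_dist D (level t) \<and> frontier_dist D (level t) \<le> t / b0"
proof -
  obtain D1 where b: "0 < b0" "b0 \<le> 1" "1 \<le> B0" and D1: "sphere_domain D1" "rel_compact_in D1 D"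
    and bnd: "\<And>p. p \<in> D - D1 \<Longrightarrow> ereal b0 * compl_dist D p \<le> g p \<and> g p \<le> ereal B0 * compl_dist D p"
    using bd unfolding green_dist_bounds_def by blast
  obtain ts where ts: "0 < ts" and L: "\<And>t. 0 < t \<Longrightarrow> t \<le> ts \<Longrightarrow> sphere_domain (level t) \<and> riemann_sphere closure_of (level t) \<subseteq> D \<and>
     riemann_sphere frontier_of (level t) = {p \<in> D. g p = ereal t}" using level_facts by blast
  have oL: "openin riemann_sphere (level t)" if "0 < t" "t \<le> ts" for t using L[OF that] by (simp add: sphere_domain_def)
  have D1c: "riemann_sphere closure_of D1 \<subseteq> D" "D1 \<subseteq> riemann_sphere closure_of D1"
    using D1(2) by (auto simp: rel_compact_in_def closure_of_subset)
  have pos1: "0 < g p" if p: "p \<in> D - D1" for p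
  proof -
    have "0 < compl_dist D p"
    proof (cases p)
      case None
      then show ?thesis using compl_dist_None[of D] p by simp
    next
      case (Some z)
      show ?thesis
      proof (cases "compl_dist D p = \<infinity>")
        case False
        then obtain w where "Some w \<notin> D" "compl_dist D p = ereal (dist z w)"
          using compl_dist_attained[OF oD, of z] p Some by auto
        moreover from this have "z \<noteq> w" using p Some by auto
        ultimately show ?thesis by simp
      qed simp
    qed
    then have "0 < ereal b0 * compl_dist D p" using b(1) by (simp add: ereal_zero_less_0_iff)
    then show ?thesis using bnd[OF p] by (meson less_le_trans)
  qed
  have pos: "0 < g p" if "p \<in> D" for p by (rule green_positive[OF D1c(1) _ that]) (rule pos1)
  have "\<exists>t1>0. t1 \<le> ts \<and> riemann_sphere closure_of D1 \<subseteq> level t1"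
  proof -
    \<comment> \<open>Since g > 0, the open sets \<open>level s\<close> with 0 < s <= ts cover this
      compact set. They are nested, so the smallest s of a finite subcover suffices.\<close>
    have c: "compactin riemann_sphere (riemann_sphere closure_of D1)"
      by (intro closedin_imp_compactin_sphere closedin_closure_of)
    have "riemann_sphere closure_of D1 \<subseteq> \<Union> (level ` {0<..ts})"
    proof
      fix p assume "p \<in> riemann_sphere closure_of D1"
      then have p: "p \<in> D" using D1c by blast
      show "p \<in> \<Union> (level ` {0<..ts})"
      proof (cases "p = z0")
        case True
        then show ?thesis using p g_z0 ts by (auto simp: level_def)
      next
        case False
        then have ge: "g p = ereal (G p)" using p g_real by simp
        then have G0: "0 < G p" using pos[OF p] by (metis ereal_less(2))
        define s where "s = min ts (G p / 2)"
        have s: "0 < s" "s \<le> ts" "s < G p" using G0 ts by (auto simp: s_def)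
        have "ereal s < ereal (G p)" using s by simp
        then have "p \<in> level s" using p ge by (simp add: level_def)
        then show ?thesis using s by auto
      qed
    qed
    moreover have "\<And>V. V \<in> level ` {0<..ts} \<Longrightarrow> openin riemann_sphere V" using oL by auto
    ultimately obtain V where V: "finite V" "V \<subseteq> level ` {0<..ts}" "riemann_sphere closure_of D1 \<subseteq> \<Union> V"
      using compactinD[OF c, of "level ` {0<..ts}"] by blast
    obtain T where T: "T \<subseteq> {0<..ts}" "finite T" "V = level ` T" using finite_subset_image[OF V(1,2)] by blast
    define t1 where "t1 = Min (insert ts T)"
    have t1: "t1 \<in> insert ts T" "\<And>x. x \<in> insert ts T \<Longrightarrow> t1 \<le> x"
      unfolding t1_def using T(2) Min_in[of "insert ts T"] Min_le[of "insert ts T"] by blast+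
    have t10: "0 < t1" "t1 \<le> ts" using t1 T(1) ts by auto
    moreover have "riemann_sphere closure_of D1 \<subseteq> level t1"
    proof
      fix p assume "p \<in> riemann_sphere closure_of D1"
      then obtain x where x: "x \<in> T" "p \<in> level x" using V(3) T(3) by blast
      then have "ereal t1 \<le> ereal x" using t1(2) by simp
      then show "p \<in> level t1" using x(2) unfolding level_def mem_Collect_eq by (meson le_less_trans)
    qed
    ultimately show ?thesis by blast
  qed
  then obtain t1 where t1: "0 < t1" "t1 \<le> ts" "riemann_sphere closure_of D1 \<subseteq> level t1" by blast
  define t where "t = min t1 (min (b0\<^sup>2) (1 / B0\<^sup>2))"
  have t: "0 < t" "t \<le> t1" "t \<le> b0\<^sup>2" "t \<le> 1 / B0\<^sup>2" using t1 b by (auto simp: t_def)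
  have tts: "t \<le> ts" using t t1 by simp
  have "ereal t \<le> ereal t1" using t by simp
  then have "level t1 \<subseteq> level t" unfolding level_def using le_less_trans by blast
  then have D1t: "D1 \<subseteq> level t" using t1(3) D1c(2) by blast
  have coll: "\<exists>x. compl_dist D p = ereal x \<and> 0 < x \<and> x \<le> t / b0 \<and> b0 * x \<le> G p \<and> G p \<le> B0 * x" if p: "p \<in> D - level t" for p
  proof -
    have pD: "p \<in> D" "p \<in> D - D1" using p D1t by auto
    have "p \<noteq> z0" using p g_z0 by (auto simp: level_def)
    then have ge: "g p = ereal (G p)" using pD g_real by simp
    have Gt: "G p \<le> t" using p ge by (metis (no_types, lifting) DiffE ereal_less_eq(3) level_def mem_Collect_eq not_less)
    have G0: "0 < G p" using pos[OF pD(1)] ge by (metis ereal_less(2))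
    have lo: "ereal b0 * compl_dist D p \<le> ereal (G p)" and hi: "ereal (G p) \<le> ereal B0 * compl_dist D p" using bnd[OF pD(2)] ge by simp_all
    obtain x where x: "compl_dist D p = ereal x" using lo b(1) compl_dist_nonneg[of D p] by (cases "compl_dist D p") auto
    have le: "b0 * x \<le> G p" "G p \<le> B0 * x" using lo hi x by simp_all
    then have "0 < B0 * x" using G0 by linarith
    then have "0 < x" using b(3) by (simp add: zero_less_mult_iff)
    moreover have "x \<le> t / b0" using le Gt b by (simp add: field_simps)
    ultimately show ?thesis using x le by blast
  qed
  note Lt = L[OF t(1) tts]
  have fr: "riemann_sphere frontier_of (level t) = {p \<in> D. g p = ereal t}" using Lt by blast
  \<comment> \<open>On the boundary of D0 one has g = t exactly, so the bounds of g by d can be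
    solved for d.\<close>
  have frx: "\<exists>x. compl_dist D p = ereal x \<and> t / B0 \<le> x \<and> x \<le> t / b0" if "p \<in> riemann_sphere frontier_of (level t)" for p
  proof -
    have p: "p \<in> D - level t" "G p = t" using that fr by (auto simp: level_def)
    then obtain x where "compl_dist D p = ereal x" "x \<le> t / b0" "G p \<le> B0 * x" using coll by blast
    then show ?thesis using p(2) b by (auto simp: field_simps)
  qed
  obtain p0 where p0: "p0 \<in> riemann_sphere frontier_of (level t)" using sphere_domain_frontier_nonempty Lt by blast
  obtain x0 where x0: "compl_dist D p0 = ereal x0" "t / B0 \<le> x0" using frx[OF p0] by blast
  let ?S = "SUP p\<in>riemann_sphere frontier_of (level t). compl_dist D p"
  have S1: "ereal (t / B0) \<le> ?S" using x0 by (intro SUP_upper2[OF p0]) simp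
  have S2: "?S \<le> ereal (t / b0)" using frx by (intro SUP_least) force
  have S: "?S = ereal (frontier_dist D (level t))"
    using S1 S2 unfolding frontier_dist_def by (cases ?S) auto
  have S3: "t / B0 \<le> frontier_dist D (level t)" "frontier_dist D (level t) \<le> t / b0" using S1 S2 unfolding S by simp_all
  have p0D: "p0 \<in> D" using p0 fr by blast
  show ?thesis
  proof (rule exI[of _ t], intro conjI ballI allI impI)
    show "rel_compact_in (level t) D" using Lt by (simp add: rel_compact_in_def)
    show "\<exists>p\<in>D. \<exists>x. compl_dist D p = ereal x \<and> t / B0 \<le> x" using p0D x0 by blast
    show "openin riemann_sphere (level s)" "riemann_sphere closure_of level s \<subseteq> D" if "0 < s \<and> s \<le> t" for s
      using L[of s] oL[of s] that tts by auto
  qed (use t Lt pos coll S S3 in auto)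
qed

text \<open>One statement serves both inequalities: w = 1 with K = f for (a), and w = 1 / b0 with K
  s = s f(1 / s) for (b), because d f(1 / (b0 d)) = (1 / b0) K(b0 d).\<close>

lemma riesz_mass_estimate:
  assumes bd: "green_dist_bounds D z0 g b0 B0"
  shows "\<exists>D0 t0. sphere_domain D0 \<and> rel_compact_in D0 D \<and> z0 \<in> D0 \<and>
    (\<forall>p\<in>D - D0. \<exists>x. compl_dist D p = ereal x \<and> 0 < x) \<and> 0 < t0 \<and>
    ereal t0 = ereal B0 * (SUP p\<in>riemann_sphere frontier_of D0. compl_dist D p) \<and>
    (\<forall>F u \<nu> b K w k. majorized D F u \<nu> b \<and> convex_weight K t0 b \<and> (w = 1 \<or> w = 1 / b0) \<and> (\<forall>x>0. k x \<le> w * K (b0 * x)) \<longrightarrow>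
          (let J = (\<integral>\<^sup>+r\<in>{0<..t0}. ennreal (K r * deriv (deriv F) (- r / B0)) \<partial>lborel) in
            enn2ereal (mass_integral D D0 \<nu> k) \<le> right_side (w / B0\<^sup>2) J (estimate_const z0 D D0 b) (3 * majorant_const D D0 (majorant D F)) (u z0) \<and>
            (J < \<infinity> \<longrightarrow> mass_integral D D0 \<nu> k < \<infinity>)))"
proof -
  have b: "0 < b0" "b0 \<le> 1" "1 \<le> B0" using bd unfolding green_dist_bounds_def by blast+
  obtain t where t: "0 < t" "t \<le> b0\<^sup>2" "t \<le> 1 / B0\<^sup>2" and Lt: "sphere_domain (level t)" "rel_compact_in (level t) D"
    and Ls: "\<And>s. 0 < s \<Longrightarrow> s \<le> t \<Longrightarrow> openin riemann_sphere (level s) \<and> riemann_sphere closure_of (level s) \<subseteq> D"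
    and pos: "\<And>p. p \<in> D \<Longrightarrow> 0 < g p"
    and coll: "\<And>p. p \<in> D - level t \<Longrightarrow> \<exists>x. compl_dist D p = ereal x \<and> 0 < x \<and> x \<le> t / b0 \<and> b0 * x \<le> G p \<and> G p \<le> B0 * x"
    and far: "\<exists>p\<in>D. \<exists>x. compl_dist D p = ereal x \<and> t / B0 \<le> x"
    and S: "(SUP p\<in>riemann_sphere frontier_of (level t). compl_dist D p) = ereal (frontier_dist D (level t))"
    and \<delta>: "t / B0 \<le> frontier_dist D (level t)" "frontier_dist D (level t) \<le> t / b0"
    using collar_exists[OF bd] by (elim exE conjE) blast
  define \<delta> where "\<delta> = frontier_dist D (level t)"
  define t0 where "t0 = B0 * \<delta>"
  have \<delta>0: "0 < \<delta>" "t \<le> t0"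
  proof -
    have "0 < t / B0" using t b by simp
    then show "0 < \<delta>" using \<delta> by (simp add: \<delta>_def)
    show "t \<le> t0" using \<delta>(1) b by (simp add: \<delta>_def t0_def field_simps)
  qed
  have tb: "t / b0 \<le> b0" using t(2) b by (simp add: field_simps power2_eq_square)
  have tB: "t / b0 \<le> 1 / B0"
  proof -
    have "t\<^sup>2 \<le> b0\<^sup>2 * (1 / B0\<^sup>2)" unfolding power2_eq_square[of t] using t by (intro mult_mono) auto
    also have "\<dots> = (b0 / B0)\<^sup>2" by (simp add: power_divide)
    finally have "t \<le> b0 / B0" by (rule power2_le_imp_le) (use b in simp)
    then show ?thesis using b by (simp add: field_simps)
  qed
  have \<delta>b: "\<delta> \<le> b0" "\<delta> \<le> 1 / B0" "\<delta> \<le> 1" "b0 * \<delta> \<le> t"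
  proof -
    have 1: "\<delta> \<le> t / b0" using \<delta>(2) by (simp add: \<delta>_def)
    have 2: "1 / B0 \<le> 1" using b by simp
    show "\<delta> \<le> b0" "\<delta> \<le> 1 / B0" "\<delta> \<le> 1" using 1 2 tb tB b by linarith+
    show "b0 * \<delta> \<le> t" using 1 b by (simp add: field_simps)
  qed
  \<comment> \<open>From \<delta> <= b0 and b0 \<delta> <= t. One more factor \<delta>, which is at
    most 1, 1 / B0 and b0, gives the three bounds of \<delta>^3.\<close>
  have \<delta>2: "\<delta>\<^sup>2 \<le> t"
  proof -
    have "\<delta> * \<delta> \<le> b0 * \<delta>" using \<delta>b \<delta>0 by (intro mult_right_mono) auto
    then show ?thesis using \<delta>b by (simp add: power2_eq_square)
  qed
  have \<delta>3: "\<delta> ^ 3 \<le> t / B0" "\<delta> ^ 3 \<le> t"  "\<delta> ^ 3 \<le> t * b0"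
  proof -
    have e: "\<delta> ^ 3 = \<delta>\<^sup>2 * \<delta>" by (simp add: power3_eq_cube power2_eq_square)
    have "\<delta>\<^sup>2 * \<delta> \<le> t * (1 / B0)" "\<delta>\<^sup>2 * \<delta> \<le> t * 1" "\<delta>\<^sup>2 * \<delta> \<le> t * b0" using \<delta>2 \<delta>b \<delta>0 t by (intro mult_mono; simp)+
    then show "\<delta> ^ 3 \<le> t / B0" "\<delta> ^ 3 \<le> t"  "\<delta> ^ 3 \<le> t * b0" unfolding e by simp_all
  qed
  have main: "enn2ereal (mass_integral D (level t) \<nu> k) \<le> right_side (w / B0\<^sup>2) J (estimate_const z0 D (level t) b) (3 * majorant_const D (level t) (majorant D F)) (u z0) \<and>
      (J < \<infinity> \<longrightarrow> mass_integral D (level t) \<nu> k < \<infinity>)"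
    if H: "majorized D F u \<nu> b" "convex_weight K t0 b"
      and w: "w = 1 \<or> w = 1 / b0" and k: "\<And>x. 0 < x \<Longrightarrow> k x \<le> w * K (b0 * x)"
      and J: "J = (\<integral>\<^sup>+r\<in>{0<..t0}. ennreal (K r * deriv (deriv F) (- r / B0)) \<partial>lborel)"
    for F u \<nu> b K w k J
  proof -
    have F: "convex_on {..<0} F" "C2_on_reals {..<0} F" and u: "sphere_subharmonic_on D u" "\<exists>p\<in>D. u p \<noteq> -\<infinity>"
      and \<nu>: "is_riesz_measure D u \<nu>" and uM: "\<And>p. p \<in> D \<Longrightarrow> u p \<le> majorant D F p" and b0: "0 \<le> b"
      and K: "convex_on {0..} K" "mono_on {0..} K" "K 0 = 0" "\<And>x. 0 \<le> x \<Longrightarrow> 0 \<le> K x" "K t0 \<le> b"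
      using H by (auto simp: majorized_def convex_weight_def)
    \<comment> \<open>The estimate is run with H, the function that the constants see. F and H agree
      wherever -d takes values, in particular on [-x1, 0) with x1 >= t / B0, which contains -r / B0
      for all 0 < r <= t.\<close>
    define H where "H = majorant_fun D (majorant D F)"
    have "convex_on {..<0} H \<and> C2_on_reals {..<0} H \<and> majorant D H = majorant D F"
      unfolding H_def majorant_fun_def by (rule someI[of _ F]) (use F in blast)
    then have H: "convex_on {..<0} H" "C2_on_reals {..<0} H" "majorant D H = majorant D F" by auto
    obtain p1 x1 where p1: "p1 \<in> D" "compl_dist D p1 = ereal x1" "t / B0 \<le> x1" using far by blast
    have FH: "F x = H x" if "- x1 \<le> x" "x < 0" for x
    proof -
      obtain p where p: "p \<in> D" "compl_dist D p = ereal (- x)"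
        using compl_dist_takes_values[OF oD p1(1,2), of "- x"] \<open>- x1 \<le> x\<close> \<open>x < 0\<close> by force
      show ?thesis using majorant_finite[OF p, of F] majorant_finite[OF p, of H] H(3) by simp
    qed
    have dFH: "deriv F x = deriv H x" if "- x1 < x" "x < 0" for x
    proof (rule deriv_cong_ev[OF _ refl])
      have "\<forall>\<^sub>F y in nhds x. y \<in> {- x1<..<0}" using that by (intro eventually_nhds_in_open) auto
      then show "\<forall>\<^sub>F y in nhds x. F y = H y" by eventually_elim (use FH in auto)
    qed
    have ddFH: "deriv (deriv F) x = deriv (deriv H) x" if "- x1 < x" "x < 0" for x
    proof (rule deriv_cong_ev[OF _ refl])
      have "\<forall>\<^sub>F y in nhds x. y \<in> {- x1<..<0}" using that by (intro eventually_nhds_in_open) auto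
      then show "\<forall>\<^sub>F y in nhds x. deriv F y = deriv H y" by eventually_elim (use dFH in auto)
    qed
    note dH = C2_on_reals_deriv[OF H(2)]
    have cont2: "continuous_on {..<0} (deriv (deriv H))" "continuous_on {..<0} (deriv (deriv F))"
      using H(2) F(2) by (auto simp: C2_on_reals_def)
    have mon: "deriv H x \<le> deriv H y" if "x \<le> y" "y < 0" for x y
      by (rule convex_on_deriv_mono[OF H(1) _ _ _ _ that(1) dH(1) dH(1)]) (use that in auto)
    have nn2: "0 \<le> deriv (deriv H) x" if "x < 0" for x
      by (rule convex_on_second_deriv_nonneg[OF H(1) _ _ _ dH(1) dH(2)]) (use that in auto)
    have nn2F: "0 \<le> deriv (deriv F) x" if "x < 0" for x
      by (rule convex_on_second_deriv_nonneg[OF F(1) _ _ _ C2_on_reals_deriv(1)[OF F(2)] C2_on_reals_deriv(2)[OF F(2)]]) (use that in auto)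
    have tangent: "deriv H y * (x - y) \<le> H x - H y" if "x < 0" "y < 0" for x y
    proof (rule convex_on_imp_above_tangent[OF H(1)])
      show "(H has_real_derivative deriv H y) (at y within {..<0})" using dH(1)[OF that(2)] by (rule has_field_derivative_at_within)
    qed (use that in \<open>auto simp: interior_open\<close>)
    \<comment> \<open>On [-1, 0) the slope of H is at least -e, so moving to the right by at most 1
      lowers H by at most e.\<close>
    define e where "e = \<bar>deriv H (- 1)\<bar>"
    define A where "A = \<bar>H (-1)\<bar> + \<bar>deriv H (-1)\<bar> + \<bar>deriv H (- (\<delta> ^ 3 / 4))\<bar>"
    have MC: "majorant_const D (level t) (majorant D F) = A"
      using \<delta>0 by (simp add: majorant_const_def Let_def H_def[symmetric] A_def \<delta>_def[symmetric])
    have EC: "estimate_const z0 D (level t) b = 6 * b / \<delta> ^ 3"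
      using \<delta>0 b0 by (simp add: estimate_const_def \<delta>_def[symmetric])
    have A0: "0 \<le> A" "e \<le> A" by (auto simp: A_def e_def)
    \<comment> \<open>The tangent of H at -y, evaluated at -1, bounds H(-y) by H(-1) plus the slope
      times 1 - y, and slopes increase up to -\<delta>^3 / 4.\<close>
    have HA: "H (- y) \<le> A" "deriv H (- y) \<le> A" if y: "\<delta> ^ 3 / 4 \<le> y" "y \<le> 1" for y
    proof -
      have y0: "0 < y" using y(1) \<delta>0 zero_less_power[of \<delta> 3] by linarith
      have m: "deriv H (- y) \<le> deriv H (- (\<delta> ^ 3 / 4))" using y \<delta>0 by (intro mon) auto
      have "H (- y) \<le> H (- 1) + deriv H (- y) * (1 - y)" using tangent[of "- 1" "- y"] y0 by (simp add: algebra_simps)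
      also have "\<dots> \<le> H (- 1) + \<bar>deriv H (- (\<delta> ^ 3 / 4))\<bar> * (1 - y)" using m y by (intro add_left_mono mult_right_mono) auto
      also have "\<dots> \<le> H (- 1) + \<bar>deriv H (- (\<delta> ^ 3 / 4))\<bar> * 1" using y y0 by (intro add_left_mono mult_left_mono) auto
      finally show "H (- y) \<le> A" by (simp add: A_def)
      show "deriv H (- y) \<le> A" using m by (simp add: A_def)
    qed
    have small: "\<delta> ^ 3 / 4 \<le> t / 2 / B0" "t / 2 / B0 \<le> 1" "\<delta> ^ 3 / 4 \<le> t / 4 / B0" "t / 4 / B0 \<le> 1"
    proof -
      have 1: "0 < t / B0" "t / B0 \<le> 1" using t b \<delta>(1) \<delta>b(3) unfolding \<delta>_def by (simp, linarith)
      have 2: "t / 2 / B0 = t / B0 / 2" "t / 4 / B0 = t / B0 / 4" by simp_all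
      have "0 < \<delta> ^ 3" using \<delta>0 by simp
      then show "\<delta> ^ 3 / 4 \<le> t / 2 / B0" using 1 2 \<delta>3(1) by linarith
      show "t / 2 / B0 \<le> 1" using 1 2 by linarith
      show "\<delta> ^ 3 / 4 \<le> t / 4 / B0" using 1 2 \<delta>3(1) by linarith
      show "t / 4 / B0 \<le> 1" using 1 2 by linarith
    qed
    define f where "f = (\<lambda>r. H (- r / B0))"
    define f' where "f' = (\<lambda>r. - deriv H (- r / B0) / B0)"
    define f'' where "f'' = (\<lambda>r. deriv (deriv H) (- r / B0) / B0\<^sup>2)"
    have rB: "- r / B0 < 0" if "0 < r" for r using that b by simp
    have lin: "((\<lambda>r. - r / B0) has_real_derivative - (1 / B0)) (at r)" for r
      using b by (auto intro!: derivative_eq_intros)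
    have d1: "(f has_real_derivative f' r) (at r)" if "0 < r" for r
      using DERIV_chain2[OF dH(1)[OF rB[OF that]] lin] by (simp add: f_def f'_def)
    have d2: "(f' has_real_derivative f'' r) (at r)" if "0 < r" for r
    proof -
      have "((\<lambda>r. - deriv H (- r / B0) / B0) has_real_derivative (- (deriv (deriv H) (- r / B0) * - (1 / B0)) / B0)) (at r)"
        by (intro DERIV_cdivide DERIV_minus DERIV_chain2[OF dH(2)[OF rB[OF that]] lin])
      then show ?thesis using b by (simp add: f'_def f''_def power2_eq_square)
    qed
    have cont: "continuous_on {0<..} f''"
      unfolding f''_def using b rB
      by (intro continuous_intros continuous_on_compose2[OF cont2(1)]) auto
    \<comment> \<open>Here s <= g p <= B0 d, so -d lies to the left of -s / B0, and both lie in [-1,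
      0).\<close>
    have maj: "u p \<le> ereal (f s + e)" if p: "p \<in> D" "0 < s" "ereal s \<le> g p" "g p \<le> ereal t" for p s
    proof -
      have pL: "p \<in> D - level t" using p by (auto simp: level_def)
      then obtain x where x: "compl_dist D p = ereal x" "0 < x" "x \<le> t / b0" "G p \<le> B0 * x" using coll by blast
      have "p \<noteq> z0" using p g_z0 by auto
      then have "g p = ereal (G p)" using p(1) g_real by simp
      then have "s \<le> G p" using p(3) by (metis ereal_less_eq(3))
      then have sx: "s / B0 \<le> x" using x(4) b by (simp add: field_simps)
      have x1: "x \<le> 1" using x(3) tb b by linarith
      have "deriv H (- x) * (- s / B0 - - x) \<le> H (- s / B0) - H (- x)" by (rule tangent) (use rB[OF p(2)] x in auto)
      moreover have "- e * (x - s / B0) \<le> deriv H (- x) * (x - s / B0)"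
      proof (rule mult_right_mono)
        have "deriv H (- 1) \<le> deriv H (- x)" using x x1 by (intro mon) auto
        then show "- e \<le> deriv H (- x)" by (simp add: e_def)
      qed (use sx in simp)
      moreover have "e * (x - s / B0) \<le> e * 1"
      proof (rule mult_left_mono)
        have "0 < s / B0" using p b by simp
        then show "x - s / B0 \<le> 1" using x1 by linarith
      qed (simp add: e_def)
      ultimately have "H (- x) \<le> f s + e" by (simp add: f_def algebra_simps)
      moreover have "u p \<le> ereal (H (- x))" using uM[OF p(1)] majorant_finite[OF p(1) x(1), of H] H(3) by simp
      ultimately show ?thesis by (metis ereal_less_eq(3) order_trans)
    qed
    have "- f' (t / 2) \<le> A"
    proof -
      have "deriv H (- (t / 2 / B0)) / B0 \<le> A / B0" using HA(2) small b by (intro divide_right_mono) auto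
      also have "\<dots> \<le> A" using b A0 by (simp add: divide_le_eq mult_le_cancel_left1)
      finally show ?thesis by (simp add: f'_def)
    qed
    moreover have "f (t / 2) + e \<le> 2 * A" "f (t / 4) + e \<le> 2 * A"
      using HA(1)[of "t / 2 / B0"] HA(1)[of "t / 4 / B0"] small A0(2) by (simp_all add: f_def)
    moreover have "0 \<le> f'' r" if "0 < r" for r using nn2[OF rB[OF that]] by (simp add: f''_def)
    ultimately obtain U where U: "0 \<le> 2 * A + U" "u z0 \<noteq> -\<infinity> \<Longrightarrow> U \<le> - real_of_ereal (u z0)"
      and est: "\<And>K b. convex_on {0..} K \<Longrightarrow> mono_on {0..} K \<Longrightarrow> K 0 = 0 \<Longrightarrow> (\<forall>x\<ge>0. 0 \<le> K x) \<Longrightarrow> K t \<le> b \<Longrightarrow>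
       (\<integral>\<^sup>+p\<in>D - level t. ennreal (K (G p)) \<partial>\<nu>)
         \<le> ennreal (6 * b / t * (2 * A + U) + b * A) + (\<integral>\<^sup>+r\<in>{0<..t}. ennreal (K r * f'' r) \<partial>lborel)"
      using collar_convex_estimate[OF u \<nu> t(1) Ls pos maj d1 d2 _ cont, of "2 * A" A] A0(1) by blast
    have w0: "0 < w" "w \<le> 1 / b0" using w b by (auto simp: le_divide_eq)
    define R where "R = 6 * (w * b) / t * (2 * A + U) + w * b * A"
    have mass: "mass_integral D (level t) \<nu> k \<le> ennreal R + ennreal (w / B0\<^sup>2) * J"
    proof -
      have "mass_integral D (level t) \<nu> k \<le> (\<integral>\<^sup>+p\<in>D - level t. ennreal (w * K (G p)) \<partial>\<nu>)"
        unfolding mass_integral_def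
      proof (rule nn_integral_mono)
        fix p
        show "ennreal (k (real_of_ereal (compl_dist D p))) * indicator (D - level t) p \<le> ennreal (w * K (G p)) * indicator (D - level t) p"
        proof (cases "p \<in> D - level t")
          case True
          then obtain x where x: "compl_dist D p = ereal x" "0 < x" "b0 * x \<le> G p" using coll by blast
          have "k x \<le> w * K (b0 * x)" by (rule k[OF x(2)])
          also have "\<dots> \<le> w * K (G p)"
          proof (rule mult_left_mono)
            have "0 < b0 * x" using x b by simp
            then show "K (b0 * x) \<le> K (G p)" using x(3) by (intro mono_onD[OF K(2)]) auto
          qed (use w0 in simp)
          finally show ?thesis using x(1) True by (simp add: ennreal_leI)
        qed simp
      qed
      also have "\<dots> \<le> ennreal R + (\<integral>\<^sup>+r\<in>{0<..t}. ennreal (w * K r * f'' r) \<partial>lborel)"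
        unfolding R_def
      proof (rule est)
        show "convex_on {0..} (\<lambda>x. w * K x)" using K(1) w0 by (intro convex_on_cmul) auto
        show "mono_on {0..} (\<lambda>x. w * K x)"
        proof (rule mono_onI)
          fix x y :: real assume xy: "x \<in> {0..}" "y \<in> {0..}" "x \<le> y"
          show "w * K x \<le> w * K y" by (rule mult_left_mono[OF mono_onD[OF K(2) xy]]) (use w0 in simp)
        qed
        have "K t \<le> K t0" using \<delta>0 t by (intro mono_onD[OF K(2)]) auto
        then show "w * K t \<le> w * b" using K(5) w0 by (intro mult_left_mono) auto
      qed (use K w0 in auto)
      also have "(\<integral>\<^sup>+r\<in>{0<..t}. ennreal (w * K r * f'' r) \<partial>lborel)
          \<le> (\<integral>\<^sup>+r. ennreal (w / B0\<^sup>2) * (ennreal (K r * deriv (deriv F) (- r / B0)) * indicator {0<..t0} r) \<partial>lborel)"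
      proof (rule nn_integral_mono_AE)
        \<comment> \<open>At r = t the argument -t / B0 may be the end point -x1 of the interval on
          which F and H agree, so their second derivatives may differ there; this single point is
          discarded.\<close>
        show "AE r in lborel. ennreal (w * K r * f'' r) * indicator {0<..t} r
            \<le> ennreal (w / B0\<^sup>2) * (ennreal (K r * deriv (deriv F) (- r / B0)) * indicator {0<..t0} r)"
          using AE_lborel_singleton[of t]
        proof eventually_elim
          case (elim r)
          show ?case
          proof (cases "0 < r \<and> r < t")
            case True
            then have "r / B0 < t / B0" using b by (intro divide_strict_right_mono) auto
            then have "deriv (deriv F) (- r / B0) = deriv (deriv H) (- r / B0)"
              using True rB p1(3) by (intro ddFH) auto
            then have "w * K r * f'' r = w / B0\<^sup>2 * (K r * deriv (deriv F) (- r / B0))" by (simp add: f''_def)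
            then have "ennreal (w * K r * f'' r) = ennreal (w / B0\<^sup>2) * ennreal (K r * deriv (deriv F) (- r / B0))"
            proof (simp only:, intro ennreal_mult)
              show "0 \<le> w / B0\<^sup>2" using w0 by simp
              show "0 \<le> K r * deriv (deriv F) (- r / B0)" using K(4) True nn2F[OF rB] by simp
            qed
            then show ?thesis using True \<delta>0 by simp
          qed (use elim in \<open>auto simp: indicator_def\<close>)
        qed
      qed
      also have "(\<integral>\<^sup>+r. ennreal (w / B0\<^sup>2) * (ennreal (K r * deriv (deriv F) (- r / B0)) * indicator {0<..t0} r) \<partial>lborel) = ennreal (w / B0\<^sup>2) * J"
        unfolding J
      proof (rule nn_integral_cmult)
        have cK: "continuous_on {0<..} K" by (rule convex_on_continuous[OF _ convex_on_subset[OF K(1)]]) auto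
        have "(\<lambda>r. indicator {0<..t0} r *\<^sub>R (K r * deriv (deriv F) (- r / B0))) \<in> borel_measurable borel"
        proof (rule borel_measurable_continuous_on_indicator)
          show "continuous_on {0<..t0} (\<lambda>r. K r * deriv (deriv F) (- r / B0))"
            using b rB by (intro continuous_intros continuous_on_compose2[OF cont2(2)] continuous_on_subset[OF cK]) auto
        qed simp
        then have "(\<lambda>r. ennreal (indicator {0<..t0} r *\<^sub>R (K r * deriv (deriv F) (- r / B0)))) \<in> borel_measurable borel" by measurable
        moreover have "(\<lambda>r. ennreal (indicator {0<..t0} r *\<^sub>R (K r * deriv (deriv F) (- r / B0)))) =
            (\<lambda>r. ennreal (K r * deriv (deriv F) (- r / B0)) * indicator {0<..t0} r)"
          by (auto simp: fun_eq_iff indicator_def)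
        ultimately show "(\<lambda>r. ennreal (K r * deriv (deriv F) (- r / B0)) * indicator {0<..t0} r) \<in> borel_measurable lborel" by simp
      qed
      finally show ?thesis by (simp add: add_left_mono)
    qed
    have fin: "mass_integral D (level t) \<nu> k < \<infinity>" if "J < \<infinity>"
      by (rule le_less_trans[OF mass]) (use that in \<open>simp add: ennreal_mult_less_top\<close>)
    have "enn2ereal (mass_integral D (level t) \<nu> k) \<le> right_side (w / B0\<^sup>2) J (6 * b / \<delta> ^ 3) (3 * A) (u z0)"
    proof (cases "u z0 = -\<infinity> \<or> J = \<infinity>")
      case True
      have "0 < w / B0\<^sup>2" using w0 b by simp
      moreover have "u z0 \<noteq> \<infinity>"
        using sphere_subharmonic_lt_top[OF u(1) z0D] by simp
      ultimately have "right_side (w / B0\<^sup>2) J (6 * b / \<delta> ^ 3) (3 * A) (u z0) = \<infinity>"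
        using True by (cases "u z0") (auto simp: right_side_def)
      then show ?thesis by simp
    next
      case False
      then obtain j where j: "J = ennreal j" "0 \<le> j" by (cases J) auto
      obtain v where v: "u z0 = ereal v" using False sphere_subharmonic_lt_top[OF u(1) z0D] by (cases "u z0") auto
      have UV: "U \<le> - v" using U(2) v by simp
      define c where "c = 6 * b / \<delta> ^ 3"
      have \<delta>30: "0 < \<delta> ^ 3" using \<delta>0 by simp
      \<comment> \<open>For w = 1 this is \<delta>^3 <= t, for w = 1 / b0 it is \<delta>^3 <= t
        b0.\<close>
      have kt: "w / t \<le> 1 / \<delta> ^ 3"
      proof -
        have "\<delta> ^ 3 * w \<le> t"
        proof (cases "w = 1")
          case False
          then have "\<delta> ^ 3 * w = \<delta> ^ 3 / b0" using w by simp
          then show ?thesis using \<delta>3(3) b by (simp add: divide_le_eq)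
        qed (use \<delta>3(2) in simp)
        then show ?thesis using t \<delta>30 by (simp add: field_simps)
      qed
      have k1: "w \<le> 6 / \<delta> ^ 3"
      proof -
        have "w = w / t * t" using t by simp
        also have "\<dots> \<le> 1 / \<delta> ^ 3 * 1"
        proof (rule mult_mono[OF kt])
          have "t \<le> b0" using tb t b by (simp add: field_simps) (metis b(1) b(2) less_eq_real_def mult_left_le order_trans)
          then show "t \<le> 1" using b by linarith
        qed (use t \<delta>30 in auto)
        also have "\<dots> \<le> 6 / \<delta> ^ 3" using \<delta>30 by (simp add: divide_right_mono)
        finally show ?thesis .
      qed
      have "R = (6 * b) * (w / t) * (2 * A + U) + w * (b * A)" by (simp add: R_def)
      \<comment> \<open>The 3 in front of A: one for the values of H, one for the error e, one for
        the slope at t / 2.\<close>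
      also have "\<dots> \<le> (6 * b) * (1 / \<delta> ^ 3) * (2 * A + U) + (6 / \<delta> ^ 3) * (b * A)"
        using kt k1 b0 U(1) A0 by (intro add_mono mult_right_mono mult_left_mono) auto
      also have "\<dots> = c * (3 * A + U)" by (simp add: c_def algebra_simps add_divide_distrib)
      also have "\<dots> \<le> c * (3 * A - v)" using UV b0 \<delta>30 by (intro mult_left_mono) (auto simp: c_def)
      finally have R: "R \<le> c * (3 * A) - c * v" by (simp add: algebra_simps)
      have "0 \<le> 6 * (w * b) / t" "0 \<le> w * b * A" using b0 w0 t A0 by auto
      then have R0: "0 \<le> R" unfolding R_def using add_nonneg_nonneg[OF mult_nonneg_nonneg[OF _ U(1)]] by blast
      have cj: "0 \<le> w / B0\<^sup>2 * j" using w0 b j by simp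
      have "enn2ereal (mass_integral D (level t) \<nu> k) \<le> enn2ereal (ennreal (R + w / B0\<^sup>2 * j))"
      proof -
        have "ennreal R + ennreal (w / B0\<^sup>2) * J = ennreal (R + w / B0\<^sup>2 * j)"
          using R0 cj j w0 b by (simp add: ennreal_mult[symmetric])
        then show ?thesis using mass by (simp add: less_eq_ennreal.rep_eq)
      qed
      also have "\<dots> = ereal (R + w / B0\<^sup>2 * j)" by (rule enn2ereal_ennreal) (use R0 cj in linarith)
      also have "\<dots> \<le> ereal (w / B0\<^sup>2 * j + c * (3 * A) - c * v)" using R by simp
      also have "\<dots> = right_side (w / B0\<^sup>2) J c (3 * A) (u z0)" using j v by (simp add: right_side_def)
      finally show ?thesis by (simp add: c_def)
    qed
    then show ?thesis using fin unfolding MC EC by blast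
  qed
  show ?thesis
  proof (intro exI[of _ "level t"] exI[of _ t0] conjI)
    show "sphere_domain (level t)" "rel_compact_in (level t) D" by fact+
    show "z0 \<in> level t" using z0D g_z0 by (simp add: level_def)
    show "\<forall>p\<in>D - level t. \<exists>x. compl_dist D p = ereal x \<and> 0 < x" using coll by blast
    show "0 < t0" using \<delta>0 t by linarith
    show "ereal t0 = ereal B0 * (SUP p\<in>riemann_sphere frontier_of level t. compl_dist D p)"
      unfolding S t0_def \<delta>_def by simp
  qed (intro allI impI, elim conjE, unfold Let_def, rule main, assumption+, blast+)
qed

end

section \<open>The Riesz measure of \<open>ln |h|\<close>\<close>

text \<open>The test function is a step in ln |w - a|, so its Laplacian is minus the radial kernel
  of p''. Against the harmonic ln |k| it gives a multiple of the integral of p'', which is 0;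
  against m ln |w - a| it gives -2 pi m times the integral of x p'', which is -1.\<close>

lemma log_zero_test:
  assumes k: "k holomorphic_on ball a r" "\<And>w. w \<in> ball a r \<Longrightarrow> k w \<noteq> 0"
    and U: "\<And>w. w \<in> ball a r \<Longrightarrow> w \<noteq> a \<Longrightarrow> U w = ln (cmod (k w)) + m * ln (cmod (w - a))"
    and AB: "A < B" "exp B < r"
  shows "\<exists>h. test_function (ball a r) h \<and> (\<forall>w. 0 \<le> h w \<and> h w \<le> 1) \<and> (\<forall>w\<in>cball a (exp A). h w = 1) \<and>
    (\<forall>w. w \<notin> cball a (exp B) \<longrightarrow> h w = 0) \<and> 1 / (2 * pi) * (LINT w|lborel. U w * laplacian h w) = m"
proof -
  obtain p p' p'' where s: "\<And>k. Ck_real k p" "\<And>x. (p has_real_derivative p' x) (at x)" "\<And>x. (p' has_real_derivative p'' x) (at x)"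
    "continuous_on UNIV p''" "\<And>x. 0 \<le> p x \<and> p x \<le> 1" "\<And>x. x \<le> A \<Longrightarrow> p x = 0 \<and> p' x = 0 \<and> p'' x = 0"
    "\<And>x. B \<le> x \<Longrightarrow> p x = 1 \<and> p' x = 0 \<and> p'' x = 0"
    using smooth_step[OF AB(1)] by (elim exE conjE) blast
  have sz: "p'' x = 0" if "x \<le> A \<or> B \<le> x" for x using that s(6,7) by blast
  define h where "h = (\<lambda>w. if w = a then 1 else 1 - p (ln (cmod (w - a))))"
  have r: "0 < r" using AB(2) exp_gt_zero[of B] by linarith
  have one: "h w = 1" if "w \<in> cball a (exp A)" for w
  proof (cases "w = a")
    case False
    then have "ln (cmod (w - a)) \<le> A" using that ln_le_cancel_iff[of "cmod (w - a)" "exp A"] by (simp add: dist_norm norm_minus_commute)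
    then show ?thesis using s(6) False by (simp add: h_def)
  qed (simp add: h_def)
  have zero: "h w = 0" if "w \<notin> cball a (exp B)" for w
  proof -
    have c: "exp B < cmod (w - a)" using that by (simp add: dist_norm norm_minus_commute)
    then have "w \<noteq> a" by auto
    moreover have "B \<le> ln (cmod (w - a))" using c \<open>w \<noteq> a\<close> by (simp add: ln_ge_iff)
    ultimately show ?thesis using s(7) by (simp add: h_def)
  qed
  have o: "open (- {a})" by auto
  have Ck: "Ck_on n UNIV h" for n
  proof (rule Ck_on_local)
    fix z
    show "\<exists>U. open U \<and> z \<in> U \<and> Ck_on n U h"
    proof (cases "z = a")
      case True
      have "Ck_on n (ball a (exp A)) h" by (rule Ck_on_cong[OF open_ball _ Ck_on_const[of n _ 1]]) (use one in auto)
      then show ?thesis using True by (intro exI[of _ "ball a (exp A)"]) simp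
    next
      case False
      have "Ck_on n (- {a}) h"
        by (rule Ck_on_cong[OF o _ Ck_on_diff[OF o Ck_on_const[of n _ 1] Ck_on_compose_real[OF o s(1) Ck_on_ln_norm]]])
          (simp add: h_def)
      then show ?thesis using False o by blast
    qed
  qed
  have lap: "laplacian h w = - radial_kernel p'' a w" for w
  proof (cases "w = a")
    case True
    have "laplacian h w = laplacian (\<lambda>w. 1) w" using True one by (intro laplacian_cong_open[OF open_ball[of a "exp A"]]) auto
    then show ?thesis using True by (simp add: laplacian_const radial_kernel_def)
  next
    case False
    have "laplacian h w = laplacian (\<lambda>w. 1 - p (ln (cmod (w - a)))) w"
      using False by (intro laplacian_cong_open[OF o]) (auto simp: h_def)
    also have "\<dots> = radial_kernel (\<lambda>x. - p'' x) a w"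
      by (rule laplacian_radial[OF False, where \<tau> = "\<lambda>x. 1 - p x" and \<tau>' = "\<lambda>x. - p' x"])
        (auto intro!: derivative_eq_intros s)
    finally show ?thesis using False by (simp add: radial_kernel_def)
  qed
  have test: "test_function (ball a r) h"
    unfolding test_function_def using Ck zero AB(2) by (intro conjI allI exI[of _ "cball a (exp B)"]) auto
  obtain L where L: "L holomorphic_on ball a r" "\<And>w. w \<in> ball a r \<Longrightarrow> exp (L w) = k w"
    using holomorphic_logarithm_exists[OF convex_ball open_ball k, of a] r by auto
  have lnk: "ln (cmod (k w)) = Re (L w)" if "w \<in> ball a r" for w
    using L(2)[OF that, symmetric] by simp
  let ?rk = "radial_kernel p'' a"
  have rk0: "?rk w = 0" if "w \<notin> ball a r" for w
    using that AB(2) by (intro radial_kernel_zero[OF sz]) (auto simp: dist_norm norm_minus_commute)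
  have "continuous_on (ball a r) (\<lambda>w. Re (L w))" using L(1) by (intro continuous_intros holomorphic_on_imp_continuous_on)
  then have li: "loc_integrable (ball a r) (\<lambda>w. Re (L w))" by (rule loc_integrable_continuous[OF open_ball])
  have i1: "integrable lborel (\<lambda>w. Re (L w) * ?rk w)"
    by (rule integrable_radial_kernel[OF s(4) sz li]) (use AB(2) in auto)
  define k2 where "k2 = (\<lambda>x. x * p'' x)"
  have k2: "continuous_on UNIV k2" "\<And>x. x \<le> A \<or> B \<le> x \<Longrightarrow> k2 x = 0"
    unfolding k2_def using sz by (auto intro!: continuous_intros s(4))
  have e: "U w * laplacian h w = - (Re (L w) * ?rk w) - m * radial_kernel k2 a w" for w
  proof (cases "w \<in> ball a r \<and> w \<noteq> a")
    case True
    then show ?thesis using U[of w] lnk[of w] by (simp add: lap radial_kernel_def k2_def algebra_simps add_divide_distrib)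
  next
    case False
    have "radial_kernel k2 a w = 0" if "w \<notin> ball a r"
      using that AB(2) by (intro radial_kernel_zero[OF k2(2)]) (auto simp: dist_norm norm_minus_commute)
    then show ?thesis using False rk0[of w] by (auto simp: lap radial_kernel_def)
  qed
  have j1: "(LINT w|lborel. Re (L w) * ?rk w) = 0"
  proof -
    have "(LINT w|lborel. Re (L w) * ?rk w)
        = (LINT x|lborel. p'' x * (LINT t|lborel. indicator {0<..<2*pi} t * Re (L (a + of_real (exp x) * cis t))))"
      by (rule radial_kernel_integral(1)[OF i1])
    also have "\<dots> = (LINT x|lborel. p'' x * (2 * pi * Re (L a)))"
    proof (rule Bochner_Integration.integral_cong[OF refl])
      fix x
      show "p'' x * (LINT t|lborel. indicator {0<..<2*pi} t * Re (L (a + of_real (exp x) * cis t))) = p'' x * (2 * pi * Re (L a))"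
      proof (cases "x < B")
        case True
        then have xr: "exp x < r" using AB(2) by (meson exp_less_mono less_trans)
        have c: "continuous_on {0..2*pi} (\<lambda>t. Re (L (a + of_real (exp x) * cis t)))"
          by (intro continuous_intros continuous_on_compose2[OF holomorphic_on_imp_continuous_on[OF L(1)]])
            (use xr in \<open>auto simp: dist_norm norm_mult\<close>)
        have "(LINT t|lborel. indicator {0<..<2*pi} t * Re (L (a + of_real (exp x) * cis t)))
            = (LINT t|lborel. indicator {0..2*pi} t *\<^sub>R Re (L (a + of_real (exp x) * cis t)))"
          using integral_open_interval_eq(1) by simp
        also have "\<dots> = integral {0..2*pi} (\<lambda>t. Re (L (a + of_real (exp x) * cis t)))"
          using set_borel_integral_eq_integral(2)[OF borel_integrable_atLeastAtMost'[OF c]] by (simp add: set_lebesgue_integral_def)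
        also have "\<dots> = 2 * pi * Re (L a)"
          using mean_value_Re_holomorphic[OF L(1) _ xr] by (intro integral_unique) simp
        finally show ?thesis by simp
      qed (use sz in simp)
    qed
    also have "\<dots> = (LINT x|lborel. p'' x) * (2 * pi * Re (L a))" by simp
    also have "(LINT x|lborel. p'' x) = p' B - p' A"
      by (rule integral_second_derivative_step(1)[OF s(3,4)]) (use AB sz in auto)
    finally show ?thesis using s(6)[of A] s(7)[of B] by simp
  qed
  have j2: "(LINT w|lborel. radial_kernel k2 a w) = - 2 * pi"
  proof -
    \<comment> \<open>Integration by parts: x p'' is the derivative of x p' - p, and p rises from 0
      to 1.\<close>
    have "(LINT x|lborel. k2 x) = (B * p' B - p B) - (A * p' A - p A)"
    proof (rule integral_second_derivative_step(1)[where f = "\<lambda>x. x * p' x - p x", OF _ k2(1)])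
      show "((\<lambda>x. x * p' x - p x) has_real_derivative k2 x) (at x)" for x
        unfolding k2_def by (rule derivative_eq_intros s(2,3) refl | simp)+
    qed (use AB k2(2) in auto)
    also have "\<dots> = - 1" using s(6)[of A] s(7)[of B] by simp
    finally show ?thesis using radial_kernel_total(2)[OF k2] by simp
  qed
  have "(LINT w|lborel. U w * laplacian h w) = - 0 - m * (- 2 * pi)"
  proof -
    have "integrable lborel (radial_kernel k2 a)" by (rule radial_kernel_total(1)[OF k2])
    then show ?thesis unfolding e using i1 j1 j2 by (subst Bochner_Integration.integral_diff) auto
  qed
  then have "1 / (2 * pi) * (LINT w|lborel. U w * laplacian h w) = m" using pi_gt_zero by simp
  moreover have "\<forall>w. 0 \<le> h w \<and> h w \<le> 1" using s(5) by (auto simp: h_def)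
  ultimately show ?thesis using test one zero by blast
qed

text \<open>A test that is 1 on N A and 0 off N B bounds the measure of N A by m and that of N B
  below by m. So all small neighbourhoods have measure m; continuity from above concentrates it at p
  and leaves nothing around p.\<close>

lemma point_mass_from_tests:
  fixes N :: "real \<Rightarrow> 'a set"
  assumes N: "\<And>x. N x \<in> sets \<nu>" "\<And>x y. x \<le> y \<Longrightarrow> N x \<subseteq> N y" "(\<Inter>x. N x) = {p}"
    and T: "\<And>A B. A < B \<Longrightarrow> B < b \<Longrightarrow> \<exists>\<Phi>. integrable \<nu> \<Phi> \<and> (LINT q|\<nu>. \<Phi> q) = m \<and> (\<forall>q. 0 \<le> \<Phi> q \<and> \<Phi> q \<le> 1) \<and>
      (\<forall>q\<in>N A. \<Phi> q = 1) \<and> (\<forall>q. q \<notin> N B \<longrightarrow> \<Phi> q = (0::real))"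
    and x: "x < b"
  shows "emeasure \<nu> {p} = ennreal m" "emeasure \<nu> (N x - {p}) = 0"
proof -
  have N_eq: "emeasure \<nu> (N y) = ennreal m" if y: "y < b" for y
  proof (rule antisym)
    obtain B where B: "y < B" "B < b" using dense y by blast
    obtain \<Phi> where \<Phi>: "integrable \<nu> \<Phi>" "(LINT q|\<nu>. \<Phi> q) = m" "\<And>q. 0 \<le> \<Phi> q" "\<And>q. q \<in> N y \<Longrightarrow> \<Phi> q = 1"
      using T[OF B] by blast
    have "emeasure \<nu> (N y) = (\<integral>\<^sup>+q. indicator (N y) q \<partial>\<nu>)" using N(1) by simp
    also have "\<dots> \<le> (\<integral>\<^sup>+q. ennreal (\<Phi> q) \<partial>\<nu>)"
      using \<Phi>(3,4) by (intro nn_integral_mono) (auto simp: indicator_def)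
    also have "\<dots> = ennreal m" using nn_integral_eq_integral[OF \<Phi>(1)] \<Phi>(2,3) by simp
    finally show "emeasure \<nu> (N y) \<le> ennreal m" .
    have "y - 1 < y" by simp
    from T[OF this y] obtain \<Psi> where \<Psi>: "integrable \<nu> \<Psi>" "(LINT q|\<nu>. \<Psi> q) = m" "\<And>q. 0 \<le> \<Psi> q \<and> \<Psi> q \<le> 1" "\<And>q. q \<notin> N y \<Longrightarrow> \<Psi> q = 0"
      by blast
    have "ennreal m = (\<integral>\<^sup>+q. ennreal (\<Psi> q) \<partial>\<nu>)" using nn_integral_eq_integral[OF \<Psi>(1)] \<Psi>(2,3) by simp
    also have "\<dots> \<le> (\<integral>\<^sup>+q. indicator (N y) q \<partial>\<nu>)"
      using \<Psi>(3,4) by (intro nn_integral_mono) (auto simp: indicator_def intro: ennreal_leI[of _ 1, simplified])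
    also have "\<dots> = emeasure \<nu> (N y)" using N(1) by simp
    finally show "ennreal m \<le> emeasure \<nu> (N y)" .
  qed
  define A where "A = (\<lambda>n::nat. N (x - real n))"
  have xn: "x - real n < b" for n using x by (meson diff_le_self le_less_trans of_nat_0_le_iff diff_left_mono linorder_not_less order_le_less_trans le_add_same_cancel1 diff_le_eq)
  have "(\<Inter>n. A n) = (\<Inter>x. N x)"
  proof (rule antisym)
    show "(\<Inter>n. A n) \<subseteq> (\<Inter>x. N x)"
    proof (intro INT_greatest)
      fix y
      obtain n :: nat where "x - y \<le> real n" using real_arch_simple by blast
      then have "A n \<subseteq> N y" unfolding A_def by (intro N(2)) simp
      then show "(\<Inter>n. A n) \<subseteq> N y" by blast
    qed
  qed (auto simp: A_def)
  then have A: "(\<Inter>n. A n) = {p}" using N(3) by simp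
  have "(INF n. emeasure \<nu> (A n)) = emeasure \<nu> (\<Inter>n. A n)"
  proof (rule INF_emeasure_decseq)
    show "range A \<subseteq> sets \<nu>" using N(1) by (auto simp: A_def)
    show "decseq A" unfolding decseq_def A_def by (intro allI impI N(2)) simp
    show "emeasure \<nu> (A n) \<noteq> \<infinity>" for n using N_eq[OF xn] by (simp add: A_def)
  qed
  then show p: "emeasure \<nu> {p} = ennreal m" unfolding A using N_eq[OF xn] by (simp add: A_def)
  have "{p} \<in> sets \<nu>" unfolding A[symmetric] using N(1) by (intro sets.countable_INT) (auto simp: A_def)
  moreover have "{p} \<subseteq> N x" using N(3) by blast
  ultimately show "emeasure \<nu> (N x - {p}) = 0"
    using emeasure_Diff[of \<nu> "{p}" "N x"] p N_eq[OF x] N(1) by simp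
qed

text \<open>Applied to the Riesz measure with the identity and to the counting measure with Z, it
  expands both sides over the same enumeration. The guard
  \<open>to_nat_on C (from_nat_into C n) = n\<close> counts every element once, also when C is
  finite.\<close>

lemma nn_integral_countable_range:
  fixes T :: "'a \<Rightarrow> 'c" and \<mu> :: "'a measure"
  assumes C: "countable C" "AE x in \<mu>. T x \<in> C" "\<And>c. c \<in> C \<Longrightarrow> {x \<in> space \<mu>. T x = c} \<in> sets \<mu>"
  shows "(\<integral>\<^sup>+x. f (T x) \<partial>\<mu>) = (\<Sum>n. if from_nat_into C n \<in> C \<and> to_nat_on C (from_nat_into C n) = n
    then f (from_nat_into C n) * emeasure \<mu> {x \<in> space \<mu>. T x = from_nat_into C n} else 0)"
proof -
  let ?c = "from_nat_into C"
  let ?P = "\<lambda>n. ?c n \<in> C \<and> to_nat_on C (?c n) = n"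
  let ?g = "\<lambda>n x. (if ?P n then f (?c n) else 0) * indicator {x \<in> space \<mu>. T x = ?c n} x"
  have m: "?g n \<in> borel_measurable \<mu>" for n
  proof (cases "?P n")
    case True
    then have "{x \<in> space \<mu>. T x = ?c n} \<in> sets \<mu>" using C(3) by blast
    then show ?thesis by measurable
  next
    case False
    then have "(if ?P n then f (?c n) else 0) = 0" by (rule if_not_P)
    then show ?thesis by (simp only: mult_zero_left borel_measurable_const)
  qed
  have "(\<integral>\<^sup>+x. f (T x) \<partial>\<mu>) = (\<integral>\<^sup>+x. (\<Sum>n. ?g n x) \<partial>\<mu>)"
  proof (rule nn_integral_cong_AE)
    show "AE x in \<mu>. f (T x) = (\<Sum>n. ?g n x)"
      using C(2) AE_space
    proof eventually_elim
      case (elim x)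
      define n0 where "n0 = to_nat_on C (T x)"
      have n0: "?c n0 = T x" using from_nat_into_to_nat_on[OF C(1) elim(1)] by (simp add: n0_def)
      have "?g n x = 0" if "n \<notin> {n0}" for n
        using that by (auto simp: n0_def indicator_def)
      then have "(\<Sum>n. ?g n x) = (\<Sum>n\<in>{n0}. ?g n x)" by (intro suminf_finite) auto
      also have "\<dots> = f (T x)" using n0 elim by (simp add: n0_def[symmetric])
      finally show ?case by simp
    qed
  qed
  also have "\<dots> = (\<Sum>n. \<integral>\<^sup>+x. ?g n x \<partial>\<mu>)" by (rule nn_integral_suminf[OF m])
  also have "\<dots> = (\<Sum>n. if ?P n then f (?c n) * emeasure \<mu> {x \<in> space \<mu>. T x = ?c n} else 0)"
    using C(3) by (intro arg_cong[where f = suminf] ext) (auto intro!: nn_integral_cmult_indicator)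
  finally show ?thesis .
qed

text \<open>Multiplicities at infinity are read in the chart 1 / w, Riesz measures in 1 / cnj w; a
  conjugation mediates.\<close>

lemma hol_chart_inf_eq: "hol_chart_inf w = sphere_inv (Some (cnj w))"
  by (cases "w = 0") (auto simp: hol_chart_inf_def)

lemma log_product:
  assumes "g \<noteq> 0" "v \<noteq> 0"
  shows "ln (cmod (g * v ^ n)) = ln (cmod g) + real n * ln (cmod v)"
  using assms by (simp add: norm_mult norm_power ln_mult ln_realpow)

lemma test_function_mono: "test_function S f \<Longrightarrow> S \<subseteq> T \<Longrightarrow> test_function T f"
  unfolding test_function_def by blast

lemma INT_cball_exp: "0 < c \<Longrightarrow> (\<Inter>x. cball a (min (exp x) c)) = {a :: complex}"
proof (intro equalityI subsetI)
  fix w assume c: "0 < c" and w: "w \<in> (\<Inter>x. cball a (min (exp x) c))"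
  show "w \<in> {a}"
  proof (rule ccontr)
    assume "w \<notin> {a}"
    then have d: "0 < dist a w" by simp
    have "w \<in> cball a (min (exp (ln (dist a w / 2))) c)" using w by blast
    then show False using d by simp
  qed
qed (auto simp: less_imp_le)

text \<open>Here i is the identity or the inversion, so that \<open>w \<mapsto> i (Some w)\<close> is one of the two charts.\<close>

lemma chart_point_mass:
  assumes s: "sets \<nu> = sets (restrict_space riemann_sphere_borel D)" and i: "\<And>q. i (i q) = q"
    and iU: "\<And>U. open U \<Longrightarrow> openin riemann_sphere {q. i q \<in> Some ` U}"
    and iK: "\<And>d. 0 < d \<Longrightarrow> closedin riemann_sphere {q. i q \<in> Some ` cball a d}"
    and r: "0 < r" "\<And>w. w \<in> ball a r \<Longrightarrow> i (Some w) \<in> D"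
    and test: "\<And>\<phi>. test_function {w. i (Some w) \<in> D} \<phi> \<Longrightarrow> integrable \<nu> (\<lambda>q. extend_zero \<phi> (i q)) \<and>
      (LINT q|\<nu>. extend_zero \<phi> (i q)) = 1 / (2 * pi) * (LINT w|lborel. U w * laplacian \<phi> w)"
    and k: "k holomorphic_on ball a r" "\<And>w. w \<in> ball a r \<Longrightarrow> k w \<noteq> 0"
    and U: "\<And>w. w \<in> ball a r \<Longrightarrow> w \<noteq> a \<Longrightarrow> U w = ln (cmod (k w)) + m * ln (cmod (w - a))"
  shows "\<exists>V. openin riemann_sphere V \<and> i (Some a) \<in> V \<and> V \<subseteq> D \<and> emeasure \<nu> {i (Some a)} = ennreal m \<and> emeasure \<nu> (V - {i (Some a)}) = 0"
proof -
  note mem = inj_image_mem_iff[OF inj_Some]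
  \<comment> \<open>The cap r / 2 keeps N x inside D for every real x; for x < ln (r / 2) it has no
    effect.\<close>
  define N where "N = (\<lambda>x. {q. i q \<in> Some ` cball a (min (exp x) (r / 2))})"
  have er: "exp x < r / 2" if "x < ln (r / 2)" for x using that r(1) by (metis exp_less_cancel_iff exp_ln half_gt_zero)
  have Nb: "N x = {q. i q \<in> Some ` cball a (exp x)}" if "x < ln (r / 2)" for x using er[OF that] by (simp add: N_def min_def)
  have ND: "N x \<subseteq> D" for x
  proof
    fix q assume "q \<in> N x"
    then obtain w where w: "w \<in> cball a (min (exp x) (r / 2))" "i q = Some w" by (auto simp: N_def)
    then have "w \<in> ball a r" using r(1) by (auto simp: min_le_iff_disj)
    then show "q \<in> D" using r(2) w(2) i by metis
  qed
  have sets: "K \<in> sets \<nu>" if "closedin riemann_sphere K" "K \<subseteq> D" for K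
    by (rule riesz_sets[OF s closedin_sets_riemann_sphere_borel[OF that(1)] that(2)])
  have Ns: "N x \<in> sets \<nu>" for x by (rule sets[OF _ ND]) (use iK r(1) in \<open>simp add: N_def\<close>)
  have Nm: "N x \<subseteq> N y" if "x \<le> y" for x y :: real
  proof -
    have "cball a (min (exp x) (r / 2)) \<subseteq> cball a (min (exp y) (r / 2))" using that by (intro subset_cball min.mono) auto
    then show ?thesis unfolding N_def by blast
  qed
  have NI: "(\<Inter>x. N x) = {i (Some a)}"
  proof -
    have "(\<Inter>x. N x) = {q. i q \<in> (\<Inter>x. Some ` cball a (min (exp x) (r / 2)))}" by (auto simp: N_def)
    also have "(\<Inter>x. Some ` cball a (min (exp x) (r / 2))) = Some ` (\<Inter>x. cball a (min (exp x) (r / 2)))"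
      by (subst image_INT[of _ UNIV]) auto
    also have "{q. i q \<in> Some ` (\<Inter>x. cball a (min (exp x) (r / 2)))} = {i (Some a)}"
      using INT_cball_exp[of "r / 2" a] r(1) i by auto (metis i)
    finally show ?thesis .
  qed
  have T: "\<exists>F. integrable \<nu> F \<and> (LINT q|\<nu>. F q) = m \<and> (\<forall>q. 0 \<le> F q \<and> F q \<le> 1) \<and>
    (\<forall>q\<in>N A. F q = 1) \<and> (\<forall>q. q \<notin> N B \<longrightarrow> F q = (0::real))" if AB: "A < B" "B < ln (r / 2)" for A B
  proof -
    have "exp B < r" using er[OF AB(2)] r(1) by simp
    from log_zero_test[OF k U AB(1) this] obtain \<phi> where \<phi>: "test_function (ball a r) \<phi>" "\<And>w. 0 \<le> \<phi> w \<and> \<phi> w \<le> 1"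
      "\<And>w. w \<in> cball a (exp A) \<Longrightarrow> \<phi> w = 1" "\<And>w. w \<notin> cball a (exp B) \<Longrightarrow> \<phi> w = 0"
      "1 / (2 * pi) * (LINT w|lborel. U w * laplacian \<phi> w) = m" by blast
    have "test_function {w. i (Some w) \<in> D} \<phi>"
      by (rule test_function_mono[OF \<phi>(1)], rule subsetI, rule CollectI, rule r(2))
    note t = test[OF this]
    let ?F = "\<lambda>q. extend_zero \<phi> (i q)"
    have "0 \<le> ?F q \<and> ?F q \<le> 1" for q using \<phi>(2) by (cases "i q") auto
    moreover have "?F q = 1" if "q \<in> N A" for q using that \<phi>(3) Nb[of A] AB by auto
    moreover have "?F q = 0" if "q \<notin> N B" for q
    proof (cases "i q")
      case (Some w)
      then have "w \<notin> cball a (exp B)" using that Nb[OF AB(2)] by auto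
      then show ?thesis using \<phi>(4) Some by simp
    qed simp
    ultimately show ?thesis using t \<phi>(5) by (intro exI[of _ ?F]) auto
  qed
  define x where "x = ln (r / 2) - 1"
  have x: "x < ln (r / 2)" by (simp add: x_def)
  note mass = point_mass_from_tests[OF Ns Nm NI T x]
  let ?V = "{q. i q \<in> Some ` ball a (exp x)}"
  have V: "?V \<subseteq> N x" using Nb[OF x] by auto
  have aV: "i (Some a) \<in> ?V" using i by simp
  have "{i (Some a)} \<in> sets \<nu>" using sets[OF closedin_singleton_sphere] aV V ND by blast
  then have "emeasure \<nu> (?V - {i (Some a)}) \<le> emeasure \<nu> (N x - {i (Some a)})" using V Ns by (intro emeasure_mono) auto
  then have "emeasure \<nu> (?V - {i (Some a)}) = 0" using mass(2) by simp
  moreover have "openin riemann_sphere ?V" by (rule iU) simp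
  ultimately show ?thesis using aV V ND mass(1) by (intro exI[of _ ?V]) blast
qed

text \<open>Near p, h is a nonvanishing holomorphic function times the m-th power of the coordinate,
  so u has the form required by \<open>chart_point_mass\<close>. At points where h is nonzero m = 0,
  so there is no mass nearby.\<close>

lemma zero_point_mass:
  assumes dom: "sphere_domain D" and u: "sphere_subharmonic_on D u" "\<exists>p\<in>D. u p \<noteq> -\<infinity>" and \<nu>: "is_riesz_measure D u \<nu>"
    and h: "sphere_holomorphic_on D h" and uh: "\<And>p. p \<in> D \<Longrightarrow> u p = (if h p = 0 then -\<infinity> else ereal (ln (cmod (h p))))"
    and p: "p \<in> D"
  shows "\<exists>V. openin riemann_sphere V \<and> p \<in> V \<and> V \<subseteq> D \<and> emeasure \<nu> {p} = ennreal (real_of_int (zero_mult h p)) \<and> emeasure \<nu> (V - {p}) = 0"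
proof -
  have oD: "openin riemann_sphere D" using dom by (simp add: sphere_domain_def)
  have s: "sets \<nu> = sets (restrict_space riemann_sphere_borel D)"
    and fin: "\<forall>K. compactin riemann_sphere K \<and> K \<subseteq> D \<longrightarrow> emeasure \<nu> K < \<infinity>"
    and t0: "\<And>v. test_function (finite_part D) v \<Longrightarrow>
        (LINT p|\<nu>. extend_zero v p) = 1 / (2 * pi) * (LINT z|lborel. real_of_ereal (u (Some z)) * laplacian v z)"
    and t1: "\<And>v. None \<in> D \<Longrightarrow> test_function (finite_part (sphere_inv ` D)) v \<Longrightarrow>
        (LINT p|\<nu>. extend_zero v (sphere_inv p)) = 1 / (2 * pi) * (LINT w|lborel. real_of_ereal (u (sphere_inv (Some w))) * laplacian v w)"
    using \<nu> unfolding is_riesz_measure_def by blast+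
  \<comment> \<open>If h vanished on an open set, u would be minus infinity there, against its
    finiteness almost everywhere. So the zero order is defined at every point.\<close>
  have nz: "\<exists>z\<in>V. h (Some z) \<noteq> 0" if V: "open V" "V \<noteq> {}" "V \<subseteq> finite_part D" for V
  proof (rule ccontr)
    assume "\<not> (\<exists>z\<in>V. h (Some z) \<noteq> 0)"
    then have "u (Some z) = -\<infinity>" if "z \<in> V" for z using that V(3) uh[of "Some z"] by (auto simp: finite_part_def)
    moreover have "Some z \<in> D" if "z \<in> V" for z using that V(3) by (auto simp: finite_part_def)
    ultimately have "AE z in lborel. z \<notin> V"
      using sphere_subharmonic_AE_finite[OF dom u] by (auto elim!: eventually_mono)
    then show False using not_AE_avoid_open[OF V(1,2)] by blast
  qed
  show ?thesis
  proof (cases p)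
    case (Some a)
    let ?f = "\<lambda>z. h (Some z)"
    have "a \<in> finite_part D" using p Some by (simp add: finite_part_def)
    then obtain r0 where r0: "0 < r0" "ball a r0 \<subseteq> finite_part D" using open_finite_part[OF oD] openE by blast
    have f: "?f holomorphic_on ball a r0" using h r0(2) holomorphic_on_subset by (auto simp: sphere_holomorphic_on_def)
    define m where "m = zorder ?f a"
    define g where "g = zor_poly ?f a"
    have zo: "(if ?f a = 0 then 0 < m else m = 0) \<and> (\<exists>r. 0 < r \<and> cball a r \<subseteq> ball a r0 \<and> g holomorphic_on cball a r
      \<and> (\<forall>w\<in>cball a r. ?f w = g w * (w - a) ^ nat m \<and> g w \<noteq> 0))"
      unfolding m_def g_def
      by (rule zorder_exist_zero[OF f open_ball connected_ball]) (use r0 nz[of "ball a r0"] in auto)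
    from conjunct2[OF this] obtain r where r: "0 < r" "cball a r \<subseteq> ball a r0" and g: "g holomorphic_on cball a r"
      "\<And>w. w \<in> cball a r \<Longrightarrow> ?f w = g w * (w - a) ^ nat m \<and> g w \<noteq> 0" by blast
    have m0: "0 \<le> m" using conjunct1[OF zo] by (cases "?f a = 0") simp_all
    have sub: "ball a r \<subseteq> finite_part D" using r r0 by fastforce
    have gb: "g holomorphic_on ball a r" "\<And>w. w \<in> ball a r \<Longrightarrow> g w \<noteq> 0" using g holomorphic_on_subset[OF g(1)] by auto
    have U: "real_of_ereal (u (Some w)) = ln (cmod (g w)) + real_of_int m * ln (cmod (w - a))" if w: "w \<in> ball a r" "w \<noteq> a" for w
    proof -
      have gw: "?f w = g w * (w - a) ^ nat m" "g w \<noteq> 0" using g(2)[of w] w by auto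
      have "Some w \<in> D" using w sub by (auto simp: finite_part_def)
      moreover have "?f w \<noteq> 0" using gw w by simp
      ultimately have "real_of_ereal (u (Some w)) = ln (cmod (?f w))" using uh by simp
      also have "\<dots> = ln (cmod (g w)) + real (nat m) * ln (cmod (w - a))"
        unfolding gw(1) using w by (intro log_product gw(2)) simp
      finally show ?thesis using m0 by simp
    qed
    have "\<exists>V. openin riemann_sphere V \<and> Some a \<in> V \<and> V \<subseteq> D \<and> emeasure \<nu> {Some a} = ennreal (real_of_int m) \<and> emeasure \<nu> (V - {Some a}) = 0"
    proof (rule chart_point_mass[where i = "\<lambda>q. q", OF s refl _ _ r(1) _ _ gb U])
      show "openin riemann_sphere {q. q \<in> Some ` U}" if "open U" for U using that by (simp add: riemann_sphere_def)
      show "closedin riemann_sphere {q. q \<in> Some ` cball a d}" for d by (simp add: riemann_sphere_def)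
      show "Some w \<in> D" if "w \<in> ball a r" for w using sub that by (auto simp: finite_part_def)
      show "integrable \<nu> (extend_zero v) \<and> (LINT q|\<nu>. extend_zero v q) = 1 / (2 * pi) * (LINT w|lborel. real_of_ereal (u (Some w)) * laplacian v w)"
        if "test_function {w. Some w \<in> D} v" for v
        using riesz_integrable_test(1)[OF s fin] t0 that by (simp add: finite_part_def)
    qed
    moreover have "zero_mult h p = m" using Some by (simp add: zero_mult_def m_def)
    ultimately show ?thesis using Some by simp
  next
    case None
    let ?f = "\<lambda>w. h (hol_chart_inf w)"
    have nD: "None \<in> D" using p None by simp
    obtain r0 where r0: "0 < r0" "\<And>w. w \<in> ball 0 r0 \<Longrightarrow> sphere_inv (Some w) \<in> D" using sphere_chart_inf[OF oD nD] by blast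
    have f: "?f holomorphic_on ball 0 r0"
    proof (rule holomorphic_on_subset)
      show "?f holomorphic_on {w. hol_chart_inf w \<in> D}" using h nD by (simp add: sphere_holomorphic_on_def)
      show "ball 0 r0 \<subseteq> {w. hol_chart_inf w \<in> D}" using r0(2) by (auto simp: hol_chart_inf_eq)
    qed
    have nzf: "\<exists>w\<in>ball 0 r0. ?f w \<noteq> 0"
    proof -
      have 1: "1 / z \<in> ball 0 r0" "hol_chart_inf (1 / z) = Some z" if "1 / r0 < cmod z" for z
      proof -
        have "z \<noteq> 0" using that r0(1) by auto
        then show "1 / z \<in> ball 0 r0" "hol_chart_inf (1 / z) = Some z" using that r0(1) by (auto simp: norm_divide field_simps hol_chart_inf_def)
      qed
      have "- cball 0 (1 / r0) \<subseteq> finite_part D"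
      proof
        fix z :: complex assume "z \<in> - cball 0 (1 / r0)"
        then have z: "1 / r0 < cmod z" by simp
        have "hol_chart_inf (1 / z) \<in> D" using 1(1)[OF z] r0(2)[of "cnj (1 / z)"] by (simp add: hol_chart_inf_eq norm_divide)
        then show "z \<in> finite_part D" using 1(2)[OF z] by (simp add: finite_part_def)
      qed
      moreover have "of_real (1 / r0 + 1) \<in> - cball (0::complex) (1 / r0)" using r0(1) unfolding Compl_iff mem_cball_0 norm_of_real by simp
      ultimately obtain z where "z \<in> - cball 0 (1 / r0)" "h (Some z) \<noteq> 0" using nz[of "- cball 0 (1 / r0)"] by (metis closed_cball empty_iff open_Compl)
      then show ?thesis using 1[of z] by (intro bexI[of _ "1 / z"]) auto
    qed
    define m where "m = zorder ?f 0"
    define g where "g = zor_poly ?f 0"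
    have zo: "(if ?f 0 = 0 then 0 < m else m = 0) \<and> (\<exists>r. 0 < r \<and> cball 0 r \<subseteq> ball (0::complex) r0 \<and> g holomorphic_on cball 0 r
      \<and> (\<forall>w\<in>cball 0 r. ?f w = g w * (w - 0) ^ nat m \<and> g w \<noteq> 0))"
    proof -
      have "(0::complex) \<in> ball 0 r0" using r0(1) by simp
      from zorder_exist_zero[OF f open_ball connected_ball this nzf] show ?thesis unfolding m_def g_def .
    qed
    from conjunct2[OF this] obtain r where r: "0 < r" "cball 0 r \<subseteq> ball (0::complex) r0" and g: "g holomorphic_on cball 0 r"
      "\<And>w. w \<in> cball 0 r \<Longrightarrow> ?f w = g w * w ^ nat m \<and> g w \<noteq> 0" unfolding diff_zero by blast
    have m0: "0 \<le> m" using conjunct1[OF zo] by (cases "?f 0 = 0") simp_all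
    have "ball 0 r \<subseteq> ball (0::complex) r0" using r(2) ball_subset_cball by blast
    then have sub: "ball 0 r \<subseteq> finite_part (sphere_inv ` D)" unfolding finite_part_sphere_inv using r0(2) by blast
    \<comment> \<open>Conjugating on both sides keeps the factor holomorphic while passing from the
      chart 1 / w to 1 / cnj w; moduli are unchanged.\<close>
    define k where "k = cnj \<circ> g \<circ> cnj"
    have "cnj ` ball 0 r = ball 0 r" by (auto simp: in_image_cnj_iff)
    then have "g holomorphic_on cnj ` ball 0 r" using holomorphic_on_subset[OF g(1)] by auto
    then have kb: "k holomorphic_on ball 0 r" unfolding k_def by (rule holomorphic_on_compose_cnj_cnj) simp
    have k0: "k w \<noteq> 0" if "w \<in> ball 0 r" for w using g(2)[of "cnj w"] that by (simp add: k_def)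
    have U: "real_of_ereal (u (sphere_inv (Some w))) = ln (cmod (k w)) + real_of_int m * ln (cmod (w - 0))" if w: "w \<in> ball 0 r" "w \<noteq> 0" for w
    proof -
      have gw: "?f (cnj w) = g (cnj w) * cnj w ^ nat m" "g (cnj w) \<noteq> 0" using g(2)[of "cnj w"] w by auto
      have fw: "?f (cnj w) = h (sphere_inv (Some w))" by (simp add: hol_chart_inf_eq)
      have "sphere_inv (Some w) \<in> D" using w sub unfolding finite_part_sphere_inv by blast
      moreover have "?f (cnj w) \<noteq> 0" using gw w by simp
      ultimately have "real_of_ereal (u (sphere_inv (Some w))) = ln (cmod (?f (cnj w)))" using uh fw by simp
      also have "\<dots> = ln (cmod (g (cnj w))) + real (nat m) * ln (cmod (cnj w))"
        unfolding gw(1) using w by (intro log_product gw(2)) simp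
      finally show ?thesis using m0 by (simp add: k_def)
    qed
    have "\<exists>V. openin riemann_sphere V \<and> sphere_inv (Some 0) \<in> V \<and> V \<subseteq> D \<and> emeasure \<nu> {sphere_inv (Some 0)} = ennreal (real_of_int m) \<and>
      emeasure \<nu> (V - {sphere_inv (Some 0)}) = 0"
    proof (rule chart_point_mass[where i = sphere_inv, OF s sphere_inv_sphere_inv _ _ r(1) _ _ kb k0 U])
      fix U :: "complex set" assume "open U"
      moreover have "{q. sphere_inv q \<in> Some ` U} = {q. \<exists>w\<in>U. q = sphere_inv (Some w)}"
        by auto (metis sphere_inv_sphere_inv)
      ultimately show "openin riemann_sphere {q. sphere_inv q \<in> Some ` U}" using openin_chart_inf_image by simp
    next
      fix d :: real assume d: "0 < d"
      let ?N = "{q. sphere_inv q \<in> Some ` cball 0 d}"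
      have "- ?N = Some ` ball 0 (1 / d)"
      proof (rule set_eqI)
        fix q
        show "q \<in> - ?N \<longleftrightarrow> q \<in> Some ` ball 0 (1 / d)"
        proof (cases q)
          case None then show ?thesis using d by auto
        next
          case (Some z)
          note mem = inj_image_mem_iff[OF inj_Some]
          show ?thesis
          proof (cases "z = 0")
            case True
            then show ?thesis using Some d by (simp add: mem)
          next
            case False
            then have "q \<in> ?N \<longleftrightarrow> 1 / cmod z \<le> d" using Some by (simp add: mem norm_divide)
            then show ?thesis using Some False d by (simp add: mem field_simps not_le)
          qed
        qed
      qed
      moreover have "openin riemann_sphere (Some ` ball 0 (1 / d))" by (simp add: riemann_sphere_def)
      ultimately show "closedin riemann_sphere ?N" by (simp add: closedin_riemann_sphere_iff)
    next
      show "sphere_inv (Some w) \<in> D" if "w \<in> ball 0 r" for w using sub that unfolding finite_part_sphere_inv by blast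
      show "integrable \<nu> (\<lambda>q. extend_zero v (sphere_inv q)) \<and>
        (LINT q|\<nu>. extend_zero v (sphere_inv q)) = 1 / (2 * pi) * (LINT w|lborel. real_of_ereal (u (sphere_inv (Some w))) * laplacian v w)"
        if "test_function {w. sphere_inv (Some w) \<in> D} v" for v
        using riesz_integrable_test(2)[OF s fin] t1[OF nD] that by (simp add: finite_part_sphere_inv)
    qed
    moreover have "zero_mult h p = m" using None by (simp add: zero_mult_def m_def)
    ultimately show ?thesis using None by simp
  qed
qed

text \<open>Countably many neighbourhoods, each charged at its centre only, cover the finite part of
  D. So the Riesz measure is carried by a countable set, with multiplicities as masses, and the
  comparison with Z is made atom by atom.\<close>

lemma mass_sum_le_mass_integral:
  assumes dom: "sphere_domain D" and u: "sphere_subharmonic_on D u" "\<exists>p\<in>D. u p \<noteq> -\<infinity>" and \<nu>: "is_riesz_measure D u \<nu>"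
    and h: "sphere_holomorphic_on D h" and uh: "\<And>p. p \<in> D \<Longrightarrow> u p = (if h p = 0 then -\<infinity> else ereal (ln (cmod (h p))))"
    and Z: "range Z \<subseteq> D" "vanishes_on D h Z"
  shows "mass_sum D D0 Z k \<le> mass_integral D D0 \<nu> k"
    "is_zero_sequence D h Z \<Longrightarrow> mass_integral D D0 \<nu> k = mass_sum D D0 Z k"
proof -
  have s: "sets \<nu> = sets (restrict_space riemann_sphere_borel D)" using \<nu> by (simp add: is_riesz_measure_def)
  note sp = riesz_space[OF s]
  obtain V where V: "\<And>p. p \<in> D \<Longrightarrow> openin riemann_sphere (V p)" "\<And>p. p \<in> D \<Longrightarrow> p \<in> V p" "\<And>p. p \<in> D \<Longrightarrow> V p \<subseteq> D"
    "\<And>p. p \<in> D \<Longrightarrow> emeasure \<nu> {p} = ennreal (real_of_int (zero_mult h p))" "\<And>p. p \<in> D \<Longrightarrow> emeasure \<nu> (V p - {p}) = 0"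
    using zero_point_mass[OF dom u \<nu> h uh] by metis
  let ?F = "(\<lambda>p. finite_part (V p)) ` D"
  have "\<And>S. S \<in> ?F \<Longrightarrow> open S" using V(1) open_finite_part by auto
  then obtain F' where F': "F' \<subseteq> ?F" "countable F'" "\<Union>F' = \<Union>?F" using Lindelof[of ?F] by metis
  obtain C1 where C1: "C1 \<subseteq> D" "countable C1" "F' = (\<lambda>p. finite_part (V p)) ` C1"
    using countable_subset_image[of F' "\<lambda>p. finite_part (V p)" D] F' by auto
  \<comment> \<open>Infinity is added because Lindelof was used in the finite plane, and the range
    of Z so that the sum over Z runs over the same countable set.\<close>
  define C where "C = C1 \<union> range Z \<union> ({None} \<inter> D)"
  have C: "countable C" "C \<subseteq> D" using C1 Z(1) countable_finite[of "{None} \<inter> D"] by (auto simp: C_def)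
  have single: "{c} \<in> sets \<nu>" if "c \<in> D" for c
    using riesz_sets[OF s closedin_sets_riemann_sphere_borel[OF closedin_singleton_sphere[of c]]] that by simp
  have null: "(\<Union>p\<in>C1. V p - {p}) \<in> null_sets \<nu>"
  proof (rule null_sets_UN'[OF C1(2)])
    fix p assume "p \<in> C1"
    then have p: "p \<in> D" using C1 by blast
    have "V p \<in> sets \<nu>" using V p by (intro riesz_sets[OF s openin_sets_riemann_sphere_borel]) auto
    then show "V p - {p} \<in> null_sets \<nu>" using single[OF p] V(5)[OF p] by (intro null_setsI) auto
  qed
  have ae: "AE x in \<nu>. x \<in> C"
  proof (rule AE_I'[OF null])
    show "{x \<in> space \<nu>. x \<notin> C} \<subseteq> (\<Union>p\<in>C1. V p - {p})"
    proof
      fix x assume "x \<in> {x \<in> space \<nu>. x \<notin> C}"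
      then have x: "x \<in> D" "x \<notin> C" by (simp_all add: sp)
      then obtain z where z: "x = Some z" by (cases x) (auto simp: C_def)
      have "z \<in> finite_part (V x)" using V(2)[OF x(1)] z by (simp add: finite_part_def)
      then have "z \<in> \<Union>F'" unfolding F'(3) using x(1) by blast
      then obtain p where p: "p \<in> C1" "z \<in> finite_part (V p)" unfolding C1(3) by blast
      then have "x \<in> V p" "x \<noteq> p" using x z by (auto simp: finite_part_def C_def)
      then show "x \<in> (\<Union>p\<in>C1. V p - {p})" using p(1) by blast
    qed
  qed
  define f where "f = (\<lambda>p. ennreal (k (real_of_ereal (compl_dist D p))) * indicator (D - D0) p)"
  let ?c = "from_nat_into C"
  let ?P = "\<lambda>n. ?c n \<in> C \<and> to_nat_on C (?c n) = n"
  have sing: "{x \<in> space \<nu>. x = c} = {c}" if "c \<in> D" for c using that by (auto simp: sp)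
  have "(\<integral>\<^sup>+x. f x \<partial>\<nu>) = (\<Sum>n. if ?P n then f (?c n) * emeasure \<nu> {x \<in> space \<nu>. x = ?c n} else 0)"
  proof (rule nn_integral_countable_range[OF C(1) ae])
    show "{x \<in> space \<nu>. x = c} \<in> sets \<nu>" if "c \<in> C" for c
      using that C(2) single[of c] sing[of c] by auto
  qed
  also have "\<dots> = (\<Sum>n. if ?P n then f (?c n) * ennreal (real_of_int (zero_mult h (?c n))) else 0)"
    using C(2) V(4) sing by (intro arg_cong[where f = suminf] ext) (auto simp: subset_iff)
  finally have I: "mass_integral D D0 \<nu> k = (\<Sum>n. if ?P n then f (?c n) * ennreal (real_of_int (zero_mult h (?c n))) else 0)"
    by (simp add: mass_integral_def f_def)
  have "mass_sum D D0 Z k = (\<Sum>j. f (Z j))"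
    unfolding mass_sum_def f_def by (intro arg_cong[where f = suminf] ext) (simp add: indicator_def)
  also have "\<dots> = (\<integral>\<^sup>+j. f (Z j) \<partial>count_space UNIV)" by (rule nn_integral_count_space_nat[symmetric])
  also have "\<dots> = (\<Sum>n. if ?P n then f (?c n) * emeasure (count_space UNIV) {j \<in> space (count_space UNIV). Z j = ?c n} else 0)"
    by (rule nn_integral_countable_range[OF C(1)]) (auto simp: C_def)
  also have "\<dots> = (\<Sum>n. if ?P n then f (?c n) * ennreal (real (card {j. Z j = ?c n})) else 0)"
  proof (intro arg_cong[where f = suminf] ext)
    fix n
    have "emeasure (count_space UNIV) {j \<in> space (count_space UNIV). Z j = ?c n} = ennreal (real (card {j. Z j = ?c n}))" if "?P n"
    proof -
      have "finite {j. Z j = ?c n}" using that C(2) Z(2) by (auto simp: vanishes_on_def)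
      then show ?thesis by (simp add: ennreal_of_nat_eq_real_of_nat)
    qed
    then show "(if ?P n then f (?c n) * emeasure (count_space UNIV) {j \<in> space (count_space UNIV). Z j = ?c n} else 0)
        = (if ?P n then f (?c n) * ennreal (real (card {j. Z j = ?c n})) else 0)" by simp
  qed
  finally have S: "mass_sum D D0 Z k = (\<Sum>n. if ?P n then f (?c n) * ennreal (real (card {j. Z j = ?c n})) else 0)" .
  show "mass_sum D D0 Z k \<le> mass_integral D D0 \<nu> k"
    unfolding S I
  proof (rule suminf_le[OF _ summableI summableI])
    fix n
    show "(if ?P n then f (?c n) * ennreal (real (card {j. Z j = ?c n})) else 0)
        \<le> (if ?P n then f (?c n) * ennreal (real_of_int (zero_mult h (?c n))) else 0)"
    proof (cases "?P n")
      case True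
      then have "?c n \<in> D" using C(2) by blast
      then have "int (card {j. Z j = ?c n}) \<le> zero_mult h (?c n)" using Z(2) by (simp add: vanishes_on_def)
      then have "real (card {j. Z j = ?c n}) \<le> real_of_int (zero_mult h (?c n))" by linarith
      then show ?thesis using True by (simp add: mult_left_mono ennreal_leI)
    next
      case False
      show ?thesis unfolding if_not_P[OF False] by simp
    qed
  qed
  show "mass_integral D D0 \<nu> k = mass_sum D D0 Z k" if z: "is_zero_sequence D h Z"
    unfolding S I
  proof (intro arg_cong[where f = suminf] ext)
    fix n
    have "real (card {j. Z j = ?c n}) = real_of_int (zero_mult h (?c n))" if "?P n"
    proof -
      have "?c n \<in> D" using that C(2) by blast
      then have "int (card {j. Z j = ?c n}) = zero_mult h (?c n)" using z by (simp add: is_zero_sequence_def)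
      then show ?thesis by linarith
    qed
    then show "(if ?P n then f (?c n) * ennreal (real_of_int (zero_mult h (?c n))) else 0)
        = (if ?P n then f (?c n) * ennreal (real (card {j. Z j = ?c n})) else 0)" by simp
  qed
qed

lemma mass_estimateI:
  assumes dom: "sphere_domain D" and u: "sphere_subharmonic_on D u" "\<exists>p\<in>D. u p \<noteq> -\<infinity>" and \<nu>: "is_riesz_measure D u \<nu>"
    and est: "enn2ereal (mass_integral D D0 \<nu> k) \<le> right_side c J C CM (u z0)" "J < \<infinity> \<longrightarrow> mass_integral D D0 \<nu> k < \<infinity>"
  shows "mass_estimate D D0 z0 u \<nu> k c J C CM"
  unfolding mass_estimate_def
proof (intro conjI est allI impI, goal_cases)
  case (1 h Z)
  then have "mass_sum D D0 Z k \<le> mass_integral D D0 \<nu> k" by (intro mass_sum_le_mass_integral(1)[OF dom u \<nu>]) auto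
  then show ?case using est(1) by (simp add: less_eq_ennreal.rep_eq)
next
  case (2 h Z)
  then have "mass_sum D D0 Z k \<le> mass_integral D D0 \<nu> k" by (intro mass_sum_le_mass_integral(1)[OF dom u \<nu>]) auto
  then show ?case using est(2) 2 by (simp add: le_less_trans)
next
  case (3 h Z)
  then show ?case by (intro mass_sum_le_mass_integral(2)[OF dom u \<nu>]) auto
qed

theorem mainTheorem15:
  shows "\<exists>(C :: csphere \<Rightarrow> csphere set \<Rightarrow> csphere set \<Rightarrow> real \<Rightarrow> real)
          (CM :: csphere \<Rightarrow> csphere set \<Rightarrow> csphere set \<Rightarrow> (csphere \<Rightarrow> ereal) \<Rightarrow> real).
    (\<forall>z0 D D0 b. 0 \<le> C z0 D D0 b) \<and> (\<forall>z0 D D0 M. 0 \<le> CM z0 D D0 M) \<and>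
    (\<forall>D z0 g b0 B0.
       sphere_domain D \<and> dirichlet_regular D \<and> z0 \<in> D \<and> is_green_function D z0 g \<and>
       green_level_condition D g \<and> (finite_C2_curve_boundary D \<or> (uniform_disc_condition D z0 \<and> lyapunov_dini_condition D)) \<and>
       green_dist_bounds D z0 g b0 B0
       \<longrightarrow>
       (\<exists>D0 t0.
          sphere_domain D0 \<and> rel_compact_in D0 D \<and> z0 \<in> D0 \<and>
          (\<forall>p\<in>D - D0. compl_dist D p < \<infinity>) \<and>
          ereal t0 = ereal B0 * (SUP p\<in>riemann_sphere frontier_of D0. compl_dist D p) \<and>
          (\<forall>F u \<nu> b.
             convex_on {..<0} F \<and> C2_on_reals {..<0} F \<and>
             sphere_subharmonic_on D u \<and> (\<exists>p\<in>D. u p \<noteq> -\<infinity>) \<and> is_riesz_measure D u \<nu> \<and>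
             (\<forall>p\<in>D. u p \<le> majorant D F p) \<and> 0 \<le> b
             \<longrightarrow>
             (\<forall>f. (\<forall>x\<ge>0. 0 \<le> f x) \<and> convex_on {0..} f \<and> mono_on {0..} f \<and> f 0 = 0 \<and> f t0 \<le> b
                \<longrightarrow>
                mass_estimate D D0 z0 u \<nu> (\<lambda>s. f (b0 * s))
                  (1 / B0\<^sup>2)
                  (\<integral>\<^sup>+t\<in>{0<..t0}. ennreal (f t * deriv (deriv F) (- (1 / B0) * t)) \<partial>lborel)
                  (C z0 D D0 b) (CM z0 D D0 (majorant D F))) \<and>
             (\<forall>f. (\<forall>x\<ge>0. 0 \<le> f x) \<and> convex_on {0..} f \<and> antimono_on {0..} f \<and>
                  (\<exists>l::ereal. ((\<lambda>t. ereal ((f t - f 0) / t)) \<longlongrightarrow> l) (at_right 0) \<and> l < \<infinity>) \<and>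
                  f 0 * t0 \<le> b
                \<longrightarrow>
                mass_estimate D D0 z0 u \<nu> (\<lambda>s. s * f (1 / (b0 * s)))
                  (1 / (b0 * B0\<^sup>2))
                  (\<integral>\<^sup>+t\<in>{0<..t0}. ennreal (t * f (1 / t) * deriv (deriv F) (- t / B0)) \<partial>lborel)
                  (C z0 D D0 b) (CM z0 D D0 (majorant D F))))))"
\<comment> \<open>The constants are fixed as functions before any domain is given, which expresses
  that they depend on their arguments alone.\<close>
proof (rule exI[of _ estimate_const], rule exI[of _ "\<lambda>z0 D D0 M. 3 * majorant_const D D0 M"], intro conjI allI impI, goal_cases)
  case (3 D z0 g b0 B0)
  then have dom: "sphere_domain D" and bd: "green_dist_bounds D z0 g b0 B0" by blast+
  have b: "0 < b0" using bd unfolding green_dist_bounds_def by blast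
  interpret green_domain D z0 g using 3 by unfold_locales blast+
  obtain D0 t0 where D0: "sphere_domain D0" "rel_compact_in D0 D" "z0 \<in> D0"
    and dist: "\<And>p. p \<in> D - D0 \<Longrightarrow> \<exists>x. compl_dist D p = ereal x \<and> 0 < x" and t0: "0 < t0"
      "ereal t0 = ereal B0 * (SUP p\<in>riemann_sphere frontier_of D0. compl_dist D p)"
    and est: "\<forall>F u \<nu> b K \<kappa> k. majorized D F u \<nu> b \<and> convex_weight K t0 b \<and> (\<kappa> = 1 \<or> \<kappa> = 1 / b0) \<and> (\<forall>x>0. k x \<le> \<kappa> * K (b0 * x)) \<longrightarrow>
          (let J = (\<integral>\<^sup>+r\<in>{0<..t0}. ennreal (K r * deriv (deriv F) (- r / B0)) \<partial>lborel) in
            enn2ereal (mass_integral D D0 \<nu> k) \<le> right_side (\<kappa> / B0\<^sup>2) J (estimate_const z0 D D0 b) (3 * majorant_const D D0 (majorant D F)) (u z0) \<and>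
            (J < \<infinity> \<longrightarrow> mass_integral D D0 \<nu> k < \<infinity>))"
    using riesz_mass_estimate[OF bd] by (elim exE conjE) blast
  have fin: "\<forall>p\<in>D - D0. compl_dist D p < \<infinity>" using dist by fastforce
  have main: "mass_estimate D D0 z0 u \<nu> k (\<kappa> / B0\<^sup>2)
      (\<integral>\<^sup>+r\<in>{0<..t0}. ennreal (K r * deriv (deriv F) (- r / B0)) \<partial>lborel)
      (estimate_const z0 D D0 b) (3 * majorant_const D D0 (majorant D F))"
    if H: "majorized D F u \<nu> b" "convex_weight K t0 b" "\<kappa> = 1 \<or> \<kappa> = 1 / b0" "\<forall>x>0. k x \<le> \<kappa> * K (b0 * x)" for F u \<nu> b K \<kappa> k
  proof -
    note e = est[rule_format, OF conjI[OF H(1) conjI[OF H(2) conjI[OF H(3,4)]]], unfolded Let_def]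
    show ?thesis
      by (rule mass_estimateI[OF dom]; (rule conjunct1[OF e] | rule conjunct2[OF e] | use H(1) in \<open>simp add: majorized_def\<close>))
  qed
  show ?case
  proof (rule exI[of _ D0], rule exI[of _ t0], intro conjI allI impI, goal_cases)
    case (6 F u \<nu> b f)
    then have f: "majorized D F u \<nu> b" "convex_weight f t0 b" by (simp_all add: majorized_def convex_weight_def)
    have "mass_estimate D D0 z0 u \<nu> (\<lambda>s. f (b0 * s)) (1 / B0\<^sup>2)
        (\<integral>\<^sup>+r\<in>{0<..t0}. ennreal (f r * deriv (deriv F) (- r / B0)) \<partial>lborel)
        (estimate_const z0 D D0 b) (3 * majorant_const D D0 (majorant D F))"
      by (rule main[OF f]) auto
    moreover have "- (1 / B0) * r = - r / B0" for r by simp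
    ultimately show ?case by (simp only:)
  next
    case (7 F u \<nu> b f)
    then have f: "convex_on {0..} f" "antimono_on {0..} f" "\<And>x. 0 \<le> x \<Longrightarrow> 0 \<le> f x" "f 0 * t0 \<le> b"
      and m: "majorized D F u \<nu> b" unfolding majorized_def by blast+
    let ?K = "\<lambda>s. s * f (1 / s)"
    \<comment> \<open>The new weight satisfies the normalisation of (a): its value at t0 is t0 f(1 /
      t0) <= t0 f(0) <= b.\<close>
    have "f (1 / t0) \<le> f 0" by (rule monotone_onD[OF f(2)]) (use t0(1) in auto)
    then have "t0 * f (1 / t0) \<le> t0 * f 0" using t0(1) by (intro mult_left_mono) auto
    then have "convex_weight ?K t0 b"
      using f(3,4) convex_on_perspective[OF f(1,2)] mono_on_perspective[OF f(2,3)] by (simp add: convex_weight_def mult.commute)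
    then have "mass_estimate D D0 z0 u \<nu> (\<lambda>s. s * f (1 / (b0 * s))) (1 / b0 / B0\<^sup>2)
        (\<integral>\<^sup>+r\<in>{0<..t0}. ennreal (?K r * deriv (deriv F) (- r / B0)) \<partial>lborel)
        (estimate_const z0 D D0 b) (3 * majorant_const D D0 (majorant D F))"
      by (rule main[OF m]) (use b in auto)
    then show ?case by (simp only: divide_divide_eq_left)
  qed (use D0 fin t0 in blast)+
qed (simp_all add: estimate_const_def majorant_const_def Let_def)

end
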